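(* Let $b,r\ge1$ and let $a\ge 2b-1$ be an integer. Then $$\mathrm{SYT}((ar)^b)^{\operatorname{pr}^{br}}=\{R_a(S): S\in\mathrm{SYT}(\beta_{b,r})\},$$ and $$\#\,\mathrm{SYT}((ar)^b)^{\operatorname{pr}^{br}}=\binom{br}{r,r,\dots,r}=\frac{(br)!}{(r!)^b}.$$
   Context: Tableaux in English notation, rows indexed top to bottom. $\mathrm{SYT}(\lambda)$ is the set of standard tableaux of (skew) shape $\lambda$; $((ar)^b)$ is the rectangle with $b$ rows of length $ar$. For a set $W$ and map $g:W\to W$, $W^g=\{w\in W: g(w)=w\}$. Promotion $\operatorname{pr}$ on a standard (skew) tableau with $n$ cells: erase $1$, slide the empty cell by jeu de taquin (repeatedly move into it the smaller of its right and lower neighbours in the shape) until it reaches an outer corner, fill that corner with $n+1$, subtract $1$ from all entries. $\beta_{b,r}=(r)\cup\cdots\cup(r)$ ($b$ pieces) is the skew shape with $b$ rows of length $r$ arranged block anti-diagonally: row $i$ (from the top) occupies columns $(b-i)r+1,\dots,(b-i+1)r$; i.e. $\beta_{b,r}=\lambda/\mu$ with $\lambda=(br,(b-1)r,\dots,r)$, $\mu=((b-1)r,\dots,r,0)$. $\operatorname{Rect}$ is jeu de taquin rectification; $\operatorname{Rect}^\ast(U)$, for a skew tableau $U$ with $b$ rows, is obtained by repeatedly performing outer jeu de taquin slides inside a rectangle with $b$ rows containing $U$ until the occupied cells have complement a partition (pushed to the southeast corner). $U+x$ adds $x$ to each entry. For a standard skew tableau $S$ with $m$ cells whose row lengths weakly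 decrease from top to bottom and $k\ge1$, $S^{(k)}$ is obtained by attaching $k-1$ shifted copies of $S$ to the right of $S$: row $i$ of $S^{(k)}$ begins in the same column as row $i$ of $S$ and consists of the entries of row $i$ of $S$, followed by these entries plus $m$, ..., followed by these entries plus $(k-1)m$; $S^{(0)}$ is empty. For $S\in\mathrm{SYT}(\beta_{b,r})$ and $a\ge 2b-1$, $R_a(S)$ is the left-justified filling with $b$ rows whose $i$-th row is the concatenation of the $i$-th rows of $\operatorname{Rect}(S^{(b-1)})$, of $S^{(a-2b+2)}+(b-1)br$, and of $\operatorname{Rect}^\ast(S^{(b-1)})+(a-b+1)br$, in this order. *)

theory Defs
  imports Main
begin

text \<open>Cells are pairs (row, column), 0-indexed, English notation (row 0 on top).
  A filling (tableau) is a partial map from cells to positive integers; its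
  domain is its shape.\<close>

type_synonym tab = "nat \<times> nat \<Rightarrow> nat option"

definition is_standard :: "(nat \<times> nat) set \<Rightarrow> tab \<Rightarrow> bool" where
  "is_standard D T \<longleftrightarrow> finite D \<and> dom T = D \<and> ran T = {1..card D} \<and> inj_on T D \<and>
     (\<forall>i j i' j'. (i, j) \<in> D \<longrightarrow> (i', j') \<in> D \<longrightarrow> i \<le> i' \<longrightarrow> j \<le> j' \<longrightarrow> (i, j) \<noteq> (i', j')
        \<longrightarrow> the (T (i, j)) < the (T (i', j')))"

definition SYT :: "(nat \<times> nat) set \<Rightarrow> tab set" where
  "SYT D = {T. is_standard D T}"

definition rect :: "nat \<Rightarrow> nat \<Rightarrow> (nat \<times> nat) set" where
  "rect b w = {(i, j). i < b \<and> j < w}"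

definition beta :: "nat \<Rightarrow> nat \<Rightarrow> (nat \<times> nat) set" where
  "beta b r = {(i, j). i < b \<and> (b - 1 - i) * r \<le> j \<and> j < (b - i) * r}"

definition jdt_step :: "tab \<times> (nat \<times> nat) \<Rightarrow> tab \<times> (nat \<times> nat)" where
  "jdt_step = (\<lambda>(T, (i, j)).
     let R = (i, Suc j); L = (Suc i, j) in
     (case (T R, T L) of
        (None, None) \<Rightarrow> (T, (i, j))
      | (Some x, None) \<Rightarrow> (T((i, j) := Some x, R := None), R)
      | (None, Some y) \<Rightarrow> (T((i, j) := Some y, L := None), L)
      | (Some x, Some y) \<Rightarrow>
          if x < y then (T((i, j) := Some x, R := None), R)
          else (T((i, j) := Some y, L := None), L)))"

text \<open>Full slide of the hole h (a cell not in the domain of T) until it reaches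
  an outer corner; the hole visits distinct cells, so card (dom T) steps suffice
  (the step is the identity once the hole is at an outer corner).
  Returns the new filling and the final position of the hole.\<close>
definition jdt_slide :: "tab \<Rightarrow> nat \<times> nat \<Rightarrow> tab \<times> (nat \<times> nat)" where
  "jdt_slide T h = (jdt_step ^^ card (dom T)) (T, h)"

definition pr :: "tab \<Rightarrow> tab" where
  "pr T = (let n = card (dom T); h = (THE c. T c = Some 1);
              (T1, h1) = jdt_slide (T(h := None)) h
           in (\<lambda>c. map_option (\<lambda>v. v - 1) ((T1(h1 := Some (Suc n))) c)))"

text \<open>Inner cells of a (skew) shape D, i.e. the cells of mu for D = lambda/mu.\<close>
definition inner_cells :: "(nat \<times> nat) set \<Rightarrow> (nat \<times> nat) set" where
  "inner_cells D = {c. c \<notin> D \<and> (\<exists>d\<in>D. fst c \<le> fst d \<and> snd c \<le> snd d)}"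

definition inner_corner :: "(nat \<times> nat) set \<Rightarrow> nat \<times> nat \<Rightarrow> bool" where
  "inner_corner D c \<longleftrightarrow> c \<in> inner_cells D \<and> (fst c, Suc (snd c)) \<notin> inner_cells D
      \<and> (Suc (fst c), snd c) \<notin> inner_cells D"

definition rect_step :: "tab \<Rightarrow> tab" where
  "rect_step T = (if inner_cells (dom T) = {} then T
                  else fst (jdt_slide T (SOME c. inner_corner (dom T) c)))"

text \<open>Rectification: perform inner slides into inner corners until the shape is straight.
  (Each slide removes one inner cell.)\<close>
definition Rect :: "tab \<Rightarrow> tab" where
  "Rect T = (rect_step ^^ card (inner_cells (dom T))) T"

definition rjdt_step :: "tab \<times> (nat \<times> nat) \<Rightarrow> tab \<times> (nat \<times> nat)" where
  "rjdt_step = (\<lambda>(T, (i, j)).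
     let Lc = (i, j - 1); Uc = (i - 1, j);
         Lv = (if j = 0 then None else T Lc); Uv = (if i = 0 then None else T Uc) in
     (case (Lv, Uv) of
        (None, None) \<Rightarrow> (T, (i, j))
      | (Some x, None) \<Rightarrow> (T((i, j) := Some x, Lc := None), Lc)
      | (None, Some y) \<Rightarrow> (T((i, j) := Some y, Uc := None), Uc)
      | (Some x, Some y) \<Rightarrow>
          if y < x then (T((i, j) := Some x, Lc := None), Lc)
          else (T((i, j) := Some y, Uc := None), Uc)))"

definition rjdt_slide :: "tab \<Rightarrow> nat \<times> nat \<Rightarrow> tab \<times> (nat \<times> nat)" where
  "rjdt_slide T h = (rjdt_step ^^ card (dom T)) (T, h)"

definition outer_cells :: "(nat \<times> nat) set \<Rightarrow> (nat \<times> nat) set \<Rightarrow> (nat \<times> nat) set" where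
  "outer_cells B D = {c \<in> B. c \<notin> D \<and> (\<exists>d\<in>D. fst d \<le> fst c \<and> snd d \<le> snd c)}"

definition outer_corner :: "(nat \<times> nat) set \<Rightarrow> (nat \<times> nat) set \<Rightarrow> nat \<times> nat \<Rightarrow> bool" where
  "outer_corner B D c \<longleftrightarrow> c \<in> outer_cells B D
      \<and> (snd c = 0 \<or> (fst c, snd c - 1) \<notin> outer_cells B D)
      \<and> (fst c = 0 \<or> (fst c - 1, snd c) \<notin> outer_cells B D)"

definition rstar_step :: "(nat \<times> nat) set \<Rightarrow> tab \<Rightarrow> tab" where
  "rstar_step B T = (if outer_cells B (dom T) = {} then T
                     else fst (rjdt_slide T (SOME c. outer_corner B (dom T) c)))"

text \<open>Rect^*: outer slides inside the rectangle with b rows and width (1 + largest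
  occupied column) until the complement of the occupied cells is a partition
  (i.e. the occupied cells are pushed to the south-east corner).\<close>
definition RectStar :: "nat \<Rightarrow> tab \<Rightarrow> tab" where
  "RectStar b U = (let B = rect b (Suc (Max (snd ` dom U)))
                   in (rstar_step B ^^ card (outer_cells B (dom U))) U)"

definition shift :: "tab \<Rightarrow> nat \<Rightarrow> tab" where
  "shift U x = (\<lambda>c. map_option (\<lambda>v. v + x) (U c))"

text \<open>S^(k): row i begins in the same column as row i of S and consists of row i of S,
  then row i of S plus m, ..., row i of S plus (k-1)m, where m = number of cells of S.\<close>
definition tpow :: "tab \<Rightarrow> nat \<Rightarrow> tab" where
  "tpow S k = (\<lambda>(i, j).
     let cols = {j'. (i, j') \<in> dom S}; m = card (dom S) in
     if cols = {} then None
     else let c0 = Min cols; l = card cols in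
       if c0 \<le> j \<and> j < c0 + k * l
       then map_option (\<lambda>v. v + ((j - c0) div l) * m) (S (i, c0 + (j - c0) mod l))
       else None)"

definition row_of :: "tab \<Rightarrow> nat \<Rightarrow> nat list" where
  "row_of T i = map (\<lambda>j. the (T (i, j))) (sorted_list_of_set {j. (i, j) \<in> dom T})"

definition tab_of_rows :: "nat list list \<Rightarrow> tab" where
  "tab_of_rows rs = (\<lambda>(i, j). if i < length rs \<and> j < length (rs ! i) then Some (rs ! i ! j) else None)"

definition R :: "nat \<Rightarrow> nat \<Rightarrow> nat \<Rightarrow> tab \<Rightarrow> tab" where
  "R a b r S = tab_of_rows (map (\<lambda>i.
       row_of (Rect (tpow S (b - 1))) i
     @ row_of (shift (tpow S (a + 2 - 2 * b)) ((b - 1) * b * r)) i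
     @ row_of (shift (RectStar b (tpow S (b - 1))) ((a + 1 - b) * b * r)) i) [0..<b])"

end

theory Submission
  imports Defs "HOL-Library.Multiset" "HOL-Combinatorics.Multiset_Permutations"
begin

text \<open>A standard tableau is encoded by the word \<open>u\<close> whose letter \<open>u t\<close> is the row of the entry \<open>t + 1\<close>.
  For a word \<open>u\<close> and a monotone \<open>n\<close> with values in \<open>{0..b}\<close>, \<open>V b u N n\<close> is the largest weight of a chain with
  \<open>n t\<close> unit steps at time \<open>t\<close>. It does not change under jeu de taquin slides and it determines a lattice
  word; as a function of the multiset of the \<open>b\<close> times at which \<open>n\<close> increases it satisfies the exchange
  property of valuated matroids.

  Let \<open>u\<close> be the word of a rectangular tableau fixed by the \<open>br\<close>-th power of promotion. Allowing only multiples of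
  \<open>br\<close> as times and adding a linear term, \<open>V\<close> becomes a function on the \<open>b\<close>-element multisets of \<open>\<int>/a\<int>\<close>
  which is invariant under rotation. Exchange and invariance force this function to be constant on
  sets, and to be additive on pairs of distant clusters. Constancy says that the windows of length \<open>br\<close> in the
  middle of \<open>u\<close> contain each letter \<open>r\<close> times; since promotion slides only decrease letters, these windows are all equal to
  one word \<open>w\<close>, which is the word of \<open>S\<close>. Additivity shows that the beginning of \<open>u\<close>, continued by
  copies of \<open>w\<close>, is the lattice word with the same valuation as the periodic word \<open>www\<dots>\<close>, that is, its rectification.
  The end of \<open>u\<close> follows by reversing the word, which inverts promotion. Conversely, the word glued in this
  way from \<open>w\<close> is taken by promotion to the word glued from the rotation of \<open>w\<close>, hence it is fixed after
  \<open>br\<close> steps.\<close>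

section \<open>Chains and the valuation of a word\<close>

text \<open>With constant \<open>n = k\<close> the unit steps of a chain are \<open>k\<close>
  positions that only move down, so each of them collects a weakly decreasing subsequence of
  \<open>u\<close>, and \<open>V\<close> is an invariant of Greene type. Letting \<open>n\<close>
  grow in time makes it see prefixes, which is what separates lattice words. The obstacle is that
  invariance under promotion concerns the whole word, while the claim is local. Multisets of sources
  localize it: delaying all \<open>b\<close> sources by one period costs \<open>b * r\<close>, which
  a linear term of \<open>r\<close> per source cancels, and a source at the end of the word can be
  traded for one at time \<open>0\<close>. The hypothesis \<open>2 * b \<le> a + 1\<close> enters as
  room. A cluster of \<open>i\<close> points leaves a zone ending at \<open>a - i\<close> in which
  the sample block \<open>{b..<2 * b - i}\<close> must fit, and the balanced stretch of the word,
  from period \<open>b - 1\<close> to period \<open>a + 1 - b\<close>, must contain at least one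
  period. In the periodic word the \<open>b - 1\<close> transient periods are the time in which
  interlaced chain entries, each jumping at every second opportunity, can run through their whole
  range.\<close>

definition cnt :: "(nat \<Rightarrow> nat) \<Rightarrow> nat \<Rightarrow> nat \<Rightarrow> nat" where
  "cnt u i t = card {s. s < t \<and> u s = i}"

lemma cnt_0 [simp]: "cnt u i 0 = 0"
  by (simp add: cnt_def)

lemma cnt_Suc [simp]: "cnt u i (Suc t) = cnt u i t + (if u t = i then 1 else 0)"
proof -
  have "{s. s < Suc t \<and> u s = i} = {s. s < t \<and> u s = i} \<union> (if u t = i then {t} else {})"
    by (auto simp: less_Suc_eq)
  then show ?thesis
    by (simp add: cnt_def)
qed

lemma cnt_cong: "(\<And>s. s < t \<Longrightarrow> u s = v s) \<Longrightarrow> cnt u i t = cnt v i t"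
  by (auto simp: cnt_def intro!: arg_cong[where f = card])

lemma cnt_mono: "s \<le> t \<Longrightarrow> cnt u i s \<le> cnt u i t"
  by (auto simp: cnt_def intro!: card_mono)

lemma cnt_int: "int (cnt u i t) = (\<Sum>s<t. of_bool (u s = i))"
  by (induction t) auto

text \<open>\<open>\<kappa> t i\<close> is the number of particles at positions below
  \<open>i\<close> at time \<open>t\<close>, with at most one particle per position. Monotonicity in
  \<open>t\<close> says that particles move to smaller positions only; \<open>n t\<close> of them
  have entered by time \<open>t\<close>.\<close>

definition chain :: "nat \<Rightarrow> (nat \<Rightarrow> int) \<Rightarrow> (nat \<Rightarrow> nat \<Rightarrow> int) \<Rightarrow> bool" where
  "chain b n \<kappa> \<longleftrightarrow> (\<forall>t. \<kappa> t 0 = 0 \<and> \<kappa> t b = n t)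
     \<and> (\<forall>t. \<forall>i<b. \<kappa> t i \<le> \<kappa> t (Suc i) \<and> \<kappa> t (Suc i) \<le> \<kappa> t i + 1)
     \<and> (\<forall>t. \<forall>i\<le>b. \<kappa> t i \<le> \<kappa> (Suc t) i)"

definition good :: "nat \<Rightarrow> (nat \<Rightarrow> int) \<Rightarrow> bool" where
  "good b n \<longleftrightarrow> mono n \<and> (\<forall>t. 0 \<le> n t \<and> n t \<le> int b)"

text \<open>For a chain each summand is \<open>1\<close> if a particle stands at position
  \<open>u t\<close> at time \<open>t\<close> and \<open>0\<close> otherwise, so letters met by
  particles are counted.\<close>

definition weight :: "(nat \<Rightarrow> nat) \<Rightarrow> nat \<Rightarrow> (nat \<Rightarrow> nat \<Rightarrow> int) \<Rightarrow> int" where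
  "weight u N \<kappa> = (\<Sum>t<N. \<kappa> t (Suc (u t)) - \<kappa> t (u t))"

definition V :: "nat \<Rightarrow> (nat \<Rightarrow> nat) \<Rightarrow> nat \<Rightarrow> (nat \<Rightarrow> int) \<Rightarrow> int" where
  "V b u N n = Max {weight u N \<kappa> | \<kappa>. chain b n \<kappa>}"

definition letters :: "nat \<Rightarrow> (nat \<Rightarrow> nat) \<Rightarrow> bool" where
  "letters b u \<longleftrightarrow> (\<forall>t. u t < b)"

lemma chainD:
  assumes "chain b n \<kappa>"
  shows "\<kappa> t 0 = 0" "\<kappa> t b = n t" "i < b \<Longrightarrow> \<kappa> t i \<le> \<kappa> t (Suc i)"
    "i < b \<Longrightarrow> \<kappa> t (Suc i) \<le> \<kappa> t i + 1" "i \<le> b \<Longrightarrow> \<kappa> t i \<le> \<kappa> (Suc t) i"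
  using assms by (auto simp: chain_def)

lemma chain_bounds:
  assumes "chain b n \<kappa>" "i \<le> b"
  shows "0 \<le> \<kappa> t i" "\<kappa> t i \<le> int i" "\<kappa> t i \<le> n t" "n t \<le> \<kappa> t i + int (b - i)"
proof -
  have a: "i \<le> b \<Longrightarrow> 0 \<le> \<kappa> t i \<and> \<kappa> t i \<le> int i" for i
  proof (induction i)
    case (Suc i)
    then show ?case using chainD(3,4)[OF assms(1), of i t] by auto
  qed (use chainD[OF assms(1)] in auto)
  have b: "\<kappa> t i \<le> n t \<and> n t \<le> \<kappa> t i + int (b - i)"
    using assms(2)
  proof (induction i rule: inc_induct)
    case (step k)
    then show ?case using chainD(3,4)[OF assms(1), of k t] by auto
  qed (use chainD[OF assms(1)] in auto)
  show "0 \<le> \<kappa> t i" "\<kappa> t i \<le> int i" "\<kappa> t i \<le> n t" "n t \<le> \<kappa> t i + int (b - i)"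
    using a[OF assms(2)] b by auto
qed

text \<open>All particles are packed at the lowest positions. The same chain turns out to be optimal
  for lattice words.\<close>

lemma chain_exists:
  assumes "good b n" shows "chain b n (\<lambda>t i. min (int i) (n t))"
proof -
  have "n t \<le> n (Suc t)" "0 \<le> n t" "n t \<le> int b" for t
    using assms by (auto simp: good_def mono_def)
  then show ?thesis
    unfolding chain_def by (auto simp: min_def intro: order_trans antisym)
qed

lemma weight_bounds:
  assumes "letters b u" "chain b n \<kappa>" shows "0 \<le> weight u N \<kappa>" "weight u N \<kappa> \<le> int N"
proof -
  have k: "0 \<le> \<kappa> t (Suc (u t)) - \<kappa> t (u t) \<and> \<kappa> t (Suc (u t)) - \<kappa> t (u t) \<le> 1" for t
    using assms chainD(3,4)[OF assms(2), of "u t" t] by (auto simp: letters_def)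
  show "0 \<le> weight u N \<kappa>"
    unfolding weight_def using k by (intro sum_nonneg) auto
  have "weight u N \<kappa> \<le> (\<Sum>t<N. 1)"
    unfolding weight_def using k by (intro sum_mono) auto
  then show "weight u N \<kappa> \<le> int N" by simp
qed

lemma weights_finite: "letters b u \<Longrightarrow> finite {weight u N \<kappa> | \<kappa>. chain b n \<kappa>}"
  by (rule finite_subset[of _ "{0..int N}"]) (use weight_bounds in auto)

lemma V_ge: "letters b u \<Longrightarrow> chain b n \<kappa> \<Longrightarrow> weight u N \<kappa> \<le> V b u N n"
  unfolding V_def by (rule Max_ge) (auto intro: weights_finite)

lemma V_attained:
  assumes "letters b u" "good b n" obtains \<kappa> where "chain b n \<kappa>" "weight u N \<kappa> = V b u N n"
proof -
  have "V b u N n \<in> {weight u N \<kappa> | \<kappa>. chain b n \<kappa>}"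
    unfolding V_def using weights_finite[OF assms(1)] chain_exists[OF assms(2)]
    by (intro Max_in) auto
  then show ?thesis using that by force
qed

lemma V_le:
  assumes "letters b u" "good b n" "\<And>\<kappa>. chain b n \<kappa> \<Longrightarrow> weight u N \<kappa> \<le> x"
  shows "V b u N n \<le> x"
  using V_attained[OF assms(1,2), of N] assms(3) by metis

lemma V_cong: "(\<And>t. t < N \<Longrightarrow> u t = v t) \<Longrightarrow> V b u N n = V b v N n"
  unfolding V_def weight_def by (auto intro!: arg_cong[where f = Max] Collect_cong)

lemma div2_steps:
  fixes x y z w :: int
  shows "x \<le> y \<Longrightarrow> z \<le> w \<Longrightarrow> (x + z) div 2 \<le> (y + w) div 2"
    "y \<le> x + 1 \<Longrightarrow> w \<le> z + 1 \<Longrightarrow> (y + w) div 2 \<le> (x + z) div 2 + 1"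
    "x \<le> y \<Longrightarrow> z \<le> w \<Longrightarrow> (x + z + 1) div 2 \<le> (y + w + 1) div 2"
    "y \<le> x + 1 \<Longrightarrow> w \<le> z + 1 \<Longrightarrow> (y + w + 1) div 2 \<le> (x + z + 1) div 2 + 1"
  by linarith+

text \<open>Monotonicity and unit steps survive rounding a half sum down or up, and the two
  roundings add up to the sum. This is the source of midpoint concavity of \<open>V\<close>.\<close>

lemma chain_average:
  assumes "chain b n1 \<kappa>1" "chain b n2 \<kappa>2"
  shows "chain b (\<lambda>t. (n1 t + n2 t) div 2) (\<lambda>t i. (\<kappa>1 t i + \<kappa>2 t i) div 2)"
    "chain b (\<lambda>t. (n1 t + n2 t + 1) div 2) (\<lambda>t i. (\<kappa>1 t i + \<kappa>2 t i + 1) div 2)"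
  using assms unfolding chain_def by (simp_all add: div2_steps)

lemma V_average:
  assumes "letters b u" "good b n1" "good b n2"
  shows "V b u N n1 + V b u N n2
    \<le> V b u N (\<lambda>t. (n1 t + n2 t) div 2) + V b u N (\<lambda>t. (n1 t + n2 t + 1) div 2)"
proof -
  obtain \<kappa>1 where k1: "chain b n1 \<kappa>1" "weight u N \<kappa>1 = V b u N n1"
    using V_attained[OF assms(1,2)] .
  obtain \<kappa>2 where k2: "chain b n2 \<kappa>2" "weight u N \<kappa>2 = V b u N n2"
    using V_attained[OF assms(1,3)] .
  have eq: "x div 2 + (x + 1) div 2 = x" for x :: int by linarith
  have "weight u N \<kappa>1 + weight u N \<kappa>2 =
     weight u N (\<lambda>t i. (\<kappa>1 t i + \<kappa>2 t i) div 2) + weight u N (\<lambda>t i. (\<kappa>1 t i + \<kappa>2 t i + 1) div 2)"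
    unfolding weight_def sum.distrib[symmetric]
    by (rule sum.cong[OF refl]) (smt (verit) eq)
  then show ?thesis
    using V_ge[OF assms(1) chain_average(1)[OF k1(1) k2(1)], of N]
      V_ge[OF assms(1) chain_average(2)[OF k1(1) k2(1)], of N] k1(2) k2(2) by linarith
qed

section \<open>Sources given by multisets of times\<close>

definition srcs :: "nat multiset \<Rightarrow> nat \<Rightarrow> int" where
  "srcs M t = int (size (filter_mset (\<lambda>s. s \<le> t) M))"

definition VM :: "nat \<Rightarrow> (nat \<Rightarrow> nat) \<Rightarrow> nat \<Rightarrow> nat multiset \<Rightarrow> int" where
  "VM b u N M = V b u N (srcs M)"

lemma srcs_simps [simp]: "srcs {#} t = 0" "srcs (add_mset x M) t = srcs M t + of_bool (x \<le> t)"
  "srcs (M + M') t = srcs M t + srcs M' t"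
  by (auto simp: srcs_def)

lemma srcs_replicate [simp]: "srcs (replicate_mset k x) t = (if x \<le> t then int k else 0)"
  by (induction k) auto

lemma srcs_image_Suc: "srcs (image_mset Suc M) 0 = 0" "srcs (image_mset Suc M) (Suc t) = srcs M t"
  by (induction M) auto

lemma srcs_nonneg: "0 \<le> srcs M t" and srcs_le: "srcs M t \<le> int (size M)"
  by (auto simp: srcs_def size_filter_mset_lesseq)

lemma good_srcs: "size M \<le> b \<Longrightarrow> good b (srcs M)"
  unfolding good_def
proof (intro conjI allI monoI)
  fix x y :: nat assume "x \<le> y"
  then show "srcs M x \<le> srcs M y"
    by (induction M) (auto simp: of_bool_def split: if_splits)
next
  fix t assume "size M \<le> b"
  then show "srcs M t \<le> int b" using srcs_le[of M t] by linarith
qed (rule srcs_nonneg)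

text \<open>Both inequalities are midpoint inequalities for the same pair of averages: among four
  sources \<open>w \<le> x \<le> y \<le> z\<close>, rounding the half count down keeps the second
  and the fourth, rounding up keeps the first and the third, however the four were paired
  before.\<close>

lemma VM_cross:
  assumes "letters b u" "size S + 2 \<le> b" "w \<le> x" "x \<le> y" "y \<le> z"
  shows "VM b u N (add_mset w (add_mset x S)) + VM b u N (add_mset y (add_mset z S))
      \<le> VM b u N (add_mset w (add_mset y S)) + VM b u N (add_mset x (add_mset z S))" (is ?A)
    "VM b u N (add_mset w (add_mset z S)) + VM b u N (add_mset x (add_mset y S))
      \<le> VM b u N (add_mset w (add_mset y S)) + VM b u N (add_mset x (add_mset z S))" (is ?B)
proof -
  have g: "good b (srcs (add_mset c (add_mset d S)))" for c d
    using assms(2) by (intro good_srcs) auto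
  have 1: "(\<lambda>t. (srcs (add_mset w (add_mset x S)) t + srcs (add_mset y (add_mset z S)) t) div 2)
      = srcs (add_mset x (add_mset z S))"
    "(\<lambda>t. (srcs (add_mset w (add_mset x S)) t + srcs (add_mset y (add_mset z S)) t + 1) div 2)
      = srcs (add_mset w (add_mset y S))"
    "(\<lambda>t. (srcs (add_mset w (add_mset z S)) t + srcs (add_mset x (add_mset y S)) t) div 2)
      = srcs (add_mset x (add_mset z S))"
    "(\<lambda>t. (srcs (add_mset w (add_mset z S)) t + srcs (add_mset x (add_mset y S)) t + 1) div 2)
      = srcs (add_mset w (add_mset y S))"
    using assms(3-5) by (auto simp: fun_eq_iff of_bool_def)
  show ?A
    using V_average[OF assms(1) g g, of N w x y z] unfolding VM_def 1 by linarith
  show ?B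
    using V_average[OF assms(1) g g, of N w z x y] unfolding VM_def 1 by linarith
qed

lemma weight_Suc_shift: "weight u (Suc N) \<kappa> = \<kappa> 0 (Suc (u 0)) - \<kappa> 0 (u 0) + weight (u \<circ> Suc) N (\<kappa> \<circ> Suc)"
  unfolding weight_def by (subst sum.lessThan_Suc_shift) simp

text \<open>No particle is present at time \<open>0\<close>, so the first letter earns nothing and
  the chain can be restarted one step later.\<close>

lemma V_shift_Suc:
  assumes "letters b u" "good b n" "good b n'" "n' 0 = 0" "\<And>t. n' (Suc t) = n t"
  shows "V b u (Suc N) n' = V b (u \<circ> Suc) N n"
proof (rule antisym)
  have l: "letters b (u \<circ> Suc)" using assms(1) by (simp add: letters_def)
  show "V b u (Suc N) n' \<le> V b (u \<circ> Suc) N n"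
  proof (rule V_le[OF assms(1,3)])
    fix \<kappa> assume k: "chain b n' \<kappa>"
    have "\<kappa> 0 i = 0" if "i \<le> b" for i
      using chain_bounds(1,3)[OF k that, of 0] assms(4) by linarith
    then have "\<kappa> 0 (Suc (u 0)) = 0" "\<kappa> 0 (u 0) = 0"
      using assms(1) by (auto simp: letters_def Suc_le_eq less_imp_le)
    moreover have "chain b n (\<kappa> \<circ> Suc)" using k assms(5) by (auto simp: chain_def)
    ultimately show "weight u (Suc N) \<kappa> \<le> V b (u \<circ> Suc) N n"
      using V_ge[OF l, of n "\<kappa> \<circ> Suc" N] by (simp add: weight_Suc_shift)
  qed
  obtain \<kappa> where k: "chain b n \<kappa>" "weight (u \<circ> Suc) N \<kappa> = V b (u \<circ> Suc) N n"
    using V_attained[OF l assms(2)] .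
  define \<kappa>' where "\<kappa>' = (\<lambda>t. case t of 0 \<Rightarrow> (\<lambda>i. 0) | Suc t \<Rightarrow> \<kappa> t)"
  have "chain b n' \<kappa>'"
    using k(1) assms(4,5) chain_bounds(1)[OF k(1)]
    unfolding chain_def \<kappa>'_def by (auto split: nat.split)
  moreover have "weight u (Suc N) \<kappa>' = weight (u \<circ> Suc) N \<kappa>"
    unfolding weight_Suc_shift by (simp add: \<kappa>'_def comp_def)
  ultimately show "V b (u \<circ> Suc) N n \<le> V b u (Suc N) n'"
    using V_ge[OF assms(1)] k(2) by metis
qed

text \<open>When all \<open>b\<close> positions are occupied, every letter is met.\<close>

lemma V_Suc_full:
  assumes "letters b u" "good b n" "n N = int b"
  shows "V b u (Suc N) n = V b u N n + 1"
proof -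
  have w: "weight u (Suc N) \<kappa> = weight u N \<kappa> + 1" if k: "chain b n \<kappa>" for \<kappa>
  proof -
    have "\<kappa> N i = int i" if "i \<le> b" for i
      using chain_bounds(2,4)[OF k that, of N] assms(3) that by linarith
    then show ?thesis using assms(1) by (simp add: weight_def letters_def Suc_le_eq less_imp_le)
  qed
  obtain \<kappa>1 where k1: "chain b n \<kappa>1" "weight u N \<kappa>1 = V b u N n"
    using V_attained[OF assms(1,2)] .
  show ?thesis
  proof (rule antisym)
    show "V b u (Suc N) n \<le> V b u N n + 1"
      by (rule V_le[OF assms(1,2)]) (use w V_ge[OF assms(1), of n] in force)
    show "V b u N n + 1 \<le> V b u (Suc N) n"
      using V_ge[OF assms(1) k1(1), of "Suc N"] w[OF k1(1)] k1(2) by linarith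
  qed
qed

lemma V_full_tail:
  assumes "letters b u" "good b n" "n T = int b" "T \<le> N"
  shows "V b u N n = V b u T n + int (N - T)"
  using assms(4)
proof (induction N rule: dec_induct)
  case (step k)
  have "n k = int b" using assms(2,3) step(1) unfolding good_def mono_def
    by (metis order_antisym)
  then show ?case using V_Suc_full[OF assms(1,2)] step by auto
qed simp

section \<open>The exchange property\<close>

text \<open>Greedy matching: the smallest element of \<open>A\<close> goes to the smallest element
  of \<open>B\<close>, and the counting condition survives the removal of both. Applied to particle
  positions at consecutive times it gives the individual moves.\<close>

lemma dominating_injection:
  fixes A B :: "nat set"
  assumes "finite A" "finite B" "\<And>k. card (A \<inter> {..<k}) \<le> card (B \<inter> {..<k})"
  shows "\<exists>g. inj_on g A \<and> g ` A \<subseteq> B \<and> (\<forall>a\<in>A. g a \<le> a)"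
  using assms
proof (induction "card A" arbitrary: A B)
  case (Suc n)
  then have ne: "A \<noteq> {}" by auto
  define a where "a = Min A"
  have a: "a \<in> A" "\<And>x. x \<in> A \<Longrightarrow> a \<le> x" using ne Suc.prems by (auto simp: a_def)
  have "card (A \<inter> {..<Suc a}) > 0" using a(1) Suc.prems(1) by (auto simp: card_gt_0_iff)
  then have "card (B \<inter> {..<Suc a}) > 0" using Suc.prems(3)[of "Suc a"] by linarith
  then obtain c0 where c0: "c0 \<in> B" "c0 \<le> a" by (auto simp: card_gt_0_iff less_Suc_eq_le)
  define c where "c = Min B"
  have "c \<in> B" unfolding c_def using c0(1) Suc.prems(2) by (intro Min_in) auto
  moreover have "c \<le> c0" unfolding c_def using c0(1) Suc.prems(2) by (intro Min_le) auto
  ultimately have c: "c \<in> B" "c \<le> a" using c0(2) by auto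
  have "card ((A - {a}) \<inter> {..<k}) \<le> card ((B - {c}) \<inter> {..<k})" for k
  proof (cases "k \<le> a")
    case True
    then have "(A - {a}) \<inter> {..<k} = {}" using a(2) by fastforce
    then show ?thesis by simp
  next
    case False
    have "(A - {a}) \<inter> {..<k} = (A \<inter> {..<k}) - {a}" "(B - {c}) \<inter> {..<k} = (B \<inter> {..<k}) - {c}" by auto
    moreover have "a \<in> A \<inter> {..<k}" "c \<in> B \<inter> {..<k}" using False a c by auto
    ultimately show ?thesis using Suc.prems(3)[of k] by (simp add: card_Diff_singleton)
  qed
  moreover have "n = card (A - {a})" using Suc.hyps(2) a(1) Suc.prems(1) by simp
  ultimately obtain g where g: "inj_on g (A - {a})" "g ` (A - {a}) \<subseteq> B - {c}" "\<forall>x\<in>A - {a}. g x \<le> x"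
    using Suc.hyps(1)[of "A - {a}" "B - {c}"] Suc.prems by auto
  have "inj_on (g(a := c)) A"
  proof (rule inj_onI)
    fix x y assume "x \<in> A" "y \<in> A" "(g(a := c)) x = (g(a := c)) y"
    moreover have "g z \<noteq> c" if "z \<in> A - {a}" for z using g(2) that by blast
    ultimately show "x = y" using inj_onD[OF g(1), of x y] by (cases "x = a"; cases "y = a") force+
  qed
  moreover have "(g(a := c)) ` A \<subseteq> B" using g(2) c(1) by (auto simp: image_subset_iff)
  moreover have "\<forall>x\<in>A. (g(a := c)) x \<le> x" using g(3) c(2) by auto
  ultimately show ?case by blast
qed auto

text \<open>Augmenting path: the value vacated by exchanging one point is passed along \<open>X\<close>, where the two
  bijections are swapped, until it comes to rest in \<open>Y1\<close>.\<close>
lemma bijection_exchange: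
  assumes "finite X" "bij_betw f (X \<union> Y1) Z" "bij_betw g (X \<union> Y2) Z"
    "X \<inter> Y1 = {}" "X \<inter> Y2 = {}" "e \<in> Y2" "e \<notin> Y1" "Y1 \<inter> Y2 = {}"
  shows "\<exists>y f' g'. y \<in> Y1 \<and> bij_betw f' (X \<union> insert e (Y1 - {y})) Z
     \<and> bij_betw g' (X \<union> insert y (Y2 - {e})) Z
     \<and> (\<forall>x\<in>X. (f' x = f x \<and> g' x = g x) \<or> (f' x = g x \<and> g' x = f x))
     \<and> f' e = g e \<and> g' y = f y \<and> (\<forall>z\<in>Y1 - {y}. f' z = f z) \<and> (\<forall>z\<in>Y2 - {e}. g' z = g z)"
  using assms
proof (induction "card X" arbitrary: X Z Y2 e rule: less_induct)
  case less
  define v where "v = g e"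
  have "v \<in> Z" using less.prems(3,6) unfolding v_def bij_betw_def by auto
  \<comment> \<open>The new point \<open>e\<close> must receive the value \<open>v = g e\<close>, so
    the point \<open>l\<close> at which \<open>f\<close> takes this value has to give it up.\<close>
  then obtain l where l: "l \<in> X \<union> Y1" "f l = v" using less.prems(2) unfolding bij_betw_def by force
  have eX: "e \<notin> X" using less.prems(5,6) by auto
  have R1: "bij_betw f (X \<union> Y1 - {l}) (Z - {v})"
    using bij_betw_DiffI[OF less.prems(2), of "{l}" "{v}"] l \<open>v \<in> Z\<close> by (simp add: bij_betw_def)
  have R2: "bij_betw g (X \<union> Y2 - {e}) (Z - {v})"
    using bij_betw_DiffI[OF less.prems(3), of "{e}" "{v}"] less.prems(6) \<open>v \<in> Z\<close> by (simp add: bij_betw_def v_def)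
  show ?case
  proof (cases "l \<in> Y1")
    case True
    define f' g' where "f' = f(e := v)" and "g' = g(l := v)"
    have lX: "l \<notin> X" "l \<notin> Y2" "l \<noteq> e" using True less.prems(4,6,7,8) by auto
    have "bij_betw f' (X \<union> Y1 - {l}) (Z - {v})"
      by (rule iffD1[OF bij_betw_cong R1]) (use eX less.prems(7) in \<open>auto simp: f'_def\<close>)
    then have "bij_betw f' (X \<union> Y1 - {l} \<union> {e}) (Z - {v} \<union> {f' e})"
      by (intro notIn_Un_bij_betw) (use eX less.prems(7) in \<open>auto simp: f'_def\<close>)
    moreover have "X \<union> Y1 - {l} \<union> {e} = X \<union> insert e (Y1 - {l})" "Z - {v} \<union> {f' e} = Z"
      using lX \<open>v \<in> Z\<close> by (auto simp: f'_def)
    moreover have "bij_betw g' (X \<union> Y2 - {e}) (Z - {v})"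
      by (rule iffD1[OF bij_betw_cong R2]) (use lX in \<open>auto simp: g'_def\<close>)
    then have "bij_betw g' (X \<union> Y2 - {e} \<union> {l}) (Z - {v} \<union> {g' l})"
      by (intro notIn_Un_bij_betw) (use lX in \<open>auto simp: g'_def\<close>)
    moreover have "X \<union> Y2 - {e} \<union> {l} = X \<union> insert l (Y2 - {e})" "Z - {v} \<union> {g' l} = Z"
      using eX \<open>v \<in> Z\<close> by (auto simp: g'_def)
    moreover have "(\<forall>x\<in>X. f' x = f x \<and> g' x = g x) \<and> f' e = g e \<and> g' l = f l
        \<and> (\<forall>z\<in>Y1 - {l}. f' z = f z) \<and> (\<forall>z\<in>Y2 - {e}. g' z = g z)"
      using eX lX less.prems(7) l(2) by (auto simp: f'_def g'_def v_def)
    ultimately show ?thesis using True by metis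
  next
    case False
    \<comment> \<open>Here \<open>l\<close> is a common point. It hands \<open>v\<close> over to
      \<open>e\<close> and takes over the role of \<open>e\<close> in the smaller problem without
      \<open>l\<close> and without \<open>v\<close>.\<close>
    then have lX: "l \<in> X" "l \<notin> Y1" "l \<notin> Y2" using l(1) less.prems(5) by auto
    have c: "card (X - {l}) < card X" using lX(1) less.prems(1) by (meson card_Diff1_less)
    have e1: "X - {l} \<union> Y1 = X \<union> Y1 - {l}" "X - {l} \<union> insert l (Y2 - {e}) = X \<union> Y2 - {e}"
      using lX eX by auto
    have "\<exists>y f' g'. y \<in> Y1 \<and> bij_betw f' (X - {l} \<union> insert l (Y1 - {y})) (Z - {v})
      \<and> bij_betw g' (X - {l} \<union> insert y (insert l (Y2 - {e}) - {l})) (Z - {v})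
      \<and> (\<forall>x\<in>X - {l}. (f' x = f x \<and> g' x = g x) \<or> (f' x = g x \<and> g' x = f x))
      \<and> f' l = g l \<and> g' y = f y \<and> (\<forall>z\<in>Y1 - {y}. f' z = f z) \<and> (\<forall>z\<in>insert l (Y2 - {e}) - {l}. g' z = g z)"
      by (rule less.hyps[OF c]) (use less.prems R1 R2 e1 lX in auto)
    then obtain y f1 g1 where y: "y \<in> Y1" "bij_betw f1 (X - {l} \<union> insert l (Y1 - {y})) (Z - {v})"
      "bij_betw g1 (X - {l} \<union> insert y (insert l (Y2 - {e}) - {l})) (Z - {v})"
      "\<forall>x\<in>X - {l}. (f1 x = f x \<and> g1 x = g x) \<or> (f1 x = g x \<and> g1 x = f x)"
      "f1 l = g l" "g1 y = f y" "\<forall>z\<in>Y1 - {y}. f1 z = f z" "\<forall>z\<in>insert l (Y2 - {e}) - {l}. g1 z = g z"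
      by blast
    have yn: "y \<noteq> l" "y \<notin> X" "y \<noteq> e" "y \<notin> Y2" using y(1) lX less.prems(4,6,8) by auto
    define f' g' where "f' = f1(e := v)" and "g' = g1(l := v)"
    have "bij_betw f' (X - {l} \<union> insert l (Y1 - {y})) (Z - {v})"
      by (rule iffD1[OF bij_betw_cong y(2)]) (use eX less.prems(7) lX in \<open>auto simp: f'_def\<close>)
    then have "bij_betw f' (X - {l} \<union> insert l (Y1 - {y}) \<union> {e}) (Z - {v} \<union> {f' e})"
      by (intro notIn_Un_bij_betw) (use eX less.prems(7) lX in \<open>auto simp: f'_def\<close>)
    moreover have "X - {l} \<union> insert l (Y1 - {y}) \<union> {e} = X \<union> insert e (Y1 - {y})" "Z - {v} \<union> {f' e} = Z"
      using lX \<open>v \<in> Z\<close> by (auto simp: f'_def)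
    moreover have "bij_betw g' (X - {l} \<union> insert y (insert l (Y2 - {e}) - {l})) (Z - {v})"
      by (rule iffD1[OF bij_betw_cong y(3)]) (use lX yn in \<open>auto simp: g'_def\<close>)
    then have "bij_betw g' (X - {l} \<union> insert y (insert l (Y2 - {e}) - {l}) \<union> {l}) (Z - {v} \<union> {g' l})"
      by (intro notIn_Un_bij_betw) (use lX yn in \<open>auto simp: g'_def\<close>)
    moreover have "X - {l} \<union> insert y (insert l (Y2 - {e}) - {l}) \<union> {l} = X \<union> insert y (Y2 - {e})"
      "Z - {v} \<union> {g' l} = Z"
      using lX \<open>v \<in> Z\<close> by (auto simp: g'_def)
    moreover have "\<forall>x\<in>X. (f' x = f x \<and> g' x = g x) \<or> (f' x = g x \<and> g' x = f x)"
    proof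
      fix x assume x: "x \<in> X"
      show "(f' x = f x \<and> g' x = g x) \<or> (f' x = g x \<and> g' x = f x)"
      proof (cases "x = l")
        case True
        then show ?thesis using y(5) l(2) eX lX by (auto simp: f'_def g'_def)
      next
        case False
        then have "f' x = f1 x" "g' x = g1 x" using eX x by (auto simp: f'_def g'_def)
        then show ?thesis using y(4) x False by auto
      qed
    qed
    moreover have "f' e = g e \<and> g' y = f y
        \<and> (\<forall>z\<in>Y1 - {y}. f' z = f z) \<and> (\<forall>z\<in>Y2 - {e}. g' z = g z)"
      using eX lX less.prems(7) y yn by (auto simp: f'_def g'_def v_def)
    ultimately show ?thesis using y(1) by metis
  qed
qed

text \<open>One level more than there are letters: the \<open>b\<close> entering tokens and the
  \<open>N * b\<close> cells together fill exactly \<open>Suc N * b\<close> slots.\<close>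

definition slots :: "nat \<Rightarrow> nat \<Rightarrow> (nat \<times> nat) set" where
  "slots b N = {..N} \<times> {..<b}"

definition tokcnt :: "(nat \<times> nat) set \<Rightarrow> nat \<Rightarrow> int" where
  "tokcnt J t = int (card {j\<in>J. fst j \<le> t})"

text \<open>A chain as a perfect matching. The unit steps of the chain at time \<open>t\<close> are particles, which may only move to
  smaller positions. \<open>Inr (t, i)\<close> occupies its own slot if there is no particle at position \<open>i\<close> at time \<open>t\<close> and
  otherwise the slot \<open>(Suc t, k)\<close> to which this particle moves; \<open>Inl j\<close> is a particle entering at time \<open>fst j\<close>.\<close>
definition bchain :: "nat \<Rightarrow> nat \<Rightarrow> (nat \<times> nat) set \<Rightarrow> ((nat \<times> nat) + (nat \<times> nat) \<Rightarrow> nat \<times> nat) \<Rightarrow> bool" where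
  "bchain b N J f \<longleftrightarrow> bij_betw f (Inl ` J \<union> Inr ` ({..<N} \<times> {..<b})) (slots b N)
     \<and> (\<forall>j\<in>J. fst (f (Inl j)) = fst j)
     \<and> (\<forall>t<N. \<forall>i<b. f (Inr (t, i)) = (t, i) \<or> (\<exists>k\<le>i. f (Inr (t, i)) = (Suc t, k)))"

definition bweight :: "(nat \<Rightarrow> nat) \<Rightarrow> nat \<Rightarrow> ((nat \<times> nat) + (nat \<times> nat) \<Rightarrow> nat \<times> nat) \<Rightarrow> int" where
  "bweight u N f = (\<Sum>t<N. of_bool (f (Inr (t, u t)) \<noteq> (t, u t)))"

lemma chain_count:
  assumes "chain b n \<kappa>" "i \<le> b"
  shows "int (card ({k. k < b \<and> \<kappa> t (Suc k) \<noteq> \<kappa> t k} \<inter> {..<i})) = \<kappa> t i"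
  using assms(2)
proof (induction i)
  case 0
  then show ?case using chainD(1)[OF assms(1)] by simp
next
  case (Suc i)
  let ?K = "{k. k < b \<and> \<kappa> t (Suc k) \<noteq> \<kappa> t k}"
  have "?K \<inter> {..<Suc i} = ?K \<inter> {..<i} \<union> (if i \<in> ?K then {i} else {})" by (auto simp: less_Suc_eq)
  then have "card (?K \<inter> {..<Suc i}) = card (?K \<inter> {..<i}) + (if i \<in> ?K then 1 else 0)" by auto
  then show ?case using Suc chainD(3,4)[OF assms(1), of i t] by auto
qed

text \<open>Dominance between consecutive particle sets yields the moves; the positions not reached
  by a move are as many as the tokens entering at that time, and any bijection between them will
  do.\<close>

lemma chain_to_bchain:
  assumes k: "chain b (tokcnt J) \<kappa>" and J: "finite J" "card J = b" "\<forall>j\<in>J. fst j \<le> N"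
    and l: "letters b u"
  obtains f where "bchain b N J f" "bweight u N f = weight u N \<kappa>"
proof -
  define K where "K t = {k. k < b \<and> \<kappa> t (Suc k) \<noteq> \<kappa> t k}" for t
  have finK: "finite (K t)" for t by (simp add: K_def)
  have cK: "int (card (K t \<inter> {..<i})) = \<kappa> t i" if "i \<le> b" for i t
    using chain_count[OF k that] by (simp add: K_def)
  have cK': "card (K t \<inter> {..<i}) \<le> card (K (Suc t) \<inter> {..<i})" for i t
  proof -
    have "K t \<inter> {..<i} = K t \<inter> {..<min i b}" for t by (auto simp: K_def)
    then show ?thesis using cK[of "min i b" t] cK[of "min i b" "Suc t"] chainD(5)[OF k, of "min i b" t] by simp
  qed
  have cardK: "int (card (K t)) = tokcnt J t" for t
    using cK[of b t] chainD(2)[OF k, of t] by (simp add: Int_absorb2 K_def Collect_conj_eq lessThan_def[symmetric] inf_assoc Int_ac)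
  define g where "g t = (SOME g. inj_on g (K t) \<and> g ` K t \<subseteq> K (Suc t) \<and> (\<forall>a\<in>K t. g a \<le> a))" for t
  have g: "inj_on (g t) (K t)" "g t ` K t \<subseteq> K (Suc t)" "\<And>a. a \<in> K t \<Longrightarrow> g t a \<le> a" for t
    using someI_ex[OF dominating_injection[OF finK finK cK', of t]] by (auto simp: g_def)
  define P where "P t = (case t of 0 \<Rightarrow> {} | Suc s \<Rightarrow> g s ` K s)" for t
  have P: "P t \<subseteq> K t" for t using g(2) by (auto simp: P_def split: nat.split)
  have "card {j\<in>J. fst j = t} = card (K t - P t)" for t
  proof (cases t)
    case 0
    have "{j\<in>J. fst j \<le> 0} = {j\<in>J. fst j = 0}" by auto
    then show ?thesis using cardK[of 0] 0 by (simp add: P_def tokcnt_def)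
  next
    case (Suc s)
    have "{j\<in>J. fst j \<le> Suc s} = {j\<in>J. fst j \<le> s} \<union> {j\<in>J. fst j = Suc s}" by auto
    then have "card {j\<in>J. fst j \<le> Suc s} = card {j\<in>J. fst j \<le> s} + card {j\<in>J. fst j = Suc s}"
      using J(1) by (simp add: card_Un_disjoint disjoint_iff)
    moreover have "card (g s ` K s) = card (K s)" using g(1) by (rule card_image)
    ultimately show ?thesis
      using cardK[of s] cardK[of "Suc s"] Suc P[of t] finK
      by (simp add: P_def tokcnt_def card_Diff_subset finite_subset)
  qed
  then have "\<exists>h. bij_betw h {j\<in>J. fst j = t} (K t - P t)" for t
    using J(1) finK by (intro finite_same_card_bij) auto
  then obtain h where h: "\<And>t. bij_betw (h t) {j\<in>J. fst j = t} (K t - P t)" by metis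
  define f where "f x = (case x of Inl j \<Rightarrow> (fst j, h (fst j) j)
     | Inr (t, i) \<Rightarrow> if i \<in> K t then (Suc t, g t i) else (t, i))" for x :: "(nat \<times> nat) + (nat \<times> nat)"
  let ?D = "Inl ` J \<union> Inr ` ({..<N} \<times> {..<b})"
  have hK: "h (fst j) j \<in> K (fst j)" "h (fst j) j \<notin> P (fst j)" if "j \<in> J" for j
    using h[of "fst j"] that unfolding bij_betw_def by auto
  have hinj: "j = j'" if "j \<in> J" "j' \<in> J" "fst j = fst j'" "h (fst j) j = h (fst j) j'" for j j'
    using inj_onD[OF bij_betw_imp_inj_on[OF h[of "fst j"]], of j j'] that by simp
  have gP: "g t i \<in> P (Suc t)" "g t i \<in> K (Suc t)" if "i \<in> K t" for i t
    using that g(2)[of t] by (auto simp: P_def)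
  have ginj: "i = i'" if "i \<in> K t" "i' \<in> K t" "g t i = g t i'" for i i' t
    using that g(1)[of t] by (auto simp: inj_on_def)
  have fl: "f (Inl j) = (fst j, h (fst j) j)" for j by (simp add: f_def)
  have fr: "f (Inr (t, i)) = (if i \<in> K t then (Suc t, g t i) else (t, i))" for t i by (simp add: f_def)
  have "inj_on f ?D"
  proof (rule inj_onI)
    fix x y assume xy: "x \<in> ?D" "y \<in> ?D" "f x = f y"
    have lr: False if "j \<in> J" "f (Inl j) = f (Inr (t, i))" for j t i
      using hK[OF that(1)] gP[of i t] that(2) unfolding fl fr by (auto split: if_splits)
    have rr: "(t, i) = (t', i')" if "f (Inr (t, i)) = f (Inr (t', i'))" for t i t' i'
      using that gP[of i t] gP[of i' t'] ginj[of i t i'] unfolding fr by (auto split: if_splits)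
    show "x = y"
      using xy lr rr hinj by (elim UnE imageE) (auto simp: fl, metis+)
  qed
  moreover have sub: "f ` ?D \<subseteq> slots b N"
  proof -
    have "i < b" if "i \<in> K t" for i t using that by (simp add: K_def)
    moreover have "f (Inl j) \<in> slots b N" if "j \<in> J" for j
      using hK(1)[OF that] J(3) that calculation by (simp add: slots_def fl)
    moreover have "f (Inr (t, i)) \<in> slots b N" if "t < N" "i < b" for t i
      using gP(2)[of i t] that calculation(1)[of "g t i" "Suc t"] by (simp add: slots_def fr)
    ultimately show ?thesis by auto
  qed
  moreover have "card ?D = card (slots b N)"
  proof -
    have "card ?D = card (Inl ` J :: (nat\<times>nat + nat\<times>nat) set) + card (Inr ` ({..<N} \<times> {..<b}) :: (nat\<times>nat + nat\<times>nat) set)"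
      by (rule card_Un_disjoint) (use J(1) in auto)
    also have "\<dots> = b + N * b" using J(2) by (simp add: card_image card_cartesian_product)
    finally show ?thesis by (simp add: slots_def)
  qed
  ultimately have bij: "bij_betw f ?D (slots b N)"
    unfolding bij_betw_def using card_subset_eq[OF _ sub] card_image[of f ?D] by (simp add: slots_def)
  have "bchain b N J f"
    unfolding bchain_def using bij g(3) by (auto simp: fl fr)
  moreover have "bweight u N f = weight u N \<kappa>"
    unfolding bweight_def weight_def
  proof (rule sum.cong[OF refl])
    fix t
    have ub: "u t < b" using l by (simp add: letters_def)
    then have "f (Inr (t, u t)) \<noteq> (t, u t) \<longleftrightarrow> \<kappa> t (Suc (u t)) \<noteq> \<kappa> t (u t)"
      by (auto simp: fr K_def)
    then show "of_bool (f (Inr (t, u t)) \<noteq> (t, u t)) = \<kappa> t (Suc (u t)) - \<kappa> t (u t)"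
      using chainD(3,4)[OF k ub, of t] by auto
  qed
  ultimately show ?thesis by (rule that)
qed

lemma card_Inl_Inr: "finite S \<Longrightarrow> finite T \<Longrightarrow> card (Inl ` S \<union> Inr ` T) = card S + card T"
  by (metis Plus_def card_Plus)

text \<open>A cell that does not keep its own slot carries a particle. Each level of slots is filled
  exactly once, so the number of particles at time \<open>t\<close> equals the number of tokens that
  have entered.\<close>

lemma bchain_to_chain:
  assumes f: "bchain b N J f" and J: "finite J" "card J = b" "\<forall>j\<in>J. fst j \<le> N"
    and l: "letters b u"
  obtains \<kappa> where "chain b (tokcnt J) \<kappa>" "weight u N \<kappa> = bweight u N f"
proof -
  let ?D = "Inl ` J \<union> Inr ` ({..<N} \<times> {..<b})"
  \<comment> \<open>From time \<open>N\<close> on there are no cells left; all positions count as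
    occupied, in agreement with all \<open>b\<close> tokens having entered.\<close>
  define K where "K t = (if t < N then {i. i < b \<and> f (Inr (t, i)) \<noteq> (t, i)} else {..<b})" for t
  have finK: "finite (K t)" for t by (simp add: K_def)
  have bij: "bij_betw f ?D (slots b N)" and ft: "\<And>j. j \<in> J \<Longrightarrow> fst (f (Inl j)) = fst j"
    and fc: "\<And>t i. t < N \<Longrightarrow> i < b \<Longrightarrow> f (Inr (t, i)) = (t, i) \<or> (\<exists>k\<le>i. f (Inr (t, i)) = (Suc t, k))"
    using f by (auto simp: bchain_def)
  have finj: "inj_on f ?D" using bij by (simp add: bij_betw_def)
  have mono: "card (K t \<inter> {..<i}) \<le> card (K (Suc t) \<inter> {..<i})" for t i
  proof (cases "Suc t < N")
    case False
    then show ?thesis by (intro card_mono) (auto simp: K_def)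
  next
    case True
    define g where "g k = snd (f (Inr (t, k)))" for k
    have g: "f (Inr (t, k)) = (Suc t, g k)" "g k \<le> k" if "k \<in> K t" for k
      using that fc[of t k] True unfolding K_def g_def by auto
    have "inj_on g (K t)"
    proof (rule inj_onI)
      fix x y assume "x \<in> K t" "y \<in> K t" "g x = g y"
      then have "f (Inr (t, x)) = f (Inr (t, y))" using g by simp
      moreover have "Inr (t, x) \<in> ?D" "Inr (t, y) \<in> ?D"
        using \<open>x \<in> K t\<close> \<open>y \<in> K t\<close> True by (auto simp: K_def)
      ultimately show "x = y" using inj_onD[OF finj] by fastforce
    qed
    moreover have "g ` (K t \<inter> {..<i}) \<subseteq> K (Suc t) \<inter> {..<i}"
    proof
      fix z assume "z \<in> g ` (K t \<inter> {..<i})"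
      then obtain x where x: "x \<in> K t" "x < i" "z = g x" by auto
      have xb: "x < b" using x(1) True by (auto simp: K_def)
      have "z < i" "z < b" using g(2)[OF x(1)] x xb by auto
      moreover have "f (Inr (Suc t, z)) \<noteq> (Suc t, z)"
      proof
        assume "f (Inr (Suc t, z)) = (Suc t, z)"
        then have "f (Inr (Suc t, z)) = f (Inr (t, x))" using g(1)[OF x(1)] x(3) by simp
        moreover have "Inr (Suc t, z) \<in> ?D" "Inr (t, x) \<in> ?D" using True xb \<open>z < b\<close> by auto
        ultimately show False using inj_onD[OF finj] by fastforce
      qed
      ultimately show "z \<in> K (Suc t) \<inter> {..<i}" using True by (simp add: K_def)
    qed
    ultimately show ?thesis
      by (meson card_inj_on_le finite_Int finK inf_le1 inj_on_subset)
  qed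
  have level: "f ` {x\<in>?D. fst (f x) = t} = {t} \<times> {..<b}" if "t \<le> N" for t
  proof -
    have "f ` ?D = slots b N" using bij by (simp add: bij_betw_def)
    moreover have "f ` {x\<in>?D. fst (f x) = t} = {y\<in>f ` ?D. fst y = t}" by blast
    ultimately show ?thesis using that by (auto simp: slots_def)
  qed
  have cardK: "int (card (K t)) = tokcnt J t" for t
  proof (cases "t < N")
    case False
    then have "{j\<in>J. fst j \<le> t} = J" using J(3) by auto
    then show ?thesis using False J(2) by (simp add: K_def tokcnt_def)
  next
    case True
    then show ?thesis
    proof (induction t)
      case (0)
      define A where "A = {x\<in>?D. fst (f x) = 0}"
      have "A = Inl ` {j\<in>J. fst j = 0} \<union> Inr ` ({0} \<times> ({..<b} - K 0))"
      proof (intro set_eqI iffI)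
        fix x assume x: "x \<in> A"
        show "x \<in> Inl ` {j\<in>J. fst j = 0} \<union> Inr ` ({0} \<times> ({..<b} - K 0))"
        proof (cases x)
          case (Inl j)
          then show ?thesis using x ft by (auto simp: A_def)
        next
          case (Inr c)
          obtain s i where c: "c = (s, i)" by fastforce
          have si: "s < N" "i < b" using x Inr c by (auto simp: A_def)
          then show ?thesis using x Inr c fc[OF si] 0 by (auto simp: A_def K_def)
        qed
      qed (use 0 ft in \<open>auto simp: A_def K_def\<close>)
      moreover have "card A = b"
      proof -
        have "f ` A = {0} \<times> {..<b}"
          using level[of 0] by (simp add: A_def)
        moreover have "inj_on f A" by (rule inj_on_subset[OF finj]) (unfold A_def, blast)
        ultimately show ?thesis using card_image[of f A] by simp
      qed
      moreover have "K 0 \<subseteq> {..<b}" by (auto simp: K_def)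
      ultimately have "b = card {j\<in>J. fst j = 0} + (b - card (K 0))"
        using J(1) finK by (simp add: card_Inl_Inr card_Diff_subset card_cartesian_product)
      moreover have "card (K 0) \<le> b" using card_mono[OF _ \<open>K 0 \<subseteq> {..<b}\<close>] by simp
      moreover have "{j\<in>J. fst j \<le> 0} = {j\<in>J. fst j = 0}" by auto
      ultimately show ?case by (simp add: tokcnt_def)
    next
      case (Suc t)
      define A where "A = {x\<in>?D. fst (f x) = Suc t}"
      have Ksub: "K s \<subseteq> {..<b}" for s by (auto simp: K_def)
      have "A = Inl ` {j\<in>J. fst j = Suc t} \<union> (Inr ` ({Suc t} \<times> ({..<b} - K (Suc t))) \<union> Inr ` ({t} \<times> K t))"
      proof (intro set_eqI iffI)
        fix x assume x: "x \<in> A"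
        show "x \<in> Inl ` {j\<in>J. fst j = Suc t} \<union> (Inr ` ({Suc t} \<times> ({..<b} - K (Suc t))) \<union> Inr ` ({t} \<times> K t))"
        proof (cases x)
          case (Inl j)
          then show ?thesis using x ft by (auto simp: A_def)
        next
          case (Inr c)
          obtain s i where c: "c = (s, i)" by fastforce
          have si: "s < N" "i < b" using x Inr c by (auto simp: A_def)
          have "s = Suc t \<or> s = t" "s = Suc t \<Longrightarrow> f (Inr (s, i)) = (s, i)" "s = t \<Longrightarrow> f (Inr (s, i)) \<noteq> (s, i)"
            using x Inr c fc[OF si] by (auto simp: A_def)
          then show ?thesis using Inr c si Suc.prems by (auto simp: K_def)
        qed
      next
        fix x assume x: "x \<in> Inl ` {j\<in>J. fst j = Suc t} \<union> (Inr ` ({Suc t} \<times> ({..<b} - K (Suc t))) \<union> Inr ` ({t} \<times> K t))"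
        then show "x \<in> A"
        proof (elim UnE)
          assume "x \<in> Inr ` ({t} \<times> K t)"
          then obtain i where i: "x = Inr (t, i)" "i \<in> K t" by auto
          then have "i < b" "f (Inr (t, i)) \<noteq> (t, i)" using Suc.prems by (auto simp: K_def)
          then show ?thesis using fc[of t i] i Suc.prems by (auto simp: A_def)
        qed (use Suc.prems ft in \<open>auto simp: A_def K_def\<close>)
      qed
      moreover have "card A = b"
      proof -
        have "f ` A = {Suc t} \<times> {..<b}"
          using level[of "Suc t"] Suc.prems by (simp add: A_def)
        moreover have "inj_on f A" by (rule inj_on_subset[OF finj]) (unfold A_def, blast)
        ultimately show ?thesis using card_image[of f A] by simp
      qed
      moreover have "card ({Suc t} \<times> ({..<b} - K (Suc t)) \<union> {t} \<times> K t) = (b - card (K (Suc t))) + card (K t)"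
        using finK Ksub[of "Suc t"]
        by (subst card_Un_disjoint) (auto simp: card_Diff_subset card_cartesian_product)
      ultimately have "b = card {j\<in>J. fst j = Suc t} + ((b - card (K (Suc t))) + card (K t))"
        using J(1) finK by (simp add: card_Inl_Inr image_Un[symmetric])
      moreover have "card (K (Suc t)) \<le> b" using card_mono[OF _ Ksub] by fastforce
      moreover have "card {j\<in>J. fst j \<le> Suc t} = card {j\<in>J. fst j \<le> t} + card {j\<in>J. fst j = Suc t}"
      proof -
        have "{j\<in>J. fst j \<le> Suc t} = {j\<in>J. fst j \<le> t} \<union> {j\<in>J. fst j = Suc t}" by auto
        then show ?thesis using J(1) by (simp add: card_Un_disjoint disjoint_iff)
      qed
      ultimately show ?case using Suc by (simp add: tokcnt_def)
    qed
  qed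
  define \<kappa> where "\<kappa> t i = int (card (K t \<inter> {..<i}))" for t i
  have step: "\<kappa> t (Suc i) = \<kappa> t i + of_bool (i \<in> K t)" for t i
  proof -
    have "K t \<inter> {..<Suc i} = K t \<inter> {..<i} \<union> (if i \<in> K t then {i} else {})" by (auto simp: less_Suc_eq)
    then have "card (K t \<inter> {..<Suc i}) = card (K t \<inter> {..<i}) + (if i \<in> K t then 1 else 0)" by auto
    then show ?thesis by (simp add: \<kappa>_def)
  qed
  have "K t \<inter> {..<b} = K t" for t by (auto simp: K_def)
  then have "chain b (tokcnt J) \<kappa>"
    unfolding chain_def using mono cardK by (simp add: step) (simp add: \<kappa>_def)
  moreover have "weight u N \<kappa> = bweight u N f"
    unfolding bweight_def weight_def
    by (rule sum.cong[OF refl]) (use l in \<open>auto simp: step K_def letters_def\<close>)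
  ultimately show ?thesis by (rule that)
qed

text \<open>Numbering the copies of a source from \<open>0\<close> turns the intersection of
  multisets into the intersection of sets.\<close>

definition tokens :: "nat multiset \<Rightarrow> (nat \<times> nat) set" where
  "tokens M = {(s, k). k < count M s}"

lemma tokens_mem: "j \<in> tokens M \<Longrightarrow> fst j \<in># M"
  by (rule ccontr) (auto simp: tokens_def not_in_iff)

lemma tokens_card: "finite (tokens M)" "card (tokens M) = size M"
proof -
  have e: "tokens M = Sigma (set_mset M) (\<lambda>s. {..<count M s})"
    using tokens_mem[of _ M] by (force simp: tokens_def)
  show "finite (tokens M)" unfolding e by auto
  show "card (tokens M) = size M" unfolding e by (simp add: size_multiset_overloaded_eq)
qed

lemma tokens_filter: "{j\<in>tokens M. fst j \<le> t} = tokens (filter_mset (\<lambda>s. s \<le> t) M)"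
  by (auto simp: tokens_def split: if_splits)

lemma tokcnt_tokens: "tokcnt (tokens M) = srcs M"
  by (simp add: fun_eq_iff tokcnt_def srcs_def tokens_filter tokens_card)

text \<open>The matchings of two optimal chains share all cells, and
  \<open>bijection_exchange\<close> trades one entering token of the second for one of the first. On
  a cell the two values are kept or swapped, so the sum of the two weights does not change. This is
  the exchange axiom of valuated matroids.\<close>

lemma VM_exchange:
  assumes l: "letters b u" and M: "size M1 = b" "size M2 = b" "\<forall>s\<in>#M1. s \<le> N" "\<forall>s\<in>#M2. s \<le> N"
    and e: "count M1 e < count M2 e"
  obtains y where "count M2 y < count M1 y"
    "VM b u N M1 + VM b u N M2 \<le> VM b u N (add_mset e (M1 - {#y#})) + VM b u N (add_mset y (M2 - {#e#}))"
proof -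
  define J1 J2 where "J1 = tokens M1" and "J2 = tokens M2"
  have J: "finite J1" "card J1 = b" "\<forall>j\<in>J1. fst j \<le> N" "finite J2" "card J2 = b" "\<forall>j\<in>J2. fst j \<le> N"
    using M tokens_card[of M1] tokens_card[of M2] tokens_mem[of _ M1] tokens_mem[of _ M2]
    unfolding J1_def J2_def by auto
  obtain \<kappa>1 where k1: "chain b (srcs M1) \<kappa>1" "weight u N \<kappa>1 = V b u N (srcs M1)"
    using V_attained[OF l good_srcs, of M1 N] M by auto
  obtain \<kappa>2 where k2: "chain b (srcs M2) \<kappa>2" "weight u N \<kappa>2 = V b u N (srcs M2)"
    using V_attained[OF l good_srcs, of M2 N] M by auto
  obtain f where f: "bchain b N J1 f" "bweight u N f = weight u N \<kappa>1"
    using chain_to_bchain[of b J1 \<kappa>1 N u] k1(1) J l by (auto simp: J1_def tokcnt_tokens)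
  obtain g where g: "bchain b N J2 g" "bweight u N g = weight u N \<kappa>2"
    using chain_to_bchain[of b J2 \<kappa>2 N u] k2(1) J l by (auto simp: J2_def tokcnt_tokens)
  define C :: "(nat \<times> nat + nat \<times> nat) set" where "C = Inr ` ({..<N} \<times> {..<b})"
  define X :: "(nat \<times> nat + nat \<times> nat) set" where "X = C \<union> Inl ` (J1 \<inter> J2)"
  define Y1 :: "(nat \<times> nat + nat \<times> nat) set" where "Y1 = Inl ` (J1 - J2)"
  define Y2 :: "(nat \<times> nat + nat \<times> nat) set" where "Y2 = Inl ` (J2 - J1)"
  \<comment> \<open>The first copy of \<open>e\<close> that belongs to the second token set but not
    to the first.\<close>
  define e' where "e' = (e, count M1 e)"
  have e': "e' \<in> J2 - J1" using e by (auto simp: J1_def J2_def tokens_def e'_def)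
  have D: "X \<union> Y1 = Inl ` J1 \<union> C" "X \<union> Y2 = Inl ` J2 \<union> C" by (auto simp: X_def Y1_def Y2_def)
  have "finite X" using J(1) by (simp add: X_def C_def)
  moreover have "bij_betw f (X \<union> Y1) (slots b N)" "bij_betw g (X \<union> Y2) (slots b N)"
    using f(1) g(1) by (auto simp: bchain_def D C_def)
  moreover have "X \<inter> Y1 = {}" "X \<inter> Y2 = {}" "Inl e' \<in> Y2" "Inl e' \<notin> Y1" "Y1 \<inter> Y2 = {}"
    using e' by (auto simp: X_def Y1_def Y2_def C_def)
  ultimately have "\<exists>y f' g'. y \<in> Y1 \<and> bij_betw f' (X \<union> insert (Inl e') (Y1 - {y})) (slots b N)
     \<and> bij_betw g' (X \<union> insert y (Y2 - {Inl e'})) (slots b N)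
     \<and> (\<forall>x\<in>X. (f' x = f x \<and> g' x = g x) \<or> (f' x = g x \<and> g' x = f x))
     \<and> f' (Inl e') = g (Inl e') \<and> g' y = f y \<and> (\<forall>z\<in>Y1 - {y}. f' z = f z) \<and> (\<forall>z\<in>Y2 - {Inl e'}. g' z = g z)"
    by (rule bijection_exchange)
  then obtain y0 f' g' where E: "y0 \<in> Y1" "bij_betw f' (X \<union> insert (Inl e') (Y1 - {y0})) (slots b N)"
     "bij_betw g' (X \<union> insert y0 (Y2 - {Inl e'})) (slots b N)"
     "\<And>x. x \<in> X \<Longrightarrow> (f' x = f x \<and> g' x = g x) \<or> (f' x = g x \<and> g' x = f x)"
     "f' (Inl e') = g (Inl e')" "g' y0 = f y0" "\<And>z. z \<in> Y1 - {y0} \<Longrightarrow> f' z = f z" "\<And>z. z \<in> Y2 - {Inl e'} \<Longrightarrow> g' z = g z"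
    by blast
  obtain y' where y': "y0 = Inl y'" "y' \<in> J1 - J2" using E(1) by (auto simp: Y1_def)
  obtain y k where yk: "y' = (y, k)" by fastforce
  have cy: "count M2 y \<le> k" "k < count M1 y" using y' yk by (auto simp: J1_def J2_def tokens_def)
  define J1' J2' where "J1' = insert e' (J1 - {y'})" and "J2' = insert y' (J2 - {e'})"
  have D': "X \<union> insert (Inl e') (Y1 - {y0}) = Inl ` J1' \<union> C" "X \<union> insert y0 (Y2 - {Inl e'}) = Inl ` J2' \<union> C"
    using y' e' by (auto simp: X_def Y1_def Y2_def J1'_def J2'_def)
  have J': "finite J1'" "card J1' = b" "\<forall>j\<in>J1'. fst j \<le> N" "finite J2'" "card J2' = b" "\<forall>j\<in>J2'. fst j \<le> N"
  proof -
    have "J1 \<noteq> {}" "J2 \<noteq> {}" using y' e' by auto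
    then show "finite J1'" "card J1' = b" "\<forall>j\<in>J1'. fst j \<le> N" "finite J2'" "card J2' = b" "\<forall>j\<in>J2'. fst j \<le> N"
      using J y' e' card_gt_0_iff[of J1] card_gt_0_iff[of J2]
      by (auto simp: J1'_def J2'_def card_insert_if)
  qed
  have X1: "Inl j \<in> X \<or> (Inl j \<in> Y1 - {y0})" if "j \<in> J1 - {y'}" for j
    using that y' by (auto simp: X_def Y1_def)
  have X2: "Inl j \<in> X \<or> (Inl j \<in> Y2 - {Inl e'})" if "j \<in> J2 - {e'}" for j
    using that e' by (auto simp: X_def Y2_def)
  have XJ: "j \<in> J1 \<inter> J2" if "Inl j \<in> X" for j using that by (auto simp: X_def C_def)
  have tf: "\<And>j. j \<in> J1 \<Longrightarrow> fst (f (Inl j)) = fst j" "\<And>j. j \<in> J2 \<Longrightarrow> fst (g (Inl j)) = fst j"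
    using f(1) g(1) by (auto simp: bchain_def)
  have t1: "fst (f' (Inl j)) = fst j" if "j \<in> J1'" for j
  proof (cases "j = e'")
    case True then show ?thesis using E(5) tf(2) e' by auto
  next
    case False
    then have "j \<in> J1 - {y'}" using that by (simp add: J1'_def)
    then show ?thesis using X1[of j] E(4)[of "Inl j"] E(7)[of "Inl j"] XJ[of j] tf(1)[of j] tf(2)[of j] by auto
  qed
  have t2: "fst (g' (Inl j)) = fst j" if "j \<in> J2'" for j
  proof (cases "j = y'")
    case True then show ?thesis using E(6) tf(1) y' by auto
  next
    case False
    then have "j \<in> J2 - {e'}" using that by (simp add: J2'_def)
    then show ?thesis using X2[of j] E(4)[of "Inl j"] E(8)[of "Inl j"] XJ[of j] tf(1)[of j] tf(2)[of j] by auto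
  qed
  have c12: "(f' (Inr (t, i)) = f (Inr (t, i)) \<and> g' (Inr (t, i)) = g (Inr (t, i))) \<or>
     (f' (Inr (t, i)) = g (Inr (t, i)) \<and> g' (Inr (t, i)) = f (Inr (t, i)))" if "t < N" "i < b" for t i
    using E(4)[of "Inr (t, i)"] that by (auto simp: X_def C_def)
  have fg: "f (Inr (t, i)) = (t, i) \<or> (\<exists>k\<le>i. f (Inr (t, i)) = (Suc t, k))"
    "g (Inr (t, i)) = (t, i) \<or> (\<exists>k\<le>i. g (Inr (t, i)) = (Suc t, k))" if "t < N" "i < b" for t i
    using f(1) g(1) that unfolding bchain_def by blast+
  have "bchain b N J1' f' \<and> bchain b N J2' g'"
    unfolding bchain_def
  proof (intro conjI ballI allI impI)
    show "bij_betw f' (Inl ` J1' \<union> Inr ` ({..<N} \<times> {..<b})) (slots b N)"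
      "bij_betw g' (Inl ` J2' \<union> Inr ` ({..<N} \<times> {..<b})) (slots b N)"
      using E(2,3) unfolding D' C_def by simp_all
    show "f' (Inr (t, i)) = (t, i) \<or> (\<exists>k\<le>i. f' (Inr (t, i)) = (Suc t, k))"
      "g' (Inr (t, i)) = (t, i) \<or> (\<exists>k\<le>i. g' (Inr (t, i)) = (Suc t, k))" if "t < N" "i < b" for t i
      using c12[OF that] fg[OF that] by auto
  qed (use t1 t2 in auto)
  then have bc: "bchain b N J1' f'" "bchain b N J2' g'" by auto
  have "bweight u N f' + bweight u N g' = bweight u N f + bweight u N g"
    unfolding bweight_def sum.distrib[symmetric]
  proof (rule sum.cong[OF refl])
    fix t assume "t \<in> {..<N}"
    then show "of_bool (f' (Inr (t, u t)) \<noteq> (t, u t)) + of_bool (g' (Inr (t, u t)) \<noteq> (t, u t)) =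
      (of_bool (f (Inr (t, u t)) \<noteq> (t, u t)) + of_bool (g (Inr (t, u t)) \<noteq> (t, u t)) :: int)"
      using c12[of t "u t"] l by (auto simp: letters_def)
  qed
  moreover obtain \<kappa>3 where k3: "chain b (tokcnt J1') \<kappa>3" "weight u N \<kappa>3 = bweight u N f'"
    using bchain_to_chain[OF bc(1) J'(1-3) l] .
  moreover obtain \<kappa>4 where k4: "chain b (tokcnt J2') \<kappa>4" "weight u N \<kappa>4 = bweight u N g'"
    using bchain_to_chain[OF bc(2) J'(4-6) l] .
  moreover have "tokcnt J1' = srcs (add_mset e (M1 - {#y#}))"
  proof
    fix t
    have "tokcnt J1' t = tokcnt J1 t - of_bool (y \<le> t) + of_bool (e \<le> t)"
    proof -
      have c2: "{j\<in>J1'. fst j \<le> t} = {j\<in>J1. fst j \<le> t} - (if y \<le> t then {y'} else {}) \<union> (if e \<le> t then {e'} else {})"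
        by (auto simp: J1'_def yk e'_def)
      have c0: "card ({j\<in>J1. fst j \<le> t} - (if y \<le> t then {y'} else {})) + of_bool (y \<le> t) = card {j\<in>J1. fst j \<le> t}"
        using y' yk J(1) card_gt_0_iff[of "{j\<in>J1. fst j \<le> t}"] by auto
      have "e' \<notin> {j\<in>J1. fst j \<le> t} - (if y \<le> t then {y'} else {})" using e' by auto
      moreover have c1: "card (S \<union> (if e \<le> t then {e'} else {})) = card S + of_bool (e \<le> t)" if "finite S" "e' \<notin> S" for S
        using that by simp
      moreover have f1: "finite ({j\<in>J1. fst j \<le> t} - (if y \<le> t then {y'} else {}))" using J(1) by simp
      ultimately have "card {j\<in>J1'. fst j \<le> t} = card ({j\<in>J1. fst j \<le> t} - (if y \<le> t then {y'} else {})) + of_bool (e \<le> t)" unfolding c2 by blast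
      with c0 have "card {j\<in>J1'. fst j \<le> t} + of_bool (y \<le> t) = card {j\<in>J1. fst j \<le> t} + of_bool (e \<le> t)"
        by linarith
      from arg_cong[where f = int, OF this]
      have "int (card {j\<in>J1'. fst j \<le> t}) + of_bool (y \<le> t) = int (card {j\<in>J1. fst j \<le> t}) + of_bool (e \<le> t)"
        by (simp only: of_nat_add of_nat_of_bool)
      then show ?thesis unfolding tokcnt_def by linarith
    qed
    moreover have "y \<in># M1" using cy by (metis count_greater_zero_iff gr_implies_not0 neq0_conv)
    then have "srcs M1 t = srcs (M1 - {#y#}) t + of_bool (y \<le> t)" by (metis insert_DiffM srcs_simps(2))
    ultimately show "tokcnt J1' t = srcs (add_mset e (M1 - {#y#})) t"
      by (simp add: J1_def tokcnt_tokens)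
  qed
  moreover have "tokcnt J2' = srcs (add_mset y (M2 - {#e#}))"
  proof
    fix t
    have "tokcnt J2' t = tokcnt J2 t - of_bool (e \<le> t) + of_bool (y \<le> t)"
    proof -
      have c2: "{j\<in>J2'. fst j \<le> t} = {j\<in>J2. fst j \<le> t} - (if e \<le> t then {e'} else {}) \<union> (if y \<le> t then {y'} else {})"
        by (auto simp: J2'_def yk e'_def)
      have c0: "card ({j\<in>J2. fst j \<le> t} - (if e \<le> t then {e'} else {})) + of_bool (e \<le> t) = card {j\<in>J2. fst j \<le> t}"
        using e' J(4) card_gt_0_iff[of "{j\<in>J2. fst j \<le> t}"] by (auto simp: e'_def)
      have "y' \<notin> {j\<in>J2. fst j \<le> t} - (if e \<le> t then {e'} else {})" using y' by auto
      moreover have c1: "card (S \<union> (if y \<le> t then {y'} else {})) = card S + of_bool (y \<le> t)" if "finite S" "y' \<notin> S" for S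
        using that by simp
      moreover have f1: "finite ({j\<in>J2. fst j \<le> t} - (if e \<le> t then {e'} else {}))" using J(4) by simp
      ultimately have "card {j\<in>J2'. fst j \<le> t} = card ({j\<in>J2. fst j \<le> t} - (if e \<le> t then {e'} else {})) + of_bool (y \<le> t)" unfolding c2 by blast
      with c0 have "card {j\<in>J2'. fst j \<le> t} + of_bool (e \<le> t) = card {j\<in>J2. fst j \<le> t} + of_bool (y \<le> t)"
        by linarith
      from arg_cong[where f = int, OF this]
      have "int (card {j\<in>J2'. fst j \<le> t}) + of_bool (e \<le> t) = int (card {j\<in>J2. fst j \<le> t}) + of_bool (y \<le> t)"
        by (simp only: of_nat_add of_nat_of_bool)
      then show ?thesis unfolding tokcnt_def by linarith
    qed
    moreover have "e \<in># M2" using e by (metis count_greater_zero_iff gr_implies_not0 neq0_conv)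
    then have "srcs M2 t = srcs (M2 - {#e#}) t + of_bool (e \<le> t)" by (metis insert_DiffM srcs_simps(2))
    ultimately show "tokcnt J2' t = srcs (add_mset y (M2 - {#e#})) t"
      by (simp add: J2_def tokcnt_tokens)
  qed
  ultimately have "VM b u N M1 + VM b u N M2 \<le> VM b u N (add_mset e (M1 - {#y#})) + VM b u N (add_mset y (M2 - {#e#}))"
    using V_ge[OF l k3(1), of N] V_ge[OF l k4(1), of N] f(2) g(2) k1(2) k2(2) by (simp add: VM_def)
  then show ?thesis using that cy by (meson le_less_trans)
qed

section \<open>Changing a letter and lattice words\<close>

definition wdiff :: "(nat \<Rightarrow> nat) \<Rightarrow> nat \<Rightarrow> nat \<Rightarrow> int" where
  "wdiff u i t = int (cnt u i t) - int (cnt u (Suc i) t)"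

lemma weight_update:
  "weight u N (\<lambda>t i. \<kappa> t i + (if i = Suc h then d t else 0))
    = weight u N \<kappa> + (\<Sum>t<N. d t * (of_bool (u t = h) - of_bool (u t = Suc h)))"
  unfolding weight_def sum.distrib[symmetric] by (rule sum.cong) auto

lemma wdiff_sum: "s \<le> t \<Longrightarrow> wdiff u h t - wdiff u h s = (\<Sum>x\<in>{s..<t}. of_bool (u x = h) - of_bool (u x = Suc h))"
  by (induction t rule: dec_induct) (auto simp: wdiff_def)

lemma initial_segment:
  fixes P :: "nat \<Rightarrow> bool"
  shows "\<exists>\<tau>. p \<le> \<tau> \<and> {t. p \<le> t \<and> t < N \<and> (\<forall>s. p \<le> s \<and> s \<le> t \<longrightarrow> P s)} = {p..<\<tau>} \<and> (p < N \<longrightarrow> P p \<longrightarrow> p < \<tau> \<and> \<tau> \<le> N)"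
proof (induction N)
  case 0
  then show ?case by (intro exI[of _ p]) auto
next
  case (Suc N)
  then obtain \<tau> where t: "p \<le> \<tau>" "{t. p \<le> t \<and> t < N \<and> (\<forall>s. p \<le> s \<and> s \<le> t \<longrightarrow> P s)} = {p..<\<tau>}"
    "p < N \<longrightarrow> P p \<longrightarrow> p < \<tau> \<and> \<tau> \<le> N" by blast
  show ?case
  proof (cases "p \<le> N \<and> (\<forall>s. p \<le> s \<and> s \<le> N \<longrightarrow> P s)")
    case True
    then have "{t. p \<le> t \<and> t < Suc N \<and> (\<forall>s. p \<le> s \<and> s \<le> t \<longrightarrow> P s)} = {p..<Suc N}"
      by (auto simp: less_Suc_eq_le)
    then show ?thesis using True by (intro exI[of _ "Suc N"]) auto
  next
    case False
    then have "{t. p \<le> t \<and> t < Suc N \<and> (\<forall>s. p \<le> s \<and> s \<le> t \<longrightarrow> P s)} = {p..<\<tau>}"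
      unfolding t(2)[symmetric] by (auto simp: less_Suc_eq)
    moreover have "P p \<Longrightarrow> p \<noteq> N" using False by auto
    ultimately show ?thesis using t(1,3) by (intro exI[of _ \<tau>]) (auto simp: less_Suc_eq)
  qed
qed

text \<open>The conditions of this lemma and of \<open>V_letter_change_ge\<close> together say that
  \<open>p\<close> is the step into the first minimum of \<open>wdiff u h\<close>, that is, the
  letter changed by the crystal raising operator. Weight is lost at \<open>p\<close> only if
  position \<open>h\<close> is empty and \<open>Suc h\<close> is occupied. Keeping that particle at
  \<open>h\<close> while this situation lasts regains the loss, because later prefixes do not fall
  below the value of \<open>wdiff\<close> after \<open>p\<close>.\<close>

lemma V_letter_change_le:
  assumes l: "letters b u" and n: "good b n" and p: "u p = Suc h"
    and post: "\<And>\<tau>. Suc p \<le> \<tau> \<Longrightarrow> wdiff u h (Suc p) \<le> wdiff u h \<tau>"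
  shows "V b u N n \<le> V b (u(p := h)) N n"
proof (cases "p < N")
  case False
  then show ?thesis using V_cong[of N u "u(p := h)" b n] by fastforce
next
  case pN: True
  have hb: "Suc h < b" using l p unfolding letters_def by metis
  define v where "v = u(p := h)"
  have lv: "letters b v" using l hb by (auto simp: v_def letters_def)
  obtain \<kappa> where k: "chain b n \<kappa>" "weight u N \<kappa> = V b u N n" using V_attained[OF l n] .
  have wuv: "weight v N k' = weight u N k' + (k' p (Suc h) - k' p h) - (k' p (Suc (Suc h)) - k' p (Suc h))" for k'
  proof -
    have "weight w N k' = (\<Sum>t\<in>{..<N} - {p}. k' t (Suc (w t)) - k' t (w t)) + (k' p (Suc (w p)) - k' p (w p))" for w
      unfolding weight_def using pN by (subst sum.remove[of _ p]) auto
    moreover have "(\<Sum>t\<in>{..<N} - {p}. k' t (Suc (v t)) - k' t (v t)) = (\<Sum>t\<in>{..<N} - {p}. k' t (Suc (u t)) - k' t (u t))"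
      by (rule sum.cong) (auto simp: v_def)
    ultimately show ?thesis using p by (simp add: v_def)
  qed
  \<comment> \<open>\<open>Q t\<close> means that position \<open>h\<close> is empty and position
    \<open>Suc h\<close> is occupied, the only configuration in which the new letter is worse than
    the old one.\<close>
  define Q where "Q t \<longleftrightarrow> \<kappa> t (Suc h) = \<kappa> t h \<and> \<kappa> t (Suc (Suc h)) = \<kappa> t (Suc h) + 1" for t
  have st: "\<kappa> t h \<le> \<kappa> t (Suc h)" "\<kappa> t (Suc h) \<le> \<kappa> t h + 1" "\<kappa> t (Suc h) \<le> \<kappa> t (Suc (Suc h))"
    "\<kappa> t (Suc (Suc h)) \<le> \<kappa> t (Suc h) + 1" for t
    using chainD(3,4)[OF k(1)] hb by auto
  have mn: "\<kappa> t h \<le> \<kappa> (Suc t) h" "\<kappa> t (Suc h) \<le> \<kappa> (Suc t) (Suc h)" "\<kappa> t (Suc (Suc h)) \<le> \<kappa> (Suc t) (Suc (Suc h))" for t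
    using chainD(5)[OF k(1)] hb by auto
  show ?thesis
  proof (cases "Q p")
    case False
    then have "weight u N \<kappa> \<le> weight v N \<kappa>" using wuv[of \<kappa>] st[of p] unfolding Q_def by linarith
    then show ?thesis using V_ge[OF lv k(1), of N] k(2) unfolding v_def by linarith
  next
    case Qp: True
    define P where "P t \<longleftrightarrow> p \<le> t \<and> (\<forall>s. p \<le> s \<and> s \<le> t \<longrightarrow> Q s)" for t
    define \<kappa>' where "\<kappa>' = (\<lambda>t i. \<kappa> t i + (if i = Suc h then of_bool (P t) else 0))"
    have PQ: "P t \<Longrightarrow> Q t" and PS: "P t \<Longrightarrow> Q (Suc t) \<Longrightarrow> P (Suc t)" for t
      by (auto simp: P_def le_Suc_eq)
    have "chain b n \<kappa>'"
      unfolding chain_def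
    proof (intro conjI allI impI)
      fix t i
      show "\<kappa>' t 0 = 0" "\<kappa>' t b = n t" using chainD(1,2)[OF k(1)] hb by (auto simp: \<kappa>'_def)
      { assume ib: "i < b"
        show "\<kappa>' t i \<le> \<kappa>' t (Suc i)" "\<kappa>' t (Suc i) \<le> \<kappa>' t i + 1"
          using chainD(3,4)[OF k(1) ib, of t] PQ[of t] unfolding \<kappa>'_def Q_def by auto }
      { assume ib: "i \<le> b"
        show "\<kappa>' t i \<le> \<kappa>' (Suc t) i"
        proof (cases "i = Suc h \<and> P t \<and> \<not> P (Suc t)")
          case True
          \<comment> \<open>At the end of the run \<open>Q\<close> fails. As the neighbouring values
            cannot decrease, the middle value must already have increased by one, which leaves room
            for the raise.\<close>
          then have "Q t" "\<not> Q (Suc t)" using PQ PS by auto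
          then show ?thesis using True st[of t] st[of "Suc t"] mn[of t] unfolding \<kappa>'_def Q_def by auto
        next
          case False
          then show ?thesis using chainD(5)[OF k(1) ib, of t] unfolding \<kappa>'_def by auto
        qed }
    qed
    then have "weight v N \<kappa>' \<le> V b v N n" by (rule V_ge[OF lv])
    moreover have "weight v N \<kappa>' = weight v N \<kappa> + (\<Sum>t<N. of_bool (P t) * (of_bool (v t = h) - of_bool (v t = Suc h)))"
      unfolding \<kappa>'_def by (rule weight_update)
    moreover have "(\<Sum>t<N. of_bool (P t) * (of_bool (v t = h) - of_bool (v t = Suc h)) :: int) \<ge> 1"
    proof -
      obtain \<tau> where \<tau>: "{t. p \<le> t \<and> t < N \<and> (\<forall>s. p \<le> s \<and> s \<le> t \<longrightarrow> Q s)} = {p..<\<tau>}" "p < \<tau>" "\<tau> \<le> N"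
        using initial_segment[of p N Q] pN Qp by blast
      have "(\<Sum>t<N. of_bool (P t) * (of_bool (v t = h) - of_bool (v t = Suc h)) :: int)
          = (\<Sum>t\<in>{p..<\<tau>}. of_bool (v t = h) - of_bool (v t = Suc h))"
        unfolding \<tau>(1)[symmetric] by (rule sum.mono_neutral_cong_right) (auto simp: P_def)
      also have "\<dots> = 1 + (\<Sum>t\<in>{Suc p..<\<tau>}. of_bool (v t = h) - of_bool (v t = Suc h))"
        using \<tau>(2) by (subst sum.atLeast_Suc_lessThan) (auto simp: v_def)
      also have "(\<Sum>t\<in>{Suc p..<\<tau>}. of_bool (v t = h) - of_bool (v t = Suc h) :: int)
          = wdiff u h \<tau> - wdiff u h (Suc p)"
        using \<tau>(2) by (subst wdiff_sum) (auto simp: v_def intro!: sum.cong)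
      finally show ?thesis using post[of \<tau>] \<tau>(2) by simp
    qed
    moreover have "weight v N \<kappa> = weight u N \<kappa> - 1" using wuv[of \<kappa>] Qp unfolding Q_def by simp
    ultimately show ?thesis using k(2) v_def by simp
  qed
qed

lemma final_segment:
  fixes P :: "nat \<Rightarrow> bool"
  assumes "P p"
  shows "\<exists>\<sigma>\<le>p. {t. t \<le> p \<and> (\<forall>s. t \<le> s \<and> s \<le> p \<longrightarrow> P s)} = {\<sigma>..p}"
  using assms
proof (induction p)
  case (Suc p)
  show ?case
  proof (cases "P p")
    case True
    then obtain \<sigma> where s: "\<sigma> \<le> p" "{t. t \<le> p \<and> (\<forall>s. t \<le> s \<and> s \<le> p \<longrightarrow> P s)} = {\<sigma>..p}" using Suc.IH by blast
    have "{t. t \<le> Suc p \<and> (\<forall>s. t \<le> s \<and> s \<le> Suc p \<longrightarrow> P s)} = insert (Suc p) {t. t \<le> p \<and> (\<forall>s. t \<le> s \<and> s \<le> p \<longrightarrow> P s)}"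
      using Suc.prems by (auto simp: le_Suc_eq)
    also have "\<dots> = {\<sigma>..Suc p}" unfolding s(2) using s(1) by auto
    finally show ?thesis using s(1) by (intro exI[of _ \<sigma>]) auto
  next
    case False
    then have "{t. t \<le> Suc p \<and> (\<forall>s. t \<le> s \<and> s \<le> Suc p \<longrightarrow> P s)} = {Suc p..Suc p}"
      using Suc.prems by (auto simp: le_Suc_eq)
    then show ?thesis by blast
  qed
qed auto

text \<open>Mirror image in time: a particle at \<open>h\<close> with \<open>Suc h\<close> empty is
  pushed back to \<open>Suc h\<close> on the longest run ending at \<open>p\<close>, and the
  condition on earlier prefixes makes up for the lost letter.\<close>

lemma V_letter_change_ge:
  assumes l: "letters b u" and n: "good b n" and p: "u p = Suc h"
    and pre: "\<And>s. s \<le> p \<Longrightarrow> wdiff u h p \<le> wdiff u h s"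
  shows "V b (u(p := h)) N n \<le> V b u N n"
proof (cases "p < N")
  case False
  then show ?thesis using V_cong[of N u "u(p := h)" b n] by fastforce
next
  case pN: True
  have hb: "Suc h < b" using l p unfolding letters_def by metis
  define v where "v = u(p := h)"
  have lv: "letters b v" using l hb by (auto simp: v_def letters_def)
  obtain \<kappa> where k: "chain b n \<kappa>" "weight v N \<kappa> = V b v N n" using V_attained[OF lv n] .
  have wuv: "weight v N k' = weight u N k' + (k' p (Suc h) - k' p h) - (k' p (Suc (Suc h)) - k' p (Suc h))" for k'
  proof -
    have "weight w N k' = (\<Sum>t\<in>{..<N} - {p}. k' t (Suc (w t)) - k' t (w t)) + (k' p (Suc (w p)) - k' p (w p))" for w
      unfolding weight_def using pN by (subst sum.remove[of _ p]) auto
    moreover have "(\<Sum>t\<in>{..<N} - {p}. k' t (Suc (v t)) - k' t (v t)) = (\<Sum>t\<in>{..<N} - {p}. k' t (Suc (u t)) - k' t (u t))"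
      by (rule sum.cong) (auto simp: v_def)
    ultimately show ?thesis using p by (simp add: v_def)
  qed
  define Q where "Q t \<longleftrightarrow> \<kappa> t (Suc h) = \<kappa> t h + 1 \<and> \<kappa> t (Suc (Suc h)) = \<kappa> t (Suc h)" for t
  have st: "\<kappa> t h \<le> \<kappa> t (Suc h)" "\<kappa> t (Suc h) \<le> \<kappa> t h + 1" "\<kappa> t (Suc h) \<le> \<kappa> t (Suc (Suc h))"
    "\<kappa> t (Suc (Suc h)) \<le> \<kappa> t (Suc h) + 1" for t
    using chainD(3,4)[OF k(1)] hb by auto
  have mn: "\<kappa> t h \<le> \<kappa> (Suc t) h" "\<kappa> t (Suc h) \<le> \<kappa> (Suc t) (Suc h)" "\<kappa> t (Suc (Suc h)) \<le> \<kappa> (Suc t) (Suc (Suc h))" for t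
    using chainD(5)[OF k(1)] hb by auto
  show ?thesis
  proof (cases "Q p")
    case False
    then have "weight v N \<kappa> \<le> weight u N \<kappa>" using wuv[of \<kappa>] st[of p] unfolding Q_def by linarith
    then show ?thesis using V_ge[OF l k(1), of N] k(2) unfolding v_def by linarith
  next
    case Qp: True
    define P where "P t \<longleftrightarrow> t \<le> p \<and> (\<forall>s. t \<le> s \<and> s \<le> p \<longrightarrow> Q s)" for t
    define \<kappa>' where "\<kappa>' = (\<lambda>t i. \<kappa> t i + (if i = Suc h then - of_bool (P t) else 0))"
    have PQ: "P t \<Longrightarrow> Q t" for t by (auto simp: P_def)
    have PS: "P (Suc t) \<Longrightarrow> Q t \<Longrightarrow> P t" for t
      unfolding P_def by (metis Suc_leI Suc_leD le_antisym not_less_eq_eq)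
    have "chain b n \<kappa>'"
      unfolding chain_def
    proof (intro conjI allI impI)
      fix t i
      show "\<kappa>' t 0 = 0" "\<kappa>' t b = n t" using chainD(1,2)[OF k(1)] hb by (auto simp: \<kappa>'_def)
      { assume ib: "i < b"
        show "\<kappa>' t i \<le> \<kappa>' t (Suc i)" "\<kappa>' t (Suc i) \<le> \<kappa>' t i + 1"
          using chainD(3,4)[OF k(1) ib, of t] PQ[of t] unfolding \<kappa>'_def Q_def by auto }
      { assume ib: "i \<le> b"
        show "\<kappa>' t i \<le> \<kappa>' (Suc t) i"
        proof (cases "i = Suc h \<and> P (Suc t) \<and> \<not> P t")
          case True
          then have "Q (Suc t)" "\<not> Q t" using PQ PS by auto
          then show ?thesis using True st[of t] st[of "Suc t"] mn[of t] unfolding \<kappa>'_def Q_def by auto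
        next
          case False
          then show ?thesis using chainD(5)[OF k(1) ib, of t] unfolding \<kappa>'_def by auto
        qed }
    qed
    then have "weight u N \<kappa>' \<le> V b u N n" by (rule V_ge[OF l])
    moreover have "weight u N \<kappa>' = weight u N \<kappa> + (\<Sum>t<N. - of_bool (P t) * (of_bool (u t = h) - of_bool (u t = Suc h)))"
      unfolding \<kappa>'_def by (rule weight_update)
    moreover have "(\<Sum>t<N. - of_bool (P t) * (of_bool (u t = h) - of_bool (u t = Suc h)) :: int) \<ge> 1"
    proof -
      obtain \<sigma> where \<sigma>: "{t. t \<le> p \<and> (\<forall>s. t \<le> s \<and> s \<le> p \<longrightarrow> Q s)} = {\<sigma>..p}" "\<sigma> \<le> p"
        using final_segment[of Q p] Qp by blast
      have "(\<Sum>t<N. - of_bool (P t) * (of_bool (u t = h) - of_bool (u t = Suc h)) :: int)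
          = (\<Sum>t\<in>{\<sigma>..<Suc p}. - (of_bool (u t = h) - of_bool (u t = Suc h)))"
        unfolding atLeastLessThanSuc_atLeastAtMost \<sigma>(1)[symmetric]
        by (rule sum.mono_neutral_cong_right) (use pN in \<open>auto simp: P_def\<close>)
      also have "\<dots> = - (wdiff u h (Suc p) - wdiff u h \<sigma>)"
        unfolding sum_negf using \<sigma>(2) by (subst wdiff_sum) auto
      also have "wdiff u h (Suc p) = wdiff u h p - 1" using p by (simp add: wdiff_def)
      finally show ?thesis using pre[of \<sigma>] \<sigma>(2) by simp
    qed
    moreover have "weight v N \<kappa> = weight u N \<kappa> + 1" using wuv[of \<kappa>] Qp unfolding Q_def by simp
    ultimately show ?thesis using k(2) v_def by simp
  qed
qed

text \<open>Summation by parts turns the ballot condition on prefixes into a sign.\<close>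
lemma abel_nonneg:
  fixes d x :: "nat \<Rightarrow> int"
  assumes "\<And>t. t < N \<Longrightarrow> 0 \<le> d t" "\<And>t. Suc t < N \<Longrightarrow> d (Suc t) \<le> d t" "\<And>t. t \<le> N \<Longrightarrow> 0 \<le> (\<Sum>s<t. x s)"
  shows "0 \<le> (\<Sum>t<N. d t * x t)"
proof (cases N)
  case (Suc n)
  have "d k * (\<Sum>s<Suc k. x s) \<le> (\<Sum>t<Suc k. d t * x t)" if "k < N" for k
    using that
  proof (induction k)
    case (Suc k)
    have "d (Suc k) * (\<Sum>s<Suc k. x s) \<le> d k * (\<Sum>s<Suc k. x s)"
      using assms(2)[of k] assms(3)[of "Suc k"] Suc.prems by (intro mult_right_mono) auto
    then show ?case using Suc by (simp add: distrib_left)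
  qed simp
  from this[of n] show ?thesis using assms(1)[of n] assms(3)[of N] Suc
    by (smt (verit) lessI mult_nonneg_nonneg order_refl)
qed simp

section \<open>Lattice words and their optimal chains\<close>

definition lattice :: "(nat \<Rightarrow> nat) \<Rightarrow> bool" where
  "lattice u \<longleftrightarrow> (\<forall>t i. cnt u (Suc i) t \<le> cnt u i t)"

text \<open>Summation by parts for each index \<open>i\<close> separately: for a lattice word the
  steps \<open>[u t = i - 1] - [u t = i]\<close> have nonnegative partial sums. Used with
  \<open>d\<close> a difference of chains: raising a chain loses nothing if the raise shrinks in
  time.\<close>

lemma weight_nonneg_lattice:
  assumes "letters b u" "lattice u" "\<And>t. d t 0 = 0" "\<And>t. d t b = 0"
    "\<And>t i. t < N \<Longrightarrow> i \<le> b \<Longrightarrow> 0 \<le> d t i" "\<And>t i. Suc t < N \<Longrightarrow> i \<le> b \<Longrightarrow> d (Suc t) i \<le> d t i"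
  shows "0 \<le> weight u N d"
proof -
  have "weight u N d = (\<Sum>t<N. \<Sum>i\<in>{1..<b}. d t i * (of_bool (Suc (u t) = i) - of_bool (u t = i)))"
    unfolding weight_def
  proof (rule sum.cong[OF refl])
    fix t
    have "u t < b" using assms(1) by (simp add: letters_def)
    have "(\<Sum>i\<in>{1..<b}. d t i * (of_bool (Suc (u t) = i) - of_bool (u t = i)))
      = (\<Sum>i\<in>{1..<b}. if i = Suc (u t) then d t i else 0) - (\<Sum>i\<in>{1..<b}. if i = u t then d t i else 0)"
      unfolding sum_subtractf[symmetric] by (rule sum.cong) auto
    also have "(\<Sum>i\<in>{1..<b}. if i = Suc (u t) then d t i else 0) = d t (Suc (u t))"
      using \<open>u t < b\<close> assms(4)[of t] by (cases "Suc (u t) = b") auto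
    also have "(\<Sum>i\<in>{1..<b}. if i = u t then d t i else 0) = d t (u t)"
      using \<open>u t < b\<close> assms(3)[of t] by (cases "u t = 0") auto
    finally show "d t (Suc (u t)) - d t (u t) = (\<Sum>i\<in>{1..<b}. d t i * (of_bool (Suc (u t) = i) - of_bool (u t = i)))"
      by simp
  qed
  also have "\<dots> = (\<Sum>i\<in>{1..<b}. \<Sum>t<N. d t i * (of_bool (Suc (u t) = i) - of_bool (u t = i)))"
    by (rule sum.swap)
  also have "0 \<le> \<dots>"
  proof (rule sum_nonneg, rule abel_nonneg)
    fix i t assume i: "i \<in> {1..<b}"
    obtain k where k: "i = Suc k" using i by (cases i) auto
    have "(\<Sum>s<t. of_bool (Suc (u s) = i) - of_bool (u s = i)) = int (cnt u k t) - int (cnt u i t)"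
      unfolding cnt_int sum_subtractf k by simp
    then show "0 \<le> (\<Sum>s<t. of_bool (Suc (u s) = i) - of_bool (u s = i) :: int)"
      using assms(2) k by (simp add: lattice_def)
  qed (use assms in auto)
  finally show ?thesis .
qed

lemma weight_diff: "weight u N (\<lambda>t i. f t i - g t i) = weight u N f - weight u N g"
  unfolding weight_def sum_subtractf[symmetric] by (rule sum.cong) auto

text \<open>The packed chain lies above every other chain, and up to time \<open>T\<close> the
  excess shrinks, so it is optimal. It meets exactly the letters below \<open>i\<close>.\<close>

lemma V_lattice_step:
  assumes l: "letters b u" "lattice u" and i: "i \<le> b" and T: "T \<le> N"
  shows "V b u N (\<lambda>t. if t < T then int i else int b) = int (card {t. t < T \<and> u t < i}) + int (N - T)"
proof -
  let ?n = "\<lambda>t. if t < T then int i else int b"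
  have n: "good b ?n" using i by (auto simp: good_def mono_def)
  have "V b u N ?n = V b u T ?n + int (N - T)"
    by (rule V_full_tail[OF l(1) n _ T]) simp
  moreover have "V b u T ?n = int (card {t. t < T \<and> u t < i})"
  proof -
    let ?d = "\<lambda>t j. min (int j) (?n t)"
    have w: "weight u T ?d = int (card {t. t < T \<and> u t < i})"
    proof -
      have "weight u T ?d = (\<Sum>t<T. of_bool (u t < i))"
        unfolding weight_def by (rule sum.cong) auto
      then show ?thesis by (simp add: lessThan_def Collect_conj_eq[symmetric])
    qed
    show ?thesis
    proof (rule antisym)
      show "V b u T ?n \<le> int (card {t. t < T \<and> u t < i})"
        unfolding w[symmetric]
      proof (rule V_le[OF l(1) n])
        fix \<kappa> assume k: "chain b ?n \<kappa>"
        have "0 \<le> weight u T (\<lambda>t j. ?d t j - \<kappa> t j)"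
        proof (rule weight_nonneg_lattice[OF l])
          fix t j show "?d t 0 - \<kappa> t 0 = 0" "?d t b - \<kappa> t b = 0"
            using chainD(1,2)[OF k] n i by auto
          { assume "j \<le> b" then show "0 \<le> ?d t j - \<kappa> t j"
              using chain_bounds(2,3)[OF k, of j t] by auto }
          { assume "Suc t < T" "j \<le> b" then show "?d (Suc t) j - \<kappa> (Suc t) j \<le> ?d t j - \<kappa> t j"
              using chainD(5)[OF k, of j t] by auto }
        qed
        then show "weight u T \<kappa> \<le> weight u T ?d" unfolding weight_diff by simp
      qed
      show "int (card {t. t < T \<and> u t < i}) \<le> V b u T ?n"
        using V_ge[OF l(1) chain_exists[OF n], of T] w by simp
    qed
  qed
  ultimately show ?thesis by simp
qed

lemma card_letters_Suc:
  "card {t. t < T \<and> u t < Suc i} = card {t. t < T \<and> u t < i} + cnt u i T"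
proof -
  have "{t. t < T \<and> u t < Suc i} = {t. t < T \<and> u t < i} \<union> {t. t < T \<and> u t = i}" by auto
  then show ?thesis unfolding cnt_def by (simp add: card_Un_disjoint disjoint_iff)
qed

lemma cnt_eq_imp_eq:
  assumes "\<And>t i. t \<le> N \<Longrightarrow> cnt u i t = cnt v i t" "t < N" shows "u t = v t"
  using assms(1)[of t "u t"] assms(1)[of "Suc t" "u t"] assms(2) by (auto split: if_splits)

text \<open>Subtracting the counts of \<open>V_lattice_step\<close> for \<open>i\<close> and
  \<open>Suc i\<close> gives the content of every prefix, and hence the word.\<close>

lemma lattice_unique:
  assumes "letters b u" "lattice u" "letters b v" "lattice v"
    and "\<And>n. good b n \<Longrightarrow> V b u N n = V b v N n" "t < N"
  shows "u t = v t"
proof (rule cnt_eq_imp_eq[OF _ assms(6)])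
  fix T i assume T: "T \<le> N"
  have "card {t. t < T \<and> u t < i} = card {t. t < T \<and> v t < i}" if i: "i \<le> b" for i
  proof -
    let ?n = "\<lambda>t. if t < T then int i else int b"
    have "good b ?n" using i by (auto simp: good_def mono_def)
    then show ?thesis
      using assms(5)[of ?n] V_lattice_step[OF assms(1,2) i T] V_lattice_step[OF assms(3,4) i T] by simp
  qed
  then have "i < b \<Longrightarrow> cnt u i T = cnt v i T"
    using card_letters_Suc[of T u i] card_letters_Suc[of T v i] by (metis Suc_leI add_left_cancel less_imp_le_nat)
  moreover have "\<not> i < b \<Longrightarrow> cnt u i T = 0 \<and> cnt v i T = 0"
    using assms(1,3) unfolding cnt_def letters_def by (auto simp: card_eq_0_iff)
  ultimately show "cnt u i T = cnt v i T" by (cases "i < b") auto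
qed

text \<open>Words of standard tableaux of the rectangle with \<open>b\<close> rows of length
  \<open>w\<close>. The continuation by zeros keeps the ballot condition valid at all times.\<close>

definition closed :: "nat \<Rightarrow> nat \<Rightarrow> (nat \<Rightarrow> nat) \<Rightarrow> bool" where
  "closed b w u \<longleftrightarrow> letters b u \<and> lattice u \<and> (\<forall>i<b. cnt u i (b * w) = w) \<and> (\<forall>t\<ge>b * w. u t = 0)"

text \<open>Adding or removing a particle that is present all the time is compared with the constant
  profiles \<open>[b \<le> i]\<close> and \<open>[1 \<le> i]\<close>, whose weights are the numbers
  of letters \<open>b - 1\<close> and \<open>0\<close>. Both numbers are \<open>w\<close>. This
  allows a source at the end of the word to be traded for one at time \<open>0\<close>.\<close>

lemma V_wrap:
  assumes c: "letters b u" "lattice u" "\<And>i. i < b \<Longrightarrow> cnt u i N = w" and b: "1 \<le> b"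
    and n: "good b n" "\<And>t. n t \<le> int b - 1"
  shows "V b u N (\<lambda>t. n t + 1) = V b u N n + int w"
proof -
  have n': "good b (\<lambda>t. n t + 1)" using n unfolding good_def mono_def by (smt (verit))
  have cw: "(\<Sum>t<N. of_bool (u t = i)) = int w" if "i < b" for i using c(3)[OF that] cnt_int[of u i N] by simp
  show ?thesis
  proof (rule antisym)
    obtain \<kappa> where k: "chain b n \<kappa>" "weight u N \<kappa> = V b u N n" using V_attained[OF c(1) n(1)] .
    let ?k = "\<lambda>t i. min (int i) (\<kappa> t i + 1)"
    have "chain b (\<lambda>t. n t + 1) ?k"
      unfolding chain_def using chainD[OF k(1)] chain_bounds[OF k(1)] n(2)
      by (smt (verit) of_nat_0_le_iff of_nat_Suc of_nat_0)
    then have 1: "weight u N ?k \<le> V b u N (\<lambda>t. n t + 1)" by (rule V_ge[OF c(1)])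
    have "0 \<le> weight u N (\<lambda>t i. (?k t i - \<kappa> t i) - of_bool (b \<le> i))"
    proof (rule weight_nonneg_lattice[OF c(1,2)])
      fix t i
      show "?k t 0 - \<kappa> t 0 - of_bool (b \<le> 0) = 0" using b chainD(1)[OF k(1)] by simp
      show "?k t b - \<kappa> t b - of_bool (b \<le> b) = 0" using chainD(2)[OF k(1)] n(2)[of t] by simp
      { assume "i \<le> b" then show "0 \<le> ?k t i - \<kappa> t i - of_bool (b \<le> i)"
          using chain_bounds(2)[OF k(1), of i t] chainD(2)[OF k(1), of t] n(2)[of t] by auto }
      { assume "i \<le> b" then show "?k (Suc t) i - \<kappa> (Suc t) i - of_bool (b \<le> i) \<le> ?k t i - \<kappa> t i - of_bool (b \<le> i)"
          using chainD(5)[OF k(1), of i t] by auto }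
    qed
    then have "weight u N \<kappa> + weight u N (\<lambda>t i. of_bool (b \<le> i)) \<le> weight u N ?k"
      unfolding weight_diff by simp
    moreover have "weight u N (\<lambda>t i. of_bool (b \<le> i)) = int w"
    proof -
      have "weight u N (\<lambda>t i. of_bool (b \<le> i)) = (\<Sum>t<N. of_bool (u t = b - 1))"
        unfolding weight_def
      proof (rule sum.cong[OF refl])
        fix t show "of_bool (b \<le> Suc (u t)) - of_bool (b \<le> u t) = (of_bool (u t = b - 1) :: int)"
          using c(1)[unfolded letters_def, rule_format, of t] by auto
      qed
      then show ?thesis using cw[of "b - 1"] b by simp
    qed
    ultimately show "V b u N n + int w \<le> V b u N (\<lambda>t. n t + 1)" using 1 k(2) by simp
  next
    obtain \<kappa> where k: "chain b (\<lambda>t. n t + 1) \<kappa>" "weight u N \<kappa> = V b u N (\<lambda>t. n t + 1)" using V_attained[OF c(1) n'] .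
    let ?k = "\<lambda>t i. max 0 (\<kappa> t i - 1)"
    have n0: "0 \<le> n t" for t using n(1) by (simp add: good_def)
    have "chain b n ?k"
      unfolding chain_def using chainD[OF k(1)] n0
      by (smt (verit))
    then have 1: "weight u N ?k \<le> V b u N n" by (rule V_ge[OF c(1)])
    have "0 \<le> weight u N (\<lambda>t i. of_bool (1 \<le> i) - (\<kappa> t i - ?k t i))"
    proof (rule weight_nonneg_lattice[OF c(1,2)])
      fix t i
      show "of_bool (1 \<le> (0::nat)) - (\<kappa> t 0 - ?k t 0) = 0" using b chainD(1)[OF k(1)] by simp
      show "of_bool (1 \<le> b) - (\<kappa> t b - ?k t b) = 0" using chainD(2)[OF k(1)] n0[of t] b by simp
      { assume "i \<le> b" then show "0 \<le> of_bool (1 \<le> i) - (\<kappa> t i - ?k t i)"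
          using chain_bounds(1,2)[OF k(1), of i t] by (auto simp: of_bool_def) }
      { assume "i \<le> b" then show "of_bool (1 \<le> i) - (\<kappa> (Suc t) i - ?k (Suc t) i) \<le> of_bool (1 \<le> i) - (\<kappa> t i - ?k t i)"
          using chainD(5)[OF k(1), of i t] by auto }
    qed
    then have "weight u N \<kappa> \<le> weight u N (\<lambda>t i. of_bool (1 \<le> i)) + weight u N ?k"
      unfolding weight_diff by simp
    moreover have "weight u N (\<lambda>t i. of_bool (1 \<le> i)) = int w"
    proof -
      have "weight u N (\<lambda>t i. of_bool (1 \<le> i)) = (\<Sum>t<N. of_bool (u t = 0))"
        unfolding weight_def by (rule sum.cong) auto
      then show ?thesis using cw[of 0] b by simp
    qed
    ultimately show "V b u N (\<lambda>t. n t + 1) \<le> V b u N n + int w" using 1 k(2) by simp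
  qed
qed

section \<open>Slides and promotion of words\<close>

definition lam :: "(nat \<Rightarrow> nat) \<Rightarrow> (nat \<Rightarrow> nat) \<Rightarrow> nat \<Rightarrow> nat \<Rightarrow> nat" where
  "lam \<mu> u t i = \<mu> i + cnt u i t"

lemma lam_simps [simp]: "lam \<mu> u 0 i = \<mu> i" "lam \<mu> u (Suc t) i = lam \<mu> u t i + (if u t = i then 1 else 0)"
  by (simp_all add: lam_def)

text \<open>The slide into the inner corner at the end of row \<open>l\<close>, followed in the order of the entries: \<open>hol \<mu> u l t\<close> is
  the row of the hole after \<open>t\<close> letters. The entry at time \<open>t\<close> changes its row exactly if it enters the
  row above, that is, if the hole moves down.\<close>
primrec hol :: "(nat \<Rightarrow> nat) \<Rightarrow> (nat \<Rightarrow> nat) \<Rightarrow> nat \<Rightarrow> nat \<Rightarrow> nat" where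
  "hol \<mu> u l 0 = l"
| "hol \<mu> u l (Suc t) = (if u t = Suc (hol \<mu> u l t) \<and> lam \<mu> u (Suc t) (hol \<mu> u l t) = lam \<mu> u (Suc t) (Suc (hol \<mu> u l t))
     then Suc (hol \<mu> u l t) else hol \<mu> u l t)"

definition sl :: "(nat \<Rightarrow> nat) \<Rightarrow> (nat \<Rightarrow> nat) \<Rightarrow> nat \<Rightarrow> nat \<Rightarrow> nat" where
  "sl \<mu> u l t = (if hol \<mu> u l (Suc t) \<noteq> hol \<mu> u l t then hol \<mu> u l t else u t)"

definition skew :: "(nat \<Rightarrow> nat) \<Rightarrow> (nat \<Rightarrow> nat) \<Rightarrow> bool" where
  "skew \<mu> u \<longleftrightarrow> (\<forall>t i. lam \<mu> u t (Suc i) \<le> lam \<mu> u t i)"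

lemma skewD: "skew \<mu> u \<Longrightarrow> lam \<mu> u t (Suc i) \<le> lam \<mu> u t i"
  by (simp add: skew_def)

text \<open>The hole remains the last cell of its row and a corner of the current shape; therefore
  its row determines it.\<close>

lemma hol_corner:
  assumes "skew \<mu> u" "\<mu> (Suc l) < \<mu> l"
  shows "lam \<mu> u t (Suc (hol \<mu> u l t)) < lam \<mu> u t (hol \<mu> u l t)"
proof (induction t)
  case (Suc t)
  show ?case
    using Suc skewD[OF assms(1), of "Suc t" "hol \<mu> u l t"] skewD[OF assms(1), of t "Suc (hol \<mu> u l t)"]
    by (auto split: if_splits)
qed (use assms in simp)

lemma hol_mono: "s \<le> t \<Longrightarrow> hol \<mu> u l s \<le> hol \<mu> u l t"
  by (rule lift_Suc_mono_le[of "hol \<mu> u l"]) auto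

lemma sl_cases:
  obtains (move) "u t = Suc (hol \<mu> u l t)" "lam \<mu> u (Suc t) (hol \<mu> u l t) = lam \<mu> u (Suc t) (Suc (hol \<mu> u l t))"
      "hol \<mu> u l (Suc t) = Suc (hol \<mu> u l t)" "sl \<mu> u l t = hol \<mu> u l t"
  | (stay) "hol \<mu> u l (Suc t) = hol \<mu> u l t" "sl \<mu> u l t = u t"
    "u t \<noteq> Suc (hol \<mu> u l t) \<or> lam \<mu> u (Suc t) (hol \<mu> u l t) \<noteq> lam \<mu> u (Suc t) (Suc (hol \<mu> u l t))"
proof (cases "u t = Suc (hol \<mu> u l t) \<and> lam \<mu> u (Suc t) (hol \<mu> u l t) = lam \<mu> u (Suc t) (Suc (hol \<mu> u l t))")
  case True
  have h: "hol \<mu> u l (Suc t) = Suc (hol \<mu> u l t)" unfolding hol.simps(2) by (rule if_P[OF True])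
  have "sl \<mu> u l t = hol \<mu> u l t" unfolding sl_def h by simp
  then show ?thesis using move True h by blast
next
  case False
  have h: "hol \<mu> u l (Suc t) = hol \<mu> u l t" unfolding hol.simps(2) by (rule if_not_P[OF False])
  have "sl \<mu> u l t = u t" unfolding sl_def h by simp
  then show ?thesis using stay False h by blast
qed

lemma lam_sl:
  assumes "\<mu> (Suc l) < \<mu> l"
  shows "lam (\<mu>(l := \<mu> l - 1)) (sl \<mu> u l) t i + of_bool (i = hol \<mu> u l t) = lam \<mu> u t i"
proof (induction t)
  case (Suc t)
  show ?case
  proof (cases rule: sl_cases[where t = t and u = u and \<mu> = \<mu> and l = l])
    case move
    then show ?thesis using Suc by (auto simp del: hol.simps)
  next
    case stay
    then show ?thesis using Suc by (auto simp del: hol.simps)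
  qed
qed (use assms in auto)

lemma skew_sl:
  assumes "skew \<mu> u" "\<mu> (Suc l) < \<mu> l" shows "skew (\<mu>(l := \<mu> l - 1)) (sl \<mu> u l)"
  unfolding skew_def
proof (intro allI)
  fix t i
  show "lam (\<mu>(l := \<mu> l - 1)) (sl \<mu> u l) t (Suc i) \<le> lam (\<mu>(l := \<mu> l - 1)) (sl \<mu> u l) t i"
    using lam_sl[OF assms(2), of u t i] lam_sl[OF assms(2), of u t "Suc i"] skewD[OF assms(1), of t i]
      hol_corner[OF assms, of t] by (cases "i = hol \<mu> u l t") (auto simp: of_bool_def split: if_splits)
qed

lemma sl_le: "sl \<mu> u l t \<le> u t"
  by (cases rule: sl_cases[where t = t and u = u and \<mu> = \<mu> and l = l]) auto

lemma letters_le: "letters b u \<Longrightarrow> (\<And>t. v t \<le> u t) \<Longrightarrow> letters b v"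
  unfolding letters_def by (meson le_less_trans)

lemma letters_sl: "letters b u \<Longrightarrow> letters b (sl \<mu> u l)"
  using letters_le sl_le by blast

lemma lam_cong: "(\<And>s. s < t \<Longrightarrow> u s = v s) \<Longrightarrow> lam \<mu> u t i = lam \<mu> v t i"
  unfolding lam_def using cnt_cong by metis

lemma hol_cong: "(\<And>s. s < t \<Longrightarrow> u s = v s) \<Longrightarrow> hol \<mu> u l t = hol \<mu> v l t"
proof (induction t)
  case (Suc t)
  then have "hol \<mu> u l t = hol \<mu> v l t" "u t = v t" by auto
  moreover have "lam \<mu> u (Suc t) i = lam \<mu> v (Suc t) i" for i using Suc.prems by (rule lam_cong)
  ultimately show ?case unfolding hol.simps by simp
qed simp

lemma sl_cong: "(\<And>s. s \<le> t \<Longrightarrow> u s = v s) \<Longrightarrow> sl \<mu> u l t = sl \<mu> v l t"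
  unfolding sl_def using hol_cong[of t u v \<mu> l] hol_cong[of "Suc t" u v \<mu> l]
  by (metis less_Suc_eq_le less_imp_le_nat order_refl)

lemma wdiff_lam: "wdiff u h t = int (lam \<mu> u t h) - int (lam \<mu> u t (Suc h)) - (int (\<mu> h) - int (\<mu> (Suc h)))"
  by (simp add: wdiff_def lam_def)

definition veq :: "nat \<Rightarrow> (nat \<Rightarrow> nat) \<Rightarrow> (nat \<Rightarrow> nat) \<Rightarrow> bool" where
  "veq b u v \<longleftrightarrow> (\<forall>N n. good b n \<longrightarrow> V b u N n = V b v N n)"

text \<open>The letters are replaced one at a time, with the slid word before time \<open>k\<close>
  and the old word from \<open>k\<close> on. If the letter at \<open>k\<close> drops from
  \<open>Suc h\<close> to \<open>h\<close>, rows \<open>h\<close> and \<open>Suc h\<close> are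
  equally long in the new shape at time \<open>k\<close> and in the old shape at time
  \<open>Suc k\<close>. Since all shapes are partitions, these are the minima required by the two
  letter change lemmas.\<close>

lemma V_sl:
  assumes l: "letters b u" and n: "good b n" and s: "skew \<mu> u" "\<mu> (Suc l) < \<mu> l"
  shows "V b (sl \<mu> u l) N n = V b u N n"
proof -
  define v where "v k = (\<lambda>t. if t < k then sl \<mu> u l t else u t)" for k
  have lv: "letters b (v k)" for k
    by (rule letters_le[OF l]) (simp add: v_def sl_le)
  have "V b (v (Suc k)) N n = V b (v k) N n" for k
  proof (cases rule: sl_cases[where t = k and u = u and \<mu> = \<mu> and l = l])
    case stay
    then have "v (Suc k) = v k" by (auto simp: v_def fun_eq_iff less_Suc_eq)
    then show ?thesis by simp
  next
    case move
    define h where "h = hol \<mu> u l k"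
    have vs: "v (Suc k) = (v k)(k := h)" using move by (auto simp: v_def fun_eq_iff less_Suc_eq h_def)
    have vk: "v k k = Suc h" using move by (simp add: v_def h_def)
    let ?\<mu> = "\<mu>(l := \<mu> l - 1)"
    have 1: "wdiff (v k) h x = wdiff (sl \<mu> u l) h x" if "x \<le> k" for x
      using that unfolding wdiff_def by (intro arg_cong2[where f = "(-)"] arg_cong[where f = int] cnt_cong) (auto simp: v_def)
    have 2: "wdiff (v k) h \<tau> - wdiff (v k) h (Suc k) = wdiff u h \<tau> - wdiff u h (Suc k)" if "Suc k \<le> \<tau>" for \<tau>
      unfolding wdiff_sum[OF that] by (rule sum.cong) (auto simp: v_def)
    have "lam ?\<mu> (sl \<mu> u l) k h = lam ?\<mu> (sl \<mu> u l) k (Suc h)"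
      using lam_sl[of \<mu> l u k h] lam_sl[of \<mu> l u k "Suc h"] s(2) move(1,2) by (simp add: h_def)
    then have pre: "wdiff (v k) h k \<le> wdiff (v k) h x" if "x \<le> k" for x
      using 1[OF that] 1[of k] wdiff_lam[of "sl \<mu> u l" h k ?\<mu>] wdiff_lam[of "sl \<mu> u l" h x ?\<mu>]
        skewD[OF skew_sl[OF s], of x h] by simp
    have post: "wdiff (v k) h (Suc k) \<le> wdiff (v k) h \<tau>" if "Suc k \<le> \<tau>" for \<tau>
      using 2[OF that] wdiff_lam[of u h "Suc k" \<mu>] wdiff_lam[of u h \<tau> \<mu>] skewD[OF s(1), of \<tau> h] move(2)
      unfolding h_def by linarith
    show ?thesis unfolding vs
      using V_letter_change_le[OF lv n vk post] V_letter_change_ge[OF lv n vk pre] by (intro antisym) auto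
  qed
  then have "V b (v k) N n = V b (v 0) N n" for k by (induction k) auto
  from this[of N] show ?thesis using V_cong[of N "v N" "sl \<mu> u l" b n] by (simp add: v_def)
qed

lemma veq_sl: "letters b u \<Longrightarrow> skew \<mu> u \<Longrightarrow> \<mu> (Suc l) < \<mu> l \<Longrightarrow> veq b u (sl \<mu> u l)"
  by (simp add: veq_def V_sl)

lemma veq_trans: "veq b u v \<Longrightarrow> veq b v w \<Longrightarrow> veq b u w"
  and veq_sym: "veq b u v \<Longrightarrow> veq b v u" and veq_refl: "veq b u u"
  by (simp_all add: veq_def)

lemma veq_shift:
  assumes "letters b u" "letters b v" "veq b u v" shows "veq b (u \<circ> Suc) (v \<circ> Suc)"
  unfolding veq_def
proof (intro allI impI)
  fix N n assume n: "good b n"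
  let ?n = "\<lambda>t. case t of 0 \<Rightarrow> 0 | Suc t \<Rightarrow> n t"
  have g: "good b ?n" using n by (auto simp: good_def mono_def split: nat.split)
  show "V b (u \<circ> Suc) N n = V b (v \<circ> Suc) N n"
    using V_shift_Suc[OF assms(1) n g, of N] V_shift_Suc[OF assms(2) n g, of N] assms(3) g by (simp add: veq_def)
qed

lemma veq_lattice_eq: "letters b u \<Longrightarrow> lattice u \<Longrightarrow> letters b v \<Longrightarrow> lattice v \<Longrightarrow> veq b u v \<Longrightarrow> u = v"
  unfolding veq_def fun_eq_iff by (metis lattice_unique lessI)

lemma skew_zero: "skew (\<lambda>i. 0) u \<longleftrightarrow> lattice u"
  by (simp add: skew_def lattice_def lam_def)

text \<open>Inner cells are removed by slides that always start at the last nonempty row of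
  \<open>\<mu>\<close>, whose end is a corner. No slide raises a letter.\<close>

lemma highest_weight_exists:
  assumes "letters b u" "skew \<mu> u" "\<And>i. b \<le> i \<Longrightarrow> \<mu> i = 0"
  shows "\<exists>q. letters b q \<and> lattice q \<and> veq b u q \<and> (\<forall>t. q t \<le> u t)"
  using assms
proof (induction "\<Sum>i<b. \<mu> i" arbitrary: u \<mu> rule: less_induct)
  case less
  show ?case
  proof (cases "\<forall>i. \<mu> i = 0")
    case True
    then have "\<mu> = (\<lambda>i. 0)" by auto
    then show ?thesis using less.prems skew_zero veq_refl by blast
  next
    case False
    define l where "l = Max {i. i < b \<and> \<mu> i > 0}"
    obtain i where i: "\<mu> i \<noteq> 0" using False by blast
    then have "i < b" using less.prems(3)[of i] by (meson not_le)
    then have ne: "{i. i < b \<and> \<mu> i > 0} \<noteq> {}" using i by auto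
    have "l \<in> {i. i < b \<and> \<mu> i > 0}" unfolding l_def by (rule Max_in[OF _ ne]) simp
    then have l: "l < b" "\<mu> l > 0" by auto
    have "\<mu> (Suc l) = 0"
    proof (rule ccontr)
      assume "\<mu> (Suc l) \<noteq> 0"
      moreover have "Suc l < b" using calculation less.prems(3)[of "Suc l"] by (meson not_le)
      ultimately have "Suc l \<in> {i. i < b \<and> \<mu> i > 0}" by simp
      then have "Suc l \<le> l" unfolding l_def by (intro Max_ge) auto
      then show False by simp
    qed
    then have c: "\<mu> (Suc l) < \<mu> l" using l by simp
    let ?\<mu> = "\<mu>(l := \<mu> l - 1)"
    have "(\<Sum>i<b. ?\<mu> i) < (\<Sum>i<b. \<mu> i)"
      by (rule sum_strict_mono_ex1) (use l in auto)
    moreover have "?\<mu> i = 0" if "b \<le> i" for i using less.prems(3)[OF that] l that by simp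
    ultimately obtain q where "letters b q \<and> lattice q \<and> veq b (sl \<mu> u l) q \<and> (\<forall>t. q t \<le> sl \<mu> u l t)"
      using less.hyps[of ?\<mu> "sl \<mu> u l"] letters_sl[OF less.prems(1)] skew_sl[OF less.prems(2) c] by blast
    then show ?thesis using veq_sl[OF less.prems(1,2) c] veq_trans sl_le order_trans by meson
  qed
qed

text \<open>As \<open>V\<close> separates lattice words, the result does not depend on the order of
  the slides that produce it.\<close>

definition hw :: "nat \<Rightarrow> (nat \<Rightarrow> nat) \<Rightarrow> nat \<Rightarrow> nat" where
  "hw b u = (SOME q. letters b q \<and> lattice q \<and> veq b u q)"

lemma hw_unique:
  assumes "letters b q" "lattice q" "veq b u q" shows "hw b u = q"
proof -
  have "letters b (hw b u) \<and> lattice (hw b u) \<and> veq b u (hw b u)"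
    unfolding hw_def by (rule someI[of _ q]) (use assms in blast)
  then show ?thesis using veq_lattice_eq[of b "hw b u" q] assms veq_trans veq_sym by blast
qed

lemma hw:
  assumes "letters b u" "skew \<mu> u" "\<And>i. b \<le> i \<Longrightarrow> \<mu> i = 0"
  shows "letters b (hw b u)" "lattice (hw b u)" "veq b u (hw b u)" "hw b u t \<le> u t"
proof -
  obtain q where "letters b q" "lattice q" "veq b u q" "\<forall>t. q t \<le> u t"
    using highest_weight_exists[OF assms] by blast
  then show "letters b (hw b u)" "lattice (hw b u)" "veq b u (hw b u)" "hw b u t \<le> u t"
    using hw_unique[of b q u] by simp_all
qed

lemma cnt_shift: "cnt u i (Suc t) = (if u 0 = i then 1 else 0) + cnt (u \<circ> Suc) i t"
  by (induction t) auto

text \<open>The inner shape left behind when the entry \<open>1\<close> is erased.\<close>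

definition unit0 :: "nat \<Rightarrow> nat" where "unit0 i = (if i = 0 then 1 else 0)"

lemma unit0_simps [simp]: "unit0 0 = 1" "unit0 (Suc i) = 0" "unit0(0 := 0) = (\<lambda>i. 0)"
  by (auto simp: unit0_def)

lemma lattice_0: assumes "lattice u" shows "u 0 = 0"
proof (cases "u 0")
  case (Suc k)
  then show ?thesis using assms[unfolded lattice_def, rule_format, of k "Suc 0"] by simp
qed simp

lemma lam_unit0: "lattice u \<Longrightarrow> lam unit0 (u \<circ> Suc) t i = cnt u i (Suc t)"
  by (simp only: cnt_shift lattice_0) (auto simp: lam_def unit0_def)

lemma skew_unit0: "lattice u \<Longrightarrow> skew unit0 (u \<circ> Suc)"
  unfolding skew_def lam_unit0 by (simp only: lattice_def) blast

definition wsl :: "(nat \<Rightarrow> nat) \<Rightarrow> nat \<Rightarrow> nat" where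
  "wsl u = sl unit0 (u \<circ> Suc) 0"

abbreviation whol :: "(nat \<Rightarrow> nat) \<Rightarrow> nat \<Rightarrow> nat" where
  "whol u \<equiv> hol unit0 (u \<circ> Suc) 0"

lemma cnt_wsl: "lattice u \<Longrightarrow> cnt (wsl u) i t + of_bool (i = whol u t) = cnt u i (Suc t)"
  using lam_sl[of unit0 0 "u \<circ> Suc" t i] by (simp add: lam_unit0 wsl_def lam_def[of "\<lambda>i. 0"] del: cnt_Suc)

lemma whol_corner: "lattice u \<Longrightarrow> cnt u (Suc (whol u t)) (Suc t) < cnt u (whol u t) (Suc t)"
  using hol_corner[OF skew_unit0, of u 0 t] by (simp only: lam_unit0 unit0_simps)

lemma lattice_wsl: "lattice u \<Longrightarrow> lattice (wsl u)"
  using skew_sl[OF skew_unit0, of u 0] by (simp add: wsl_def skew_zero)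

lemma letters_shift: "letters b u \<Longrightarrow> letters b (u \<circ> Suc)"
  by (simp add: letters_def)

lemma letters_wsl: "letters b u \<Longrightarrow> letters b (wsl u)"
  by (simp add: wsl_def letters_sl letters_shift)

lemma veq_wsl: "letters b u \<Longrightarrow> lattice u \<Longrightarrow> veq b (u \<circ> Suc) (wsl u)"
  unfolding wsl_def by (rule veq_sl) (auto simp: letters_shift skew_unit0)

lemma wsl_le: "wsl u t \<le> u (Suc t)"
  using sl_le[of unit0 "u \<circ> Suc" 0 t] by (simp add: wsl_def)

lemma wsl_cong: "(\<And>s. s \<le> Suc t \<Longrightarrow> u s = v s) \<Longrightarrow> wsl u t = wsl v t"
  unfolding wsl_def by (rule sl_cong) simp

lemma wsl_pow:
  assumes "letters b u" "lattice u"
  shows "letters b ((wsl ^^ k) u) \<and> lattice ((wsl ^^ k) u) \<and> veq b (\<lambda>t. u (t + k)) ((wsl ^^ k) u)"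
proof (induction k)
  case (Suc k)
  let ?q = "(wsl ^^ k) u"
  have "letters b (\<lambda>t. u (t + k))" using assms(1) by (simp add: letters_def)
  then have "veq b ((\<lambda>t. u (t + k)) \<circ> Suc) (?q \<circ> Suc)" using Suc veq_shift by blast
  then have "veq b ((\<lambda>t. u (t + k)) \<circ> Suc) (wsl ?q)" using Suc veq_wsl veq_trans by blast
  moreover have "(\<lambda>t. u (t + k)) \<circ> Suc = (\<lambda>t. u (t + Suc k))" by auto
  ultimately show ?case using Suc letters_wsl lattice_wsl by simp
qed (use assms veq_refl in simp)

section \<open>Promotion and reversal of rectangular words\<close>

definition prw :: "nat \<Rightarrow> nat \<Rightarrow> (nat \<Rightarrow> nat) \<Rightarrow> nat \<Rightarrow> nat" where
  "prw b N u t = (if Suc t < N then wsl u t else if Suc t = N then b - 1 else 0)"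

text \<open>On tableaux this is the half turn of the rectangle with complemented entries.\<close>

definition revw :: "nat \<Rightarrow> nat \<Rightarrow> (nat \<Rightarrow> nat) \<Rightarrow> nat \<Rightarrow> nat" where
  "revw b N u t = (if t < N then b - 1 - u (N - 1 - t) else 0)"

lemma closedD:
  assumes "closed b w u"
  shows "letters b u" "lattice u" "i < b \<Longrightarrow> cnt u i (b * w) = w" "b * w \<le> t \<Longrightarrow> u t = 0"
  using assms by (auto simp: closed_def)

lemma cnt_zero: "letters b u \<Longrightarrow> b \<le> i \<Longrightarrow> cnt u i t = 0"
  unfolding cnt_def letters_def by (auto simp: card_eq_0_iff) (metis not_less)

lemma closedI:
  assumes l: "letters b u" and b: "1 \<le> b" and c: "\<And>i. i < b \<Longrightarrow> cnt u i N = w" and z: "\<And>t. N \<le> t \<Longrightarrow> u t = 0"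
    and N: "N = b * w" and lat: "\<And>t i. t < N \<Longrightarrow> Suc i < b \<Longrightarrow> cnt u (Suc i) t \<le> cnt u i t"
  shows "closed b w u"
proof -
  have tail: "cnt u i t = cnt u i N + (if i = 0 then t - N else 0)" if "N \<le> t" for i t
    using that
  proof (induction t rule: dec_induct)
    case (step t)
    then show ?case using z[of t] by (auto simp: Suc_diff_le)
  qed simp
  have "cnt u (Suc i) t \<le> cnt u i t" for t i
  proof (cases "Suc i < b")
    case False
    then show ?thesis using cnt_zero[OF l, of "Suc i" t] by simp
  next
    case True
    then show ?thesis using lat[of t i] tail[of t i] tail[of t "Suc i"] c[of i] c[of "Suc i"] by (cases "t < N") auto
  qed
  then show ?thesis using l c z N by (simp add: closed_def lattice_def)
qed

text \<open>The hole sits at a corner and the full rectangle has only one, in its last row. This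
  justifies the letter \<open>b - 1\<close> appended by \<open>prw\<close>.\<close>

lemma whol_last:
  assumes c: "closed b w u" and w: "1 \<le> w" "1 \<le> b" shows "whol u (b * w - 1) = b - 1"
proof -
  let ?h = "whol u (b * w - 1)"
  have e: "Suc (b * w - 1) = b * w" using w by simp
  have lt: "cnt u (Suc ?h) (b * w) < cnt u ?h (b * w)"
    using whol_corner[OF closedD(2)[OF c], of "b * w - 1"] unfolding e .
  then have "?h < b" using cnt_zero[OF closedD(1)[OF c], of ?h "b * w"] by (cases "?h < b") auto
  moreover have "\<not> Suc ?h < b" using lt closedD(3)[OF c, of ?h] closedD(3)[OF c, of "Suc ?h"] by auto
  ultimately show ?thesis by simp
qed

lemma cnt_prw:
  assumes c: "closed b w u" and t: "t < b * w"
  shows "cnt (prw b (b * w) u) i t + of_bool (i = whol u t) = cnt u i (Suc t)"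
proof -
  have "cnt (prw b (b * w) u) i t = cnt (wsl u) i t"
    by (rule cnt_cong) (use t in \<open>auto simp: prw_def\<close>)
  then show ?thesis using cnt_wsl[OF closedD(2)[OF c]] by simp
qed

lemma closed_prw:
  assumes c: "closed b w u" and w: "1 \<le> w" "1 \<le> b" shows "closed b w (prw b (b * w) u)"
proof (rule closedI[where N = "b * w"])
  have e: "Suc (b * w - 1) = b * w" using w by simp
  show "letters b (prw b (b * w) u)"
    using letters_wsl[OF closedD(1)[OF c]] w by (auto simp: letters_def prw_def)
  show "cnt (prw b (b * w) u) i (b * w) = w" if "i < b" for i
  proof -
    have "cnt (prw b (b * w) u) i (b * w) = cnt (prw b (b * w) u) i (b * w - 1) + (if prw b (b * w) u (b * w - 1) = i then 1 else 0)"
      using cnt_Suc[of "prw b (b * w) u" i "b * w - 1"] unfolding e .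
    moreover have "prw b (b * w) u (b * w - 1) = b - 1" unfolding prw_def using e by simp
    moreover have "cnt u i (b * w) = w" using closedD(3)[OF c that] .
    moreover have "cnt (prw b (b * w) u) i (b * w - 1) + of_bool (i = b - 1) = cnt u i (b * w)"
      using cnt_prw[OF c, of "b * w - 1" i] whol_last[OF c w] e by (simp del: cnt_Suc)
    ultimately show ?thesis by (cases "i = b - 1") simp_all
  qed
  show "cnt (prw b (b * w) u) (Suc i) t \<le> cnt (prw b (b * w) u) i t" if t: "t < b * w" for t i
  proof -
    have "cnt (prw b (b * w) u) j t = cnt (wsl u) j t" for j
      by (rule cnt_cong) (use t in \<open>auto simp: prw_def\<close>)
    then show ?thesis using lattice_wsl[OF closedD(2)[OF c]] by (simp add: lattice_def)
  qed
qed (use w in \<open>auto simp: prw_def\<close>)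

lemma prw_le: "Suc t < N \<Longrightarrow> prw b N u t \<le> u (Suc t)"
  by (simp add: prw_def wsl_le)

lemma cnt_revw:
  assumes l: "letters b u" and i: "i < b" and t: "t \<le> N"
  shows "cnt (revw b N u) i t + cnt u (b - 1 - i) (N - t) = cnt u (b - 1 - i) N"
  using t
proof (induction t)
  case (Suc t)
  have e: "N - t = Suc (N - Suc t)" using Suc.prems by simp
  have "revw b N u t = b - 1 - u (N - Suc t)" using Suc.prems by (simp add: revw_def)
  moreover have "u (N - Suc t) < b" using l by (simp add: letters_def)
  ultimately have "revw b N u t = i \<longleftrightarrow> u (N - Suc t) = b - 1 - i" using i by auto
  moreover have "cnt (revw b N u) i t + cnt u (b - 1 - i) (Suc (N - Suc t)) = cnt u (b - 1 - i) N"
    using Suc unfolding e by simp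
  ultimately show ?case by simp
qed simp

lemma letters_revw: "1 \<le> b \<Longrightarrow> letters b (revw b N u)"
  by (auto simp: letters_def revw_def)

lemma closed_revw:
  assumes c: "closed b w u" and b: "1 \<le> b" shows "closed b w (revw b (b * w) u)"
proof (rule closedI[where N = "b * w"])
  show "cnt (revw b (b * w) u) i (b * w) = w" if "i < b" for i
    using cnt_revw[OF closedD(1)[OF c] that, of "b * w" "b * w"] closedD(3)[OF c, of "b - 1 - i"] that by simp
  show "cnt (revw b (b * w) u) (Suc i) t \<le> cnt (revw b (b * w) u) i t" if "t < b * w" "Suc i < b" for t i
  proof -
    have e: "b - 1 - i = Suc (b - 1 - Suc i)" using that by simp
    have "cnt u (b - 1 - i) (b * w - t) \<le> cnt u (b - 1 - Suc i) (b * w - t)"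
      using closedD(2)[OF c] unfolding lattice_def e by blast
    then show ?thesis
      using cnt_revw[OF closedD(1)[OF c], of i t "b * w"] cnt_revw[OF closedD(1)[OF c], of "Suc i" t "b * w"]
        closedD(3)[OF c, of "b - 1 - i"] closedD(3)[OF c, of "b - 1 - Suc i"] that by simp
  qed
qed (use b letters_revw in \<open>auto simp: revw_def\<close>)

lemma revw_revw:
  assumes c: "closed b w u" shows "revw b (b * w) (revw b (b * w) u) = u"
proof
  fix t
  have "u t < b" using closedD(1)[OF c] by (simp add: letters_def)
  then show "revw b (b * w) (revw b (b * w) u) t = u t"
    using closedD(4)[OF c, of t] by (auto simp: revw_def)
qed

text \<open>Reversing the time and the order of the rows turns promotion into its inverse: the slide path of
  the reversed word is the reversed slide path.\<close>
lemma prw_revw_prw: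
  assumes c: "closed b w u" and w: "1 \<le> w" "1 \<le> b"
  shows "prw b (b * w) (revw b (b * w) (prw b (b * w) u)) = revw b (b * w) u"
proof -
  define N where "N = b * w"
  define y where "y = prw b N u"
  define z where "z = revw b N y"
  define H where "H = whol u"
  have N: "1 \<le> N" using w by (simp add: N_def)
  have cy: "closed b w y" unfolding y_def N_def by (rule closed_prw[OF c w])
  have cz: "closed b w z" unfolding z_def N_def by (rule closed_revw[OF cy w(2)])
  have Hlast: "H (N - 1) = b - 1" unfolding H_def N_def by (rule whol_last[OF c w])
  have Hmono: "s \<le> t \<Longrightarrow> H s \<le> H t" for s t unfolding H_def by (rule hol_mono)
  have Hb: "H s < b" if "s < N" for s
  proof -
    have "H s \<le> H (N - 1)" by (rule Hmono) (use that in simp)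
    then show ?thesis using Hlast w(2) by linarith
  qed
  have cntz: "cnt z i t + cnt y (b - 1 - i) (N - t) = w" if "i < b" "t \<le> N" for i t
    using cnt_revw[OF closedD(1)[OF cy] that] closedD(3)[OF cy, of "b - 1 - i"] that by (simp add: z_def N_def)
  have cnty: "cnt y j s + of_bool (j = H s) = cnt u j (Suc s)" if "s < N" for j s
    unfolding y_def N_def H_def by (rule cnt_prw[OF c]) (use that in \<open>simp add: N_def\<close>)
  have ly: "y s < b" for s using closedD(1)[OF cy] by (simp add: letters_def)
  have step: "whol z (Suc t) = b - 1 - H (N - 1 - Suc t) \<and> wsl z t = b - 1 - u (N - 1 - t)"
    if t: "Suc t < N" and ih: "whol z t = b - 1 - H (N - 1 - t)" for t
  proof -
    \<comment> \<open>\<open>s\<close> mirrors the time step: while the hole of \<open>z\<close>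
      passes from \<open>t\<close> to \<open>Suc t\<close>, the hole of \<open>u\<close> is followed
      backwards from \<open>Suc s\<close> to \<open>s\<close>.\<close>
    define s where "s = N - 1 - Suc t"
    have s: "N - 1 - t = Suc s" "Suc s < N" "N - Suc (Suc t) = s" using t by (auto simp: s_def)
    have zt: "(z \<circ> Suc) t = b - 1 - y s" using t by (simp add: z_def revw_def s_def numeral_2_eq_2)
    have lz: "lam unit0 (z \<circ> Suc) (Suc t) i + cnt y (b - 1 - i) s = w" if "i < b" for i
      using cntz[OF that, of "Suc (Suc t)"] t lam_unit0[OF closedD(2)[OF cz], of "Suc t" i] unfolding s(3) by simp
    have ys: "y s = wsl u s" using s(2) by (simp add: y_def prw_def)
    have zh: "whol z t = b - 1 - H (Suc s)" using ih unfolding s(1) .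
    show ?thesis
    proof (cases rule: sl_cases[where t = s and u = "u \<circ> Suc" and \<mu> = unit0 and l = 0])
      case move
      have HS: "H (Suc s) = Suc (H s)" using move(3) unfolding H_def .
      have yH: "y s = H s" using move(4) ys unfolding H_def wsl_def by simp
      have uH: "u (Suc s) = Suc (H s)" using move(1) unfolding H_def by simp
      have "cnt u (H s) (Suc (Suc s)) = cnt u (Suc (H s)) (Suc (Suc s))"
        using move(2) lam_unit0[OF closedD(2)[OF c], of "Suc s"] unfolding H_def by (simp only:)
      then have eq: "cnt y (H (Suc s)) s = cnt y (H s) s"
        using cnty[of s "H s"] cnty[of s "Suc (H s)"] s(2) uH HS by simp
      have hb: "Suc (H s) < b" using Hb[OF s(2)] HS by simp
      have zh': "b - 1 - H s = Suc (whol z t)" using zh HS hb by simp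
      have m1: "(z \<circ> Suc) t = Suc (whol z t)" unfolding zt yH zh' ..
      have m2: "lam unit0 (z \<circ> Suc) (Suc t) (whol z t) = lam unit0 (z \<circ> Suc) (Suc t) (Suc (whol z t))"
      proof -
        have a: "b - 1 - whol z t = H (Suc s)" "b - 1 - Suc (whol z t) = H s" "whol z t < b" "Suc (whol z t) < b"
          using zh zh' hb HS by auto
        show ?thesis using lz[OF a(3)] lz[OF a(4)] eq unfolding a(1,2) by linarith
      qed
      have "whol z (Suc t) = Suc (whol z t)" "wsl z t = whol z t"
        using m1 m2 unfolding wsl_def sl_def hol.simps by simp_all
      then show ?thesis using zh' zh HS uH unfolding s(1) s_def[symmetric] by simp
    next
      case stay
      have HS: "H (Suc s) = H s" using stay(1) unfolding H_def .
      have yu: "y s = u (Suc s)" using stay(2) ys unfolding wsl_def by simp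
      have hb: "H s < b" using Hb[of s] s(2) by simp
      \<comment> \<open>A move in \<open>z\<close> would need rows \<open>H s\<close> and
        \<open>H s - 1\<close> of \<open>y\<close> to be equally long at time \<open>s\<close>. But
        row \<open>H s\<close> of \<open>u\<close> is longer than that of \<open>y\<close> by the
        hole, so the ballot condition of \<open>u\<close> would fail.\<close>
      have nm: "\<not> ((z \<circ> Suc) t = Suc (whol z t) \<and>
         lam unit0 (z \<circ> Suc) (Suc t) (whol z t) = lam unit0 (z \<circ> Suc) (Suc t) (Suc (whol z t)))"
      proof
        assume A: "(z \<circ> Suc) t = Suc (whol z t) \<and>
         lam unit0 (z \<circ> Suc) (Suc t) (whol z t) = lam unit0 (z \<circ> Suc) (Suc t) (Suc (whol z t))"
        then have 1: "b - 1 - y s = Suc (b - 1 - H s)" unfolding zt zh HS by simp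
        then have 2: "H s = Suc (y s)" using ly[of s] hb by linarith
        have "cnt y (H s) s = cnt y (y s) s"
        proof -
          have a: "b - 1 - whol z t = H s" "b - 1 - Suc (whol z t) = y s" "whol z t < b" "Suc (whol z t) < b"
            using zh HS hb 1 2 by auto
          show ?thesis using lz[OF a(3)] lz[OF a(4)] conjunct2[OF A] unfolding a(1,2) by linarith
        qed
        moreover have "cnt u (H s) (Suc s) \<le> cnt u (y s) (Suc s)"
          unfolding 2 using closedD(2)[OF c] unfolding lattice_def by blast
        ultimately show False
          using cnty[of s "H s"] cnty[of s "y s"] s(2) 2 by simp
      qed
      then have "whol z (Suc t) = whol z t" "wsl z t = (z \<circ> Suc) t"
        unfolding wsl_def sl_def hol.simps by (simp_all only: if_False not_True_eq_False simp_thms)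
      then show ?thesis using zh HS yu zt unfolding s(1) s_def[symmetric] by simp
    qed
  qed
  have hz: "whol z t = b - 1 - H (N - 1 - t)" if "t < N" for t
    using that
  proof (induction t)
    case 0
    then show ?case using Hlast by simp
  next
    case (Suc t)
    show ?case by (rule step[OF Suc.prems Suc.IH[OF Suc_lessD[OF Suc.prems]], THEN conjunct1])
  qed
  show ?thesis
    unfolding N_def[symmetric] y_def[symmetric] z_def[symmetric]
  proof
    fix t
    have u0: "u 0 = 0" using closedD(2)[OF c] by (rule lattice_0)
    consider "Suc t < N" | "Suc t = N" | "N \<le> t" by linarith
    then show "prw b N z t = revw b N u t"
    proof cases
      case 1
      then show ?thesis using step[OF 1] hz[of t] by (simp add: prw_def revw_def)
    next
      case 2
      then show ?thesis using u0 by (auto simp: prw_def revw_def)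
    qed (simp add: prw_def revw_def)
  qed
qed

lemma closed_prw_pow: "closed b w u \<Longrightarrow> 1 \<le> w \<Longrightarrow> 1 \<le> b \<Longrightarrow> closed b w ((prw b (b * w) ^^ k) u)"
  by (induction k) (auto intro: closed_prw)

lemma prw_pow_revw:
  assumes c: "closed b w u" and w: "1 \<le> w" "1 \<le> b"
  shows "(prw b (b * w) ^^ k) (revw b (b * w) ((prw b (b * w) ^^ k) u)) = revw b (b * w) u"
proof (induction k)
  case (Suc k)
  let ?P = "prw b (b * w)" and ?R = "revw b (b * w)"
  have "(?P ^^ Suc k) (?R ((?P ^^ Suc k) u)) = (?P ^^ k) (?P (?R (?P ((?P ^^ k) u))))"
    by (simp add: funpow_swap1)
  then show ?case using prw_revw_prw[OF closed_prw_pow[OF c w, of k] w] Suc by simp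
qed simp

lemma prw_fixed_revw:
  assumes "closed b w u" "1 \<le> w" "1 \<le> b" "(prw b (b * w) ^^ k) u = u"
  shows "(prw b (b * w) ^^ k) (revw b (b * w) u) = revw b (b * w) u"
  using prw_pow_revw[OF assms(1-3), of k] assms(4) by simp

section \<open>Cyclically invariant valuations\<close>

lemma mset_set_exchange:
  assumes "finite K" "y \<in> K" "e \<notin> K"
  shows "add_mset e (mset_set K - {#y#}) = mset_set (insert e (K - {y}))"
  using assms mset_set_Diff[of K "{y}"] by simp

lemma exchange_connected:
  assumes ex: "\<And>K u v. K \<subseteq> Z \<Longrightarrow> card K + 1 = c \<Longrightarrow> u \<in> Z - K \<Longrightarrow> v \<in> Z - K \<Longrightarrow> h (insert u K) = h (insert v K)"
    and fin: "finite Z" and K: "K1 \<subseteq> Z" "K2 \<subseteq> Z" "card K1 = c" "card K2 = c"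
  shows "h K1 = h K2"
  using K
proof (induction "card (K1 - K2)" arbitrary: K1)
  case 0
  then have "K1 \<subseteq> K2" using fin finite_subset by (metis card_0_eq Diff_eq_empty_iff finite_Diff)
  then show ?case using 0 fin by (metis card_subset_eq finite_subset)
next
  case (Suc n)
  have f: "finite K1" "finite K2" using Suc.prems fin finite_subset by auto
  have "K1 - K2 \<noteq> {}" using Suc.hyps(2) by (intro notI) simp
  then obtain u where u: "u \<in> K1" "u \<notin> K2" by blast
  have "\<not> K2 \<subseteq> K1" using u Suc.prems f by (metis card_subset_eq)
  then obtain v where v: "v \<in> K2" "v \<notin> K1" by auto
  let ?K = "K1 - {u}"
  have c: "card ?K + 1 = c" using card.remove[OF f(1) u(1)] Suc.prems(3) by simp
  have "h (insert u ?K) = h (insert v ?K)"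
    by (rule ex) (use c Suc.prems u v in auto)
  moreover have "insert u ?K = K1" using u by auto
  moreover have "h (insert v ?K) = h K2"
  proof (rule Suc.hyps(1))
    have "insert v ?K - K2 = (K1 - K2) - {u}" using v u by auto
    then show "n = card (insert v ?K - K2)" using Suc.hyps(2) u f by simp
    show "insert v ?K \<subseteq> Z" using Suc.prems v by auto
    show "card (insert v ?K) = c" using c v f by simp
  qed (use Suc.prems in auto)
  ultimately show ?case by simp
qed

text \<open>The crossing inequalities are stated for the linear order of the representatives. A
  rotation that carries the largest of the four points past \<open>a\<close> turns
  \<open>cross1\<close> into \<open>cross2\<close>, so the pair is cyclically symmetric.\<close>

locale cyclic_exchange =
  fixes a b :: nat and F :: "nat multiset \<Rightarrow> int"
  assumes b2: "2 \<le> b" and a2b: "2 * b \<le> a + 1"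
    and rot: "\<And>M. size M = b \<Longrightarrow> set_mset M \<subseteq> {..<a} \<Longrightarrow> F (image_mset (\<lambda>x. Suc x mod a) M) = F M"
    and cross1: "\<And>w x y z S. w \<le> x \<Longrightarrow> x \<le> y \<Longrightarrow> y \<le> z \<Longrightarrow> z < a \<Longrightarrow> size S + 2 = b \<Longrightarrow> set_mset S \<subseteq> {..<a} \<Longrightarrow>
       F (add_mset w (add_mset x S)) + F (add_mset y (add_mset z S)) \<le> F (add_mset w (add_mset y S)) + F (add_mset x (add_mset z S))"
    and cross2: "\<And>w x y z S. w \<le> x \<Longrightarrow> x \<le> y \<Longrightarrow> y \<le> z \<Longrightarrow> z < a \<Longrightarrow> size S + 2 = b \<Longrightarrow> set_mset S \<subseteq> {..<a} \<Longrightarrow>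
       F (add_mset w (add_mset z S)) + F (add_mset x (add_mset y S)) \<le> F (add_mset w (add_mset y S)) + F (add_mset x (add_mset z S))"
    and exch: "\<And>M1 M2 e. size M1 = b \<Longrightarrow> size M2 = b \<Longrightarrow> set_mset M1 \<subseteq> {..<a} \<Longrightarrow> set_mset M2 \<subseteq> {..<a} \<Longrightarrow>
       count M1 e < count M2 e \<Longrightarrow>
       \<exists>y. count M2 y < count M1 y \<and> F M1 + F M2 \<le> F (add_mset e (M1 - {#y#})) + F (add_mset y (M2 - {#e#}))"
begin

lemma ba: "b < a" "0 < a" "2 \<le> a"
  using b2 a2b by auto

lemma rot_pow:
  assumes "size M = b" "set_mset M \<subseteq> {..<a}"
  shows "F (image_mset (\<lambda>x. (x + k) mod a) M) = F M"
proof (induction k)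
  case 0
  have "image_mset (\<lambda>x. (x + 0) mod a) M = image_mset (\<lambda>x. x) M"
    by (rule image_mset_cong) (use assms in auto)
  then show ?case by simp
next
  case (Suc k)
  have "image_mset (\<lambda>x. (x + Suc k) mod a) M = image_mset (\<lambda>x. Suc x mod a) (image_mset (\<lambda>x. (x + k) mod a) M)"
    by (simp add: image_mset.compositionality comp_def mod_Suc_eq)
  moreover have "F (image_mset (\<lambda>x. Suc x mod a) (image_mset (\<lambda>x. (x + k) mod a) M)) = F (image_mset (\<lambda>x. (x + k) mod a) M)"
    by (rule rot) (use assms ba in auto)
  ultimately show ?case using Suc by simp
qed

lemma shift_down:
  assumes "size M = b" "set_mset M \<subseteq> {..<a}" "\<And>x. x \<in># M \<Longrightarrow> k \<le> x"
  shows "F (image_mset (\<lambda>x. x - k) M) = F M"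
proof -
  have "F (image_mset (\<lambda>x. (x + k) mod a) (image_mset (\<lambda>x. x - k) M)) = F (image_mset (\<lambda>x. x - k) M)"
    by (rule rot_pow) (use assms in fastforce)+
  moreover have "image_mset (\<lambda>x. (x + k) mod a) (image_mset (\<lambda>x. x - k) M) = image_mset (\<lambda>x. x) M"
    unfolding image_mset.compositionality by (rule image_mset_cong) (use assms in auto)
  ultimately show ?thesis by simp
qed

lemma set_shift_down:
  assumes "K \<subseteq> {k..<a}" "card K = b"
  shows "F (mset_set ((\<lambda>x. x - k) ` K)) = F (mset_set K)" "(\<lambda>x. x - k) ` K \<subseteq> {..<a - k}" "card ((\<lambda>x. x - k) ` K) = b"
proof -
  have f: "finite K" using assms(1) finite_subset by blast
  have i: "inj_on (\<lambda>x. x - k) K" by (rule inj_on_diff_nat) (use assms(1) in auto)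
  have "F (image_mset (\<lambda>x. x - k) (mset_set K)) = F (mset_set K)"
    by (rule shift_down) (use assms f in auto)
  then show "F (mset_set ((\<lambda>x. x - k) ` K)) = F (mset_set K)" using image_mset_mset_set[OF i] by simp
  show "(\<lambda>x. x - k) ` K \<subseteq> {..<a - k}" using assms(1) by fastforce
  show "card ((\<lambda>x. x - k) ` K) = b" using card_image[OF i] assms(2) by simp
qed

section \<open>Constancy on sets\<close>

definition top where "top = Max {F (mset_set K) | K. K \<subseteq> {..<a} \<and> card K = b}"

lemma tops_finite: "finite {F (mset_set K) | K. K \<subseteq> {..<a} \<and> card K = b}"
  by (rule finite_subset[of _ "(\<lambda>K. F (mset_set K)) ` Pow {..<a}"]) auto

lemma le_top: "K \<subseteq> {..<a} \<Longrightarrow> card K = b \<Longrightarrow> F (mset_set K) \<le> top"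
  unfolding top_def by (rule Max_ge[OF tops_finite]) auto

lemma top_attained: "\<exists>K. K \<subseteq> {..<a} \<and> card K = b \<and> F (mset_set K) = top"
proof -
  have "top \<in> {F (mset_set K) | K. K \<subseteq> {..<a} \<and> card K = b}"
    unfolding top_def
  proof (rule Max_in[OF tops_finite])
    have "{..<b} \<subseteq> {..<a}" "card {..<b} = b" using ba by auto
    then show "{F (mset_set K) | K. K \<subseteq> {..<a} \<and> card K = b} \<noteq> {}" by blast
  qed
  then show ?thesis by auto
qed

text \<open>A normal form up to rotation: \<open>0\<close> is occupied and \<open>a - 1\<close> is
  free, so one further rotation step does not wrap around. It exists because
  \<open>b < a\<close>.\<close>

definition norm_arc :: "nat set \<Rightarrow> bool" where
  "norm_arc K \<longleftrightarrow> K \<subseteq> {..<a - 1} \<and> card K = b \<and> 0 \<in> K"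

lemma inj_mod: "inj_on (\<lambda>x. (x + k) mod a) {..<a}"
proof (rule linorder_inj_onI')
  fix x y assume xy: "x \<in> {..<a}" "y \<in> {..<a}" "x < y"
  show "(x + k) mod a \<noteq> (y + k) mod a"
  proof
    assume "(x + k) mod a = (y + k) mod a"
    then have "a dvd y - x" using mod_eq_dvd_iff_nat[of "x + k" "y + k" a] xy by simp
    then show False using xy dvd_imp_le[of a "y - x"] by simp
  qed
qed

lemma normalize:
  assumes "K \<subseteq> {..<a}" "card K = b"
  obtains K' where "norm_arc K'" "F (mset_set K') = F (mset_set K)"
proof -
  have f: "finite K" using assms(1) finite_subset by blast
  obtain z where z: "z < a" "z \<notin> K"
  proof -
    have "K \<noteq> {..<a}" using assms(2) ba by auto
    then show ?thesis using assms(1) that by auto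
  qed
  define k where "k = a - 1 - z"
  have inj: "inj_on (\<lambda>x. (x + k) mod a) {..<a}" by (rule inj_mod)
  let ?K = "(\<lambda>x. (x + k) mod a) ` K"
  have ij: "inj_on (\<lambda>x. (x + k) mod a) K" using inj assms(1) inj_on_subset by blast
  have "F (image_mset (\<lambda>x. (x + k) mod a) (mset_set K)) = F (mset_set K)"
    by (rule rot_pow) (use assms f in auto)
  then have FK: "F (mset_set ?K) = F (mset_set K)" using image_mset_mset_set[OF ij] by simp
  have cK: "card ?K = b" using card_image[OF ij] assms(2) by simp
  have "a - 1 \<notin> ?K"
  proof
    assume "a - 1 \<in> ?K"
    then obtain x where x: "x \<in> K" "(x + k) mod a = a - 1" by auto
    moreover have "(z + k) mod a = a - 1" using z by (simp add: k_def)
    ultimately have "x = z" using inj_onD[OF inj, of x z] assms(1) z by auto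
    then show False using x z by simp
  qed
  moreover have "?K \<subseteq> {..<a}" using ba by auto
  ultimately have sub: "?K \<subseteq> {..<a - 1}"
  proof (intro subsetI)
    fix x assume A: "x \<in> ?K" "a - 1 \<notin> ?K" "?K \<subseteq> {..<a}"
    then have "x \<noteq> a - 1" "x < a" by blast+
    then show "x \<in> {..<a - 1}" by simp
  qed
  define m where "m = Min ?K"
  have ne: "?K \<noteq> {}" "finite ?K" using cK b2 f by auto
  have m: "m \<in> ?K" "\<And>x. x \<in> ?K \<Longrightarrow> m \<le> x" using Min_in[OF ne(2,1)] Min_le[OF ne(2)] by (auto simp: m_def)
  have s2: "?K \<subseteq> {m..<a}"
  proof
    fix c assume c: "c \<in> ?K"
    then show "c \<in> {m..<a}" using subsetD[OF sub c] m(2)[OF c] by simp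
  qed
  let ?K2 = "(\<lambda>x. x - m) ` ?K"
  have "0 \<in> ?K2" using m(1) by force
  moreover have "?K2 \<subseteq> {..<a - 1}" using sub by (fastforce simp: subset_iff)
  ultimately have "norm_arc ?K2" using set_shift_down(3)[OF s2 cK] by (simp add: norm_arc_def)
  then show ?thesis using that set_shift_down(1)[OF s2 cK] FK by simp
qed

lemma sum_le_ab: "K \<subseteq> {..<a} \<Longrightarrow> card K = b \<Longrightarrow> \<Sum>K \<le> a * b"
  using sum_bounded_above[of K "\<lambda>x. x" a] by (force simp: mult.commute)

text \<open>Take a normalised set of value \<open>top\<close> with smallest maximum and, among
  those, with largest sum; the factor \<open>a * b + 1\<close> lets the maximum dominate. If the
  maximum exceeds \<open>b - 1\<close>, exchanging the set with its own shift by one produces two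
  more sets of value \<open>top\<close>, and one of them, moved back to \<open>0\<close>, is
  better.\<close>

lemma interval_top: "F (mset_set {..<b}) = top"
proof -
  let ?P = "\<lambda>K. norm_arc K \<and> F (mset_set K) = top"
  let ?m = "\<lambda>K. Max K * (a * b + 1) + (a * b - \<Sum>K)"
  obtain K0 where "K0 \<subseteq> {..<a}" "card K0 = b" "F (mset_set K0) = top" using top_attained by blast
  then obtain K1 where "?P K1" using normalize by metis
  then obtain K where K: "?P K" and least: "\<And>K'. ?P K' \<Longrightarrow> ?m K \<le> ?m K'"
    using ex_has_least_nat[of ?P K1 ?m] by blast
  define s where "s = Max K"
  have Ka: "K \<subseteq> {..<a - 1}" "card K = b" "0 \<in> K" using K by (auto simp: norm_arc_def)
  have Ka': "K \<subseteq> {..<a}" using Ka(1) by fastforce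
  have f: "finite K" using Ka(1) finite_subset by blast
  have sK: "s \<in> K" and Ks: "\<And>x. x \<in> K \<Longrightarrow> x \<le> s"
    using Max_in[OF f] Max_ge[OF f] Ka(3) by (auto simp: s_def)
  have sa: "Suc s < a" using sK Ka(1) by auto
  have Ksub: "K \<subseteq> {..<Suc s}" using Ks by (auto simp: less_Suc_eq_le)
  have bs: "b \<le> Suc s" using card_mono[OF _ Ksub] Ka(2) by simp
  have key: "Suc s * (a * b + 1) \<le> Max K' * (a * b + 1) + a * b \<Longrightarrow> s \<le> Max K'" for K' :: "nat set"
  proof (rule ccontr)
    assume A: "Suc s * (a * b + 1) \<le> Max K' * (a * b + 1) + a * b" "\<not> s \<le> Max K'"
    then have "(Max K' + 1) * (a * b + 1) \<le> s * (a * b + 1)" by (intro mult_right_mono) auto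
    with A(1) show False by (simp add: algebra_simps)
  qed
  have no_smaller: False if "norm_arc K'" "F (mset_set K') = top" "\<And>x. x \<in> K' \<Longrightarrow> x < s" for K'
  proof -
    have f': "finite K'" "K' \<noteq> {}" using that(1) finite_subset unfolding norm_arc_def by blast+
    have "Max K' < s" using Max_in[OF f'] that(3) by blast
    then have "Suc (Max K') * (a * b + 1) \<le> s * (a * b + 1)" by (intro mult_right_mono) auto
    moreover have "?m K \<le> ?m K'" using least that by blast
    ultimately show False unfolding s_def[symmetric] by (simp add: algebra_simps)
  qed
  have "s = b - 1"
  proof (rule ccontr)
    assume "s \<noteq> b - 1"
    then have sb: "b \<le> s" using bs by linarith
    let ?L = "Suc ` K"
    have L: "?L \<subseteq> {..<a}" "card ?L = b" "finite ?L" using Ka f by (auto simp: card_image)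
    have "F (image_mset (\<lambda>x. Suc x mod a) (mset_set K)) = F (mset_set K)"
      by (rule rot) (use Ka' Ka f in auto)
    moreover have "image_mset (\<lambda>x. Suc x mod a) (mset_set K) = image_mset Suc (mset_set K)"
      by (rule image_mset_cong) (use Ka f in auto)
    ultimately have FL: "F (mset_set ?L) = top" using K by (simp add: image_mset_mset_set)
    have eL: "Suc s \<in> ?L" "Suc s \<notin> K" using sK Ks[of "Suc s"] by auto
    have "\<exists>y. count (mset_set ?L) y < count (mset_set K) y \<and> F (mset_set K) + F (mset_set ?L)
       \<le> F (add_mset (Suc s) (mset_set K - {#y#})) + F (add_mset y (mset_set ?L - {#Suc s#}))"
      by (rule exch) (use Ka' Ka L f eL in \<open>auto simp: count_mset_set'\<close>)
    then obtain y where y: "count (mset_set ?L) y < count (mset_set K) y" "F (mset_set K) + F (mset_set ?L)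
       \<le> F (add_mset (Suc s) (mset_set K - {#y#})) + F (add_mset y (mset_set ?L - {#Suc s#}))" by blast
    have yK: "y \<in> K" "y \<notin> ?L" using y(1) f L by (auto simp: count_mset_set' split: if_splits)
    let ?A = "insert (Suc s) (K - {y})" and ?B = "insert y (?L - {Suc s})"
    have AB: "?A \<subseteq> {..<a}" "card ?A = b" "?B \<subseteq> {..<a}" "card ?B = b"
      using Ka' Ka(2) L yK eL sa f b2 by (auto simp: card_insert_if)
    have "F (mset_set K) + F (mset_set ?L) \<le> F (mset_set ?A) + F (mset_set ?B)"
      using y(2) mset_set_exchange[OF f yK(1) eL(2)] mset_set_exchange[OF L(3) eL(1) yK(2)] by simp
    then have tAB: "F (mset_set ?A) = top" "F (mset_set ?B) = top"
      using le_top[OF AB(1,2)] le_top[OF AB(3,4)] K FL by linarith+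
    show False
    proof (cases "y = 0")
      case False
      \<comment> \<open>The second set lies in \<open>{1..s}\<close>, so shifting it down by one
        lowers the maximum.\<close>
      have B1: "?B \<subseteq> {1..<a}" using AB(3) False by auto
      let ?C = "(\<lambda>x. x - 1) ` ?B"
      have Cs: "x < s" if c: "x \<in> ?C" for x
      proof -
        obtain z where z: "x = z - 1" "z \<in> ?B" using c by (rule imageE)
        have "z \<le> s" using z(2) Ks yK by fastforce
        moreover have "1 \<le> z" using z(2) B1 by (meson atLeastLessThan_iff subsetD)
        ultimately show ?thesis using z(1) by simp
      qed
      have "1 \<in> ?B" using Ka(3) sb b2 by auto
      then have "0 \<in> ?C" by force
      moreover have "?C \<subseteq> {..<a - 1}"
      proof
        fix x assume "x \<in> ?C"
        then have "x < s" by (rule Cs)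
        then show "x \<in> {..<a - 1}" using sa by simp
      qed
      ultimately have "norm_arc ?C" using set_shift_down(3)[OF B1 AB(4)] by (simp add: norm_arc_def)
      then show False using no_smaller[of ?C] Cs set_shift_down(1)[OF B1 AB(4)] tAB(2) by simp
    next
      case True
      \<comment> \<open>Now \<open>0\<close> has been replaced by \<open>Suc s\<close>. Shifting
        down by the minimum \<open>x\<close> lowers the maximum if \<open>x > 1\<close>; for
        \<open>x = 1\<close> the maximum stays at most \<open>s\<close>, and the sum grows by
        \<open>Suc s - b\<close>, which is positive.\<close>
      have ne: "?A \<noteq> {}" "finite ?A" using f by auto
      define x where "x = Min ?A"
      have x: "x \<in> ?A" "\<And>z. z \<in> ?A \<Longrightarrow> x \<le> z" using Min_in[OF ne(2,1)] Min_le[OF ne(2)] by (auto simp: x_def)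
      have x1: "1 \<le> x" using x(1) True by auto
      have A1: "?A \<subseteq> {x..<a}"
      proof
        fix z assume z: "z \<in> ?A"
        then show "z \<in> {x..<a}" using subsetD[OF AB(1) z] x(2)[OF z] by simp
      qed
      let ?C = "(\<lambda>z. z - x) ` ?A"
      have A2: "z \<le> Suc s" if "z \<in> ?A" for z using that Ks by fastforce
      have "0 \<in> ?C" using x(1) by force
      moreover have "?C \<subseteq> {..<a - 1}"
      proof
        fix c assume "c \<in> ?C"
        then obtain z where "z \<in> ?A" "c = z - x" by blast
        then show "c \<in> {..<a - 1}" using A2[of z] x1 sa by auto
      qed
      ultimately have C: "norm_arc ?C" "F (mset_set ?C) = top"
        using set_shift_down[OF A1 AB(2)] tAB(1) by (simp_all add: norm_arc_def)
      show False
      proof (cases "x = 1")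
        case False
        have "c < s" if c: "c \<in> ?C" for c
        proof -
          obtain z where "c = z - x" "z \<in> ?A" using c by (rule imageE)
          then show ?thesis using A2[of z] x1 False sb b2 by auto
        qed
        then show False using no_smaller[OF C] by blast
      next
        case x1: True
        have C': "?C = (\<lambda>z. z - 1) ` ?A" using x1 by simp
        have inj: "inj_on (\<lambda>z. z - 1) ?A"
        proof (rule inj_on_diff_nat)
          fix n assume "n \<in> ?A"
          then show "1 \<le> n" using subsetD[OF A1, of n] x1 by simp
        qed
        have "Max ?C \<le> s"
        proof (rule Max.boundedI)
          fix c assume c: "c \<in> ?C"
          obtain z where "c = z - x" "z \<in> ?A" using c by (rule imageE)
          then show "c \<le> s" using A2[of z] x1 by simp
        qed (use f in simp_all)
        moreover have "\<Sum>?C + b = \<Sum>K + Suc s"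
        proof -
          have "\<Sum>?C = (\<Sum>z\<in>?A. z - 1)" unfolding C' by (subst sum.reindex[OF inj]) (simp add: comp_def)
          moreover have "b = (\<Sum>z\<in>?A. 1)" using AB(2) by (simp only: card_eq_sum)
          ultimately have "\<Sum>?C + b = (\<Sum>z\<in>?A. z - 1) + (\<Sum>z\<in>?A. 1)" by (simp only:)
          also have "\<dots> = (\<Sum>z\<in>?A. z)" unfolding sum.distrib[symmetric] by (rule sum.cong) (use A1 x1 in auto)
          also have "\<dots> = \<Sum>K + Suc s" using True eL(2) f Ka(3) by (simp add: sum.remove[of K 0])
          finally show ?thesis .
        qed
        moreover have "\<Sum>?C \<le> a * b"
          by (rule sum_le_ab) (use C(1) in \<open>auto simp: norm_arc_def\<close>)
        ultimately have "?m ?C < ?m K"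
          using sb mult_right_mono[of "Max ?C" s "a * b + 1"] unfolding s_def[symmetric] by linarith
        then show False using least C by force
      qed
    qed
  qed
  then have "K \<subseteq> {..<b}" using Ksub b2 by auto
  then have "K = {..<b}" using Ka(2) by (intro card_subset_eq) auto
  then show ?thesis using K by simp
qed

text \<open>Induction on the maximum \<open>s\<close> and then on the first gap \<open>g\<close>.
  Crossing at \<open>0 < g < s < Suc s\<close> bounds the value of \<open>K\<close> from below by
  those of a set with smaller maximum and of a set that, moved back to \<open>0\<close>, has smaller
  maximum or an earlier gap; the fourth set is bounded by \<open>top\<close>.\<close>

lemma norm_arc_top:
  assumes "norm_arc K" shows "F (mset_set K) = top"
  using assms
proof (induction "Max K * (a + 1) + (LEAST x. x \<notin> K)" arbitrary: K rule: less_induct)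
  case less
  define s where "s = Max K"
  have Ka: "K \<subseteq> {..<a - 1}" "card K = b" "0 \<in> K" using less.prems by (auto simp: norm_arc_def)
  have Ka': "K \<subseteq> {..<a}" using Ka(1) by fastforce
  have f: "finite K" using Ka(1) finite_subset by blast
  have sK: "s \<in> K" and Ks: "\<And>x. x \<in> K \<Longrightarrow> x \<le> s"
    using Max_in[OF f] Max_ge[OF f] Ka(3) by (auto simp: s_def)
  have sa: "Suc s < a" using sK Ka(1) by auto
  have Ksub: "K \<subseteq> {..<Suc s}" using Ks by (auto simp: less_Suc_eq_le)
  define g where "g = (LEAST x. x \<notin> K)"
  have "Suc s \<notin> K" using Ks by fastforce
  then have gK: "g \<notin> K" and gl: "\<And>x. x < g \<Longrightarrow> x \<in> K"
    unfolding g_def by (rule LeastI, use not_less_Least in blast)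
  have "g \<le> Suc s" unfolding g_def by (rule Least_le) fact
  then have ga: "g < a" using sa by simp
  have lt: "Max K' * (a + 1) + (LEAST x. x \<notin> K') < Max K * (a + 1) + (LEAST x. x \<notin> K)"
    if "norm_arc K'" "\<And>x. x \<in> K' \<Longrightarrow> x < s" for K'
  proof -
    have f': "finite K'" "K' \<noteq> {}" using that(1) finite_subset unfolding norm_arc_def by blast+
    have "Max K' < s" using Max_in[OF f'] that(2) by blast
    then have "Suc (Max K') * (a + 1) \<le> s * (a + 1)" by (intro mult_right_mono) auto
    moreover have "a \<notin> K'" using that(1) by (auto simp: norm_arc_def)
    then have "(LEAST x. x \<notin> K') \<le> a" by (rule Least_le)
    ultimately show ?thesis unfolding s_def[symmetric] by (simp add: algebra_simps)
  qed
  have IHs: "F (mset_set K') = top" if "norm_arc K'" "\<And>x. x \<in> K' \<Longrightarrow> x < s" for K'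
    using less.hyps[OF lt[OF that] that(1)] .
  show ?case
  proof (cases "g \<le> s")
    case False
    then have "{..<Suc s} \<subseteq> K" using gl by auto
    then have "K = {..<Suc s}" using Ksub by auto
    then show ?thesis using Ka(2) interval_top by auto
  next
    case True
    then have gs: "g < s" using sK gK by (metis nat_less_le)
    have g0: "0 < g" using Ka(3) gK by (metis gr0I)
    let ?S = "K - {0, s}"
    have fS: "finite ?S" using f by simp
    have s0: "0 < s" using gs by simp
    have cS: "card ?S + 2 = b"
    proof -
      have "K = insert 0 (insert s ?S)" using sK Ka(3) by auto
      then have "card K = card (insert 0 (insert s ?S))" by simp
      then show ?thesis using Ka(2) fS s0 by (simp add: card_insert_if)
    qed
    let ?A = "insert 0 (insert g ?S)" and ?B = "insert s (insert (Suc s) ?S)" and ?C = "insert g (insert (Suc s) ?S)"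
    have KS: "insert 0 (insert s ?S) = K" using sK Ka(3) by auto
    have nin: "0 \<notin> insert g ?S" "0 \<notin> insert s ?S" "g \<notin> ?S" "s \<notin> insert (Suc s) ?S" "Suc s \<notin> ?S" "g \<notin> insert (Suc s) ?S" "s \<notin> ?S"
      using g0 gK gs s0 Ks by fastforce+
    have cr: "F (mset_set ?A) + F (mset_set ?B) \<le> F (mset_set K) + F (mset_set ?C)"
    proof -
      have "F (add_mset 0 (add_mset g (mset_set ?S))) + F (add_mset s (add_mset (Suc s) (mset_set ?S)))
        \<le> F (add_mset 0 (add_mset s (mset_set ?S))) + F (add_mset g (add_mset (Suc s) (mset_set ?S)))"
        by (rule cross1) (use gs sa cS Ka' fS in auto)
      moreover have "mset_set K = add_mset 0 (add_mset s (mset_set ?S))"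
        using mset_set.insert[of "insert s ?S" 0] mset_set.insert[of ?S s] fS nin KS by simp
      ultimately show ?thesis using fS nin by simp
    qed
    have cd: "card ?A = b" "card ?B = b" "card ?C = b" using cS fS nin by simp_all
    have "?A \<subseteq> {..<a - 1}" using Ka(1) gs sa by auto
    then have "norm_arc ?A" using cd(1) unfolding norm_arc_def by blast
    moreover have "x < s" if "x \<in> ?A" for x using that Ks[of x] gs s0 by fastforce
    ultimately have tA: "F (mset_set ?A) = top" by (rule IHs)
    have tB: "F (mset_set ?B) = top"
    proof -
      have Ba: "?B \<subseteq> {..<a}" using Ka' sa by auto
      have Bs: "z \<le> Suc s" if "z \<in> ?B" for z using that Ks[of z] by fastforce
      define x where "x = Min ?B"
      have x: "x \<in> ?B" "\<And>z. z \<in> ?B \<Longrightarrow> x \<le> z" using Min_in[of ?B] Min_le[of ?B] fS by (auto simp: x_def)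
      have x1: "1 \<le> x" using x(1) s0 by auto
      have B1: "?B \<subseteq> {x..<a}"
      proof
        fix z assume z: "z \<in> ?B"
        then show "z \<in> {x..<a}" using subsetD[OF Ba z] x(2)[OF z] by simp
      qed
      let ?D = "(\<lambda>z. z - x) ` ?B"
      have "0 \<in> ?D" using x(1) by force
      moreover have Dz: "c \<le> s" "x \<noteq> 1 \<Longrightarrow> c < s" if c: "c \<in> ?D" for c
      proof -
        obtain z where z: "z \<in> ?B" "c = z - x" using c by blast
        show "c \<le> s" using Bs[OF z(1)] x1 z(2) by linarith
        show "c < s" if "x \<noteq> 1" using Bs[OF z(1)] x1 z(2) that s0 by linarith
      qed
      moreover have "?D \<subseteq> {..<a - 1}"
      proof
        fix x assume "x \<in> ?D"
        then have "x \<le> s" by (rule Dz(1))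
        then show "x \<in> {..<a - 1}" using sa by simp
      qed
      ultimately have nD: "norm_arc ?D" using set_shift_down(3)[OF B1 cd(2)] by (simp add: norm_arc_def)
      have "F (mset_set ?D) = top"
      proof (cases "x = 1")
        case False
        then show ?thesis using IHs[OF nD] Dz(2) by blast
      next
        case True
        have "1 < g"
        proof (rule ccontr)
          assume "\<not> 1 < g"
          then have "1 \<notin> K" using gK g0 by (metis One_nat_def less_Suc_eq_0_disj not_less_less_Suc_eq less_one linorder_neqE_nat)
          then show False using x(1) True s0 sK by auto
        qed
        have "g - 1 \<notin> ?D"
        proof
          assume "g - 1 \<in> ?D"
          then obtain z where z: "z \<in> ?B" "g - 1 = z - 1" using True by blast
          then have "z = g" using x(2)[OF z(1)] True g0 by linarith
          then show False using z(1) gs gK by auto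
        qed
        then have "(LEAST y. y \<notin> ?D) \<le> g - 1" by (rule Least_le)
        moreover have "Max ?D \<le> s" using Dz(1) fS by (subst Max_le_iff) auto
        ultimately have "Max ?D * (a + 1) + (LEAST y. y \<notin> ?D) < Max K * (a + 1) + (LEAST x. x \<notin> K)"
          unfolding s_def[symmetric] g_def[symmetric] using mult_right_mono[of "Max ?D" s "a + 1"] g0 by linarith
        then show ?thesis using less.hyps nD by blast
      qed
      then show ?thesis using set_shift_down(1)[OF B1 cd(2)] by simp
    qed
    have "?C \<subseteq> {..<a}" using Ka' sa ga by auto
    then have "F (mset_set ?C) \<le> top" using le_top cd by blast
    moreover have "F (mset_set K) \<le> top" using le_top Ka' Ka by blast
    ultimately show ?thesis using cr tA tB by linarith
  qed
qed

lemma subset_top: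
  assumes "K \<subseteq> {..<a}" "card K = b" shows "F (mset_set K) = top"
  using normalize[OF assms] norm_arc_top by metis

section \<open>Clusters of points and additivity\<close>

definition const_on :: "nat multiset \<Rightarrow> nat set \<Rightarrow> int \<Rightarrow> bool" where
  "const_on I Z v \<longleftrightarrow> (\<forall>K\<subseteq>Z. card K + size I = b \<longrightarrow> F (I + mset_set K) = v)"

lemma const_onD: "const_on I Z v \<Longrightarrow> K \<subseteq> Z \<Longrightarrow> card K + size I = b \<Longrightarrow> F (I + mset_set K) = v"
  by (simp add: const_on_def)

text \<open>Uncrossing against the two end points of the zone shows that, once \<open>p\<close> has joined the cluster, the remaining
  points may be moved freely in the interior of the zone.\<close>
lemma zone_step:
  assumes I: "set_mset I \<subseteq> {..<a}" "size I < b" and p: "p \<le> lo" and hi: "hi < a"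
    and c: "const_on I {lo..hi} v"
  shows "\<exists>v'. const_on (add_mset p I) {Suc lo..<hi} v'"
proof -
  define h where "h K = F (add_mset p I + mset_set K)" for K
  have le: "h (insert u K) \<le> h (insert v' K)"
    if K: "K \<subseteq> {Suc lo..<hi}" "card K + 1 = b - Suc (size I)" "u \<in> {Suc lo..<hi} - K" "v' \<in> {Suc lo..<hi} - K" for K u v'
  proof -
    have f: "finite K" using K(1) finite_subset by blast
    let ?S = "I + mset_set K"
    have S: "size ?S + 2 = b" "set_mset ?S \<subseteq> {..<a}" using K f I hi by auto
    have h1: "h (insert x K) = F (add_mset p (add_mset x ?S))" if "x \<notin> K" for x
      using that f by (simp add: h_def add_mset_commute)
    have h2: "F (add_mset x (add_mset y ?S)) = v" if "x \<in> {lo..hi} - K" "y \<in> {lo..hi} - K" "x \<noteq> y" for x y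
    proof -
      have "F (I + mset_set (insert x (insert y K))) = v"
        by (rule const_onD[OF c]) (use that K f I in auto)
      then show ?thesis using that f by simp
    qed
    have end_notin: "hi \<notin> K" "lo \<notin> K" using K(1) by auto
    consider "u = v'" | "u < v'" | "v' < u" by linarith
    then show ?thesis
    proof cases
      case 2
      have "F (add_mset p (add_mset u ?S)) + F (add_mset v' (add_mset hi ?S)) \<le> F (add_mset p (add_mset v' ?S)) + F (add_mset u (add_mset hi ?S))"
        by (rule cross1) (use K p hi S 2 in auto)
      moreover have "F (add_mset v' (add_mset hi ?S)) = v" "F (add_mset u (add_mset hi ?S)) = v"
        using h2[of v' hi] h2[of u hi] K end_notin by auto
      ultimately show ?thesis using h1 K by simp
    next
      case 3
      have "F (add_mset p (add_mset u ?S)) + F (add_mset lo (add_mset v' ?S)) \<le> F (add_mset p (add_mset v' ?S)) + F (add_mset lo (add_mset u ?S))"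
        by (rule cross2) (use K p hi S 3 in auto)
      moreover have "F (add_mset lo (add_mset v' ?S)) = v" "F (add_mset lo (add_mset u ?S)) = v"
        using h2[of lo v'] h2[of lo u] K end_notin by auto
      ultimately show ?thesis using h1 K by simp
    qed simp
  qed
  show ?thesis
  proof (cases "\<exists>K0\<subseteq>{Suc lo..<hi}. card K0 = b - Suc (size I)")
    case True
    then obtain K0 where K0: "K0 \<subseteq> {Suc lo..<hi}" "card K0 = b - Suc (size I)" by blast
    have "h K = h K0" if "K \<subseteq> {Suc lo..<hi}" "card K = b - Suc (size I)" for K
      by (rule exchange_connected[where h = h and Z = "{Suc lo..<hi}" and c = "b - Suc (size I)"])
        (use that K0 le in \<open>auto intro!: antisym\<close>)
    then have "const_on (add_mset p I) {Suc lo..<hi} (h K0)"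
      unfolding const_on_def h_def[symmetric] by auto
    then show ?thesis by blast
  next
    case False
    then have "const_on (add_mset p I) {Suc lo..<hi} 0"
      unfolding const_on_def by (metis add_diff_cancel_right' size_add_mset)
    then show ?thesis by blast
  qed
qed

text \<open>A sample completion. Because of \<open>2 * b \<le> a + 1\<close> this block lies in all
  zones considered below, so that it represents their common value.\<close>

definition alpha :: "nat multiset \<Rightarrow> int" where
  "alpha I = F (I + mset_set {b..<2 * b - size I})"

lemma const_on_alpha:
  assumes "const_on I Z v" "1 \<le> size I" "size I \<le> b" "{b..<2 * b - size I} \<subseteq> Z"
  shows "const_on I Z (alpha I)"
proof -
  have "alpha I = v" unfolding alpha_def by (rule const_onD[OF assms(1,4)]) (use assms in auto)
  then show ?thesis using assms(1) by simp
qed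

text \<open>One point of the cluster together with free points is a set, hence of value
  \<open>top\<close>. Each further point of the cluster costs one point at both ends of the zone, by
  \<open>zone_step\<close>.\<close>

lemma coarse_zone:
  assumes "e \<le> 1" "set_mset I \<subseteq> {..e}" "1 \<le> size I" "size I \<le> b"
  shows "const_on I {e + size I..a - size I} (alpha I)"
proof -
  have ex: "size J + 1 \<le> b \<Longrightarrow> set_mset J \<subseteq> {..e} \<Longrightarrow> \<exists>v. const_on (add_mset x J) {e + Suc (size J)..a - Suc (size J)} v"
    if "x \<le> e" for x J
  proof (induction J)
    case empty
    have "const_on {#x#} {e + 1..a - 1} top"
      unfolding const_on_def
    proof (intro allI impI)
      fix K assume K: "K \<subseteq> {e + 1..a - 1}" "card K + size {#x#} = b"
      have f: "finite K" using K(1) finite_subset by blast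
      have "x \<notin> K" using K(1) that by auto
      moreover have "F (mset_set (insert x K)) = top"
      proof (rule subset_top)
        have "K \<subseteq> {..<a}" by (rule subset_trans[OF K(1)]) (use ba in auto)
        then show "insert x K \<subseteq> {..<a}" using that assms(1) ba by simp
      qed (use K f calculation in auto)
      ultimately show "F ({#x#} + mset_set K) = top" using f by simp
    qed
    then show ?case by auto
  next
    case (add p J)
    then obtain v where "const_on (add_mset x J) {e + Suc (size J)..a - Suc (size J)} v" by auto
    then have "\<exists>v'. const_on (add_mset p (add_mset x J)) {Suc (e + Suc (size J))..<a - Suc (size J)} v'"
      using add.prems that assms(1) ba by (intro zone_step) auto
    moreover have "{Suc (e + Suc (size J))..<a - Suc (size J)} = {e + Suc (size (add_mset p J))..a - Suc (size (add_mset p J))}"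
      using add.prems ba by auto
    ultimately show ?case by (simp add: add_mset_commute)
  qed
  obtain x J where I: "I = add_mset x J" using assms(3) by (metis size_empty multiset_cases not_one_le_zero)
  have "\<exists>v. const_on I {e + size I..a - size I} v" using ex[of x J] assms I by auto
  then obtain v where v: "const_on I {e + size I..a - size I} v" by blast
  show ?thesis
    by (rule const_on_alpha[OF v assms(3,4)]) (use assms a2b b2 in auto)
qed

text \<open>The induction starts from the pair \<open>0, 1\<close>, which is still a set. This saves
  one shrinking step compared with \<open>coarse_zone\<close>, and \<open>eta_exchange\<close> needs
  the point gained.\<close>

lemma fine_zone:
  assumes "set_mset J \<subseteq> {..1}" "size J + 2 \<le> b" and I: "I = add_mset 0 (add_mset 1 J)"
  shows "const_on I {size I..a + 1 - size I} (alpha I)"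
proof -
  have "\<exists>v. const_on (add_mset 0 (add_mset 1 J)) {size J + 2..a - Suc (size J)} v"
    using assms(1,2)
  proof (induction J)
    case empty
    have "const_on (add_mset 0 (add_mset 1 {#})) {2..a - 1} top"
      unfolding const_on_def
    proof (intro allI impI)
      fix K assume K: "K \<subseteq> {2..a - 1}" "card K + size (add_mset 0 (add_mset 1 {#}) :: nat multiset) = b"
      have f: "finite K" using K(1) finite_subset by blast
      have n: "0 \<notin> K" "Suc 0 \<notin> K" using K(1) by auto
      have "F (mset_set (insert 0 (insert 1 K))) = top"
      proof (rule subset_top)
        have "K \<subseteq> {..<a}" by (rule subset_trans[OF K(1)]) (use ba in auto)
        then show "insert 0 (insert 1 K) \<subseteq> {..<a}" using ba by simp
      qed (use K f n in auto)
      then show "F (add_mset 0 (add_mset 1 {#}) + mset_set K) = top" using f n by simp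
    qed
    then show ?case by (auto simp: numeral_2_eq_2)
  next
    case (add p J)
    then obtain v where "const_on (add_mset 0 (add_mset 1 J)) {size J + 2..a - Suc (size J)} v" by auto
    then have "\<exists>v'. const_on (add_mset p (add_mset 0 (add_mset 1 J))) {Suc (size J + 2)..<a - Suc (size J)} v'"
      using add.prems ba by (intro zone_step) auto
    moreover have "{Suc (size J + 2)..<a - Suc (size J)} = {size (add_mset p J) + 2..a - Suc (size (add_mset p J))}"
      using add.prems ba by auto
    ultimately show ?case by (simp add: add_mset_commute)
  qed
  then obtain v where v: "const_on I {size I..a + 1 - size I} v" using I by (auto simp: numeral_2_eq_2)
  show ?thesis
    by (rule const_on_alpha[OF v]) (use assms a2b b2 in auto)
qed

lemma alpha_singleton: "x \<le> 1 \<Longrightarrow> alpha {#x#} = top"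
proof -
  assume x: "x \<le> 1"
  have "F (mset_set (insert x {b..<2 * b - 1})) = top"
    by (rule subset_top) (use x ba a2b b2 in auto)
  then show ?thesis using x b2 by (simp add: alpha_def)
qed

text \<open>Induction on the number of clustered points. A cluster with a single point can be
  regarded as a free point in the zone of the other cluster, after a rotation by \<open>- k\<close>
  if it is the first one. Otherwise one point of each cluster is uncrossed against free points, and
  the two resulting bounds coincide.\<close>

lemma two_clusters:
  assumes "e \<le> 1" "e' \<le> 1" "set_mset I \<subseteq> {..e}" "set_mset J \<subseteq> {..e'}" "1 \<le> size I" "1 \<le> size J"
    "size I + size J \<le> b" "e + size I + size J \<le> k + 1" "k + e' + size I + size J \<le> a + 1"
    "\<And>z. z \<in> K \<Longrightarrow> e + size I \<le> z \<and> z + size J \<le> k \<or> k + e' + size J \<le> z \<and> z + size I \<le> a"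
    "card K + size I + size J = b"
  shows "F (I + image_mset ((+) k) J + mset_set K) = alpha I + alpha J - top"
  using assms(3-11)
proof (induction "size I + size J" arbitrary: I J K rule: less_induct)
  case less
  define i j where "i = size I" and "j = size J"
  note P = less.prems[folded i_def j_def]
  note PK = P(8)
  have "z \<le> a" if "z \<in> K" for z using PK[OF that] P(3,4,7) by linarith
  then have fK: "finite K" by (intro finite_subset[of K "{..a}"]) auto
  consider "j = 1" | "i = 1" "j > 1" | "i > 1" "j > 1" using P(3,4) by linarith
  then show ?case
  proof cases
    case 1
    then obtain x' where J: "J = {#x'#}" using j_def by (metis size_1_singleton_mset)
    have x': "x' \<le> e'" using P(2) J by auto
    have xK: "k + x' \<notin> K" using PK[of "k + x'"] 1 x' by auto
    have "F (I + mset_set (insert (k + x') K)) = alpha I"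
    proof (rule const_onD[OF coarse_zone[OF assms(1) P(1)]])
      show "1 \<le> size I" "size I \<le> b" using P i_def by auto
      show "insert (k + x') K \<subseteq> {e + size I..a - size I}"
      proof
        fix z assume "z \<in> insert (k + x') K"
        then show "z \<in> {e + size I..a - size I}"
          unfolding i_def[symmetric] using PK[of z] P(6,7) 1 x' by auto
      qed
      show "card (insert (k + x') K) + size I = b" using P(9) 1 xK fK i_def by simp
    qed
    then show ?thesis using xK fK J x' assms(2) alpha_singleton[of x'] by simp
  next
    case 2
    then obtain x where I: "I = {#x#}" using i_def by (metis size_1_singleton_mset)
    have x: "x \<le> e" using P(1) I by auto
    let ?r = "\<lambda>y. (y + (a - k)) mod a"
    have ka: "k < a" using P(7) 2 by simp
    have Ka: "K \<subseteq> {..<a}"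
    proof
      fix z assume "z \<in> K" then show "z \<in> {..<a}" using PK[of z] 2 ka by auto
    qed
    have "F (image_mset ?r (I + image_mset ((+) k) J + mset_set K)) = F (I + image_mset ((+) k) J + mset_set K)"
    proof (rule rot_pow)
      show "size (I + image_mset ((+) k) J + mset_set K) = b" using P(9) i_def j_def by simp
      show "set_mset (I + image_mset ((+) k) J + mset_set K) \<subseteq> {..<a}"
      proof -
        have "k + z < a" if "z \<in># J" for z using subsetD[OF P(2) that] P(7) 2 by auto
        moreover have "x < a" using x P(6) 2 ka by simp
        ultimately show ?thesis using I Ka fK by auto
      qed
    qed
    moreover have "image_mset ?r (image_mset ((+) k) J) = J"
    proof -
      have "image_mset ?r (image_mset ((+) k) J) = image_mset (\<lambda>y. y) J"
        unfolding image_mset.compositionality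
      proof (rule image_mset_cong)
        fix z assume "z \<in># J"
        then have "z < a" using subsetD[OF P(2), of z] assms(2) ba by simp
        moreover have "k + z + (a - k) = z + a" using ka by simp
        ultimately show "(?r \<circ> (+) k) z = z" by simp
      qed
      then show ?thesis by simp
    qed
    moreover have "image_mset ?r I = {#x + a - k#}" using I x P(6) 2 ka by simp
    moreover have "image_mset ?r (mset_set K) = mset_set (?r ` K)"
      by (rule image_mset_mset_set[OF inj_on_subset[OF inj_mod Ka]])
    ultimately have eq: "F (I + image_mset ((+) k) J + mset_set K) = F (J + add_mset (x + a - k) (mset_set (?r ` K)))"
      by (simp add: ac_simps)
    have rx: "?r x = x + a - k" using x P(6) 2 ka by simp
    have xn: "x + a - k \<notin> ?r ` K"
    proof
      assume "x + a - k \<in> ?r ` K"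
      then obtain y where y: "y \<in> K" "?r y = ?r x" using rx by auto
      have "x < a" using x assms(1) ba by simp
      then have "y = x" using inj_onD[OF inj_mod y(2)] y(1) Ka by auto
      moreover have "x \<notin> K" using PK[of x] P(6) 2 x by auto
      ultimately show False using y by simp
    qed
    have zone: "z \<in> {e' + j..a - j}" if "z \<in> insert (x + a - k) (?r ` K)" for z
    proof (cases "z = x + a - k")
      case True
      then show ?thesis using x P(6,7) 2 ka by auto
    next
      case False
      then have "z \<in> ?r ` K" using that by blast
      then obtain y where y: "z = ?r y" "y \<in> K" by (rule imageE)
      consider (lt) "e + i \<le> y" "y + j \<le> k" | (gt) "k + e' + j \<le> y" "y + i \<le> a" using PK[OF y(2)] by blast
      then show ?thesis
      proof cases
        case lt
        then have "?r y = y + (a - k)" using ka P(6) 2 by (intro mod_less) auto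
        then show ?thesis using lt y P(6,7) 2 ka by auto
      next
        case gt
        have "y < a" "k \<le> y" using subsetD[OF Ka y(2)] gt by auto
        then have "y + (a - k) = (y - k) + a" using ka by simp
        then have "?r y = (y - k) mod a" by simp
        also have "\<dots> = y - k" using \<open>y < a\<close> by simp
        finally show ?thesis using gt y P(6,7) 2 ka by auto
      qed
    qed
    have "F (J + mset_set (insert (x + a - k) (?r ` K))) = alpha J"
    proof (rule const_onD[OF coarse_zone[OF assms(2) P(2)]])
      show "1 \<le> size J" "size J \<le> b" using P j_def by auto
      show "insert (x + a - k) (?r ` K) \<subseteq> {e' + size J..a - size J}" using zone unfolding j_def by blast
      have "card (?r ` K) = card K" by (rule card_image[OF inj_on_subset[OF inj_mod Ka]])
      then show "card (insert (x + a - k) (?r ` K)) + size J = b" using P(9) 2 xn fK j_def by simp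
    qed
    then show ?thesis using eq xn fK I x assms(1) alpha_singleton[of x] by simp
  next
    case 3
    obtain p I0 where I: "I = add_mset p I0" using 3 i_def by (metis size_empty multiset_cases not_less0)
    obtain q J0 where J: "J = add_mset q J0" using 3 j_def by (metis size_empty multiset_cases not_less0)
    have s0: "i = Suc (size I0)" "j = Suc (size J0)" using I J i_def j_def by auto
    have pq: "p \<le> e" "q \<le> e'" "set_mset I0 \<subseteq> {..e}" "set_mset J0 \<subseteq> {..e'}" using P(1,2) I J by auto
    let ?J0 = "image_mset ((+) k) J0"
    let ?S = "I0 + ?J0 + mset_set K"
    \<comment> \<open>These are the extreme positions permitted for free points by the reduced
      clusters \<open>I0\<close> and \<open>J0\<close>. The full clusters forbid them, so they do
      not occur in \<open>K\<close>.\<close>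
    define x y x' where "x = k - size J0" and "y = a - size I0" and "x' = k + e' + size J0"
    have xy: "x + size J0 = k" "y + size I0 = a" using P(6,7) s0 by (simp_all add: x_def y_def)
    have nK: "x \<notin> K" "y \<notin> K" "x' \<notin> K" "x \<noteq> y" "x' \<noteq> y"
      using PK[of x] PK[of y] PK[of x'] P(6,7) s0 xy 3 unfolding x'_def by linarith+
    have Ka: "K \<subseteq> {..<a}"
    proof
      fix z assume "z \<in> K" then show "z \<in> {..<a}" using PK[of z] P(7) 3 by auto
    qed
    have S: "size ?S + 2 = b" using P(9) s0 by simp
    have Sa: "set_mset ?S \<subseteq> {..<a}"
    proof -
      have "z < a" if "z \<in># I0" for z using pq(3) that assms(1) ba by fastforce
      moreover have "k + z < a" if "z \<in># J0" for z using pq(4) that P(7) 3 by fastforce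
      ultimately show ?thesis using Ka fK by auto
    qed
    have Ix: "F (I + ?J0 + mset_set (insert z K)) = alpha I + alpha J0 - top" if zx: "z = x \<or> z = x'" for z
    proof (rule less.hyps)
      fix w assume "w \<in> insert z K"
      then show "e + size I \<le> w \<and> w + size J0 \<le> k \<or> k + e' + size J0 \<le> w \<and> w + size I \<le> a"
        using PK[of w] P(6,7) s0 xy zx unfolding i_def[symmetric] x'_def by auto
    next
      have "z \<notin> K" using zx nK by auto
      then show "card (insert z K) + size I + size J0 = b" using P(9) fK s0 i_def by simp
    qed (use P 3 s0 pq i_def j_def in linarith)+
    have Iy: "F (I0 + image_mset ((+) k) J + mset_set (insert y K)) = alpha I0 + alpha J - top"
    proof (rule less.hyps)
      fix w assume "w \<in> insert y K"
      then show "e + size I0 \<le> w \<and> w + size J \<le> k \<or> k + e' + size J \<le> w \<and> w + size I0 \<le> a"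
        using PK[of w] P(6,7) s0 xy unfolding j_def[symmetric] x'_def by auto
    next
      show "card (insert y K) + size I0 + size J = b" using P(9) nK fK s0 j_def by simp
    qed (use P 3 s0 pq i_def j_def in linarith)+
    have Ixy: "F (I0 + ?J0 + mset_set (insert z (insert y K))) = alpha I0 + alpha J0 - top" if zx: "z = x \<or> z = x'" for z
    proof (rule less.hyps)
      fix w assume "w \<in> insert z (insert y K)"
      then show "e + size I0 \<le> w \<and> w + size J0 \<le> k \<or> k + e' + size J0 \<le> w \<and> w + size I0 \<le> a"
        using PK[of w] P(6,7) s0 xy zx unfolding x'_def by auto
    next
      have "z \<notin> insert y K" using zx nK by auto
      then show "card (insert z (insert y K)) + size I0 + size J0 = b" using P(9) nK fK s0 by simp
    qed (use P 3 s0 pq i_def j_def in linarith)+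
    have ya: "y < a" using 3 s0 xy by linarith
    \<comment> \<open>\<open>1\<close> bounds the wanted value from below and \<open>2\<close> from
      above. By induction the other three values in each are known, and both bounds are
      \<open>alpha I + alpha J - top\<close>.\<close>
    have 1: "F (add_mset p (add_mset x ?S)) + F (add_mset (k + q) (add_mset y ?S))
      \<le> F (add_mset p (add_mset (k + q) ?S)) + F (add_mset x (add_mset y ?S))"
      by (rule cross1[OF _ _ _ ya S Sa]) (use P(6,7) s0 xy pq in linarith)+
    have 2: "F (add_mset p (add_mset (k + q) ?S)) + F (add_mset x' (add_mset y ?S))
      \<le> F (add_mset p (add_mset x' ?S)) + F (add_mset (k + q) (add_mset y ?S))"
      by (rule cross1[OF _ _ _ ya S Sa]) (use P(6,7) s0 xy pq x'_def in linarith)+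
    have e1: "F (add_mset p (add_mset z ?S)) = alpha I + alpha J0 - top" if "z = x \<or> z = x'" for z
    proof -
      have "z \<notin> K" using that nK by auto
      then have "I + ?J0 + mset_set (insert z K) = add_mset p (add_mset z ?S)" using fK I by simp
      then show ?thesis using Ix[OF that] by (simp only:)
    qed
    have e2: "F (add_mset (k + q) (add_mset y ?S)) = alpha I0 + alpha J - top"
      using Iy nK fK J by (simp add: add_mset_commute)
    have e3: "F (add_mset z (add_mset y ?S)) = alpha I0 + alpha J0 - top" if "z = x \<or> z = x'" for z
    proof -
      have "z \<notin> insert y K" "y \<notin> K" using that nK by auto
      then have "I0 + ?J0 + mset_set (insert z (insert y K)) = add_mset z (add_mset y ?S)" using fK by simp
      then show ?thesis using Ixy[OF that] by simp
    qed
    have "F (add_mset p (add_mset (k + q) ?S)) = alpha I + alpha J - top"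
      using 1 2 e1[of x] e1[of x'] e2 e3[of x] e3[of x'] by simp
    then show ?thesis using I J by (simp add: add_mset_commute)
  qed
qed

text \<open>The empty cluster is given the value \<open>top\<close>, so that the additivity formulas
  include it.\<close>

definition eta :: "nat \<Rightarrow> nat \<Rightarrow> int" where
  "eta p q = (if p + q = 0 then top else alpha (replicate_mset p 0 + replicate_mset q 1))"

lemma set_replicates: "set_mset (replicate_mset p 0 + replicate_mset q (1::nat)) \<subseteq> {..1}"
  and set_replicate_0: "set_mset (replicate_mset p (0::nat)) \<subseteq> {..0}"
  by (auto split: if_splits)

lemma eta_split: "1 \<le> i \<Longrightarrow> i < b \<Longrightarrow> b \<le> k + 1 \<Longrightarrow> k + b \<le> a + 1 \<Longrightarrow>
    F (replicate_mset i 0 + replicate_mset (b - i) k) = eta i 0 + eta (b - i) 0 - top"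
  using two_clusters[of 0 0 "replicate_mset i 0" "replicate_mset (b - i) 0" k "{}"] set_replicate_0
  by (auto simp: eta_def)

lemma eta_split_left: "1 \<le> p + q \<Longrightarrow> p + q + p' = b \<Longrightarrow>
    F (replicate_mset p 0 + replicate_mset q 1 + replicate_mset p' b) = eta p q + eta p' 0 - top"
proof (cases "p' = 0")
  case True
  assume "1 \<le> p + q" "p + q + p' = b"
  then show ?thesis using True by (auto simp: eta_def alpha_def)
next
  case False
  assume "1 \<le> p + q" "p + q + p' = b"
  then show ?thesis
    using two_clusters[of 1 0 "replicate_mset p 0 + replicate_mset q 1" "replicate_mset p' 0" b "{}"]
      set_replicates[of p q] set_replicate_0[of p'] False a2b by (auto simp: eta_def)
qed

lemma eta_split_right: "1 \<le> p \<Longrightarrow> p + p' + q' = b \<Longrightarrow>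
    F (replicate_mset p 0 + replicate_mset p' (b - 1) + replicate_mset q' b) = eta p 0 + eta p' q' - top"
proof (cases "p' + q' = 0")
  case True
  assume "1 \<le> p" "p + p' + q' = b"
  then show ?thesis using True by (auto simp: eta_def alpha_def)
next
  case False
  assume "1 \<le> p" "p + p' + q' = b"
  then show ?thesis
    using two_clusters[of 0 1 "replicate_mset p 0" "replicate_mset p' 0 + replicate_mset q' 1" "b - 1" "{}"]
      set_replicates[of p' q'] set_replicate_0[of p] False a2b b2 by (auto simp: eta_def add.assoc)
qed

text \<open>Crossing of the points \<open>0, 1\<close> with the two nearest free points
  \<open>i + 1, i + 2\<close>, where \<open>i\<close> is the size of the remaining cluster.\<close>

lemma eta_exchange:
  assumes "p + q + 2 \<le> b"
  shows "eta (Suc p) (Suc q) + eta p q \<le> eta (Suc p) q + eta p (Suc q)"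
proof -
  define i where "i = p + q"
  define I where "I = replicate_mset p 0 + replicate_mset q (1::nat)"
  have I: "size I = i" "set_mset I \<subseteq> {..1}" using set_replicates by (auto simp: I_def i_def)
  let ?K = "{i + 3..b}"
  let ?S = "I + mset_set ?K"
  have cK: "card ?K + i + 2 = b" using assms by (simp add: i_def)
  have Sa: "set_mset ?S \<subseteq> {..<a}" using I ba by auto
  have cr: "F (add_mset 0 (add_mset 1 ?S)) + F (add_mset (i + 1) (add_mset (i + 2) ?S))
     \<le> F (add_mset 0 (add_mset (i + 1) ?S)) + F (add_mset 1 (add_mset (i + 2) ?S))"
    by (rule cross1[OF _ _ _ _ _ Sa]) (use I cK assms a2b in \<open>auto simp: i_def\<close>)
  have b_le: "b \<le> a - i - 1" "?K \<subseteq> {..a - i - 2}" using assms a2b by (auto simp: i_def)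
  have "F (add_mset 0 (add_mset 1 I) + mset_set ?K) = alpha (add_mset 0 (add_mset 1 I))"
    by (rule const_onD[OF coarse_zone[of 1]]) (use I cK b_le in auto)
  then have 1: "F (add_mset 0 (add_mset 1 ?S)) = eta (Suc p) (Suc q)"
    by (simp add: eta_def I_def add_mset_commute)
  have 2: "F (add_mset (i + 1) (add_mset (i + 2) ?S)) = eta p q"
  proof (cases "i = 0")
    case True
    have "F (mset_set (insert 1 (insert 2 {3..b}))) = top"
      by (rule subset_top) (use ba b2 in auto)
    then show ?thesis using True by (auto simp: I_def i_def eta_def numeral_2_eq_2)
  next
    case False
    have "F (I + mset_set (insert (i + 1) (insert (i + 2) ?K))) = alpha I"
      by (rule const_onD[OF coarse_zone[of 1]]) (use I cK b_le False assms a2b in \<open>auto simp: i_def\<close>)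
    then show ?thesis using False by (auto simp: eta_def I_def i_def)
  qed
  \<comment> \<open>The free point \<open>i + 1\<close> is the size of the cluster
    \<open>add_mset 0 I\<close>, one too small for the coarse zone with \<open>e = 1\<close>. But
    this cluster is either concentrated at \<open>0\<close> or contains the pair
    \<open>0, 1\<close>.\<close>
  have 3: "F (add_mset 0 (add_mset (i + 1) ?S)) = eta (Suc p) q"
  proof -
    have "F (add_mset 0 I + mset_set (insert (i + 1) ?K)) = alpha (add_mset 0 I)"
    proof (cases "q = 0")
      case True
      then have "set_mset (add_mset 0 I) \<subseteq> {..0}" by (auto simp: I_def split: if_splits)
      then show ?thesis
        by (intro const_onD[OF coarse_zone[of 0]]) (use I cK b_le assms in \<open>auto simp: i_def\<close>)
    next
      case False
      then have e: "add_mset 0 I = add_mset 0 (add_mset 1 (replicate_mset p 0 + replicate_mset (q - 1) 1))"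
        unfolding I_def by (cases q) auto
      have "const_on (add_mset 0 I) {size (add_mset 0 I)..a + 1 - size (add_mset 0 I)} (alpha (add_mset 0 I))"
        by (rule fine_zone[OF _ _ e]) (use set_replicates[of p "q - 1"] False assms in \<open>auto\<close>)
      then show ?thesis
        by (rule const_onD) (use I cK b_le assms False in \<open>auto simp: i_def\<close>)
    qed
    then show ?thesis by (simp add: eta_def I_def add_mset_commute)
  qed
  have 4: "F (add_mset 1 (add_mset (i + 2) ?S)) = eta p (Suc q)"
  proof -
    have "F (add_mset 1 I + mset_set (insert (i + 2) ?K)) = alpha (add_mset 1 I)"
      by (rule const_onD[OF coarse_zone[of 1]]) (use I cK b_le assms in \<open>auto simp: i_def\<close>)
    then show ?thesis by (simp add: eta_def I_def add_mset_commute)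
  qed
  show ?thesis using cr 1 2 3 4 by simp
qed

end

section \<open>Words fixed by a power of promotion\<close>

lemma V_zero: "letters b u \<Longrightarrow> good b n \<Longrightarrow> V b u 0 n = 0"
  using V_attained[of b u n 0] by (metis weight_def lessThan_0 sum.empty)

lemma V_le_cong_n:
  assumes l: "letters b u" and g: "good b n" "good b n'" and eq: "\<And>t. t < N \<Longrightarrow> n t = n' t"
  shows "V b u N n \<le> V b u N n'"
proof (cases N)
  case 0
  then show ?thesis using V_zero[OF l] g by simp
next
  case (Suc M)
  show ?thesis
  proof (rule V_le[OF l g(1)])
    fix \<kappa> assume k: "chain b n \<kappa>"
    \<comment> \<open>Beyond the word the chain has only to stay monotone and to end at
      \<open>n' t\<close>; the second term is the lowest profile with unit steps that does
      so.\<close>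
    define \<kappa>' where "\<kappa>' t i = (if t < N then \<kappa> t i else max (\<kappa> M i) (int i - int b + n' t))" for t i
    have n': "n' t \<le> n' (Suc t)" "n' t \<le> int b" "N \<le> t \<Longrightarrow> n M \<le> n' t" for t
      using g(2) eq[of M] Suc by (auto simp: good_def mono_def)
    have "chain b n' \<kappa>'"
      unfolding chain_def
    proof (intro conjI allI impI)
      fix t i
      show "\<kappa>' t 0 = 0" using chainD(1)[OF k] n'(2)[of t] by (auto simp: \<kappa>'_def)
      show "\<kappa>' t b = n' t" using chainD(2)[OF k] eq[of t] n'(3)[of t] by (auto simp: \<kappa>'_def)
      { assume "i < b"
        show "\<kappa>' t i \<le> \<kappa>' t (Suc i)" "\<kappa>' t (Suc i) \<le> \<kappa>' t i + 1"
          using chainD(3,4)[OF k \<open>i < b\<close>, of t] chainD(3,4)[OF k \<open>i < b\<close>, of M]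
          by (auto simp: \<kappa>'_def max_def) }
      { assume "i \<le> b"
        show "\<kappa>' t i \<le> \<kappa>' (Suc t) i"
        proof (cases "Suc t < N")
          case True then show ?thesis using chainD(5)[OF k \<open>i \<le> b\<close>, of t] by (simp add: \<kappa>'_def)
        next
          case False
          then have "t = M \<or> N \<le> t" using Suc by auto
          then show ?thesis using n'(1)[of t] Suc by (auto simp: \<kappa>'_def)
        qed }
    qed
    moreover have "weight u N \<kappa>' = weight u N \<kappa>" unfolding weight_def by (rule sum.cong) (auto simp: \<kappa>'_def)
    ultimately show "weight u N \<kappa> \<le> V b u N n'" using V_ge[OF l] by metis
  qed
qed

lemma V_cong_n: "letters b u \<Longrightarrow> good b n \<Longrightarrow> good b n' \<Longrightarrow> (\<And>t. t < N \<Longrightarrow> n t = n' t) \<Longrightarrow> V b u N n = V b u N n'"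
  by (rule antisym) (auto intro!: V_le_cong_n)

text \<open>Moving \<open>p\<close> ever-present particles to the lowest positions raises the chain
  by an amount that shrinks in time, which costs nothing for a lattice word.\<close>

lemma V_attained_ge_min:
  assumes l: "letters b u" "lattice u" and n: "good b n" "\<And>t. int p \<le> n t"
  obtains \<kappa> where "chain b n \<kappa>" "weight u N \<kappa> = V b u N n" "\<And>t i. min (int i) (int p) \<le> \<kappa> t i"
proof -
  obtain \<kappa> where k: "chain b n \<kappa>" "weight u N \<kappa> = V b u N n" using V_attained[OF l(1) n(1)] .
  have pb: "p \<le> b" using n by (metis good_def of_nat_le_iff order_trans)
  define \<kappa>' where "\<kappa>' t i = max (\<kappa> t i) (min (int i) (int p))" for t i
  have c: "chain b n \<kappa>'"
    unfolding chain_def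
  proof (intro conjI allI impI)
    fix t i
    show "\<kappa>' t 0 = 0" using chainD(1)[OF k(1)] by (auto simp: \<kappa>'_def)
    show "\<kappa>' t b = n t" using chainD(2)[OF k(1)] n(2)[of t] by (auto simp: \<kappa>'_def)
    { assume "i < b"
      show "\<kappa>' t i \<le> \<kappa>' t (Suc i)" "\<kappa>' t (Suc i) \<le> \<kappa>' t i + 1"
        using chainD(3,4)[OF k(1) \<open>i < b\<close>, of t] by (auto simp: \<kappa>'_def) }
    { assume "i \<le> b"
      show "\<kappa>' t i \<le> \<kappa>' (Suc t) i" using chainD(5)[OF k(1) \<open>i \<le> b\<close>, of t] by (auto simp: \<kappa>'_def) }
  qed
  have "0 \<le> weight u N (\<lambda>t i. \<kappa>' t i - \<kappa> t i)"
  proof (rule weight_nonneg_lattice[OF l])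
    fix t i
    show "\<kappa>' t 0 - \<kappa> t 0 = 0" "\<kappa>' t b - \<kappa> t b = 0" using chainD(1,2)[OF c] chainD(1,2)[OF k(1)] by simp_all
    { assume "i \<le> b" then show "\<kappa>' (Suc t) i - \<kappa> (Suc t) i \<le> \<kappa>' t i - \<kappa> t i"
        using chainD(5)[OF k(1), of i t] by (auto simp: \<kappa>'_def) }
    show "0 \<le> \<kappa>' t i - \<kappa> t i" by (simp add: \<kappa>'_def)
  qed
  then have "weight u N \<kappa>' = V b u N n" using V_ge[OF l(1) c, of N] k(2) unfolding weight_diff by simp
  then show ?thesis using that c by (simp add: \<kappa>'_def)
qed

lemma weight_split: "T \<le> N \<Longrightarrow> weight u N \<kappa> = weight u T \<kappa> + (\<Sum>t\<in>{T..<N}. \<kappa> t (Suc (u t)) - \<kappa> t (u t))"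
  unfolding weight_def lessThan_atLeast0 by (simp add: sum.atLeastLessThan_concat)

lemma weight_const:
  assumes "letters b u" "\<And>t i. t < T \<Longrightarrow> i \<le> b \<Longrightarrow> \<kappa> t i = min (int i) (int p)"
  shows "weight u T \<kappa> = int (card {t. t < T \<and> u t < p})"
proof -
  have "weight u T \<kappa> = (\<Sum>t<T. of_bool (u t < p))"
    unfolding weight_def
  proof (rule sum.cong[OF refl])
    fix t assume "t \<in> {..<T}"
    moreover have "u t < b" using assms(1) by (simp add: letters_def)
    ultimately show "\<kappa> t (Suc (u t)) - \<kappa> t (u t) = of_bool (u t < p)" using assms(2)[of t] by auto
  qed
  then show ?thesis by (simp add: lessThan_def Collect_conj_eq[symmetric])
qed

text \<open>Sources at time \<open>0\<close> force an optimal chain to be constant until the next source arrives.\<close>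
lemma V_translate:
  assumes l: "letters b q" "lattice q" and per: "\<And>t. T0 \<le> t \<Longrightarrow> q (t + m) = q t"
    and n: "good b n" "\<And>t. t < T0 \<Longrightarrow> n t = int p" "\<And>t. int p \<le> n t" and L: "T0 \<le> L"
  shows "V b q (L + m) (\<lambda>t. if t < T0 + m then int p else n (t - m)) + int (card {t. t < T0 \<and> q t < p})
      = V b q L n + int (card {t. t < T0 + m \<and> q t < p})" (is "V b q (L + m) ?n + ?c0 = _ + ?c1")
proof -
  have pb: "p \<le> b" using n by (metis good_def of_nat_le_iff order_trans)
  have nm: "s \<le> t \<Longrightarrow> n s \<le> n t" for s t using n(1) by (auto simp: good_def mono_def)
  have g: "good b ?n"
    unfolding good_def
  proof (intro conjI allI monoI)
    fix s t :: nat assume "s \<le> t" then show "?n s \<le> ?n t" using nm[of "s - m" "t - m"] n(3) by auto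
  next
    fix t show "0 \<le> ?n t" "?n t \<le> int b" using n(1) pb by (auto simp: good_def)
  qed
  have np: "int p \<le> ?n t" for t using n(3) by simp
  have const: "\<kappa> t i = min (int i) (int p)"
    if "chain b n' \<kappa>" "\<And>t i. min (int i) (int p) \<le> \<kappa> t i" "n' t = int p" "i \<le> b" for \<kappa> n' t i
    using chain_bounds(2,3)[OF that(1,4), of t] that(2)[of i t] that(3) by auto
  have tail: "(\<Sum>t\<in>{T0 + m..<L + m}. \<kappa>' t (Suc (q t)) - \<kappa>' t (q t)) = (\<Sum>t\<in>{T0..<L}. \<kappa> t (Suc (q t)) - \<kappa> t (q t))"
    if "\<And>t i. T0 \<le> t \<Longrightarrow> \<kappa>' (t + m) i = \<kappa> t i" for \<kappa> \<kappa>' :: "nat \<Rightarrow> nat \<Rightarrow> int"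
    unfolding sum.shift_bounds_nat_ivl by (rule sum.cong) (use that per in auto)
  have "V b q L n + ?c1 \<le> V b q (L + m) ?n + ?c0"
  proof -
    obtain \<kappa> where k: "chain b n \<kappa>" "weight q L \<kappa> = V b q L n" "\<And>t i. min (int i) (int p) \<le> \<kappa> t i"
      using V_attained_ge_min[OF l n(1,3), where N = L] by blast
    \<comment> \<open>The packed configuration is prolonged by \<open>m\<close> steps; the inserted
      letters below \<open>p\<close> are met, and from \<open>T0\<close> on periodicity reproduces
      the old weight.\<close>
    define \<kappa>' where "\<kappa>' t i = (if t < T0 + m then min (int i) (int p) else \<kappa> (t - m) i)" for t i
    have c: "chain b ?n \<kappa>'"
      unfolding chain_def
    proof (intro conjI allI impI)
      fix t i
      show "\<kappa>' t 0 = 0" "\<kappa>' t b = ?n t" using chainD(1,2)[OF k(1)] pb by (auto simp: \<kappa>'_def)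
      { assume "i < b"
        show "\<kappa>' t i \<le> \<kappa>' t (Suc i)" "\<kappa>' t (Suc i) \<le> \<kappa>' t i + 1"
          using chainD(3,4)[OF k(1) \<open>i < b\<close>] by (auto simp: \<kappa>'_def) }
      { assume "i \<le> b"
        show "\<kappa>' t i \<le> \<kappa>' (Suc t) i"
          using chainD(5)[OF k(1) \<open>i \<le> b\<close>, of "t - m"] k(3)[of i "Suc t - m"] by (auto simp: \<kappa>'_def Suc_diff_le) }
    qed
    have "weight q (L + m) \<kappa>' = ?c1 + (\<Sum>t\<in>{T0..<L}. \<kappa> t (Suc (q t)) - \<kappa> t (q t))"
      using weight_split[of "T0 + m" "L + m" q \<kappa>'] L tail[of \<kappa>' \<kappa>] weight_const[OF l(1), of "T0 + m" \<kappa>' p]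
      by (simp add: \<kappa>'_def)
    moreover have "weight q L \<kappa> = ?c0 + (\<Sum>t\<in>{T0..<L}. \<kappa> t (Suc (q t)) - \<kappa> t (q t))"
      using weight_split[OF L, of q \<kappa>] weight_const[OF l(1), of T0 \<kappa> p] const[OF k(1,3) n(2)] by simp
    ultimately show ?thesis using V_ge[OF l(1) c, of "L + m"] k(2) by simp
  qed
  moreover have "V b q (L + m) ?n + ?c0 \<le> V b q L n + ?c1"
  proof -
    obtain \<kappa>' where k: "chain b ?n \<kappa>'" "weight q (L + m) \<kappa>' = V b q (L + m) ?n" "\<And>t i. min (int i) (int p) \<le> \<kappa>' t i"
      using V_attained_ge_min[OF l g np, where N = "L + m"] by blast
    define \<kappa> where "\<kappa> t i = (if t < T0 then min (int i) (int p) else \<kappa>' (t + m) i)" for t i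
    have c: "chain b n \<kappa>"
      unfolding chain_def
    proof (intro conjI allI impI)
      fix t i
      show "\<kappa> t 0 = 0" "\<kappa> t b = n t" using chainD(1,2)[OF k(1)] pb n(2) by (auto simp: \<kappa>_def)
      { assume "i < b"
        show "\<kappa> t i \<le> \<kappa> t (Suc i)" "\<kappa> t (Suc i) \<le> \<kappa> t i + 1"
          using chainD(3,4)[OF k(1) \<open>i < b\<close>] by (auto simp: \<kappa>_def) }
      { assume "i \<le> b"
        show "\<kappa> t i \<le> \<kappa> (Suc t) i"
          using chainD(5)[OF k(1) \<open>i \<le> b\<close>, of "t + m"] k(3)[of i "Suc t + m"] by (auto simp: \<kappa>_def) }
    qed
    have "weight q (L + m) \<kappa>' = ?c1 + (\<Sum>t\<in>{T0..<L}. \<kappa> t (Suc (q t)) - \<kappa> t (q t))"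
      using weight_split[of "T0 + m" "L + m" q \<kappa>'] L tail[of \<kappa>' \<kappa>] weight_const[OF l(1), of "T0 + m" \<kappa>' p]
        const[OF k(1,3)] by (simp add: \<kappa>_def)
    moreover have "weight q L \<kappa> = ?c0 + (\<Sum>t\<in>{T0..<L}. \<kappa> t (Suc (q t)) - \<kappa> t (q t))"
      using weight_split[OF L, of q \<kappa>] weight_const[OF l(1), of T0 \<kappa> p] by (simp add: \<kappa>_def)
    ultimately show ?thesis using V_ge[OF l(1) c, of L] k(2) by simp
  qed
  ultimately show ?thesis by simp
qed

text \<open>Delaying all sources by one means erasing the first letter, and the slide keeps
  \<open>V\<close>. The letter appended by promotion is met since all \<open>b\<close> particles are
  present by then; it accounts for the \<open>1\<close>.\<close>

lemma VM_image_Suc: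
  assumes c: "closed b w u" and w: "1 \<le> w" "1 \<le> b" and M: "size M = b" "\<And>s. s \<in># M \<Longrightarrow> s < b * w"
  shows "VM b u (b * w) (image_mset Suc M) = VM b (prw b (b * w) u) (b * w) M - 1"
proof -
  define N where "N = b * w"
  have e: "Suc (N - 1) = N" using w by (simp add: N_def)
  note l = closedD(1)[OF c] and lp = closedD(1)[OF closed_prw[OF c w]]
  have g: "good b (srcs M)" "good b (srcs (image_mset Suc M))" using M(1) by (auto intro!: good_srcs)
  have full: "srcs M (N - 1) = int b"
  proof -
    have "s \<le> N - 1" if "s \<in># M" for s using M(2)[OF that] e unfolding N_def by linarith
    then have "filter_mset (\<lambda>s. s \<le> N - 1) M = M" by (simp add: filter_mset_eq_conv)
    then show ?thesis using M(1) by (simp add: srcs_def)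
  qed
  have "V b u (Suc (N - 1)) (srcs (image_mset Suc M)) = V b (u \<circ> Suc) (N - 1) (srcs M)"
    by (rule V_shift_Suc[OF l g]) (simp_all add: srcs_image_Suc)
  also have "\<dots> = V b (wsl u) (N - 1) (srcs M)"
    using veq_wsl[OF l closedD(2)[OF c]] g by (simp add: veq_def)
  also have "\<dots> = V b (prw b N u) (N - 1) (srcs M)"
    by (rule V_cong) (auto simp: prw_def)
  also have "\<dots> = V b (prw b N u) (Suc (N - 1)) (srcs M) - 1"
    using V_Suc_full[OF lp g(1), of "N - 1"] full unfolding N_def by simp
  finally show ?thesis unfolding e VM_def by (simp only: N_def)
qed

lemma VM_image_add:
  assumes "closed b w u" "1 \<le> w" "1 \<le> b" "size M = b" "\<And>s. s \<in># M \<Longrightarrow> s + k \<le> b * w"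
  shows "VM b u (b * w) (image_mset (\<lambda>s. s + k) M) = VM b ((prw b (b * w) ^^ k) u) (b * w) M - int k"
  using assms(1,5)
proof (induction k arbitrary: u)
  case (Suc k)
  have e: "image_mset (\<lambda>s. s + Suc k) M = image_mset Suc (image_mset (\<lambda>s. s + k) M)"
    by (simp add: image_mset.compositionality comp_def)
  have "VM b u (b * w) (image_mset (\<lambda>s. s + Suc k) M) = VM b (prw b (b * w) u) (b * w) (image_mset (\<lambda>s. s + k) M) - 1"
    unfolding e by (rule VM_image_Suc[OF Suc.prems(1) assms(2,3)]) (use assms(4) Suc.prems(2) in fastforce)+
  also have "VM b (prw b (b * w) u) (b * w) (image_mset (\<lambda>s. s + k) M)
     = VM b ((prw b (b * w) ^^ k) (prw b (b * w) u)) (b * w) M - int k"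
    by (rule Suc.IH[OF closed_prw[OF Suc.prems(1) assms(2,3)]]) (use Suc.prems(2) in fastforce)
  finally show ?case by (simp add: funpow_swap1)
qed simp

lemma prw_pow_le: "t + k < N \<Longrightarrow> (prw b N ^^ k) u t \<le> u (t + k)"
proof (induction k arbitrary: t)
  case (Suc k)
  have "(prw b N ^^ Suc k) u t \<le> (prw b N ^^ k) u (Suc t)" using prw_le[of t N b "(prw b N ^^ k) u"] Suc.prems by simp
  also have "\<dots> \<le> u (Suc t + k)" by (rule Suc.IH) (use Suc.prems in simp)
  finally show ?case by simp
qed simp

lemma prw_pow_wsl_pow: "t + k < N \<Longrightarrow> (\<And>s. s \<le> t + k \<Longrightarrow> u s = v s) \<Longrightarrow> (prw b N ^^ k) u t = (wsl ^^ k) v t"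
proof (induction k arbitrary: t)
  case (Suc k)
  have "(prw b N ^^ Suc k) u t = wsl ((prw b N ^^ k) u) t" using Suc.prems by (simp add: prw_def)
  also have "\<dots> = wsl ((wsl ^^ k) v) t"
    by (rule wsl_cong) (rule Suc.IH, use Suc.prems in auto)
  finally show ?case by simp
qed simp

lemma wsl_pow_le: "(wsl ^^ k) u t \<le> u (t + k)"
proof (induction k arbitrary: t)
  case (Suc k)
  show ?case using wsl_le[of "(wsl ^^ k) u" t] Suc[of "Suc t"] by simp
qed simp

lemma sum_letters: "letters b u \<Longrightarrow> (\<Sum>t<T. u t) = (\<Sum>i<b. i * cnt u i T)"
proof (induction T)
  case (Suc T)
  have "(\<Sum>i<b. i * cnt u i (Suc T)) = (\<Sum>i<b. i * cnt u i T) + (\<Sum>i<b. if u T = i then i else 0)"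
    unfolding sum.distrib[symmetric] by (rule sum.cong) auto
  moreover have "u T < b" using Suc.prems by (simp add: letters_def)
  ultimately show ?case using Suc by simp
qed simp

text \<open>Equal contents give equal sums of letters, so a pointwise inequality is an equality. In
  this way the monotonicity of slides is turned into equality of words below.\<close>

lemma le_cnt_imp_eq:
  assumes "letters b u" "letters b v" "\<And>t. t < T \<Longrightarrow> u t \<le> v t" "\<And>i. i < b \<Longrightarrow> cnt u i T = cnt v i T" "t < T"
  shows "u t = v t"
proof -
  have "sum u {..<T} = sum v {..<T}"
    unfolding sum_letters[OF assms(1)] sum_letters[OF assms(2)] using assms(4) by simp
  then show ?thesis by (rule sum_mono_inv) (use assms in auto)
qed

lemma cnt_add: "cnt u i (s + t) = cnt u i s + cnt (\<lambda>x. u (s + x)) i t"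
  by (induction t) auto

lemma cnt_periodic:
  assumes "\<And>t. w (t + m) = w t" shows "cnt w i (e * m + s) = e * cnt w i m + cnt w i s"
proof (induction e)
  case (Suc e)
  have "cnt w i (Suc e * m + s) = cnt w i (m + (e * m + s))" by (simp add: ac_simps)
  also have "\<dots> = cnt w i m + cnt (\<lambda>x. w (m + x)) i (e * m + s)" by (rule cnt_add)
  also have "(\<lambda>x. w (m + x)) = w" using assms by (simp add: add.commute)
  finally show ?case using Suc by simp
qed simp

lemma card_less_sum: "card {t. t < T \<and> u t < i} = (\<Sum>j<i. cnt u j T)"
  by (induction i) (simp_all add: card_letters_Suc)

lemma V_shift_add:
  assumes "letters b u" "good b n"
  shows "V b u (N + k) (\<lambda>t. if t < k then 0 else n (t - k)) = V b (\<lambda>t. u (t + k)) N n"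
  using assms(1)
proof (induction k arbitrary: u)
  case (Suc k)
  let ?n = "\<lambda>k t. if t < k then 0 else n (t - k)"
  have g: "good b (?n k)" for k
    using assms(2) by (auto simp: good_def mono_def)
  have "V b u (Suc (N + k)) (?n (Suc k)) = V b (u \<circ> Suc) (N + k) (?n k)"
    by (rule V_shift_Suc[OF Suc.prems g g]) auto
  also have "\<dots> = V b (\<lambda>t. (u \<circ> Suc) (t + k)) N n" by (rule Suc.IH[OF letters_shift[OF Suc.prems]])
  finally show ?case by simp
qed simp

context cyclic_exchange
begin

text \<open>Rotation by one carries the cluster from \<open>1\<close> to \<open>0\<close> and the
  sample block to another place of the same zone.\<close>

lemma eta_swap: assumes "i \<le> b" shows "eta 0 i = eta i 0"
proof (cases "i = 0")
  case False
  let ?M = "replicate_mset i 1 + mset_set {b..<2 * b - i}"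
  have "F (image_mset (\<lambda>x. x - 1) ?M) = F ?M"
    by (rule shift_down) (use assms b2 a2b False in auto)
  moreover have "image_mset (\<lambda>x. x - 1) ?M = replicate_mset i 0 + mset_set ((\<lambda>x. x - 1) ` {b..<2 * b - i})"
  proof -
    have "inj_on (\<lambda>x. x - 1) {b..<2 * b - i}" by (rule inj_on_diff_nat) (use b2 in auto)
    then show ?thesis by (simp add: image_mset_mset_set)
  qed
  moreover have "F (replicate_mset i 0 + mset_set ((\<lambda>x. x - 1) ` {b..<2 * b - i})) = alpha (replicate_mset i 0)"
  proof (rule const_onD[OF coarse_zone[of 0]])
    have "inj_on (\<lambda>x. x - 1) {b..<2 * b - i}" by (rule inj_on_diff_nat) (use b2 in auto)
    then show "card ((\<lambda>x. x - 1) ` {b..<2 * b - i}) + size (replicate_mset i 0) = b"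
      using assms by (simp add: card_image)
    show "(\<lambda>x. x - 1) ` {b..<2 * b - i} \<subseteq> {0 + size (replicate_mset i 0)..a - size (replicate_mset i 0)}"
      using assms b2 a2b by auto
  qed (use assms False in auto)
  ultimately show ?thesis using False by (simp add: eta_def alpha_def)
qed simp

lemma eta_full: assumes "p + q = b" shows "F (replicate_mset p (b - 1) + replicate_mset q b) = eta p q"
proof -
  let ?M = "replicate_mset p (b - 1) + replicate_mset q b"
  have "F (image_mset (\<lambda>x. x - (b - 1)) ?M) = F ?M"
    by (rule shift_down) (use assms ba b2 in \<open>auto split: if_splits\<close>)
  then show ?thesis using assms b2 by (auto simp: eta_def alpha_def)
qed

end

section \<open>The valuation attached to a fixed word\<close>

locale promotion_fixed =
  fixes a b r :: nat and u :: "nat \<Rightarrow> nat"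
  assumes b2: "2 \<le> b" and r1: "1 \<le> r" and a2b: "2 * b \<le> a + 1"
    and cl: "closed b (a * r) u" and fx: "(prw b (b * (a * r)) ^^ (b * r)) u = u"
begin

definition m where "m = b * r"
definition N where "N = b * (a * r)"

lemma mN: "a * m = N" "1 \<le> m" "1 \<le> N" "m \<noteq> 0"
  using b2 r1 a2b by (simp_all add: m_def N_def)

lemma w1: "1 \<le> a * r" "1 \<le> b"
  using b2 r1 a2b by simp_all

lemmas lu = closedD(1)[OF cl]

lemma fixed: "(prw b N ^^ m) u = u" using fx by (simp add: m_def N_def)

text \<open>Delaying all sources by one period lowers \<open>VM\<close> by \<open>m = b * r\<close>;
  the linear term returns \<open>r\<close> for each of the \<open>b\<close> sources.\<close>

definition FF :: "nat multiset \<Rightarrow> int" where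
  "FF M = VM b u N (image_mset ((*) m) M) + int r * int (\<Sum>\<^sub># M)"

lemma FF_Suc:
  assumes "size M = b" "set_mset M \<subseteq> {..<a}" shows "FF (image_mset Suc M) = FF M"
proof -
  have "VM b u (b * (a * r)) (image_mset (\<lambda>s. s + m) (image_mset ((*) m) M))
     = VM b ((prw b (b * (a * r)) ^^ m) u) (b * (a * r)) (image_mset ((*) m) M) - int m"
  proof (rule VM_image_add[OF cl w1])
    fix s assume "s \<in># image_mset ((*) m) M"
    then obtain x where x: "x \<in># M" "s = m * x" by auto
    then have "m * Suc x \<le> m * a" using assms(2) by (intro mult_left_mono) auto
    then show "s + m \<le> b * (a * r)" using x mN(1) by (simp add: N_def mult.commute)
  qed (use assms in simp)
  then have "VM b u N (image_mset (\<lambda>s. s + m) (image_mset ((*) m) M)) = VM b u N (image_mset ((*) m) M) - int m"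
    using fixed unfolding N_def by simp
  moreover have "image_mset (\<lambda>s. s + m) (image_mset ((*) m) M) = image_mset ((*) m) (image_mset Suc M)"
    unfolding image_mset.compositionality by (rule image_mset_cong) simp
  moreover have "\<Sum>\<^sub># (image_mset Suc M) = \<Sum>\<^sub># M + size M" by (induction M) auto
  ultimately show ?thesis using assms(1) by (simp add: FF_def m_def algebra_simps)
qed

text \<open>A source at time \<open>N\<close> comes too late to meet a letter, while by
  \<open>V_wrap\<close> a source at time \<open>0\<close> is worth \<open>a * r\<close>. The linear
  term makes up for the difference.\<close>

lemma FF_wrap:
  assumes "size S + 1 = b" shows "FF (add_mset a S) = FF (add_mset 0 S)"
proof -
  let ?S = "image_mset ((*) m) S"
  have n: "srcs ?S t \<le> int b - 1" for t using srcs_le[of ?S t] assms by simp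
  have g: "good b (srcs ?S)" "good b (srcs (add_mset N ?S))" using assms by (auto intro!: good_srcs)
  have "V b u N (\<lambda>t. srcs ?S t + 1) = V b u N (srcs ?S) + int (a * r)"
    by (rule V_wrap[OF lu closedD(2)[OF cl] _ _ g(1) n]) (use closedD(3)[OF cl] b2 in \<open>auto simp: N_def\<close>)
  moreover have "srcs (add_mset 0 ?S) = (\<lambda>t. srcs ?S t + 1)" by auto
  moreover have "V b u N (srcs (add_mset N ?S)) = V b u N (srcs ?S)"
    by (rule V_cong_n[OF lu g(2,1)]) simp
  ultimately show ?thesis using mN(1) by (simp add: FF_def VM_def mult.commute algebra_simps)
qed

lemma FF_mod:
  assumes "size A + size B = b" "set_mset B \<subseteq> {..a}"
  shows "FF (A + image_mset (\<lambda>x. x mod a) B) = FF (A + B)"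
  using assms
proof (induction B arbitrary: A)
  case (add x B)
  show ?case
  proof (cases "x = a")
    case True
    have "FF (add_mset 0 A + image_mset (\<lambda>x. x mod a) B) = FF (add_mset 0 A + B)"
      by (rule add.IH) (use add.prems in auto)
    also have "\<dots> = FF (add_mset 0 (A + B))" by simp
    also have "\<dots> = FF (add_mset a (A + B))" by (rule FF_wrap[symmetric]) (use add.prems in simp)
    finally show ?thesis using True by simp
  next
    case False
    then have "x mod a = x" using add.prems by auto
    moreover have "FF (add_mset x A + image_mset (\<lambda>x. x mod a) B) = FF (add_mset x A + B)"
      by (rule add.IH) (use add.prems in auto)
    ultimately show ?thesis by simp
  qed
qed simp

sublocale cyclic_exchange a b FF
proof
  show "2 \<le> b" "2 * b \<le> a + 1" using b2 a2b .
next
  fix M assume M: "size M = b" "set_mset M \<subseteq> {..<a}"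
  have "FF ({#} + image_mset (\<lambda>x. x mod a) (image_mset Suc M)) = FF ({#} + image_mset Suc M)"
    by (rule FF_mod) (use M in auto)
  then show "FF (image_mset (\<lambda>x. Suc x mod a) M) = FF M"
    using FF_Suc[OF M] by (simp add: image_mset.compositionality comp_def)
next
  fix w x y z S
  assume A: "w \<le> x" "x \<le> y" "y \<le> z" "z < a" "size S + 2 = b" "set_mset S \<subseteq> {..<a}"
  have "size (image_mset ((*) m) S) + 2 \<le> b" "m * w \<le> m * x" "m * x \<le> m * y" "m * y \<le> m * z" using A by auto
  note cr = VM_cross[OF lu this, of N]
  show "FF (add_mset w (add_mset x S)) + FF (add_mset y (add_mset z S)) \<le> FF (add_mset w (add_mset y S)) + FF (add_mset x (add_mset z S))"
    using cr(1) by (simp add: FF_def algebra_simps)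
  show "FF (add_mset w (add_mset z S)) + FF (add_mset x (add_mset y S)) \<le> FF (add_mset w (add_mset y S)) + FF (add_mset x (add_mset z S))"
    using cr(2) by (simp add: FF_def algebra_simps)
next
  fix M1 M2 e
  assume A: "size M1 = b" "size M2 = b" "set_mset M1 \<subseteq> {..<a}" "set_mset M2 \<subseteq> {..<a}" "count M1 e < count M2 e"
  have cnt: "count (image_mset ((*) m) M) (m * x) = count M x" for M x
    by (induction M) (use mN(4) in auto)
  have bd: "\<forall>s\<in>#image_mset ((*) m) M. s \<le> N" if "set_mset M \<subseteq> {..<a}" for M
    using that mN(1) by (auto simp: mult.commute intro!: mult_left_mono) (metis lessThan_iff less_imp_le mult.commute mult_le_mono2 subsetD)
  obtain y' where y': "count (image_mset ((*) m) M2) y' < count (image_mset ((*) m) M1) y'"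
    "VM b u N (image_mset ((*) m) M1) + VM b u N (image_mset ((*) m) M2)
      \<le> VM b u N (add_mset (m * e) (image_mset ((*) m) M1 - {#y'#})) + VM b u N (add_mset y' (image_mset ((*) m) M2 - {#m * e#}))"
    using VM_exchange[OF lu _ _ bd[OF A(3)] bd[OF A(4)], of "m * e"] A(1,2,5) cnt by (metis size_image_mset)
  have "y' \<in># image_mset ((*) m) M1" using y'(1) by (metis count_greater_zero_iff gr_zeroI not_less_zero)
  then obtain y where y: "y \<in># M1" "y' = m * y" by auto
  have e: "e \<in># M2" using A(5) by (metis count_greater_zero_iff gr_zeroI not_less_zero)
  obtain M1' where M1: "M1 = add_mset y M1'" using y(1) by (metis insert_DiffM)
  obtain M2' where M2: "M2 = add_mset e M2'" using e by (metis insert_DiffM)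
  have "count M2 y < count M1 y" using y'(1) y(2) cnt by simp
  moreover have "FF M1 + FF M2 \<le> FF (add_mset e (M1 - {#y#})) + FF (add_mset y (M2 - {#e#}))"
    using y'(2) y(2) unfolding M1 M2 FF_def by (simp add: algebra_simps)
  ultimately show "\<exists>y. count M2 y < count M1 y \<and> FF M1 + FF M2 \<le> FF (add_mset e (M1 - {#y#})) + FF (add_mset y (M2 - {#e#}))"
    by blast
qed

text \<open>With \<open>i\<close> sources at \<open>0\<close> and the others at
  \<open>k * m\<close>, \<open>V\<close> counts the letters below \<open>i\<close> in the prefix.
  Additivity on the two clusters makes this count affine in \<open>k\<close> between
  \<open>b - 1\<close> and \<open>a + 1 - b\<close>.\<close>

lemma less_count:
  assumes "1 \<le> i" "i < b" "b \<le> k + 1" "k + b \<le> a + 1"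
  shows "int (card {t. t < k * m \<and> u t < i}) = eta i 0 + eta (b - i) 0 - top - int N + int (r * i * k)"
proof -
  have k: "k * m \<le> N" "0 < k * m" using assms mN b2 by (auto simp: mN(1)[symmetric])
  have "srcs (image_mset ((*) m) (replicate_mset i 0 + replicate_mset (b - i) k)) = (\<lambda>t. if t < k * m then int i else int b)"
    using assms(2) k by (auto simp: fun_eq_iff mult.commute)
  then have "FF (replicate_mset i 0 + replicate_mset (b - i) k)
     = int (card {t. t < k * m \<and> u t < i}) + int (N - k * m) + int r * int ((b - i) * k)"
    using V_lattice_step[OF lu closedD(2)[OF cl], of i "k * m" N] assms(2) k by (simp add: FF_def VM_def sum_mset_replicate_mset)
  moreover have "int (N - k * m) = int N - int r * int b * int k" using k(1) by (simp add: of_nat_diff m_def)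
  moreover have "int r * int ((b - i) * k) = int r * int b * int k - int (r * i * k)"
  proof -
    have "int (b - i) = int b - int i" using assms(2) by simp
    then show ?thesis by (simp add: algebra_simps)
  qed
  ultimately show ?thesis using eta_split[OF assms] by linarith
qed

abbreviation B0 where "B0 \<equiv> (b - 1) * m"

lemma less_count_diff:
  assumes "i \<le> b" "e + 2 * b \<le> a + 2"
  shows "card {t. t < (b - 1 + e) * m \<and> u t < i} = card {t. t < B0 \<and> u t < i} + r * i * e"
proof -
  consider "i = 0" | "i = b" | "1 \<le> i" "i < b" using assms(1) by linarith
  then show ?thesis
  proof cases
    case 2
    have "{t. t < T \<and> u t < b} = {..<T}" for T using lu by (auto simp: letters_def)
    then show ?thesis using 2 by (simp add: m_def algebra_simps)
  next
    case 3
    have "int (card {t. t < (b - 1 + e) * m \<and> u t < i}) = int (card {t. t < B0 \<and> u t < i}) + int (r * i * e)"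
    proof -
      have k: "b \<le> b - 1 + e + 1" "b - 1 + e + b \<le> a + 1" "b \<le> b - 1 + 1" "b - 1 + b \<le> a + 1"
        using assms(2) b2 a2b by linarith+
      have "int (r * i * (b - 1 + e)) = int (r * i * (b - 1)) + int (r * i * e)"
        by (simp only: distrib_left of_nat_add)
      then show ?thesis using less_count[OF 3 k(1,2)] less_count[OF 3 k(3,4)] by linarith
    qed
    then show ?thesis by linarith
  qed simp
qed

lemma cnt_windows:
  assumes "i < b" "e + 2 * b \<le> a + 2"
  shows "cnt u i ((b - 1 + e) * m) = cnt u i B0 + r * e"
  using less_count_diff[OF _ assms(2), of i] less_count_diff[OF _ assms(2), of "Suc i"] assms(1)
  by (simp add: card_letters_Suc algebra_simps)

lemma cnt_window:
  assumes "i < b" "Suc e + 2 * b \<le> a + 2"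
  shows "cnt (\<lambda>x. u ((b - 1 + e) * m + x)) i m = r"
proof -
  have s: "(b - 1 + Suc e) * m = (b - 1 + e) * m + m" by simp
  have "cnt u i ((b - 1 + e) * m) + cnt (\<lambda>x. u ((b - 1 + e) * m + x)) i m = cnt u i B0 + r * Suc e"
    using cnt_windows[OF assms] unfolding s cnt_add .
  then show ?thesis using cnt_windows[of i e] assms by simp
qed

lemma u_le_shift: "t + m < N \<Longrightarrow> u t \<le> u (t + m)"
  using prw_pow_le[of t m N b u] fixed by simp

text \<open>Promotion through one period moves a window onto its predecessor without raising
  letters. As \<open>u\<close> is fixed, consecutive windows are comparable, and they have the same
  content.\<close>

lemma window_eq:
  assumes "e + 2 + 2 * b \<le> a + 2" "x < m"
  shows "u ((b - 1 + e) * m + x) = u ((b - 1 + Suc e) * m + x)"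
proof -
  have s: "(b - 1 + Suc e) * m = (b - 1 + e) * m + m" by simp
  show ?thesis
  proof (rule le_cnt_imp_eq[where T = m and b = b and u = "\<lambda>x. u ((b - 1 + e) * m + x)"])
    show "letters b (\<lambda>x. u ((b - 1 + e) * m + x))" "letters b (\<lambda>x. u ((b - 1 + Suc e) * m + x))"
      using lu by (auto simp: letters_def)
    fix t assume t: "t < m"
    have "(b - 1 + Suc (Suc e)) * m \<le> a * m" using assms(1) b2 by (intro mult_right_mono) auto
    then have "(b - 1 + e) * m + t + m < N" using t unfolding mN(1) by (simp add: algebra_simps)
    then show "u ((b - 1 + e) * m + t) \<le> u ((b - 1 + Suc e) * m + t)"
      using u_le_shift[of "(b - 1 + e) * m + t"] unfolding s by (simp add: ac_simps)
  next
    fix i assume "i < b"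
    then show "cnt (\<lambda>x. u ((b - 1 + e) * m + x)) i m = cnt (\<lambda>x. u ((b - 1 + Suc e) * m + x)) i m"
      using cnt_window[of i e] cnt_window[of i "Suc e"] assms by simp
  qed (use assms in auto)
qed

section \<open>The prefix continued periodically\<close>

definition win :: "nat \<Rightarrow> nat" where "win t = u (B0 + t mod m)"

text \<open>An infinite word is needed because whole periods are to be erased from the front,
  \<open>b - 1\<close> of them in \<open>prefix_hw\<close>.\<close>

definition q :: "nat \<Rightarrow> nat" where "q t = (if t < B0 then u t else win (t - B0))"

definition L1 where "L1 = (a + 1 - b) * m"

lemma win_window: "e + 1 + 2 * b \<le> a + 2 \<Longrightarrow> x < m \<Longrightarrow> u ((b - 1 + e) * m + x) = win x"
proof (induction e)
  case (Suc e)
  then show ?case using window_eq[of e x] by simp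
qed (simp add: win_def)

lemma q_eq_u: assumes "t < L1" shows "q t = u t"
proof (cases "t < B0")
  case False
  define e where "e = (t - B0) div m"
  define x where "x = (t - B0) mod m"
  have t: "t = (b - 1 + e) * m + x"
    unfolding e_def x_def add_mult_distrib using False div_mult_mod_eq[of "t - B0" m] by linarith
  have x: "x < m" using mN by (simp add: x_def)
  have "(b - 1 + e) * m < (a + 1 - b) * m" using assms t unfolding L1_def by linarith
  then have "b - 1 + e < a + 1 - b" by (meson mult_less_cancel2)
  then have "u t = win x" using win_window[of e x] x t by simp
  moreover have "q t = win x" using False by (simp add: q_def win_def x_def)
  ultimately show ?thesis by simp
qed (simp add: q_def)

lemma win_per: "win (t + m) = win t" by (simp add: win_def)

lemma q_per: assumes "B0 \<le> t" shows "q (t + m) = q t"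
proof -
  have "t + m - B0 = t - B0 + m" using assms by simp
  moreover have "\<not> t + m < B0" "\<not> t < B0" using assms by linarith+
  ultimately show ?thesis unfolding q_def by (simp only: if_False win_per)
qed

lemma lq: "letters b q" using lu by (simp add: letters_def q_def win_def)

lemma letters_win: "letters b win" using lu by (simp add: letters_def win_def)

lemma cnt_win: "i < b \<Longrightarrow> cnt win i m = r"
proof -
  assume i: "i < b"
  have "cnt win i m = cnt (\<lambda>x. u ((b - 1 + 0) * m + x)) i m"
    by (rule cnt_cong) (simp add: win_def)
  then show ?thesis using cnt_window[OF i, of 0] a2b by simp
qed

lemma cnt_q: "i < b \<Longrightarrow> s \<le> m \<Longrightarrow> cnt q i (B0 + (e * m + s)) = cnt u i (B0 + s) + r * e"
proof -
  assume i: "i < b" and s: "s \<le> m"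
  have "cnt q i (B0 + (e * m + s)) = cnt q i B0 + cnt (\<lambda>x. q (B0 + x)) i (e * m + s)" by (rule cnt_add)
  also have "(\<lambda>x. q (B0 + x)) = win" by (simp add: q_def)
  also have "cnt win i (e * m + s) = e * r + cnt win i s" using cnt_periodic[of win m i e s] win_per cnt_win[OF i] by simp
  also have "cnt q i B0 = cnt u i B0" by (rule cnt_cong) (simp add: q_def)
  also have "cnt win i s = cnt (\<lambda>x. u (B0 + x)) i s" by (rule cnt_cong) (use s in \<open>simp add: win_def\<close>)
  finally show ?thesis using cnt_add[of u i B0 s] by simp
qed

text \<open>Cutting out whole periods lowers the number of each letter below \<open>b\<close> by the
  same amount, which reduces the ballot condition to prefixes of \<open>u\<close>.\<close>

lemma latq: "lattice q"
  unfolding lattice_def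
proof (intro allI)
  fix t i
  have lu': "cnt u (Suc i) t \<le> cnt u i t" for t using closedD(2)[OF cl] by (simp add: lattice_def)
  show "cnt q (Suc i) t \<le> cnt q i t"
  proof (cases "Suc i < b")
    case False
    then show ?thesis using cnt_zero[OF lq, of "Suc i" t] by simp
  next
    case i: True
    show ?thesis
    proof (cases "t < B0")
      case True
      have "cnt q j t = cnt u j t" for j by (rule cnt_cong) (use True in \<open>simp add: q_def\<close>)
      then show ?thesis using lu' by simp
    next
      case False
      define e where "e = (t - B0) div m"
      define s where "s = (t - B0) mod m"
      have t: "t = B0 + (e * m + s)"
        unfolding e_def s_def using False div_mult_mod_eq[of "t - B0" m] by linarith
      have "s \<le> m" using mN by (simp add: s_def less_imp_le)
      then show ?thesis unfolding t using cnt_q[of "Suc i" s e] cnt_q[of i s e] i lu'[of "B0 + s"] by simp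
    qed
  qed
qed

text \<open>The analogue of \<open>FF\<close> for prefixes of \<open>q\<close>. Letters after the
  last source have weight one each, and \<open>N - L\<close> compensates for them, so the value does
  not depend on \<open>L\<close>.\<close>

definition FQ :: "nat \<Rightarrow> nat multiset \<Rightarrow> int" where
  "FQ L M = VM b q L (image_mset ((*) m) M) + int N - int L + int r * int (\<Sum>\<^sub># M)"

lemma FQ_indep:
  assumes "size M = b" "\<And>x. x \<in># M \<Longrightarrow> m * x \<le> L" "L \<le> L'" shows "FQ L' M = FQ L M"
proof -
  have "filter_mset (\<lambda>s. s \<le> L) (image_mset ((*) m) M) = image_mset ((*) m) M"
    unfolding filter_mset_eq_conv using assms(2) by auto
  then have "srcs (image_mset ((*) m) M) L = int b" using assms(1) by (simp add: srcs_def)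
  then have "VM b q L' (image_mset ((*) m) M) = VM b q L (image_mset ((*) m) M) + int (L' - L)"
    unfolding VM_def by (intro V_full_tail[OF lq good_srcs]) (use assms in auto)
  then show ?thesis using assms(3) by (simp add: FQ_def)
qed

lemma FQ_eq_FF:
  assumes "size M = b" "\<And>x. x \<in># M \<Longrightarrow> x \<le> a + 1 - b" "\<And>x. x \<in># M \<Longrightarrow> m * x \<le> L" shows "FQ L M = FF M"
proof -
  have L1N: "L1 \<le> N" unfolding L1_def mN(1)[symmetric] using b2 by (intro mult_right_mono) auto
  have s: "m * x \<le> L1" if "x \<in># M" for x using assms(2)[OF that] by (simp add: L1_def mult.commute)
  have "filter_mset (\<lambda>s. s \<le> L1) (image_mset ((*) m) M) = image_mset ((*) m) M"
    unfolding filter_mset_eq_conv using s by auto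
  then have "srcs (image_mset ((*) m) M) L1 = int b" using assms(1) by (simp add: srcs_def)
  then have "VM b u N (image_mset ((*) m) M) = VM b u L1 (image_mset ((*) m) M) + int (N - L1)"
    unfolding VM_def by (intro V_full_tail[OF lu good_srcs]) (use assms L1N in auto)
  moreover have "VM b u L1 (image_mset ((*) m) M) = VM b q L1 (image_mset ((*) m) M)"
    unfolding VM_def by (rule V_cong) (simp add: q_eq_u)
  ultimately have "FQ L1 M = FF M" using L1N by (simp add: FQ_def FF_def)
  moreover have "FQ L M = FQ L1 M"
    using FQ_indep[OF assms(1) s, of L] FQ_indep[OF assms(1,3), of L1] by (cases "L1 \<le> L") auto
  ultimately show ?thesis by simp
qed

text \<open>Two neighbouring pairs of positions. The offset \<open>b - 1\<close> is the least
  \<open>k\<close> that \<open>two_clusters\<close> admits if all points belong to the clusters and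
  the first cluster is concentrated at \<open>0\<close>.\<close>

definition cfg :: "nat \<Rightarrow> nat \<Rightarrow> nat \<Rightarrow> nat \<Rightarrow> nat \<Rightarrow> nat multiset" where
  "cfg e p s p' s' = replicate_mset p 0 + replicate_mset s 1 + replicate_mset p' (b - 1 + e) + replicate_mset s' (b + e)"

lemma cfg_size: "size (cfg e p s p' s') = p + s + p' + s'"
  by (simp add: cfg_def)

lemma cfg_le: "x \<in># cfg e p s p' s' \<Longrightarrow> x \<le> b + e"
  using b2 by (auto simp: cfg_def split: if_splits)

lemma cfg_L: "(b + e) * m \<le> L \<Longrightarrow> x \<in># cfg e p s p' s' \<Longrightarrow> m * x \<le> L"
  using cfg_le[of x e p s p' s'] mult_le_mono2[of x "b + e" m] mult.commute[of m "b + e"] by linarith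

lemma cnt_q_step: "i < b \<Longrightarrow> B0 \<le> t \<Longrightarrow> cnt q i (t + m) = cnt q i t + r"
proof -
  assume i: "i < b" and t: "B0 \<le> t"
  define e where "e = (t - B0) div m"
  define s where "s = (t - B0) mod m"
  have t: "t = B0 + (e * m + s)"
    unfolding e_def s_def using t div_mult_mod_eq[of "t - B0" m] by linarith
  have s: "s \<le> m" using mN by (simp add: s_def less_imp_le)
  have tm: "t + m = B0 + (Suc e * m + s)" using t by simp
  have "cnt q i (t + m) = cnt u i (B0 + s) + r * Suc e" unfolding tm by (rule cnt_q[OF i s])
  moreover have "cnt q i t = cnt u i (B0 + s) + r * e" by (subst t) (rule cnt_q[OF i s])
  ultimately show ?thesis by simp
qed

text \<open>Until the second cluster arrives the optimal chain is packed, so one more period adds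
  \<open>r * p\<close> to \<open>V\<close>. The linear term adds \<open>r\<close> for each of the
  \<open>p' + s'\<close> delayed sources. The total is \<open>m\<close>, which the change of
  \<open>L\<close> absorbs.\<close>

lemma FQ_translate:
  assumes "p + p' + s' = b" "(b + e) * m \<le> L"
  shows "FQ (L + m) (cfg (Suc e) p 0 p' s') = FQ L (cfg e p 0 p' s')"
proof -
  define T0 where "T0 = (b - 1 + e) * m"
  define n where "n = srcs (image_mset ((*) m) (cfg e p 0 p' s'))"
  have T: "B0 \<le> T0" "0 < T0" "(b + e) * m = T0 + m"
  proof -
    show "B0 \<le> T0" by (simp add: T0_def)
    show "0 < T0" using b2 mN by (simp add: T0_def)
    have "b + e = Suc (b - 1 + e)" using b2 by simp
    then show "(b + e) * m = T0 + m" unfolding T0_def by (metis add.commute mult_Suc)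
  qed
  have T1: "m * (b - 1 + e) = T0" "m * (b + e) = T0 + m" "m * (b - 1 + Suc e) = T0 + m" "m * (b + Suc e) = T0 + m + m"
    using T(3) by (simp_all add: T0_def algebra_simps)
  have pb: "p \<le> b" using assms(1) by linarith
  have n: "n t = int p + (if T0 \<le> t then int p' else 0) + (if T0 + m \<le> t then int s' else 0)" for t
    unfolding n_def cfg_def using T1(1,2) by simp
  have sh: "srcs (image_mset ((*) m) (cfg (Suc e) p 0 p' s')) = (\<lambda>t. if t < T0 + m then int p else n (t - m))"
    unfolding n cfg_def using T1(3,4) by (auto simp: fun_eq_iff)
  have "V b q (L + m) (\<lambda>t. if t < T0 + m then int p else n (t - m)) + int (card {t. t < T0 \<and> q t < p})
      = V b q L n + int (card {t. t < T0 + m \<and> q t < p})"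
  proof (rule V_translate[OF lq latq])
    show "q (t + m) = q t" if "T0 \<le> t" for t by (rule q_per) (use that T in simp)
    show "good b n" unfolding n_def by (rule good_srcs) (use assms in \<open>simp add: cfg_size\<close>)
    show "T0 \<le> L" using assms(2) T by simp
  qed (use n in auto)
  moreover have "card {t. t < T0 + m \<and> q t < p} = card {t. t < T0 \<and> q t < p} + r * p"
  proof -
    have "(\<Sum>j<p. cnt q j (T0 + m)) = (\<Sum>j<p. cnt q j T0 + r)"
      by (rule sum.cong) (use pb T(1) in \<open>auto intro!: cnt_q_step\<close>)
    then show ?thesis unfolding card_less_sum by (simp add: sum.distrib)
  qed
  ultimately have "VM b q (L + m) (image_mset ((*) m) (cfg (Suc e) p 0 p' s')) = VM b q L (image_mset ((*) m) (cfg e p 0 p' s')) + int (r * p)"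
    unfolding VM_def sh n_def[symmetric] by simp
  moreover have "\<Sum>\<^sub># (cfg (Suc e) p 0 p' s') = \<Sum>\<^sub># (cfg e p 0 p' s') + (p' + s')"
    by (simp add: cfg_def sum_mset_replicate_mset algebra_simps)
  moreover have "int m = int r * int p + int r * int (p' + s')"
  proof -
    have "b * r = r * p + r * (p' + s')" using arg_cong[OF assms(1), of "\<lambda>x. x * r"] by (simp add: algebra_simps)
    then have "int m = int (r * p + r * (p' + s'))" unfolding m_def by (rule arg_cong)
    then show ?thesis by (simp only: of_nat_add of_nat_mult)
  qed
  ultimately show ?thesis by (simp add: FQ_def algebra_simps)
qed

lemma FQ_base:
  assumes "p + p' + s' = b" "(b + e) * m \<le> L" shows "FQ L (cfg e p 0 p' s') = eta p 0 + eta p' s' - top"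
  using assms(2)
proof (induction e arbitrary: L)
  case 0
  have "FQ L (cfg 0 p 0 p' s') = FF (cfg 0 p 0 p' s')"
  proof (rule FQ_eq_FF)
    show "size (cfg 0 p 0 p' s') = b" using assms(1) by (simp add: cfg_size)
    show "x \<le> a + 1 - b" if "x \<in># cfg 0 p 0 p' s'" for x using cfg_le[OF that] a2b by linarith
    show "m * x \<le> L" if "x \<in># cfg 0 p 0 p' s'" for x using cfg_L[OF 0 that] .
  qed
  also have "\<dots> = eta p 0 + eta p' s' - top"
  proof (cases "p = 0")
    case True
    then show ?thesis using eta_full[of p' s'] assms(1) by (simp add: cfg_def eta_def)
  next
    case False
    then show ?thesis using eta_split_right[of p p' s'] assms(1) by (simp add: cfg_def)
  qed
  finally show ?case .
next
  case (Suc e)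
  have "(b + e) * m \<le> L - m" using Suc.prems by simp
  moreover have "L - m + m = L" using Suc.prems by simp
  ultimately show ?case using FQ_translate[OF assms(1), of e "L - m"] Suc.IH[of "L - m"] by simp
qed

lemma FQ_cross2:
  assumes "w \<le> x" "x \<le> y" "y \<le> z" "size S + 2 = b"
  shows "FQ L (add_mset w (add_mset z S)) + FQ L (add_mset x (add_mset y S)) \<le> FQ L (add_mset w (add_mset y S)) + FQ L (add_mset x (add_mset z S))"
proof -
  have "size (image_mset ((*) m) S) + 2 \<le> b" "m * w \<le> m * x" "m * x \<le> m * y" "m * y \<le> m * z" using assms by auto
  from VM_cross(2)[OF lq this, of L] show ?thesis by (simp add: FQ_def algebra_simps)
qed

text \<open>The three term tropical Pluecker relation: in the exchange axiom the point leaving the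
  first multiset can only be \<open>x\<close> or \<open>z\<close>.\<close>

lemma FQ_three_term:
  assumes "size S + 2 = b" "w \<noteq> x" "w \<noteq> z" "x \<noteq> y" "z \<noteq> y" "\<And>v. v \<in># S \<Longrightarrow> m * v \<le> L" "m * w \<le> L" "m * x \<le> L" "m * y \<le> L" "m * z \<le> L"
  shows "FQ L (add_mset x (add_mset z S)) + FQ L (add_mset w (add_mset y S))
     \<le> max (FQ L (add_mset w (add_mset z S)) + FQ L (add_mset x (add_mset y S)))
          (FQ L (add_mset w (add_mset x S)) + FQ L (add_mset y (add_mset z S)))"
proof -
  let ?I = "image_mset ((*) m)"
  let ?S = "?I S"
  let ?M1 = "add_mset (m * x) (add_mset (m * z) ?S)" and ?M2 = "add_mset (m * w) (add_mset (m * y) ?S)"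
  have ne: "m * w \<noteq> m * x" "m * w \<noteq> m * z" "m * x \<noteq> m * y" "m * z \<noteq> m * y" using assms mN(4) by auto
  have sz: "size ?M1 = b" "size ?M2 = b" "\<forall>s\<in>#?M1. s \<le> L" "\<forall>s\<in>#?M2. s \<le> L" using assms by auto
  have lt: "count ?M1 (m * w) < count ?M2 (m * w)" using ne by simp
  obtain y' where y': "count ?M2 y' < count ?M1 y'"
     "VM b q L ?M1 + VM b q L ?M2 \<le> VM b q L (add_mset (m * w) (?M1 - {#y'#})) + VM b q L (add_mset y' (?M2 - {#m * w#}))"
    using VM_exchange[OF lq sz lt] by blast
  have "y' = m * x \<or> y' = m * z" using y'(1) by (auto split: if_splits)
  then show ?thesis
  proof
    assume "y' = m * x"
    then have "VM b q L ?M1 + VM b q L ?M2 \<le> VM b q L (add_mset (m * w) (add_mset (m * z) ?S)) + VM b q L (add_mset (m * x) (add_mset (m * y) ?S))"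
      using y'(2) by simp
    then show ?thesis by (simp add: FQ_def algebra_simps)
  next
    assume y2: "y' = m * z"
    have "?M1 - {#y'#} = add_mset (m * x) ?S" unfolding y2 by (simp add: add_mset_commute)
    then have "VM b q L ?M1 + VM b q L ?M2 \<le> VM b q L (add_mset (m * w) (add_mset (m * x) ?S)) + VM b q L (add_mset (m * y) (add_mset (m * z) ?S))"
      using y'(2) y2 by (simp add: add_mset_commute)
    then show ?thesis by (simp add: FQ_def algebra_simps)
  qed
qed

text \<open>Additivity at every distance, also beyond the length of \<open>u\<close>. Induction on
  the distance and then on the number of sources at the right ends of the two pairs. If both right
  ends are used, \<open>FQ_cross2\<close> gives the lower bound and \<open>FQ_three_term\<close> the
  upper one, because by \<open>eta_exchange\<close> the first term of the maximum is the
  larger.\<close>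

lemma FQ_clusters:
  assumes "1 \<le> e" "p + s + p' + s' = b" "(b + e) * m \<le> L"
  shows "FQ L (cfg e p s p' s') = eta p s + eta p' s' - top"
  using assms
proof (induction e arbitrary: p s p' s' L)
  case (Suc e)
  note IHe = Suc.IH
  from Suc.prems(2,3) show ?case
  proof (induction "s + s'" arbitrary: p s p' s' rule: less_induct)
    case less
    have L: "(b + Suc e) * m \<le> L" and sz: "p + s + p' + s' = b" using less.prems by auto
    consider "s = 0" | "s \<noteq> 0" "s' = 0" "e = 0" | "s \<noteq> 0" "s' = 0" "1 \<le> e" | "s \<noteq> 0" "s' \<noteq> 0" by linarith
    then show ?case
    proof cases
      case 1
      then show ?thesis using FQ_base[of p p' s' "Suc e" L] L sz by simp
    next
      case 2
      \<comment> \<open>At the smallest distance the second cluster is concentrated at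
        \<open>b\<close>, within the range where \<open>q\<close> agrees with
        \<open>u\<close>.\<close>
      have c: "cfg (Suc e) p s p' s' = replicate_mset p 0 + replicate_mset s 1 + replicate_mset p' b"
        using 2 b2 by (simp add: cfg_def)
      have "FQ L (cfg (Suc e) p s p' s') = FF (cfg (Suc e) p s p' s')"
      proof (rule FQ_eq_FF)
        show "size (cfg (Suc e) p s p' s') = b" using sz by (simp add: cfg_size)
        show "x \<le> a + 1 - b" if "x \<in># cfg (Suc e) p s p' s'" for x
          using that a2b b2 unfolding c by (auto split: if_splits)
        show "m * x \<le> L" if "x \<in># cfg (Suc e) p s p' s'" for x using cfg_L[OF L that] .
      qed
      then show ?thesis using eta_split_left[of p s p'] sz 2 c by simp
    next
      case 3
      \<comment> \<open>A cluster at the left end of the pair for \<open>Suc e\<close> is a cluster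
        at the right end of the pair for \<open>e\<close>.\<close>
      have "cfg (Suc e) p s p' s' = cfg e p s 0 p'" using 3 b2 by (simp add: cfg_def)
      moreover have "FQ L (cfg e p s 0 p') = eta p s + eta 0 p' - top"
        by (rule IHe) (use 3 sz L in auto)
      ultimately show ?thesis using eta_swap[of p'] 3 sz by simp
    next
      case 4
      obtain s1 s1' where s1: "s = Suc s1" "s' = Suc s1'" using 4 by (metis not0_implies_Suc)
      define X Y where "X = b - 1 + Suc e" and "Y = b + Suc e"
      define S where "S = replicate_mset p 0 + replicate_mset s1 1 + replicate_mset p' X + replicate_mset s1' Y"
      have XY: "0 < X" "1 < X" "X < Y" "1 < Y" using b2 by (auto simp: X_def Y_def)
      have S: "size S + 2 = b" using sz s1 by (simp add: S_def)
      have cf: "cfg (Suc e) p s p' s' = add_mset 1 (add_mset Y S)"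
        "cfg (Suc e) (Suc p) s1 p' s' = add_mset 0 (add_mset Y S)"
        "cfg (Suc e) p s (Suc p') s1' = add_mset 1 (add_mset X S)"
        "cfg (Suc e) (Suc p) s1 (Suc p') s1' = add_mset 0 (add_mset X S)"
        "cfg (Suc e) (Suc p) s p' s1' = add_mset 0 (add_mset 1 S)"
        "cfg (Suc e) p s1 (Suc p') s' = add_mset X (add_mset Y S)"
        unfolding cfg_def S_def X_def[symmetric] Y_def[symmetric] s1 by (simp_all add: add_mset_commute)
      have IH: "FQ L (cfg (Suc e) P Q P' Q') = eta P Q + eta P' Q' - top"
        if "Q + Q' < s + s'" "P + Q + P' + Q' = b" for P Q P' Q'
        using less.hyps[of Q Q' P P'] that L by simp
      have v: "FQ L (add_mset 0 (add_mset Y S)) = eta (Suc p) s1 + eta p' s' - top"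
        "FQ L (add_mset 1 (add_mset X S)) = eta p s + eta (Suc p') s1' - top"
        "FQ L (add_mset 0 (add_mset X S)) = eta (Suc p) s1 + eta (Suc p') s1' - top"
        "FQ L (add_mset 0 (add_mset 1 S)) = eta (Suc p) s + eta p' s1' - top"
        "FQ L (add_mset X (add_mset Y S)) = eta p s1 + eta (Suc p') s' - top"
        unfolding cf[symmetric] by (rule IH; use sz s1 in simp)+
      have low: "FQ L (add_mset 0 (add_mset Y S)) + FQ L (add_mset 1 (add_mset X S)) \<le> FQ L (add_mset 0 (add_mset X S)) + FQ L (add_mset 1 (add_mset Y S))"
        by (rule FQ_cross2) (use XY S in auto)
      have bound: "m * z \<le> L" if "z \<le> Y" for z
      proof -
        have "m * z \<le> m * Y" using that by simp
        then show ?thesis using L by (simp add: Y_def mult.commute)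
      qed
      have Sz: "z \<le> Y" if "z \<in># S" for z using that XY by (auto simp: S_def split: if_splits)
      have up: "FQ L (add_mset 1 (add_mset Y S)) + FQ L (add_mset 0 (add_mset X S))
        \<le> max (FQ L (add_mset 0 (add_mset Y S)) + FQ L (add_mset 1 (add_mset X S)))
          (FQ L (add_mset 0 (add_mset 1 S)) + FQ L (add_mset X (add_mset Y S)))"
      proof (rule FQ_three_term[OF S])
        show "m * v \<le> L" if "v \<in># S" for v by (rule bound[OF Sz[OF that]])
        show "m * 0 \<le> L" "m * 1 \<le> L" "m * X \<le> L" "m * Y \<le> L" by (rule bound, use XY in linarith)+
      qed (use XY in auto)
      have e1: "eta (Suc p) s + eta p s1 \<le> eta (Suc p) s1 + eta p s"
        using eta_exchange[of p s1] sz s1 by simp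
      have e2: "eta (Suc p') s' + eta p' s1' \<le> eta (Suc p') s1' + eta p' s'"
        using eta_exchange[of p' s1'] sz s1 by simp
      show ?thesis unfolding cf(1) using low up e1 e2 v by linarith
    qed
  qed
qed simp

text \<open>One period of \<open>q\<close> is erased and the rest is rectified. The aim is to see
  that \<open>q\<close> comes back.\<close>

definition q' :: "nat \<Rightarrow> nat" where "q' = (wsl ^^ m) q"

lemma q': "letters b q'" "lattice q'" "veq b (\<lambda>t. q (t + m)) q'"
  using wsl_pow[OF lq latq, of m] by (simp_all add: q'_def)

text \<open>Before \<open>B0\<close> there is even equality, since promotion of \<open>u\<close>
  sees the same letters and \<open>u\<close> is fixed. From \<open>B0\<close> on it follows from the
  periodicity of \<open>q\<close> and the fact that slides lower letters.\<close>

lemma q'_le: "t < (b - 1 + e) * m \<Longrightarrow> q' t \<le> q t"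
proof (cases "t < B0")
  case True
  have bm: "B0 + m \<le> L1" "L1 \<le> N"
  proof -
    have "Suc (b - 1) * m \<le> (a + 1 - b) * m" using a2b b2 by (intro mult_right_mono) auto
    then show "B0 + m \<le> L1" by (simp add: L1_def)
    show "L1 \<le> N" unfolding L1_def mN(1)[symmetric] using b2 by (intro mult_right_mono) auto
  qed
  have "(prw b N ^^ m) u t = (wsl ^^ m) q t"
    by (rule prw_pow_wsl_pow) (use True bm in \<open>auto simp: q_eq_u\<close>)
  then show ?thesis using fixed q_eq_u[of t] True bm by (simp add: q'_def)
next
  case False
  then show ?thesis using wsl_pow_le[of m q t] q_per[of t] by (simp add: q'_def)
qed

text \<open>Counting letters after one period has been erased means placing the first
  \<open>i\<close> sources at \<open>1\<close> instead of \<open>0\<close> and the others one period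
  later. By \<open>FQ_clusters\<close> and \<open>eta_swap\<close> both configurations have the same
  value.\<close>

lemma q'_count:
  assumes i: "i \<le> b" and e: "1 \<le> e"
  shows "card {t. t < (b - 1 + e) * m \<and> q' t < i} = card {t. t < (b - 1 + e) * m \<and> q t < i}"
proof -
  define K where "K = b - 1 + e"
  define T where "T = K * m"
  have SK: "Suc K = b + e" using b2 e by (simp add: K_def)
  have "Suc K * m = T + m" by (simp add: T_def)
  then have "(b + e) * m = T + m" by (simp only: SK)
  moreover have "0 < T" using b2 mN by (simp add: T_def K_def)
  ultimately have T0: "0 < T" "(b + e) * m = T + m" "Suc K = b + e" using SK by simp_all
  consider "i = 0" | "i = b" | "1 \<le> i" "i < b" using i by linarith
  then show ?thesis
  proof cases
    case 1
    then show ?thesis by simp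
  next
    case 2
    then show ?thesis using lq q'(1) by (simp add: letters_def)
  next
    case 3
    let ?n = "\<lambda>t. if t < T then int i else int b"
    have g: "good b ?n" using 3 by (auto simp: good_def mono_def)
    have 1: "V b q' T ?n = int (card {t. t < T \<and> q' t < i})"
      using V_lattice_step[OF q'(1,2), of i T T] i by simp
    have "V b q' T ?n = V b (\<lambda>t. q (t + m)) T ?n" using q'(3) g by (simp add: veq_def)
    also have "\<dots> = V b q (T + m) (\<lambda>t. if t < m then 0 else ?n (t - m))"
      by (rule V_shift_add[symmetric]) (use lq g in auto)
    also have "(\<lambda>t. if t < m then 0 else ?n (t - m)) = srcs (image_mset ((*) m) (cfg e 0 i 0 (b - i)))"
    proof
      fix t
      have "m * (b + e) = T + m" using T0(2) by (simp add: mult.commute)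
      then show "(if t < m then 0 else ?n (t - m)) = srcs (image_mset ((*) m) (cfg e 0 i 0 (b - i))) t"
        using 3 by (auto simp: cfg_def)
    qed
    finally have "VM b q (T + m) (image_mset ((*) m) (cfg e 0 i 0 (b - i))) = int (card {t. t < T \<and> q' t < i})"
      using 1 unfolding VM_def by linarith
    moreover have "\<Sum>\<^sub># (cfg e 0 i 0 (b - i)) = i + (b - i) * Suc K"
      unfolding T0(3) by (simp add: cfg_def sum_mset_replicate_mset)
    ultimately have 2: "FQ (T + m) (cfg e 0 i 0 (b - i)) = int (card {t. t < T \<and> q' t < i}) + int N - int (T + m) + int r * int (i + (b - i) * Suc K)"
      unfolding FQ_def by (simp only:)
    have 4: "V b q T ?n = int (card {t. t < T \<and> q t < i})"
      using V_lattice_step[OF lq latq, of i T T] i by simp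
    have "?n = srcs (image_mset ((*) m) (cfg e i 0 (b - i) 0))"
    proof
      fix t
      have "m * (b - 1 + e) = T" by (simp add: T_def K_def mult.commute)
      then show "?n t = srcs (image_mset ((*) m) (cfg e i 0 (b - i) 0)) t"
        using 3 T0 by (auto simp: cfg_def)
    qed
    then have "FQ T (cfg e i 0 (b - i) 0) = int (card {t. t < T \<and> q t < i}) + int N - int T + int r * int ((b - i) * K)"
      unfolding FQ_def VM_def using 4 by (simp add: cfg_def sum_mset_replicate_mset K_def)
    moreover have "FQ (T + m) (cfg e i 0 (b - i) 0) = FQ T (cfg e i 0 (b - i) 0)"
    proof (rule FQ_indep)
      show "m * x \<le> T" if "x \<in># cfg e i 0 (b - i) 0" for x
        using that by (auto simp: cfg_def T_def K_def mult.commute split: if_splits)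
    qed (use 3 in \<open>auto simp: cfg_size\<close>)
    moreover have "FQ (T + m) (cfg e i 0 (b - i) 0) = eta i 0 + eta (b - i) 0 - top"
      by (rule FQ_clusters) (use 3 e T0 in auto)
    moreover have "FQ (T + m) (cfg e 0 i 0 (b - i)) = eta i 0 + eta (b - i) 0 - top"
      using FQ_clusters[of e 0 i 0 "b - i" "T + m"] 3 e T0 eta_swap[of i] eta_swap[of "b - i"] by simp
    moreover have "int m = int r * int i + int r * int (b - i)" using 3 by (simp add: m_def of_nat_diff algebra_simps)
    moreover have "int r * int (i + D * Suc K) = int r * int i + int r * int D + int r * int (D * K)" for D
      by (simp add: algebra_simps)
    ultimately have "int (card {t. t < T \<and> q' t < i}) = int (card {t. t < T \<and> q t < i})"
      using 2 by (simp only: of_nat_add)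
    then show ?thesis by (simp add: T_def K_def)
  qed
qed

lemma q'_eq: "q' = q"
proof
  fix t
  define e where "e = Suc t"
  have t: "t < (b - 1 + e) * m" using mN(2) mult_le_mono[of "Suc t" "b - 1 + e" 1 m] by (simp add: e_def)
  show "q' t = q t"
  proof (rule le_cnt_imp_eq[OF q'(1) lq _ _ t])
    show "q' s \<le> q s" if "s < (b - 1 + e) * m" for s using q'_le that .
    show "cnt q' i ((b - 1 + e) * m) = cnt q i ((b - 1 + e) * m)" if "i < b" for i
      using q'_count[of i e] q'_count[of "Suc i" e] that by (simp add: e_def card_letters_Suc)
  qed
qed

text \<open>After the erasure of \<open>b - 1\<close> periods only the periodic part of
  \<open>q\<close> is left, and rectifying it still gives \<open>q\<close>.\<close>

lemma prefix_hw: assumes "t < (a + 1 - b) * m" shows "u t = hw b win t"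
proof -
  have "(wsl ^^ (m * k)) q = q" for k
    using q'_eq unfolding q'_def by (induction k) (simp_all add: funpow_add)
  from this[of "b - 1"] have "veq b (\<lambda>t. q (t + m * (b - 1))) q" using wsl_pow[OF lq latq, of "m * (b - 1)"] by simp
  moreover have "(\<lambda>t. q (t + m * (b - 1))) = win" by (auto simp: q_def mult.commute)
  ultimately have "hw b win = q" using hw_unique[OF lq latq] by simp
  then show ?thesis using q_eq_u[of t] assms by (simp add: L1_def)
qed

end

lemma abel_sum:
  fixes k X :: "nat \<Rightarrow> int"
  shows "(\<Sum>t<Suc n. k t * (X (Suc t) - X t)) = k n * X (Suc n) - k 0 * X 0 - (\<Sum>t<n. (k (Suc t) - k t) * X (Suc t))"
  by (induction n) (simp_all add: algebra_simps)

text \<open>The weight is collected by the index \<open>i\<close> of the chain entries, so that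
  summation by parts in time can be applied to each of them.\<close>

lemma weight_decomp:
  assumes "letters b u" "1 \<le> b" "\<And>t. \<kappa> t 0 = 0"
  shows "weight u N \<kappa> = (\<Sum>i\<in>{1..<b}. \<Sum>t<N. \<kappa> t i * (of_bool (u t = i - 1) - of_bool (u t = i)))
     + (\<Sum>t<N. \<kappa> t b * of_bool (u t = b - 1))"
proof -
  have "\<kappa> t (Suc (u t)) - \<kappa> t (u t) = (\<Sum>i\<in>{1..<b}. \<kappa> t i * (of_bool (u t = i - 1) - of_bool (u t = i))) + \<kappa> t b * of_bool (u t = b - 1)" for t
  proof -
    have ub: "u t < b" using assms(1) by (simp add: letters_def)
    have "(\<Sum>i\<in>{1..<b}. \<kappa> t i * (of_bool (u t = i - 1) - of_bool (u t = i)))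
      = (\<Sum>i\<in>{1..<b}. if i = Suc (u t) then \<kappa> t i else 0) - (\<Sum>i\<in>{1..<b}. if i = u t then \<kappa> t i else 0)"
      unfolding sum_subtractf[symmetric] by (rule sum.cong) auto
    also have "(\<Sum>i\<in>{1..<b}. if i = Suc (u t) then \<kappa> t i else 0) = (if Suc (u t) < b then \<kappa> t (Suc (u t)) else 0)"
      by simp
    also have "(\<Sum>i\<in>{1..<b}. if i = u t then \<kappa> t i else 0) = \<kappa> t (u t)"
      using ub assms(3)[of t] by (cases "u t = 0") auto
    finally show ?thesis using ub by (cases "Suc (u t) = b") auto
  qed
  then have "weight u N \<kappa> = (\<Sum>t<N. (\<Sum>i\<in>{1..<b}. \<kappa> t i * (of_bool (u t = i - 1) - of_bool (u t = i))) + \<kappa> t b * of_bool (u t = b - 1))"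
    unfolding weight_def by simp
  then show ?thesis unfolding sum.distrib by (subst sum.swap) simp
qed

section \<open>Periodic words and gluing\<close>

definition rvw :: "nat \<Rightarrow> nat \<Rightarrow> (nat \<Rightarrow> nat) \<Rightarrow> nat \<Rightarrow> nat" where
  "rvw b m w t = b - 1 - w (m - 1 - t mod m)"

locale periodic_word =
  fixes b r :: nat and w :: "nat \<Rightarrow> nat"
  assumes b1: "1 \<le> b" and r1: "1 \<le> r" and lw: "letters b w" and per: "\<And>t. w (t + b * r) = w t"
    and bal: "\<And>i. i < b \<Longrightarrow> cnt w i (b * r) = r"
begin

definition m where "m = b * r"

lemma m1: "1 \<le> m" "0 < m" using b1 r1 by (simp_all add: m_def)

lemma per_m: "w (t + m) = w t" using per by (simp add: m_def)

lemma per_mult: "w (e * m + t) = w t"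
proof (induction e)
  case (Suc e)
  have "w (Suc e * m + t) = w ((e * m + t) + m)" by (simp add: ac_simps)
  then show ?case using per_m Suc by simp
qed simp

lemma per_mod: "w (t mod m) = w t"
  by (rule per_mult[of "t div m" "t mod m", unfolded div_mult_mod_eq, symmetric])

lemma cnt_m: "i < b \<Longrightarrow> cnt w i m = r" using bal by (simp add: m_def)

lemma cnt_per: "i < b \<Longrightarrow> cnt w i (e * m + s) = e * r + cnt w i s"
  using cnt_periodic[of w m i e s] per_m cnt_m by simp

lemma cnt_le: "i < b \<Longrightarrow> s \<le> m \<Longrightarrow> cnt w i s \<le> r"
  using cnt_mono[of s m w i] cnt_m by simp

text \<open>The inner shape of \<open>beta b r\<close>.\<close>

definition mu0 where "mu0 i = (b - 1 - i) * r"

text \<open>Consecutive rows are offset by \<open>r\<close>, and within a period the lower row can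
  gain at most \<open>r\<close> on the upper one.\<close>

lemma skew_mu0: "skew mu0 w"
  unfolding skew_def
proof (intro allI)
  fix t i
  show "lam mu0 w t (Suc i) \<le> lam mu0 w t i"
  proof (cases "Suc i < b")
    case True
    have "t mod m \<le> m" using m1 by (simp add: less_imp_le)
    then have "cnt w (Suc i) t \<le> t div m * r + r" "t div m * r \<le> cnt w i t"
      using cnt_per[of "Suc i" "t div m" "t mod m", unfolded div_mult_mod_eq] cnt_per[of i "t div m" "t mod m", unfolded div_mult_mod_eq]
        cnt_le[of "Suc i" "t mod m"] True by linarith+
    moreover have "mu0 i = mu0 (Suc i) + r"
    proof -
      have "b - 1 - i = Suc (b - 1 - Suc i)" using True by simp
      then show ?thesis by (simp add: mu0_def)
    qed
    ultimately show ?thesis by (simp add: lam_def)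
  next
    case False
    then show ?thesis using cnt_zero[OF lw, of "Suc i" t] by (simp add: lam_def mu0_def)
  qed
qed

lemma mu0_0: "b \<le> i \<Longrightarrow> mu0 i = 0" by (simp add: mu0_def)

definition q where "q = hw b w"

lemma hwq: "letters b q" "lattice q" "veq b w q" "q t \<le> w t"
  using hw[OF lw skew_mu0] mu0_0 unfolding q_def by blast+

definition B :: "nat \<Rightarrow> nat \<Rightarrow> int" where "B i t = int (cnt w (i - 1) t) - int (cnt w i t)"

lemma B_0 [simp]: "B i 0 = 0" by (simp add: B_def)

lemma B_per: assumes "1 \<le> i" "i < b" shows "B i (e * m + s) = B i s"
  using cnt_per[of "i - 1" e s] cnt_per[of i e s] assms by (simp add: B_def)

lemma B_mult: "1 \<le> i \<Longrightarrow> i < b \<Longrightarrow> B i (e * m) = 0" using B_per[of i e 0] by simp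

lemma B_Suc: "B i (Suc t) - B i t = of_bool (w t = i - 1) - of_bool (w t = i)"
  by (simp add: B_def)

text \<open>The largest lead of letter \<open>i\<close> over letter \<open>i - 1\<close> in a
  prefix; by periodicity one period suffices to find it.\<close>

definition depth :: "nat \<Rightarrow> int" where "depth i = - Min (B i ` {..m})"

lemma depth_le: assumes "1 \<le> i" "i < b" shows "- B i t \<le> depth i"
proof -
  have "B i t = B i (t mod m)" by (rule B_per[OF assms, of "t div m" "t mod m", unfolded div_mult_mod_eq])
  moreover have "Min (B i ` {..m}) \<le> B i (t mod m)" by (rule Min_le) (use m1 in \<open>auto intro!: imageI simp: less_imp_le\<close>)
  ultimately show ?thesis unfolding depth_def by linarith
qed

lemma depth_attained: assumes "1 \<le> i" "i < b" obtains s where "s < m" "depth i = - B i s"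
proof -
  have "Min (B i ` {..m}) \<in> B i ` {..m}" by (rule Min_in) auto
  then obtain s where s: "Min (B i ` {..m}) = B i s" "s \<in> {..m}" by (rule imageE)
  have "B i s = B i (s mod m)" by (rule B_per[OF assms, of "s div m" "s mod m", unfolded div_mult_mod_eq])
  then have "depth i = - B i (s mod m)" unfolding depth_def s(1) by simp
  then show ?thesis using that[of "s mod m"] m1 by simp
qed

lemma depth_nonneg: "0 \<le> depth i"
proof -
  have "Min (B i ` {..m}) \<le> B i 0"
  proof (rule Min_le)
    show "B i 0 \<in> B i ` {..m}" by (rule imageI) simp
  qed simp
  then show ?thesis unfolding depth_def B_0 by linarith
qed

text \<open>The coefficient of \<open>depth i\<close> is the largest number of unit jumps of the
  \<open>i\<close>-th entry of a chain with \<open>n = k\<close>: this entry stays between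
  \<open>max 0 (i + k - b)\<close> and \<open>min k i\<close>.\<close>

definition C :: "nat \<Rightarrow> int" where
  "C k = (\<Sum>i\<in>{1..<b}. int (min (min k i) (min (b - k) (b - i))) * depth i)"

text \<open>Summation by parts. The boundary terms vanish because \<open>B i\<close> is zero at
  multiples of the period, and only the jumps of the entry remain.\<close>

lemma inner_sum:
  assumes "1 \<le> i" "i < b" "1 \<le> n"
  shows "(\<Sum>t<n * m. \<kappa> t i * (of_bool (w t = i - 1) - of_bool (w t = i)))
     = (\<Sum>t<n * m - 1. (\<kappa> (Suc t) i - \<kappa> t i) * (- B i (Suc t)))"
proof -
  have e: "n * m = Suc (n * m - 1)" using assms(3) m1 by simp
  have "(\<Sum>t<Suc (n * m - 1). \<kappa> t i * (B i (Suc t) - B i t))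
     = \<kappa> (n * m - 1) i * B i (Suc (n * m - 1)) - \<kappa> 0 i * B i 0 - (\<Sum>t<n * m - 1. (\<kappa> (Suc t) i - \<kappa> t i) * B i (Suc t))"
    by (rule abel_sum)
  also have "\<dots> = (\<Sum>t<n * m - 1. (\<kappa> (Suc t) i - \<kappa> t i) * (- B i (Suc t)))"
    using B_mult[OF assms(1,2), of n] unfolding e[symmetric] by (simp add: sum_negf)
  finally show ?thesis unfolding e[symmetric] B_Suc .
qed

lemma boundary_sum: "(\<Sum>t<n * m. int k * of_bool (w t = b - 1)) = int (k * (n * r))"
proof -
  have "(\<Sum>t<n * m. of_bool (w t = b - 1)) = int (cnt w (b - 1) (n * m))" by (simp only: cnt_int)
  also have "\<dots> = int (n * r)" using cnt_per[of "b - 1" n 0] b1 by simp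
  finally show ?thesis by (simp add: sum_distrib_left[symmetric])
qed

abbreviation level where "level n k t \<equiv> (if t < n * m then int k else int b)"

lemma level_good: "k \<le> b \<Longrightarrow> good b (level n k)"
  by (auto simp: good_def mono_def)

text \<open>A unit jump of the \<open>i\<close>-th entry earns at most \<open>depth i\<close>, and
  \<open>C\<close> bounds the number of jumps.\<close>

lemma level_upper:
  assumes k: "k \<le> b" and n: "1 \<le> n" shows "V b w (n * m) (level n k) \<le> int (k * (n * r)) + C k"
proof (rule V_le[OF lw level_good[OF k]])
  fix \<kappa> assume ch: "chain b (level n k) \<kappa>"
  have kb: "\<kappa> t b = int k" if "t < n * m" for t using chainD(2)[OF ch, of t] that by simp
  have "(\<Sum>t<n * m. \<kappa> t i * (of_bool (w t = i - 1) - of_bool (w t = i))) \<le> int (min (min k i) (min (b - k) (b - i))) * depth i"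
    if i: "i \<in> {1..<b}" for i
  proof -
    have i': "1 \<le> i" "i < b" using i by auto
    have "(\<Sum>t<n * m - 1. (\<kappa> (Suc t) i - \<kappa> t i) * (- B i (Suc t))) \<le> (\<Sum>t<n * m - 1. (\<kappa> (Suc t) i - \<kappa> t i) * depth i)"
      by (intro sum_mono mult_left_mono depth_le[OF i']) (use chainD(5)[OF ch, of i] i' in auto)
    also have "\<dots> = (\<kappa> (n * m - 1) i - \<kappa> 0 i) * depth i"
      unfolding sum_distrib_right[symmetric] by (subst sum_lessThan_telescope) simp
    also have "\<dots> \<le> int (min (min k i) (min (b - k) (b - i))) * depth i"
    proof (intro mult_right_mono depth_nonneg)
      have "n * m - 1 < n * m" "0 < n * m" using n m1 by simp_all
      then show "\<kappa> (n * m - 1) i - \<kappa> 0 i \<le> int (min (min k i) (min (b - k) (b - i)))"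
        using chain_bounds[OF ch, of i "n * m - 1"] chain_bounds[OF ch, of i 0] i' k by (auto simp: min_def of_nat_diff)
    qed
    finally show ?thesis unfolding inner_sum[OF i' n] .
  qed
  then have "(\<Sum>i\<in>{1..<b}. \<Sum>t<n * m. \<kappa> t i * (of_bool (w t = i - 1) - of_bool (w t = i))) \<le> C k"
    unfolding C_def by (rule sum_mono)
  moreover have "(\<Sum>t<n * m. \<kappa> t b * of_bool (w t = b - 1)) = int (k * (n * r))"
    unfolding boundary_sum[symmetric] by (rule sum.cong) (simp_all add: kb)
  ultimately show "weight w (n * m) \<kappa> \<le> int (k * (n * r)) + C k"
    using weight_decomp[of b w \<kappa> "n * m"] lw b1 chainD(1)[OF ch] by simp
qed

text \<open>The bound is attained by letting the \<open>i\<close>-th entry of the chain jump only at times where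
  \<open>B i\<close> is minimal; \<open>b - 1\<close> periods leave enough room to keep the entries interlaced.\<close>
lemma level_lower:
  assumes k: "k \<le> b" and n: "b - 1 \<le> n" "1 \<le> n" shows "int (k * (n * r)) + C k \<le> V b w (n * m) (level n k)"
proof -
  have "\<exists>s. s < m \<and> (1 \<le> i \<and> i < b \<longrightarrow> depth i = - B i s)" for i
  proof (cases "1 \<le> i \<and> i < b")
    case True
    then obtain s where "s < m" "depth i = - B i s" using depth_attained[of i] by blast
    then show ?thesis by blast
  next
    case False
    then show ?thesis using m1 by blast
  qed
  then obtain \<sigma> where \<sigma>: "\<And>i. \<sigma> i < m" "\<And>i. 1 \<le> i \<Longrightarrow> i < b \<Longrightarrow> depth i = - B i (\<sigma> i)" by metis
  \<comment> \<open>The number of times up to \<open>t\<close> that are congruent to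
    \<open>\<sigma> i\<close> modulo \<open>m\<close>, that is, of favourable moments for a
    jump.\<close>
  define c where "c i t = int ((t + m - \<sigma> i) div m)" for i t
  have c_mono: "c i t \<le> c i (Suc t)" for i t unfolding c_def by (intro zle_int[THEN iffD2] div_le_mono) (use \<sigma>(1)[of i] in simp)
  have c_diff: "c i t \<le> c j t + 1" for i j t
  proof -
    have "(t + m - \<sigma> i) div m \<le> (t + m - \<sigma> j + m) div m" by (intro div_le_mono) (use \<sigma>(1)[of j] in simp)
    also have "\<dots> = (t + m - \<sigma> j) div m + 1" using m1 by simp
    finally show ?thesis unfolding c_def by linarith
  qed
  have c0: "c i 0 \<le> 0" if "\<sigma> i \<noteq> 0" for i using \<sigma>(1)[of i] that by (simp add: c_def)
  have cn: "int n \<le> c i (n * m - 1)" for i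
  proof -
    have "n * m \<le> n * m - 1 + m - \<sigma> i" using \<sigma>(1)[of i] n m1 by simp
    then have "n * m div m \<le> (n * m - 1 + m - \<sigma> i) div m" by (rule div_le_mono)
    then show ?thesis using m1 by (simp add: c_def)
  qed
  have c_jump: "Suc t mod m = \<sigma> i" if "c i (Suc t) \<noteq> c i t" for i t
  proof -
    let ?x = "t + m - \<sigma> i"
    have x: "Suc t + m - \<sigma> i = Suc ?x" using \<sigma>(1)[of i] by simp
    have "Suc ?x mod m = 0"
      using that unfolding c_def x by (auto simp: div_Suc split: if_splits)
    then have "(Suc ?x + \<sigma> i) mod m = \<sigma> i mod m" by (metis add_0 mod_add_left_eq)
    moreover have "Suc ?x + \<sigma> i = Suc t + m" using \<sigma>(1)[of i] by simp
    ultimately show ?thesis using \<sigma>(1)[of i] by (metis mod_add_self2 mod_less)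
  qed
  \<comment> \<open>The counts for different indices differ by at most one, so the half sum with
    \<open>i\<close> is interlaced: it jumps at every second favourable moment, alternately for
    neighbouring indices. After \<open>b - 1\<close> moments it has passed from at most
    \<open>max 0 (i + k - b)\<close> to at least \<open>min k i\<close>.\<close>
  define f where "f t i = (c i t + int i + int k + 1 - int b) div 2" for t i
  define \<kappa> where "\<kappa> t i = (if t < n * m then max (max 0 (int i + int k - int b)) (min (min (int k) (int i)) (f t i)) else int i)" for t i
  have f_step: "f t i \<le> f t (Suc i)" "f t (Suc i) \<le> f t i + 1" for t i
    using c_diff[of i t "Suc i"] c_diff[of "Suc i" t i] unfolding f_def by linarith+
  have f_mono: "f t i \<le> f (Suc t) i" for t i using c_mono[of i t] unfolding f_def by linarith
  have ch: "chain b (level n k) \<kappa>"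
    unfolding chain_def
  proof (intro conjI allI impI)
    fix t i
    show "\<kappa> t 0 = 0" "\<kappa> t b = level n k t" using k by (auto simp: \<kappa>_def)
    { assume "i < b"
      show "\<kappa> t i \<le> \<kappa> t (Suc i)" "\<kappa> t (Suc i) \<le> \<kappa> t i + 1"
        using f_step[of t i] by (auto simp: \<kappa>_def) }
    { assume "i \<le> b"
      show "\<kappa> t i \<le> \<kappa> (Suc t) i" using f_mono[of t i] k by (auto simp: \<kappa>_def) }
  qed
  have kn: "n * m - 1 < n * m" "0 < n * m" using n m1 by simp_all
  have "int (min (min k i) (min (b - k) (b - i))) * depth i \<le> (\<Sum>t<n * m. \<kappa> t i * (of_bool (w t = i - 1) - of_bool (w t = i)))"
    if i: "i \<in> {1..<b}" for i
  proof -
    have i': "1 \<le> i" "i < b" using i by auto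
    have "(\<kappa> (Suc t) i - \<kappa> t i) * (- B i (Suc t)) = (\<kappa> (Suc t) i - \<kappa> t i) * depth i" if "t < n * m - 1" for t
    proof (cases "\<kappa> (Suc t) i = \<kappa> t i")
      case False
      have "Suc t < n * m" "t < n * m" using that by linarith+
      then have "c i (Suc t) \<noteq> c i t" using False by (auto simp: \<kappa>_def f_def)
      then have "Suc t mod m = \<sigma> i" by (rule c_jump)
      then have "B i (Suc t) = B i (\<sigma> i)" using B_per[OF i', of "Suc t div m" "Suc t mod m", unfolded div_mult_mod_eq] by simp
      then show ?thesis using \<sigma>(2)[OF i'] by simp
    qed simp
    then have "(\<Sum>t<n * m - 1. (\<kappa> (Suc t) i - \<kappa> t i) * (- B i (Suc t))) = (\<Sum>t<n * m - 1. \<kappa> (Suc t) i - \<kappa> t i) * depth i"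
      unfolding sum_distrib_right by (intro sum.cong) auto
    then have eq: "(\<Sum>t<n * m. \<kappa> t i * (of_bool (w t = i - 1) - of_bool (w t = i))) = (\<kappa> (n * m - 1) i - \<kappa> 0 i) * depth i"
      unfolding inner_sum[OF i' n(2)] by (subst (asm) sum_lessThan_telescope)
    show ?thesis
    proof (cases "\<sigma> i = 0")
      case True
      \<comment> \<open>Here the count is \<open>1\<close> already at time \<open>0\<close>, so a
        jump may be missing, but \<open>depth i = 0\<close> and nothing is lost.\<close>
      then show ?thesis using \<sigma>(2)[OF i'] eq by simp
    next
      case False
      have "f 0 i \<le> max 0 (int i + int k - int b)" using c0[OF False] unfolding f_def by linarith
      moreover have "min (int k) (int i) \<le> f (n * m - 1) i" using cn[of i] n(1) unfolding f_def by linarith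
      moreover have "\<kappa> 0 i = max (max 0 (int i + int k - int b)) (min (min (int k) (int i)) (f 0 i))"
        "\<kappa> (n * m - 1) i = max (max 0 (int i + int k - int b)) (min (min (int k) (int i)) (f (n * m - 1) i))"
        using kn by (simp_all add: \<kappa>_def)
      moreover have "int (min (min k i) (min (b - k) (b - i))) = min (min (int k) (int i)) (min (int b - int k) (int b - int i))"
      proof -
        have "int (b - k) = int b - int k" "int (b - i) = int b - int i" using k i' by simp_all
        then show ?thesis by (simp only: of_nat_min)
      qed
      moreover have lohi: "max x (min y z) = x" "max x (min y z') = y" if "x \<le> y" "z \<le> x" "y \<le> z'" for x y z z' :: int
        using that by simp_all
      moreover have "max 0 (int i + int k - int b) \<le> min (int k) (int i)" using k i' by simp
      moreover have "min (int k) (int i) - max 0 (int i + int k - int b) = min (min (int k) (int i)) (min (int b - int k) (int b - int i))"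
        by (cases "int k \<le> int i"; cases "int i + int k \<le> int b") (simp_all add: min_def max_def)
      ultimately have "\<kappa> (n * m - 1) i - \<kappa> 0 i = int (min (min k i) (min (b - k) (b - i)))"
        by (simp only: lohi)
      then show ?thesis unfolding eq by simp
    qed
  qed
  then have "C k \<le> (\<Sum>i\<in>{1..<b}. \<Sum>t<n * m. \<kappa> t i * (of_bool (w t = i - 1) - of_bool (w t = i)))"
    unfolding C_def by (rule sum_mono)
  moreover have "(\<Sum>t<n * m. \<kappa> t b * of_bool (w t = b - 1)) = int (k * (n * r))"
    unfolding boundary_sum[symmetric] by (rule sum.cong) (use chainD(2)[OF ch] in auto)
  ultimately have "int (k * (n * r)) + C k \<le> weight w (n * m) \<kappa>"
    using weight_decomp[of b w \<kappa> "n * m"] lw b1 chainD(1)[OF ch] by simp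
  also have "\<dots> \<le> V b w (n * m) (level n k)" by (rule V_ge[OF lw ch])
  finally show ?thesis .
qed

lemma q_count:
  assumes "k \<le> b" "b - 1 \<le> n" shows "int (card {t. t < n * m \<and> q t < k}) = int (k * (n * r)) + C k"
proof (cases "n = 0")
  case True
  then have "{1..<b} = {}" using assms by simp
  then have "C k = 0" unfolding C_def by (simp only: sum.empty)
  then show ?thesis using True by simp
next
  case False
  have "V b w (n * m) (level n k) = V b q (n * m) (level n k)"
    using hwq(3) level_good[OF assms(1)] by (simp add: veq_def)
  also have "\<dots> = int (card {t. t < n * m \<and> q t < k})"
    using V_lattice_step[OF hwq(1,2) assms(1), of "n * m" "n * m"] by simp
  finally show ?thesis using level_upper[OF assms(1), of n] level_lower[OF assms] False by simp
qed

text \<open>After \<open>b - 1\<close> periods the bounds are sharp, so every further period of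
  \<open>q\<close> is balanced; rectification does not raise letters, so
  \<open>le_cnt_imp_eq\<close> applies.\<close>

lemma q_eq_w: assumes "(b - 1) * m \<le> t" shows "q t = w t"
proof -
  define e where "e = t div m"
  define s where "s = t mod m"
  have t: "t = e * m + s" unfolding e_def s_def by (rule div_mult_mod_eq[symmetric])
  have s: "s < m" using m1 by (simp add: s_def)
  have e: "b - 1 \<le> e" using div_le_mono[OF assms, of m] m1 by (simp add: e_def)
  have cc: "card {t. t < Suc e * m \<and> q t < k} = card {t. t < e * m \<and> q t < k} + k * r" if "k \<le> b" for k
  proof -
    have "int (k * (Suc e * r)) = int (k * (e * r)) + int (k * r)" by (simp add: algebra_simps)
    then show ?thesis using q_count[OF that, of e] q_count[OF that, of "Suc e"] e by linarith
  qed
  have cq: "cnt q i (Suc e * m) = cnt q i (e * m) + r" if "i < b" for i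
    using cc[of i] cc[of "Suc i"] that by (simp add: card_letters_Suc)
  have "q (e * m + s) = w (e * m + s)"
  proof (rule le_cnt_imp_eq[where T = m and b = b and u = "\<lambda>x. q (e * m + x)" and v = "\<lambda>x. w (e * m + x)" and t = s])
    show "letters b (\<lambda>x. q (e * m + x))" "letters b (\<lambda>x. w (e * m + x))" using lw hwq(1) by (auto simp: letters_def)
    show "cnt (\<lambda>x. q (e * m + x)) i m = cnt (\<lambda>x. w (e * m + x)) i m" if "i < b" for i
    proof -
      have sm: "Suc e * m = e * m + m" by simp
      have "cnt (\<lambda>x. q (e * m + x)) i m = r"
        using cq[OF that] cnt_add[of q i "e * m" m] unfolding sm by linarith
      moreover have "(\<lambda>x. w (e * m + x)) = w" using per_mult by auto
      ultimately show ?thesis using cnt_m[OF that] by simp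
    qed
  qed (use hwq(4) s in auto)
  then show ?thesis by (simp add: t)
qed

lemma rvw_letters: "letters b (rvw b m w)" using b1 by (auto simp: letters_def rvw_def)

lemma cnt_rvw: assumes "i < b" "t \<le> m" shows "cnt (rvw b m w) i t + cnt w (b - 1 - i) (m - t) = r"
proof -
  have "cnt (rvw b m w) i t = cnt (revw b m w) i t"
    by (rule cnt_cong) (use assms in \<open>auto simp: rvw_def revw_def\<close>)
  then show ?thesis using cnt_revw[OF lw assms] cnt_m[of "b - 1 - i"] assms by simp
qed

lemma rvw_periodic: "periodic_word b r (rvw b m w)"
proof
  show "rvw b m w (t + b * r) = rvw b m w t" for t by (simp add: rvw_def m_def)
  show "cnt (rvw b m w) i (b * r) = r" if "i < b" for i
    using cnt_rvw[OF that, of m] by (simp add: m_def)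
qed (use b1 r1 rvw_letters in auto)

lemma rvw_rvw: "rvw b m (rvw b m w) = w"
proof
  fix t
  have lt: "t mod m < m" using m1 by simp
  have "(m - 1 - t mod m) mod m = m - 1 - t mod m" using m1 by simp
  then have "m - 1 - (m - 1 - t mod m) mod m = t mod m" using lt by simp
  then have "rvw b m (rvw b m w) t = b - 1 - (b - 1 - w (t mod m))" by (simp add: rvw_def)
  moreover have "w t < b" using lw by (simp add: letters_def)
  ultimately show "rvw b m (rvw b m w) t = w t" using per_mod[of t] by simp
qed

lemma rot_periodic: "periodic_word b r (w \<circ> Suc)"
proof
  show "(w \<circ> Suc) (t + b * r) = (w \<circ> Suc) t" for t using per[of "Suc t"] by simp
  show "cnt (w \<circ> Suc) i (b * r) = r" if "i < b" for i
    using cnt_shift[of w i "b * r"] bal[OF that] per[of 0] by (auto split: if_splits)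
qed (use b1 r1 letters_shift[OF lw] in auto)

lemma rvw_rot: "rvw b m (w \<circ> Suc) \<circ> Suc = rvw b m w"
proof
  fix t
  define s where "s = t mod m"
  have s: "s < m" using m1 by (simp add: s_def)
  show "(rvw b m (w \<circ> Suc) \<circ> Suc) t = rvw b m w t"
  proof (cases "Suc s = m")
    case True
    then have "Suc t mod m = 0" by (simp add: s_def mod_Suc)
    then show ?thesis using True per_m[of 0] m1 by (simp add: rvw_def s_def[symmetric])
  next
    case False
    then have "Suc t mod m = Suc s" by (simp add: s_def mod_Suc)
    then show ?thesis using False s by (simp add: rvw_def s_def[symmetric] Suc_diff_Suc)
  qed
qed

lemma hw_rot: "hw b (w \<circ> Suc) = wsl q"
  by (rule hw_unique[OF letters_wsl[OF hwq(1)] lattice_wsl[OF hwq(2)]])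
    (rule veq_trans[OF veq_shift[OF lw hwq(1,3)] veq_wsl[OF hwq(1,2)]])

end

lemma rvw_depth:
  assumes "periodic_word b r w" "1 \<le> i" "i < b"
  shows "periodic_word.depth b r (rvw b (b * r) w) i = periodic_word.depth b r w (b - i)"
proof -
  interpret W: periodic_word b r w by fact
  interpret R: periodic_word b r "rvw b W.m w" by (rule W.rvw_periodic)
  have RW: "R.B i t = W.B (b - i) (W.m - t)" if "t \<le> W.m" for t
  proof -
    have 1: "cnt (rvw b W.m w) (i - 1) t + cnt w (b - i) (W.m - t) = r"
      using W.cnt_rvw[of "i - 1" t] that assms by (simp add: Suc_diff_Suc)
    have 2: "cnt (rvw b W.m w) i t + cnt w (b - i - 1) (W.m - t) = r"
      using W.cnt_rvw[of i t] that assms by (simp add: diff_right_commute)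
    show ?thesis using 1 2 unfolding R.B_def W.B_def by simp
  qed
  have "R.B i ` {..W.m} = W.B (b - i) ` {..W.m}"
  proof (intro equalityI image_subsetI)
    fix t assume "t \<in> {..W.m}"
    then show "R.B i t \<in> W.B (b - i) ` {..W.m}" using RW[of t] by auto
  next
    fix t assume t: "t \<in> {..W.m}"
    then have "W.B (b - i) t = R.B i (W.m - t)" using RW[of "W.m - t"] by simp
    then show "W.B (b - i) t \<in> R.B i ` {..W.m}" by auto
  qed
  then show ?thesis unfolding W.m_def[symmetric] by (simp add: W.depth_def R.depth_def)
qed

text \<open>Reversal turns \<open>depth i\<close> into \<open>depth (b - i)\<close>, and the
  coefficients are symmetric under \<open>i\<close> to \<open>b - i\<close> and \<open>k\<close> to
  \<open>b - k\<close>. This balances the two ends of the glued word.\<close>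

lemma C_sym:
  assumes "periodic_word b r w" "k \<le> b"
  shows "periodic_word.C b r (rvw b (b * r) w) (b - k) = periodic_word.C b r w k"
proof -
  interpret W: periodic_word b r w by fact
  interpret R: periodic_word b r "rvw b W.m w" by (rule W.rvw_periodic)
  have "R.C (b - k) = (\<Sum>i\<in>{1..<b}. int (min (min (b - k) (b - i)) (min k i)) * W.depth i)"
    unfolding R.C_def
  proof (rule sum.reindex_bij_witness[of _ "\<lambda>i. b - i" "\<lambda>i. b - i"])
    fix i assume i: "i \<in> {1..<b}"
    then show "int (min (min (b - k) (b - (b - i))) (min k (b - i))) * W.depth (b - i)
      = int (min (min (b - k) i) (min (b - (b - k)) (b - i))) * R.depth i"
      using rvw_depth[OF assms(1), of i, folded W.m_def] assms(2) by auto
  qed auto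
  also have "\<dots> = W.C k" unfolding W.C_def by (simp add: min.commute)
  finally show ?thesis unfolding W.m_def[symmetric] .
qed

lemma card_split_less: "card {s. s < (M::nat) \<and> \<not> P s} + card {s. s < M \<and> P s} = M"
proof -
  have "card ({s. s < M \<and> \<not> P s} \<union> {s. s < M \<and> P s}) = card {s. s < M \<and> \<not> P s} + card {s. s < M \<and> P s}"
    by (rule card_Un_disjoint) auto
  moreover have "{s. s < M \<and> \<not> P s} \<union> {s. s < M \<and> P s} = {..<M}" by auto
  ultimately show ?thesis by simp
qed

section \<open>Gluing the two rectified ends\<close>

definition glue :: "nat \<Rightarrow> nat \<Rightarrow> nat \<Rightarrow> (nat \<Rightarrow> nat) \<Rightarrow> nat \<Rightarrow> nat" where
  "glue a b m w t = (if t < (a + 1 - b) * m then hw b w t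
     else if t < a * m then b - 1 - hw b (rvw b m w) (a * m - 1 - t) else 0)"

locale glued = periodic_word b r w for b r w +
  fixes a :: nat
  assumes a2b: "2 * b \<le> a + 1"
begin

lemma bounds: "(a + 1 - b) * m + (b - 1) * m = a * m" "(b - 1) * m < (a + 1 - b) * m" "b * (a * r) = a * m"
proof -
  have "(a + 1 - b) + (b - 1) = a" "b - 1 < a + 1 - b" using a2b b1 by linarith+
  then show "(a + 1 - b) * m + (b - 1) * m = a * m" "(b - 1) * m < (a + 1 - b) * m"
    using m1 by (simp_all add: add_mult_distrib[symmetric])
qed (simp add: m_def)

sublocale R: periodic_word b r "rvw b m w" by (rule rvw_periodic)

lemma letters_glue: "letters b (glue a b m w)"
  using hwq(1) b1 by (auto simp: letters_def glue_def q_def)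

lemma glue_middle: assumes "(b - 1) * m \<le> t" "t < (a + 1 - b) * m" shows "glue a b m w t = w t"
  using q_eq_w[OF assms(1)] assms(2) by (simp add: glue_def q_def)

lemma revw_glue: "revw b (a * m) (glue a b m w) = glue a b m (rvw b m w)"
proof
  fix t
  consider "t < (b - 1) * m" | "(b - 1) * m \<le> t" "t < (a + 1 - b) * m" | "(a + 1 - b) * m \<le> t" "t < a * m" | "a * m \<le> t"
    using bounds by linarith
  then show "revw b (a * m) (glue a b m w) t = glue a b m (rvw b m w) t"
  proof cases
    case 1
    have "\<not> a * m - 1 - t < (a + 1 - b) * m" "a * m - 1 - t < a * m" "a * m - 1 - (a * m - 1 - t) = t" using 1 bounds by linarith+
    then have "glue a b m w (a * m - 1 - t) = b - 1 - R.q t" by (simp add: glue_def R.q_def)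
    moreover have "R.q t < b" using R.hwq(1) by (simp add: letters_def)
    moreover have "t < (a + 1 - b) * m" "t < a * m" using 1 bounds by linarith+
    ultimately show ?thesis by (simp add: revw_def glue_def[of a b m "rvw b m w" t] R.q_def)
  next
    case 2
    have "glue a b m w (a * m - 1 - t) = w (a * m - 1 - t)" by (rule glue_middle) (use 2 bounds in linarith)+
    moreover have "R.q t = rvw b m w t" using R.q_eq_w[of t] 2(1) by simp
    moreover have "w (a * m - 1 - t) = w (m - 1 - t mod m)"
    proof -
      have lt: "t mod m < m" using m1 by simp
      have "t div m < a" using 2 bounds less_mult_imp_div_less[of t a m] by linarith
      then obtain d where d: "a = Suc (t div m + d)" by (metis less_imp_Suc_add)
      have "a * m = t div m * m + (d * m + m)" using d by (simp add: algebra_simps)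
      moreover have "t = t div m * m + t mod m" by (rule div_mult_mod_eq[symmetric])
      ultimately have "a * m - 1 - t = d * m + (m - 1 - t mod m)" using lt by linarith
      then show ?thesis using per_mult by simp
    qed
    moreover have "t < a * m" using 2 bounds by linarith
    ultimately show ?thesis using 2 by (simp add: revw_def glue_def[of a b m "rvw b m w" t] R.q_def[symmetric] rvw_def[of b m w t])
  next
    case 3
    have "a * m - 1 - t < (a + 1 - b) * m" using 3 bounds by linarith
    then show ?thesis using 3 rvw_rvw by (simp add: revw_def glue_def)
  next
    case 4
    then show ?thesis using bounds by (simp add: revw_def glue_def)
  qed
qed

text \<open>The prefix has a surplus \<open>C k\<close> of letters below \<open>k\<close>. The
  suffix has a deficit equal to the constant of the reversed word at \<open>b - k\<close>, and by
  \<open>C_sym\<close> they cancel.\<close>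

lemma glue_total: assumes "i < b" shows "cnt (glue a b m w) i (a * m) = a * r"
proof -
  let ?g = "glue a b m w"
  have cut: "int (card {t. t < a * m \<and> ?g t < k}) = int (k * (a * r))" if k: "k \<le> b" for k
  proof -
    let ?L = "(a + 1 - b) * m" and ?M = "(b - 1) * m"
    have split: "{t. t < a * m \<and> ?g t < k} = {t. t < ?L \<and> q t < k} \<union> (\<lambda>s. a * m - 1 - s) ` {s. s < ?M \<and> \<not> R.q s < b - k}"
    proof (intro set_eqI iffI)
      fix t assume t: "t \<in> {t. t < a * m \<and> ?g t < k}"
      show "t \<in> {t. t < ?L \<and> q t < k} \<union> (\<lambda>s. a * m - 1 - s) ` {s. s < ?M \<and> \<not> R.q s < b - k}"
      proof (cases "t < ?L")
        case True then show ?thesis using t by (simp add: glue_def q_def)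
      next
        case False
        have "a * m - 1 - t < ?M" "t = a * m - 1 - (a * m - 1 - t)" using t False bounds by auto
        moreover have "\<not> R.q (a * m - 1 - t) < b - k" using t False k by (auto simp: glue_def R.q_def)
        ultimately show ?thesis by blast
      qed
    next
      fix t assume "t \<in> {t. t < ?L \<and> q t < k} \<union> (\<lambda>s. a * m - 1 - s) ` {s. s < ?M \<and> \<not> R.q s < b - k}"
      then show "t \<in> {t. t < a * m \<and> ?g t < k}"
      proof
        assume "t \<in> {t. t < ?L \<and> q t < k}"
        then show ?thesis using bounds by (auto simp: glue_def q_def)
      next
        assume "t \<in> (\<lambda>s. a * m - 1 - s) ` {s. s < ?M \<and> \<not> R.q s < b - k}"
        then obtain s where s: "t = a * m - 1 - s" "s < ?M" "\<not> R.q s < b - k" by auto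
        have "\<not> t < ?L" "t < a * m" "a * m - 1 - t = s" using s bounds by auto
        moreover have "R.q s < b" using R.hwq(1) by (simp add: letters_def)
        ultimately show ?thesis using s(3) k by (auto simp: glue_def R.q_def)
      qed
    qed
    have inj: "inj_on (\<lambda>s. a * m - 1 - s) {s. s < ?M \<and> \<not> R.q s < b - k}"
    proof (rule inj_onI)
      fix x y assume A: "x \<in> {s. s < ?M \<and> \<not> R.q s < b - k}" "y \<in> {s. s < ?M \<and> \<not> R.q s < b - k}"
        "a * m - 1 - x = a * m - 1 - y"
      then have "x < ?M" "y < ?M" by simp_all
      then have "x < a * m" "y < a * m" using bounds by linarith+
      then show "x = y" using A(3) by linarith
    qed
    have "card {t. t < a * m \<and> ?g t < k} = card {t. t < ?L \<and> q t < k} + card {s. s < ?M \<and> \<not> R.q s < b - k}"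
      unfolding split card_image[OF inj, symmetric]
      by (rule card_Un_disjoint) (use bounds in auto)
    moreover have "card {s. s < ?M \<and> \<not> R.q s < b - k} + card {s. s < ?M \<and> R.q s < b - k} = ?M"
      by (rule card_split_less)
    moreover have "int (card {t. t < ?L \<and> q t < k}) = int (k * ((a + 1 - b) * r)) + C k"
      by (rule q_count) (use k a2b in auto)
    moreover have "int (card {s. s < ?M \<and> R.q s < b - k}) = int ((b - k) * ((b - 1) * r)) + R.C (b - k)"
      using R.q_count[of "b - k" "b - 1"] by simp
    moreover have "R.C (b - k) = C k" using C_sym[OF periodic_word_axioms k] by (simp add: m_def)
    moreover have "k * ((a + 1 - b) * r) + ?M = k * (a * r) + (b - k) * ((b - 1) * r)"
    proof -
      obtain j where j: "b = k + j" using k le_Suc_ex by blast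
      obtain d where d: "a + 1 = b + d" using a2b le_Suc_ex[of b "a + 1"] by auto
      obtain b' where b': "b = Suc b'" using b1 by (cases b) auto
      have a: "a = b' + d" using d b' by simp
      have "k * (d * r) + b' * ((k + j) * r) = k * ((b' + d) * r) + j * (b' * r)" by (simp add: algebra_simps)
      moreover have "a + 1 - b = d" "b - 1 = b'" "b - k = j" using d b' j by simp_all
      ultimately show ?thesis unfolding m_def using j a by simp
    qed
    ultimately show ?thesis by linarith
  qed
  have "int (cnt ?g i (a * m)) = int (Suc i * (a * r)) - int (i * (a * r))"
    using cut[of i] cut[of "Suc i"] assms by (simp add: card_letters_Suc)
  then show ?thesis unfolding mult_Suc of_nat_add by linarith
qed

lemma glue_lattice_left: "t \<le> (a + 1 - b) * m \<Longrightarrow> cnt (glue a b m w) (Suc i) t \<le> cnt (glue a b m w) i t"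
proof -
  assume t: "t \<le> (a + 1 - b) * m"
  have "cnt (glue a b m w) j t = cnt q j t" for j by (rule cnt_cong) (use t in \<open>simp add: glue_def q_def\<close>)
  then show ?thesis using hwq(2) by (simp add: lattice_def)
qed

end

lemma (in glued) glued_rvw: "glued b r (rvw b m w) a"
  by (rule glued.intro[OF rvw_periodic]) (unfold_locales, rule a2b)

lemma (in glued) glued_rot: "glued b r (w \<circ> Suc) a"
  by (rule glued.intro[OF rot_periodic]) (unfold_locales, rule a2b)

text \<open>For short prefixes the ballot condition is that of \<open>q\<close>. For long ones the
  complementary suffix is counted in the reversed word, which is glued as well.\<close>

lemma (in glued) closed_glue: "closed b (a * r) (glue a b m w)"
proof (rule closedI[OF letters_glue b1])
  let ?g = "glue a b m w"
  interpret RR: glued b r "rvw b m w" a by (rule glued_rvw)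
  show "cnt ?g i (a * m) = a * r" if "i < b" for i using glue_total[OF that] .
  show "?g t = 0" if "a * m \<le> t" for t using that bounds by (simp add: glue_def)
  show "a * m = b * (a * r)" by (simp add: bounds)
  show "cnt ?g (Suc i) t \<le> cnt ?g i t" if t: "t < a * m" and i: "Suc i < b" for t i
  proof (cases "t \<le> (a + 1 - b) * m")
    case True then show ?thesis by (rule glue_lattice_left)
  next
    case False
    let ?h = "glue a b m (rvw b m w)"
    have gh: "?g = revw b (a * m) ?h"
      using RR.revw_glue rvw_rvw by simp
    have tot: "cnt ?h j (a * m) = a * r" if "j < b" for j using RR.glue_total[OF that] .
    have "cnt ?g j t + cnt ?h (b - 1 - j) (a * m - t) = a * r" if "j < b" for j
      unfolding gh using cnt_revw[OF RR.letters_glue that, of t "a * m"] tot[of "b - 1 - j"] t that by simp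
    from this[of i] this[of "Suc i"] i
    have "cnt ?g i t + cnt ?h (b - 1 - i) (a * m - t) = a * r" "cnt ?g (Suc i) t + cnt ?h (b - 1 - Suc i) (a * m - t) = a * r" by auto
    moreover have bi: "b - 1 - i = Suc (b - 1 - Suc i)" using i by simp
    moreover have "a * m - t \<le> (a + 1 - b) * m" using False t bounds by linarith
    then have "cnt ?h (Suc (b - 1 - Suc i)) (a * m - t) \<le> cnt ?h (b - 1 - Suc i) (a * m - t)"
      by (rule RR.glue_lattice_left)
    ultimately show ?thesis unfolding bi by linarith
  qed
qed

text \<open>A letter of the promoted word depends only on letters up to the next time, and by
  \<open>hw_rot\<close> erasing one letter of a rectified periodic word gives the rectification of
  the rotated word.\<close>

lemma (in glued) prw_glue_prefix:
  assumes "Suc t < (a + 1 - b) * m" shows "prw b (a * m) (glue a b m w) t = glue a b m (w \<circ> Suc) t"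
proof -
  have "prw b (a * m) (glue a b m w) t = wsl (glue a b m w) t" using assms bounds by (simp add: prw_def)
  also have "\<dots> = wsl q t" by (rule wsl_cong) (use assms in \<open>simp add: glue_def q_def\<close>)
  finally show ?thesis using hw_rot assms by (simp add: glue_def)
qed

text \<open>Promotion of the glued word is known on a long prefix, and by reversal also on a long suffix;
  the slide paths meet in between because they are determined by the contents of the prefixes.\<close>
lemma (in glued) prw_glue: "prw b (a * m) (glue a b m w) = glue a b m (w \<circ> Suc)"
proof -
  define N where "N = a * m"
  define L where "L = (a + 1 - b) * m"
  define M where "M = (b - 1) * m"
  interpret Q: glued b r "w \<circ> Suc" a by (rule glued_rot)
  interpret Z: glued b r "rvw b m (w \<circ> Suc)" a using Q.glued_rvw .
  define y Y z where "y = glue a b m w" and "Y = glue a b m (w \<circ> Suc)" and "z = glue a b m (rvw b m (w \<circ> Suc))"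
  \<comment> \<open>The preimage of \<open>Y\<close> under promotion, obtained by reversal. It
    agrees with \<open>y\<close> after time \<open>M\<close>, and it remains to compare the
    promotions of \<open>y\<close> and \<open>y'\<close>.\<close>
  define y' where "y' = revw b N (prw b N z)"
  have NLM: "L + M = N" "M < L" using bounds by (simp_all add: N_def L_def M_def)
  have N: "b * (a * r) = N" by (simp add: N_def bounds)
  have ar: "1 \<le> a * r" using a2b b1 r1 by simp
  have cy: "closed b (a * r) y" unfolding y_def by (rule closed_glue)
  have cY: "closed b (a * r) Y" unfolding Y_def using Q.closed_glue .
  have cz: "closed b (a * r) z" unfolding z_def using Z.closed_glue .
  have zY: "z = revw b N Y" unfolding z_def Y_def N_def using Q.revw_glue by simp
  have cy': "closed b (a * r) y'"
    unfolding y'_def using closed_revw[OF closed_prw[OF cz ar b1] b1] unfolding N .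
  have Yy': "prw b N y' = Y"
    using prw_revw_prw[OF cz ar b1] revw_revw[OF cY] unfolding N y'_def zY by simp
  have pre: "prw b N y t = Y t" if "Suc t < L" for t
    unfolding N_def y_def Y_def by (rule prw_glue_prefix) (use that in \<open>simp add: L_def\<close>)
  have suf: "y' t = y t" if "M < t" for t
  proof (cases "t < N")
    case True
    have s: "Suc (N - 1 - t) < L" "N - 1 - (N - 1 - t) = t" using that True NLM by linarith+
    have "prw b N z (N - 1 - t) = glue a b m (rvw b m (w \<circ> Suc) \<circ> Suc) (N - 1 - t)"
      unfolding N_def z_def using Z.prw_glue_prefix[of "a * m - 1 - t"] s(1) unfolding L_def N_def by simp
    also have "\<dots> = revw b N y (N - 1 - t)" unfolding rvw_rot y_def N_def revw_glue ..
    also have "\<dots> = b - 1 - y t" using True s(2) by (simp add: revw_def)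
    finally have "y' t = b - 1 - (b - 1 - y t)" using True by (simp add: y'_def revw_def)
    moreover have "y t < b" using closedD(1)[OF cy] by (simp add: letters_def)
    ultimately show ?thesis by simp
  next
    case False
    then show ?thesis using closedD(4)[OF cy, of t] closedD(4)[OF cy', of t] N by simp
  qed
  have cnt_suf: "cnt y i t = cnt y' i t" if t: "M < t" "t \<le> N" for i t
  proof -
    have "cnt y i N = cnt y' i N"
    proof (cases "i < b")
      case True
      then show ?thesis using closedD(3)[OF cy] closedD(3)[OF cy'] unfolding N by simp
    next
      case False
      then show ?thesis using cnt_zero[OF closedD(1)[OF cy]] cnt_zero[OF closedD(1)[OF cy']] by simp
    qed
    moreover have "cnt (\<lambda>x. y (t + x)) i (N - t) = cnt (\<lambda>x. y' (t + x)) i (N - t)"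
      by (rule cnt_cong) (use suf t in simp)
    ultimately show ?thesis using cnt_add[of y i t "N - t"] cnt_add[of y' i t "N - t"] t by simp
  qed
  \<comment> \<open>At time \<open>M\<close> the row of the hole is the difference between the
    content of the word at \<open>Suc M\<close> and that of its promotion at \<open>M\<close>; both
    contents are known to agree. From there on the two words have the same letters.\<close>
  have hole: "whol y t = whol y' t" if "M \<le> t" "t < N" for t
    using that
  proof (induction t rule: dec_induct)
    case base
    have "cnt (prw b N y) i M = cnt (prw b N y') i M" for i
      unfolding Yy' by (rule cnt_cong) (use pre NLM in auto)
    then have "of_bool (i = whol y M) = (of_bool (i = whol y' M) :: nat)" for i
      using cnt_prw[OF cy, of M i] cnt_prw[OF cy', of M i] cnt_suf[of "Suc M" i] base NLM unfolding N by simp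
    from this[of "whol y M"] show ?case by (simp only: of_bool_eq_iff simp_thms)
  next
    case (step t)
    have IH: "whol y t = whol y' t" by (rule step.IH) (use step.prems in linarith)
    have "lam unit0 (y \<circ> Suc) (Suc t) i = lam unit0 (y' \<circ> Suc) (Suc t) i" for i
      using cnt_suf[of "Suc (Suc t)" i] step lam_unit0[OF closedD(2)[OF cy], of "Suc t" i] lam_unit0[OF closedD(2)[OF cy'], of "Suc t" i] by simp
    moreover have "(y \<circ> Suc) t = (y' \<circ> Suc) t" using suf[of "Suc t"] step by simp
    ultimately show ?case unfolding hol.simps IH by (simp only:)
  qed
  have "prw b N y = Y"
  proof
    fix t
    consider "Suc t < L" | "M \<le> t" "Suc t < N" | "N \<le> Suc t" using NLM by linarith
    then show "prw b N y t = Y t"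
    proof cases
      case 1 then show ?thesis by (rule pre)
    next
      case 2
      have "wsl y t = wsl y' t"
        unfolding wsl_def sl_def using hole[of t] hole[of "Suc t"] suf[of "Suc t"] 2 by simp
      then show ?thesis unfolding Yy'[symmetric] using 2 by (simp add: prw_def)
    next
      case 3
      then show ?thesis unfolding Yy'[symmetric] by (simp add: prw_def)
    qed
  qed
  then show ?thesis by (simp add: y_def Y_def N_def)
qed

lemma (in glued) prw_pow_glue: "(prw b (a * m) ^^ k) (glue a b m w) = glue a b m (\<lambda>t. w (t + k))"
  and glued_shift: "glued b r (\<lambda>t. w (t + k)) a"
proof (induction k)
  case 0
  show "(prw b (a * m) ^^ 0) (glue a b m w) = glue a b m (\<lambda>t. w (t + 0))" by simp
  show "glued b r (\<lambda>t. w (t + 0)) a" using glued_axioms by (simp add: glued_axioms_def glued_def periodic_word_axioms)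
next
  case (Suc k)
  interpret K: glued b r "\<lambda>t. w (t + k)" a by (rule Suc.IH(2))
  have e: "(\<lambda>t. w (t + k)) \<circ> Suc = (\<lambda>t. w (t + Suc k))" by auto
  show "(prw b (a * m) ^^ Suc k) (glue a b m w) = glue a b m (\<lambda>t. w (t + Suc k))"
    using Suc.IH(1) K.prw_glue unfolding e by simp
  show "glued b r (\<lambda>t. w (t + Suc k)) a" using K.glued_rot unfolding e .
qed

lemma (in glued) glue_fixed: "(prw b (a * m) ^^ m) (glue a b m w) = glue a b m w"
  using prw_pow_glue[of m] per_m by simp

text \<open>\<open>prefix_hw\<close> is applied to \<open>u\<close> and to its reversal, which is
  fixed too and whose window is the reversed window of \<open>u\<close>.\<close>

lemma (in promotion_fixed) fixed_is_glue:
  shows "periodic_word b r win" "u = glue a b m win"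
proof -
  show pw: "periodic_word b r win"
  proof
    show "win (t + b * r) = win t" for t using win_per by (simp add: m_def)
    show "cnt win i (b * r) = r" if "i < b" for i using cnt_win[OF that] by (simp add: m_def)
  qed (use b2 r1 letters_win in auto)
  interpret RU: promotion_fixed a b r "revw b N u"
  proof
    show "closed b (a * r) (revw b N u)" using closed_revw[OF cl] b2 by (simp add: N_def)
    show "(prw b (b * (a * r)) ^^ (b * r)) (revw b N u) = revw b N u"
      using prw_fixed_revw[OF cl w1 fx] by (simp add: N_def)
  qed (use b2 r1 a2b in auto)
  have LN: "(a + 1 - b) * m + B0 = N" "B0 + m \<le> (a + 1 - b) * m"
  proof -
    have "(a + 1 - b) + (b - 1) = a" "Suc (b - 1) \<le> a + 1 - b" using a2b b2 by linarith+
    then have "((a + 1 - b) + (b - 1)) * m = a * m" "Suc (b - 1) * m \<le> (a + 1 - b) * m" by (simp_all add: mult_right_mono)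
    then show "(a + 1 - b) * m + B0 = N" "B0 + m \<le> (a + 1 - b) * m" using mN(1) by (simp_all add: add_mult_distrib)
  qed
  have rw: "RU.win = rvw b m win"
  proof
    fix t
    define s where "s = t mod m"
    have s: "s < m" using mN by (simp add: s_def)
    obtain e where e: "a + 1 = 2 * b + e" using a2b le_Suc_ex by blast
    have "N = (b - 1 + e) * m + m + B0"
    proof -
      have "a + 1 - b = Suc (b - 1 + e)" using e b2 by simp
      then show ?thesis using LN(1) by simp
    qed
    then have "N - 1 - (B0 + s) = (b - 1 + e) * m + (m - 1 - s)" "B0 + s < N" using s by simp_all
    \<comment> \<open>The window of the reversal comes from the last of the equal windows of
      \<open>u\<close>, the one with \<open>e = a + 1 - 2 * b\<close>.\<close>
    moreover have "u ((b - 1 + e) * m + (m - 1 - s)) = win (m - 1 - s)"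
      by (rule win_window) (use e s in auto)
    ultimately have "revw b N u (B0 + s) = b - 1 - win (m - 1 - s)" by (simp add: revw_def)
    then show "RU.win t = rvw b m win t" unfolding RU.win_def rvw_def s_def .
  qed
  show "u = glue a b m win"
  proof
    fix t
    consider "t < (a + 1 - b) * m" | "(a + 1 - b) * m \<le> t" "t < N" | "N \<le> t" by linarith
    then show "u t = glue a b m win t"
    proof cases
      case 1 then show ?thesis using prefix_hw[OF 1] by (simp add: glue_def)
    next
      case 2
      have s: "N - 1 - t < (a + 1 - b) * m" "N - 1 - t < N" "N - 1 - (N - 1 - t) = t" using 2 LN by linarith+
      have "hw b (rvw b m win) (N - 1 - t) = revw b N u (N - 1 - t)" using RU.prefix_hw[of "N - 1 - t"] s(1) unfolding rw by simp
      also have "\<dots> = b - 1 - u t" using s by (simp add: revw_def)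
      finally have "b - 1 - hw b (rvw b m win) (N - 1 - t) = b - 1 - (b - 1 - u t)" by simp
      moreover have "u t < b" using lu by (simp add: letters_def)
      ultimately show ?thesis using 2 mN(1) by (simp add: glue_def)
    next
      case 3
      then show ?thesis using closedD(4)[OF cl, of t] mN(1) LN by (simp add: N_def[symmetric] glue_def)
    qed
  qed
qed

section \<open>Tableaux as words\<close>

text \<open>\<open>P s\<close> is the cell of the entry \<open>k + s + 1\<close>. The offset serves
  promotion, where the entries from \<open>2\<close> on are slid before they are relabelled.\<close>

definition tabf :: "(nat \<Rightarrow> nat \<times> nat) \<Rightarrow> nat \<Rightarrow> nat \<Rightarrow> tab" where
  "tabf P n k c = (if \<exists>s<n. P s = c then Some (k + Suc (THE s. s < n \<and> P s = c)) else None)"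

lemma tabf_Some: assumes "inj_on P {..<n}" "s < n" shows "tabf P n k (P s) = Some (k + Suc s)"
proof -
  have "(THE s'. s' < n \<and> P s' = P s) = s"
    by (rule the_equality) (use assms in \<open>auto simp: inj_on_def\<close>)
  then show ?thesis using assms(2) by (auto simp: tabf_def)
qed

lemma tabf_None: "c \<notin> P ` {..<n} \<Longrightarrow> tabf P n k c = None"
  by (auto simp: tabf_def)

lemma tabf_dom: "dom (tabf P n k) = P ` {..<n}"
proof -
  have h: "c \<in> dom (tabf P n k) \<longleftrightarrow> (\<exists>s<n. P s = c)" for c by (simp add: tabf_def dom_def)
  show ?thesis
  proof (intro set_eqI iffI)
    fix c assume "c \<in> dom (tabf P n k)"
    then obtain s where "s < n" "P s = c" unfolding h by blast
    then show "c \<in> P ` {..<n}" by blast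
  next
    fix c assume "c \<in> P ` {..<n}"
    then obtain s where "c = P s" "s \<in> {..<n}" by (rule imageE)
    then show "c \<in> dom (tabf P n k)" unfolding h by simp blast
  qed
qed

lemma tabf_eqI:
  assumes "inj_on P {..<n}" "\<And>s. s < n \<Longrightarrow> T (P s) = Some (k + Suc s)" "\<And>c. c \<notin> P ` {..<n} \<Longrightarrow> T c = None"
  shows "T = tabf P n k"
proof
  fix c
  show "T c = tabf P n k c"
  proof (cases "c \<in> P ` {..<n}")
    case True
    then obtain s where "s < n" "c = P s" by auto
    then show ?thesis using assms(2) tabf_Some[OF assms(1)] by simp
  next
    case False
    then show ?thesis using assms(3) tabf_None by metis
  qed
qed

lemma tabf_cong: assumes "\<And>s. s < n \<Longrightarrow> P s = Q s" shows "tabf P n k = tabf Q n k"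
proof -
  have "(s < n \<and> P s = c) = (s < n \<and> Q s = c)" for s c using assms by auto
  then show ?thesis unfolding tabf_def fun_eq_iff by auto
qed

lemma tabf_SomeE:
  assumes "inj_on P {..<n}" "tabf P n k c = Some v" obtains s where "s < n" "c = P s" "v = k + Suc s"
proof -
  have "c \<in> P ` {..<n}" by (rule ccontr) (use assms(2) tabf_None[of c P n k] in simp)
  then obtain s where s: "s < n" "c = P s" by auto
  then show ?thesis using that tabf_Some[OF assms(1) s(1), of k] assms(2) by simp
qed

lemma tabf_move:
  assumes "inj_on P {..<n}" "t < n" "g \<notin> P ` {..<n}"
  shows "(tabf P n k)(g := Some (k + Suc t), P t := None) = tabf (P(t := g)) n k" "inj_on (P(t := g)) {..<n}"
proof -
  have ne: "P s \<noteq> g" if "s < n" for s using assms(3) that by auto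
  have inj: "P s = P s' \<Longrightarrow> s < n \<Longrightarrow> s' < n \<Longrightarrow> s = s'" for s s' using assms(1) by (auto simp: inj_on_def)
  show i: "inj_on (P(t := g)) {..<n}"
  proof (rule inj_onI)
    fix x y assume "x \<in> {..<n}" "y \<in> {..<n}" "(P(t := g)) x = (P(t := g)) y"
    then show "x = y" using ne[of x] ne[of y] inj[of x y] by (auto split: if_splits)
  qed
  show "(tabf P n k)(g := Some (k + Suc t), P t := None) = tabf (P(t := g)) n k"
  proof (rule tabf_eqI[OF i])
    fix s assume s: "s < n"
    show "((tabf P n k)(g := Some (k + Suc t), P t := None)) ((P(t := g)) s) = Some (k + Suc s)"
      using ne[OF s] ne[OF assms(2)] inj[of s t] s assms(2) tabf_Some[OF assms(1) s, of k] by auto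
  next
    fix c assume c: "c \<notin> (P(t := g)) ` {..<n}"
    have "c \<noteq> g" using c assms(2) by force
    moreover have "c \<in> P ` {..<n} \<Longrightarrow> c = P t"
    proof -
      assume "c \<in> P ` {..<n}"
      then obtain s where "s < n" "c = P s" by auto
      then show "c = P t" using c by (cases "s = t") force+
    qed
    ultimately show "((tabf P n k)(g := Some (k + Suc t), P t := None)) c = None"
      using tabf_None[of c P n k] by auto
  qed
qed

definition pos :: "(nat \<Rightarrow> nat) \<Rightarrow> (nat \<Rightarrow> nat) \<Rightarrow> nat \<Rightarrow> nat \<times> nat" where
  "pos \<mu> u t = (u t, lam \<mu> u t (u t))"

definition tabw :: "(nat \<Rightarrow> nat) \<Rightarrow> (nat \<Rightarrow> nat) \<Rightarrow> nat \<Rightarrow> nat \<Rightarrow> tab" where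
  "tabw \<mu> u n k = tabf (pos \<mu> u) n k"

lemma lam_mono: "s \<le> t \<Longrightarrow> lam \<mu> u s i \<le> lam \<mu> u t i"
  by (simp add: lam_def cnt_mono)

lemma lam_less: "s < t \<Longrightarrow> lam \<mu> u s (u s) < lam \<mu> u t (u s)"
  using lam_mono[of "Suc s" t \<mu> u "u s"] by simp

lemma pos_inj: "inj_on (pos \<mu> u) A"
proof (rule linorder_inj_onI')
  fix s t :: nat assume "s < t"
  then show "pos \<mu> u s \<noteq> pos \<mu> u t" using lam_less[of s t \<mu> u] by (auto simp: pos_def)
qed

lemma pos_image: "pos \<mu> u ` {..<n} = {(i, j). \<mu> i \<le> j \<and> j < lam \<mu> u n i}"
proof (induction n)
  case (Suc n)
  have "\<mu> (u n) \<le> lam \<mu> u n (u n)" by (simp add: lam_def)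
  then show ?case using Suc by (auto simp: lessThan_Suc pos_def less_Suc_eq split: if_splits)
qed auto

lemma tabw_dom: "dom (tabw \<mu> u n k) = {(i, j). \<mu> i \<le> j \<and> j < lam \<mu> u n i}"
  by (simp add: tabw_def tabf_dom pos_image)

lemma tabw_card: "card (dom (tabw \<mu> u n k)) = n" "finite (dom (tabw \<mu> u n k))"
  by (simp_all add: tabw_def tabf_dom card_image pos_inj)

lemma tabw_Some: "s < n \<Longrightarrow> tabw \<mu> u n k (pos \<mu> u s) = Some (k + Suc s)"
  by (simp add: tabw_def tabf_Some pos_inj)

lemma tabw_cong: assumes "\<And>s. s < n \<Longrightarrow> u s = v s" "\<And>s. s < n \<Longrightarrow> \<mu> (u s) = \<nu> (u s)"
  shows "tabw \<mu> u n k = tabw \<nu> v n k"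
  unfolding tabw_def
proof (rule tabf_cong)
  fix s assume s: "s < n"
  have "cnt u i s = cnt v i s" for i by (rule cnt_cong) (use s assms in simp)
  then show "pos \<mu> u s = pos \<nu> v s" using s assms by (simp add: pos_def lam_def)
qed

lemma jdt_step_right:
  "T (i, Suc j) = Some x \<Longrightarrow> (\<And>y. T (Suc i, j) = Some y \<Longrightarrow> x < y) \<Longrightarrow>
    jdt_step (T, (i, j)) = (T((i, j) := Some x, (i, Suc j) := None), (i, Suc j))"
  by (cases "T (Suc i, j)") (auto simp: jdt_step_def Let_def)

lemma jdt_step_down:
  "T (Suc i, j) = Some y \<Longrightarrow> (\<And>x. T (i, Suc j) = Some x \<Longrightarrow> y < x) \<Longrightarrow>
    jdt_step (T, (i, j)) = (T((i, j) := Some y, (Suc i, j) := None), (Suc i, j))"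
  by (cases "T (i, Suc j)") (auto simp: jdt_step_def Let_def)

lemma jdt_step_stop: "T (i, Suc j) = None \<Longrightarrow> T (Suc i, j) = None \<Longrightarrow> jdt_step (T, (i, j)) = (T, (i, j))"
  by (simp add: jdt_step_def)

lemma funpow_fixpoint: "f x = x \<Longrightarrow> (f ^^ n) x = x"
  by (induction n) simp_all

text \<open>The slide is followed in the order of the entries: before time \<open>t\<close> they sit at their new
  positions, from time \<open>t\<close> on at their old ones.\<close>
lemma jdt_slide_tabw:
  assumes sk: "skew \<mu> u" "\<mu> (Suc l) < \<mu> l"
  shows "jdt_slide (tabw \<mu> u n k) (l, \<mu> l - 1)
    = (tabw (\<mu>(l := \<mu> l - 1)) (sl \<mu> u l) n k, (hol \<mu> u l n, lam \<mu> u n (hol \<mu> u l n) - 1))"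
proof -
  let ?m = "\<mu>(l := \<mu> l - 1)" and ?v = "sl \<mu> u l" and ?h = "hol \<mu> u l"
  define hyb where "hyb t s = (if s < t then pos ?m ?v s else pos \<mu> u s)" for t s
  define hc where "hc t = (?h t, lam \<mu> u t (?h t) - 1)" for t
  define X where "X t = tabf (hyb t) n k" for t
  have lv: "lam ?m ?v t i + of_bool (i = ?h t) = lam \<mu> u t i" for t i by (rule lam_sl[OF sk(2)])
  have cor: "lam \<mu> u t (Suc (?h t)) < lam \<mu> u t (?h t)" for t by (rule hol_corner[OF sk])
  have new: "hyb t s = (i, j) \<Longrightarrow> s < t \<Longrightarrow> j < lam ?m ?v t i" for t s i j
    using lam_less[of s t ?m ?v] by (auto simp: hyb_def pos_def)
  have old: "hyb t s = (i, j) \<Longrightarrow> \<not> s < t \<Longrightarrow> lam \<mu> u t i \<le> j" for t s i j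
    using lam_mono[of t s \<mu> u] by (auto simp: hyb_def pos_def)
  have inj: "inj_on (hyb t) {..<n}" for t
  proof (rule linorder_inj_onI')
    fix s s' :: nat assume "s < s'"
    show "hyb t s \<noteq> hyb t s'"
    proof
      assume eq: "hyb t s = hyb t s'"
      obtain i j where ij: "hyb t s = (i, j)" by fastforce
      consider "s' < t" | "\<not> s < t" | "s < t" "\<not> s' < t" by linarith
      then show False
      proof cases
        case 1
        then show ?thesis using eq \<open>s < s'\<close> inj_onD[OF pos_inj[of ?m ?v UNIV], of s s'] by (simp add: hyb_def)
      next
        case 2
        then show ?thesis using eq \<open>s < s'\<close> inj_onD[OF pos_inj[of \<mu> u UNIV], of s s'] by (simp add: hyb_def)
      next
        case 3
        then show ?thesis using new[OF ij 3(1)] old[of t s' i j] lv[of t i] ij eq by simp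
      qed
    qed
  qed
  have hole: "hc t \<notin> hyb t ` {..<n}" for t
  proof
    assume "hc t \<in> hyb t ` {..<n}"
    then obtain s where s: "hyb t s = hc t" by auto
    show False
      using new[of t s "?h t" "lam \<mu> u t (?h t) - 1"] old[of t s "?h t" "lam \<mu> u t (?h t) - 1"] s lv[of t "?h t"] cor[of t]
      unfolding hc_def by (cases "s < t") auto
  qed
  \<comment> \<open>Only entries that have not been treated yet can stand right of or below the
    hole. If the entry of time \<open>t\<close> is one of them, it is the smaller one and
    moves.\<close>
  have late: "\<exists>s. t \<le> s \<and> s < n \<and> y = k + Suc s \<and> c = pos \<mu> u s"
    if c: "c = (?h t, lam \<mu> u t (?h t)) \<or> c = (Suc (?h t), lam \<mu> u t (?h t) - 1)" and y: "X t c = Some y" for t c y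
  proof -
    obtain s where s: "s < n" "c = hyb t s" "y = k + Suc s" using tabf_SomeE[OF inj y[unfolded X_def]] .
    have "\<not> s < t"
    proof
      assume st: "s < t"
      obtain i j where ij: "c = (i, j)" by fastforce
      have "j < lam ?m ?v t i" using new[of t s i j] s(2) ij st by simp
      then show False using c ij lv[of t i] cor[of t] by (auto simp: of_bool_def split: if_splits)
    qed
    then show ?thesis using s by (auto simp: hyb_def)
  qed
  have hyb_Suc: "hyb (Suc t) = (hyb t)(t := pos ?m ?v t)" for t
    by (auto simp: hyb_def fun_eq_iff less_Suc_eq)
  have hyb_t: "hyb t t = pos \<mu> u t" for t by (simp add: hyb_def)
  have hpos: "Suc (lam \<mu> u t (?h t) - 1) = lam \<mu> u t (?h t)" for t using cor[of t] by simp
  have step: "\<exists>c\<le>1. (jdt_step ^^ c) (X t, hc t) = (X (Suc t), hc (Suc t))" if t: "t < n" for t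
  proof -
    have Xt: "X t (pos \<mu> u t) = Some (k + Suc t)" using tabf_Some[OF inj t, of t k] by (simp add: X_def hyb_t)
    have mv: "(X t)(hc t := Some (k + Suc t), pos \<mu> u t := None) = X (Suc t)" if "pos ?m ?v t = hc t"
      using tabf_move(1)[OF inj t hole, of t k] hyb_Suc[of t] that unfolding X_def hyb_t by simp
    show ?thesis
    proof (cases rule: sl_cases[where t = t and u = u and \<mu> = \<mu> and l = l])
      case move
      have v: "pos ?m ?v t = hc t" using move(4) lv[of t "?h t"] by (simp add: pos_def hc_def)
      have lm: "lam \<mu> u t (?h t) = Suc (lam \<mu> u t (Suc (?h t)))" using move(1,2) by simp
      have p: "pos \<mu> u t = (Suc (?h t), lam \<mu> u t (?h t) - 1)" using move(1) lm by (simp add: pos_def)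
      have "jdt_step (X t, (?h t, lam \<mu> u t (?h t) - 1))
        = ((X t)((?h t, lam \<mu> u t (?h t) - 1) := Some (k + Suc t), (Suc (?h t), lam \<mu> u t (?h t) - 1) := None),
            (Suc (?h t), lam \<mu> u t (?h t) - 1))"
      proof (rule jdt_step_down)
        show "X t (Suc (?h t), lam \<mu> u t (?h t) - 1) = Some (k + Suc t)" using Xt p by simp
        fix x assume "X t (?h t, Suc (lam \<mu> u t (?h t) - 1)) = Some x"
        then obtain s where s: "t \<le> s" "x = k + Suc s" "(?h t, lam \<mu> u t (?h t)) = pos \<mu> u s"
          using late[of "(?h t, lam \<mu> u t (?h t))" t x] unfolding hpos by blast
        have "s \<noteq> t" using s(3) p by auto
        then show "k + Suc t < x" using s by simp
      qed
      then have "jdt_step (X t, hc t) = (X (Suc t), hc (Suc t))"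
        using mv[OF v] p move(1,3) lm unfolding hc_def by simp
      then show ?thesis by (intro exI[of _ 1]) simp
    next
      case stay
      show ?thesis
      proof (cases "u t = ?h t")
        case True
        have v: "pos ?m ?v t = hc t" using stay(2) True lv[of t "?h t"] by (simp add: pos_def hc_def)
        have p: "pos \<mu> u t = (?h t, lam \<mu> u t (?h t))" using True by (simp add: pos_def)
        have "jdt_step (X t, (?h t, lam \<mu> u t (?h t) - 1))
          = ((X t)((?h t, lam \<mu> u t (?h t) - 1) := Some (k + Suc t), (?h t, Suc (lam \<mu> u t (?h t) - 1)) := None),
              (?h t, Suc (lam \<mu> u t (?h t) - 1)))"
        proof (rule jdt_step_right)
          show "X t (?h t, Suc (lam \<mu> u t (?h t) - 1)) = Some (k + Suc t)" unfolding hpos using Xt p by simp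
          fix x assume "X t (Suc (?h t), lam \<mu> u t (?h t) - 1) = Some x"
          then obtain s where s: "t \<le> s" "x = k + Suc s" "(Suc (?h t), lam \<mu> u t (?h t) - 1) = pos \<mu> u s"
            using late[of "(Suc (?h t), lam \<mu> u t (?h t) - 1)" t x] by blast
          have "s \<noteq> t" using s(3) p by auto
          then show "k + Suc t < x" using s by simp
        qed
        then have "jdt_step (X t, hc t) = (X (Suc t), hc (Suc t))"
          using mv[OF v] p stay(1) True unfolding hpos hc_def by simp
        then show ?thesis by (intro exI[of _ 1]) simp
      next
        case False
        have "pos ?m ?v t = pos \<mu> u t" using stay(2) False lv[of t "u t"] by (simp add: pos_def)
        then have "X (Suc t) = X t" unfolding X_def hyb_Suc using hyb_t[of t] by (metis fun_upd_triv)
        moreover have "hc (Suc t) = hc t" using stay(1) False unfolding hc_def by simp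
        ultimately show ?thesis by (intro exI[of _ 0]) simp
      qed
    qed
  qed
  have reach: "\<exists>c\<le>t. (jdt_step ^^ c) (X 0, hc 0) = (X t, hc t)" if "t \<le> n" for t
    using that
  proof (induction t)
    case (Suc t)
    then obtain c where c: "c \<le> t" "(jdt_step ^^ c) (X 0, hc 0) = (X t, hc t)" by auto
    obtain d where d: "d \<le> 1" "(jdt_step ^^ d) (X t, hc t) = (X (Suc t), hc (Suc t))" using step[of t] Suc.prems by auto
    have "(jdt_step ^^ (d + c)) (X 0, hc 0) = (X (Suc t), hc (Suc t))" unfolding funpow_add comp_apply c(2) d(2) ..
    then show ?case using c d by (intro exI[of _ "d + c"]) simp
  qed simp
  have stop: "jdt_step (X n, hc n) = (X n, hc n)"
  proof -
    have "X n c = None" if c: "c = (?h n, lam \<mu> u n (?h n)) \<or> c = (Suc (?h n), lam \<mu> u n (?h n) - 1)" for c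
    proof (cases "X n c")
      case (Some y)
      then show ?thesis using late[OF c Some] by auto
    qed simp
    then show ?thesis unfolding hc_def by (intro jdt_step_stop) (simp_all only: hpos simp_thms)
  qed
  obtain c where c: "c \<le> n" "(jdt_step ^^ c) (X 0, hc 0) = (X n, hc n)" using reach[of n] by auto
  have "(jdt_step ^^ n) (X 0, hc 0) = (jdt_step ^^ (n - c)) ((jdt_step ^^ c) (X 0, hc 0))"
    using c(1) by (metis comp_apply funpow_add le_add_diff_inverse2)
  also have "\<dots> = (X n, hc n)" unfolding c(2) by (rule funpow_fixpoint[of jdt_step "(X n, hc n)", OF stop])
  finally have fin: "(jdt_step ^^ n) (X 0, hc 0) = (X n, hc n)" .
  have "X 0 = tabw \<mu> u n k" unfolding X_def tabw_def by (rule tabf_cong) (simp add: hyb_def)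
  moreover have "X n = tabw ?m ?v n k" unfolding X_def tabw_def by (rule tabf_cong) (simp add: hyb_def)
  ultimately show ?thesis using fin tabw_card(1)[of \<mu> u n k] unfolding jdt_slide_def hc_def by simp
qed

lemma pr_tabw:
  assumes c: "closed b w u" and w: "1 \<le> w" "1 \<le> b"
  shows "pr (tabw (\<lambda>i. 0) u (b * w) 0) = tabw (\<lambda>i. 0) (prw b (b * w) u) (b * w) 0"
proof -
  define N where "N = b * w"
  define T where "T = tabw (\<lambda>i. 0) u N 0"
  have N: "1 \<le> N" using w by (simp add: N_def)
  have lat: "lattice u" by (rule closedD(2)[OF c])
  have u0: "u 0 = 0" by (rule lattice_0[OF lat])
  have p0: "pos (\<lambda>i. 0) u 0 = (0, 0)" by (simp add: pos_def u0)
  have the: "(THE c. T c = Some 1) = (0, 0)"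
  proof (rule the_equality)
    show "T (0, 0) = Some 1" using tabw_Some[of 0 N "\<lambda>i. 0" u 0] p0 N by (simp add: T_def)
    fix c assume "T c = Some 1"
    then obtain s where "s < N" "c = pos (\<lambda>i. 0) u s" "1 = 0 + Suc s"
      unfolding T_def tabw_def by (rule tabf_SomeE[OF pos_inj])
    then show "c = (0, 0)" using p0 by simp
  qed
  have psuc: "pos unit0 (u \<circ> Suc) s = pos (\<lambda>i. 0) u (Suc s)" for s
    using lam_unit0[OF lat, of s "u (Suc s)"] by (simp add: pos_def lam_def[of "\<lambda>i. 0"] del: lam_simps)
  \<comment> \<open>The remaining entries start with \<open>2\<close>, hence the offset
    \<open>1\<close>.\<close>
  have T': "T((0, 0) := None) = tabw unit0 (u \<circ> Suc) (N - 1) 1"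
    unfolding tabw_def
  proof (rule tabf_eqI[OF pos_inj])
    fix s assume s: "s < N - 1"
    have "pos (\<lambda>i. 0) u (Suc s) \<noteq> (0, 0)" using inj_onD[OF pos_inj[of "\<lambda>i. 0" u UNIV], of "Suc s" 0] p0 by auto
    then show "(T((0, 0) := None)) (pos unit0 (u \<circ> Suc) s) = Some (1 + Suc s)"
      using tabw_Some[of "Suc s" N "\<lambda>i. 0" u 0] s unfolding psuc T_def by simp
  next
    fix c assume c: "c \<notin> pos unit0 (u \<circ> Suc) ` {..<N - 1}"
    show "(T((0, 0) := None)) c = None"
    proof (cases "c \<in> pos (\<lambda>i. 0) u ` {..<N}")
      case True
      then obtain s where s: "s < N" "c = pos (\<lambda>i. 0) u s" by auto
      have "s = 0"
      proof (rule ccontr)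
        assume "s \<noteq> 0"
        then obtain s' where s': "s = Suc s'" by (cases s) auto
        then have "c = pos unit0 (u \<circ> Suc) s'" "s' \<in> {..<N - 1}" using s psuc[of s'] by auto
        then show False using c by blast
      qed
      then show ?thesis using s p0 by simp
    qed (auto simp: T_def tabw_def tabf_None)
  qed
  have ar: "Suc (N - 1) = N" using N by simp
  have hl: "whol u (N - 1) = b - 1" unfolding N_def by (rule whol_last[OF c w])
  have lm: "lam unit0 (u \<circ> Suc) (N - 1) (b - 1) = w"
    using lam_unit0[OF lat, of "N - 1" "b - 1"] closedD(3)[OF c, of "b - 1"] w unfolding ar N_def by simp
  have slide: "jdt_slide (T((0, 0) := None)) (0, 0) = (tabw (\<lambda>i. 0) (wsl u) (N - 1) 1, (b - 1, w - 1))"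
    using jdt_slide_tabw[OF skew_unit0[OF lat], of 0 "N - 1" 1] unfolding T' hl lm wsl_def by simp
  let ?p = "prw b N u"
  have pl: "pos (\<lambda>i. 0) ?p s = pos (\<lambda>i. 0) (wsl u) s" if "s < N - 1" for s
  proof -
    have lt: "?p x = wsl u x" if "x \<le> s" for x using that \<open>s < N - 1\<close> by (auto simp: prw_def)
    have "cnt ?p i s = cnt (wsl u) i s" for i by (rule cnt_cong) (simp add: lt)
    then show ?thesis by (simp add: pos_def lam_def lt)
  qed
  have plast: "pos (\<lambda>i. 0) ?p (N - 1) = (b - 1, w - 1)"
  proof -
    have "cnt ?p (b - 1) (N - 1) + 1 = w"
      using cnt_prw[OF c, of "N - 1" "b - 1"] N hl closedD(3)[OF c, of "b - 1"] w unfolding N_def[symmetric] ar by simp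
    moreover have "?p (N - 1) = b - 1" using ar by (simp add: prw_def)
    ultimately show ?thesis by (simp add: pos_def lam_def)
  qed
  have "pr T = (\<lambda>c. map_option (\<lambda>v. v - 1) (((tabw (\<lambda>i. 0) (wsl u) (N - 1) 1)((b - 1, w - 1) := Some (Suc N))) c))"
    unfolding pr_def Let_def the slide prod.case T_def[symmetric] using tabw_card(1)[of "\<lambda>i. 0" u N 0] by (simp add: T_def)
  also have "\<dots> = tabf (pos (\<lambda>i. 0) ?p) N 0"
  proof (rule tabf_eqI[OF pos_inj])
    fix s assume s: "s < N"
    show "map_option (\<lambda>v. v - 1) (((tabw (\<lambda>i. 0) (wsl u) (N - 1) 1)((b - 1, w - 1) := Some (Suc N))) (pos (\<lambda>i. 0) ?p s)) = Some (0 + Suc s)"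
    proof (cases "s = N - 1")
      case True
      then show ?thesis using plast ar by simp
    next
      case False
      then have s': "s < N - 1" using s by simp
      have "pos (\<lambda>i. 0) ?p s \<noteq> pos (\<lambda>i. 0) ?p (N - 1)"
        using inj_onD[OF pos_inj[of "\<lambda>i. 0" ?p UNIV], of s "N - 1"] False by auto
      then have "pos (\<lambda>i. 0) (wsl u) s \<noteq> (b - 1, w - 1)" unfolding plast pl[OF s'] .
      then show ?thesis using tabw_Some[OF s', of "\<lambda>i. 0" "wsl u" 1] unfolding pl[OF s'] by simp
    qed
  next
    fix c assume c: "c \<notin> pos (\<lambda>i. 0) ?p ` {..<N}"
    have "(b - 1, w - 1) \<in> pos (\<lambda>i. 0) ?p ` {..<N}"
      unfolding plast[symmetric] by (rule imageI) (use N in simp)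
    then have "c \<noteq> (b - 1, w - 1)" using c by blast
    moreover have "c \<notin> pos (\<lambda>i. 0) (wsl u) ` {..<N - 1}"
    proof
      assume "c \<in> pos (\<lambda>i. 0) (wsl u) ` {..<N - 1}"
      then obtain s where "s < N - 1" "c = pos (\<lambda>i. 0) (wsl u) s" by auto
      then have "s < N" "c = pos (\<lambda>i. 0) ?p s" using pl by auto
      then show False using c by blast
    qed
    ultimately show "map_option (\<lambda>v. v - 1) (((tabw (\<lambda>i. 0) (wsl u) (N - 1) 1)((b - 1, w - 1) := Some (Suc N))) c) = None"
      by (simp add: tabw_def tabf_None)
  qed
  finally show ?thesis by (simp add: T_def N_def tabw_def)
qed

lemma tabw_standard:
  assumes sk: "\<And>t i. t \<le> n \<Longrightarrow> lam \<mu> u t (Suc i) \<le> lam \<mu> u t i"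
  shows "is_standard {(i, j). \<mu> i \<le> j \<and> j < lam \<mu> u n i} (tabw \<mu> u n 0)"
  unfolding is_standard_def tabw_dom[of \<mu> u n 0, symmetric]
proof (intro conjI)
  let ?T = "tabw \<mu> u n 0"
  show "finite (dom ?T)" by (rule tabw_card)
  show "ran ?T = {1..card (dom ?T)}" unfolding tabw_card
  proof (intro equalityI subsetI)
    fix v assume "v \<in> ran ?T"
    then obtain c where "?T c = Some v" by (auto simp: ran_def)
    then obtain s where "s < n" "v = 0 + Suc s" unfolding tabw_def by (rule tabf_SomeE[OF pos_inj])
    then show "v \<in> {1..n}" by simp
  next
    fix v assume "v \<in> {1..n}"
    then obtain v' where "v = Suc v'" "v' < n" by (cases v) auto
    then have "?T (pos \<mu> u v') = Some v" using tabw_Some[of v' n \<mu> u 0] by simp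
    then show "v \<in> ran ?T" by (rule ranI)
  qed
  show "inj_on ?T (dom ?T)"
  proof (rule inj_onI)
    fix c d assume "c \<in> dom ?T" "d \<in> dom ?T" "?T c = ?T d"
    then obtain v where v: "?T c = Some v" "?T d = Some v" by auto
    obtain s where "s < n" "c = pos \<mu> u s" "v = 0 + Suc s" using v(1) unfolding tabw_def by (rule tabf_SomeE[OF pos_inj])
    moreover obtain s' where "s' < n" "d = pos \<mu> u s'" "v = 0 + Suc s'" using v(2) unfolding tabw_def by (rule tabf_SomeE[OF pos_inj])
    ultimately show "c = d" by simp
  qed
  show "\<forall>i j i' j'. (i, j) \<in> dom ?T \<longrightarrow> (i', j') \<in> dom ?T \<longrightarrow> i \<le> i' \<longrightarrow> j \<le> j' \<longrightarrow> (i, j) \<noteq> (i', j')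
        \<longrightarrow> the (?T (i, j)) < the (?T (i', j'))"
  proof (intro allI impI)
    fix i j i' j' assume A: "(i, j) \<in> dom ?T" "(i', j') \<in> dom ?T" "i \<le> i'" "j \<le> j'" "(i, j) \<noteq> (i', j')"
    obtain s where s: "s < n" "(i, j) = pos \<mu> u s" using A(1) by (auto simp: tabw_def tabf_dom)
    obtain s' where s': "s' < n" "(i', j') = pos \<mu> u s'" using A(2) by (auto simp: tabw_def tabf_dom)
    have anti: "i \<le> i' \<Longrightarrow> lam \<mu> u (Suc s') i' \<le> lam \<mu> u (Suc s') i"
      by (rule lift_Suc_antimono_le[of "lam \<mu> u (Suc s')"]) (use sk[of "Suc s'"] s'(1) in auto)
    have "j < lam \<mu> u (Suc s') i'" using s'(2) A(4) by (simp add: pos_def)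
    then have "lam \<mu> u s i < lam \<mu> u (Suc s') i" using anti A(3) s(2) by (simp add: pos_def del: lam_simps)
    then have "s < Suc s'" using lam_mono[of "Suc s'" s \<mu> u i] by (meson not_le)
    moreover have "s \<noteq> s'" using A(5) s(2) s'(2) by auto
    ultimately show "the (?T (i, j)) < the (?T (i', j'))"
      using tabw_Some[OF s(1), of \<mu> u 0] tabw_Some[OF s'(1), of \<mu> u 0] s(2) s'(2) by simp
  qed
qed simp

text \<open>The letter \<open>u t\<close> is the row of the entry \<open>t + 1\<close>; the entries
  of its row that come earlier are exactly those to its left. The \<open>max\<close> covers rows
  that are empty because \<open>\<nu> i < \<mu> i\<close>.\<close>

lemma standard_is_tabw:
  assumes st: "is_standard D T" and D: "D = {(i, j). i < b \<and> \<mu> i \<le> j \<and> j < \<nu> i}" and b: "1 \<le> b"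
  obtains u where "T = tabw \<mu> u (card D) 0" "letters b u" "\<And>t. card D \<le> t \<Longrightarrow> u t = 0"
    "\<And>i. i < b \<Longrightarrow> \<mu> i + cnt u i (card D) = max (\<mu> i) (\<nu> i)"
proof -
  define n where "n = card D"
  have fD: "finite D" "dom T = D" "ran T = {1..n}" "inj_on T D"
    using st unfolding is_standard_def n_def by simp_all
  have inc: "\<And>i j i' j'. (i, j) \<in> D \<Longrightarrow> (i', j') \<in> D \<Longrightarrow> i \<le> i' \<Longrightarrow> j \<le> j' \<Longrightarrow> (i, j) \<noteq> (i', j')
        \<Longrightarrow> the (T (i, j)) < the (T (i', j'))"
    using st unfolding is_standard_def by blast
  have "\<exists>c. T c = Some (Suc t)" if "t < n" for t
  proof -
    have "Suc t \<in> ran T" using that fD(3) by simp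
    then show ?thesis by (auto simp: ran_def)
  qed
  then obtain P where P: "\<And>t. t < n \<Longrightarrow> T (P t) = Some (Suc t)" by metis
  have PD: "P t \<in> D" if "t < n" for t using P[OF that] fD(2) by auto
  have Pinj: "inj_on P {..<n}"
  proof (rule inj_onI)
    fix x y assume "x \<in> {..<n}" "y \<in> {..<n}" "P x = P y"
    then have "Some (Suc x) = Some (Suc y)" using P[of x] P[of y] by (metis lessThan_iff)
    then show "x = y" by simp
  qed
  have Psurj: "\<exists>t<n. c = P t" if c: "c \<in> D" for c
  proof -
    have "c \<in> dom T" using c fD(2) by simp
    then obtain v where v: "T c = Some v" by blast
    then have "v \<in> {1..n}" using fD(3) ranI[of T c v] by simp
    then obtain v' where v': "v = Suc v'" "v' < n" by (cases v) auto
    then have "T (P v') = T c" using P[of v'] v by simp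
    then have "c = P v'" using inj_onD[OF fD(4), of c "P v'"] c PD[OF v'(2)] by simp
    then show ?thesis using v'(2) by blast
  qed
  define u where "u t = (if t < n then fst (P t) else 0)" for t
  have row: "s \<le> t \<longleftrightarrow> snd (P s) \<le> snd (P t)" if "s < n" "t < n" "fst (P s) = fst (P t)" for s t
  proof -
    have lt: "s < t" if "s < n" "t < n" "fst (P s) = fst (P t)" "snd (P s) < snd (P t)" for s t
    proof -
      have "the (T (P s)) < the (T (P t))"
        by (rule inc[of "fst (P s)" "snd (P s)" "fst (P t)" "snd (P t)", unfolded prod.collapse])
          (use that PD in auto)
      then show ?thesis using P that by simp
    qed
    show ?thesis
    proof (cases "snd (P s) = snd (P t)")
      case True
      then have "P s = P t" using that(3) by (simp add: prod_eq_iff)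
      then have "s = t" using inj_onD[OF Pinj] that by auto
      then show ?thesis by simp
    next
      case False
      then show ?thesis using lt[of s t] lt[of t s] that by linarith
    qed
  qed
  have cntu: "\<mu> (fst (P t)) + cnt u (fst (P t)) t = snd (P t)" if t: "t < n" for t
  proof -
    obtain i j where ij: "P t = (i, j)" by fastforce
    have bd: "i < b" "\<mu> i \<le> j" "j < \<nu> i" using PD[OF t] ij D by auto
    have "(\<lambda>s. snd (P s)) ` {s. s < t \<and> u s = i} = {\<mu> i..<j}"
    proof (intro equalityI subsetI)
      fix c assume "c \<in> (\<lambda>s. snd (P s)) ` {s. s < t \<and> u s = i}"
      then obtain s where s: "s < t" "u s = i" "c = snd (P s)" by auto
      have "P s = (i, c)" using s t by (auto simp: u_def prod_eq_iff)
      moreover have "P s \<in> D" using PD[of s] s t by simp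
      ultimately show "c \<in> {\<mu> i..<j}" using row[of t s] s t ij D by auto
    next
      fix c assume c: "c \<in> {\<mu> i..<j}"
      then have "(i, c) \<in> D" using bd D by auto
      then obtain s where s: "s < n" "(i, c) = P s" using Psurj by blast
      have Ps: "fst (P s) = i" "snd (P s) = c" using s(2)[symmetric] by simp_all
      then have "s < t" using row[of t s] s(1) t c ij by auto
      then show "c \<in> (\<lambda>s. snd (P s)) ` {s. s < t \<and> u s = i}" using Ps s(1) by (force simp: u_def)
    qed
    moreover have "inj_on (\<lambda>s. snd (P s)) {s. s < t \<and> u s = i}"
    proof (rule inj_onI)
      fix x y assume "x \<in> {s. s < t \<and> u s = i}" "y \<in> {s. s < t \<and> u s = i}" "snd (P x) = snd (P y)"
      then have "P x = P y" "x < n" "y < n" using t by (auto simp: u_def prod_eq_iff)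
      then show "x = y" using inj_onD[OF Pinj, of x y] by simp
    qed
    ultimately have "card {s. s < t \<and> u s = i} = j - \<mu> i" using card_image[of "\<lambda>s. snd (P s)" "{s. s < t \<and> u s = i}"] by simp
    then show ?thesis using bd ij by (simp add: cnt_def)
  qed
  have pP: "pos \<mu> u t = P t" if "t < n" for t
    using cntu[OF that] that by (simp add: pos_def lam_def u_def prod_eq_iff)
  have T: "T = tabw \<mu> u n 0"
    unfolding tabw_def
  proof (rule tabf_eqI[OF pos_inj])
    show "T (pos \<mu> u s) = Some (0 + Suc s)" if "s < n" for s using P[OF that] pP[OF that] by simp
    show "T c = None" if "c \<notin> pos \<mu> u ` {..<n}" for c
    proof (rule ccontr)
      assume "T c \<noteq> None"
      then have "c \<in> D" using fD(2) by auto
      then obtain t where "t < n" "c = P t" using Psurj by blast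
      then show False using that pP by force
    qed
  qed
  have "letters b u"
    unfolding letters_def
  proof
    fix t show "u t < b" using PD[of t] D b by (cases "P t") (auto simp: u_def)
  qed
  moreover have "\<mu> i + cnt u i n = max (\<mu> i) (\<nu> i)" if i: "i < b" for i
  proof -
    have "{(i, j). \<mu> i \<le> j \<and> j < lam \<mu> u n i} = D" using tabw_dom[of \<mu> u n 0] T fD(2) by simp
    then have "(i, j) \<in> {(i, j). \<mu> i \<le> j \<and> j < lam \<mu> u n i} \<longleftrightarrow> (i, j) \<in> D" for j by simp
    then have e: "\<mu> i \<le> j \<and> j < lam \<mu> u n i \<longleftrightarrow> \<mu> i \<le> j \<and> j < \<nu> i" for j using i D by simp
    have "\<mu> i \<le> lam \<mu> u n i" by (simp add: lam_def)
    then have "lam \<mu> u n i = max (\<mu> i) (\<nu> i)" using e[of "lam \<mu> u n i"] e[of "\<nu> i"] e[of "\<mu> i"] by (auto simp: max_def)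
    then show ?thesis by (simp add: lam_def)
  qed
  ultimately show ?thesis using that[of u] T unfolding n_def by (simp add: u_def n_def)
qed

lemma SYT_rect:
  assumes "1 \<le> b" shows "SYT (rect b w) = (\<lambda>u. tabw (\<lambda>i. 0) u (b * w) 0) ` {u. closed b w u}"
proof (intro equalityI subsetI)
  have cD: "card (rect b w) = b * w"
  proof -
    have "rect b w = {..<b} \<times> {..<w}" by (auto simp: rect_def)
    then show ?thesis by simp
  qed
  {
    fix T assume "T \<in> SYT (rect b w)"
    then have st: "is_standard (rect b w) T" by (simp add: SYT_def)
    obtain u where u: "T = tabw (\<lambda>i. 0) u (card (rect b w)) 0" "letters b u" "\<And>t. card (rect b w) \<le> t \<Longrightarrow> u t = 0"
      "\<And>i. i < b \<Longrightarrow> 0 + cnt u i (card (rect b w)) = max 0 w"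
      using standard_is_tabw[OF st, of b "\<lambda>i. 0" "\<lambda>i. w"] assms by (auto simp: rect_def)
    have "closed b w u"
    proof (rule closedI[OF u(2) assms, where N = "b * w"])
      show "cnt u i (b * w) = w" if "i < b" for i using u(4)[OF that] cD by simp
      show "u t = 0" if "b * w \<le> t" for t using u(3) that cD by simp
      show "cnt u (Suc i) t \<le> cnt u i t" if t: "t < b * w" and i: "Suc i < b" for t i
      \<comment> \<open>If row \<open>Suc i\<close> were the longer one at time \<open>t\<close>,
        its entry in column \<open>cnt u i t\<close> would precede the entry directly above.\<close>
      proof (rule ccontr)
        assume A: "\<not> cnt u (Suc i) t \<le> cnt u i t"
        let ?j = "cnt u i t"
        have "(Suc i, ?j) \<in> pos (\<lambda>i. 0) u ` {..<t}" unfolding pos_image using A by (simp add: lam_def)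
        then obtain s' where s': "s' < t" "(Suc i, ?j) = pos (\<lambda>i. 0) u s'" by auto
        have "cnt u (Suc i) t \<le> w" using cnt_mono[of t "b * w" u "Suc i"] u(4)[OF i] t cD by simp
        then have jw: "?j < w" using A by simp
        then have "(i, ?j) \<in> pos (\<lambda>i. 0) u ` {..<b * w}" unfolding pos_image using u(4)[of i] i cD by (simp add: lam_def)
        then obtain s where s: "s < b * w" "(i, ?j) = pos (\<lambda>i. 0) u s" by auto
        have "the (T (i, ?j)) < the (T (Suc i, ?j))"
          using st jw i unfolding is_standard_def rect_def by auto
        moreover have "T (i, ?j) = Some (Suc s)" "T (Suc i, ?j) = Some (Suc s')"
          using tabw_Some[OF s(1), of "\<lambda>i. 0" u 0] tabw_Some[of s' "b * w" "\<lambda>i. 0" u 0] s' s(2) t u(1) cD by simp_all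
        ultimately have "s < t" using s' by simp
        moreover have "u s = i" "cnt u i s = ?j" using s(2) by (auto simp: pos_def lam_def)
        ultimately show False using lam_less[of s t "\<lambda>i. 0" u] by (simp add: lam_def)
      qed
    qed simp
    then show "T \<in> (\<lambda>u. tabw (\<lambda>i. 0) u (b * w) 0) ` {u. closed b w u}" using u(1) cD by auto
  }
  fix T assume "T \<in> (\<lambda>u. tabw (\<lambda>i. 0) u (b * w) 0) ` {u. closed b w u}"
  then obtain u where u: "T = tabw (\<lambda>i. 0) u (b * w) 0" "closed b w u" by auto
  have "is_standard {(i, j). 0 \<le> j \<and> j < lam (\<lambda>i. 0) u (b * w) i} T"
    unfolding u(1) by (rule tabw_standard) (use closedD(2)[OF u(2)] in \<open>simp add: lam_def lattice_def\<close>)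
  moreover have "{(i, j). 0 \<le> j \<and> j < lam (\<lambda>i. 0) u (b * w) i} = rect b w"
  proof -
    have "lam (\<lambda>i. 0) u (b * w) i = (if i < b then w else 0)" for i
      using closedD(3)[OF u(2), of i] cnt_zero[OF closedD(1)[OF u(2)], of i] by (simp add: lam_def)
    then show ?thesis by (auto simp: rect_def split: if_splits)
  qed
  ultimately show "T \<in> SYT (rect b w)" by (simp add: SYT_def)
qed

lemma tabw_inj:
  assumes "tabw \<mu> u n k = tabw \<mu> v n k" "t < n" shows "u t = v t"
proof -
  have "tabw \<mu> v n k (pos \<mu> u t) = Some (k + Suc t)" using tabw_Some[OF assms(2), of \<mu> u k] assms(1) by simp
  then obtain s where "s < n" "pos \<mu> u t = pos \<mu> v s" "k + Suc t = k + Suc s"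
    unfolding tabw_def by (rule tabf_SomeE[OF pos_inj])
  then show ?thesis by (simp add: pos_def)
qed

section \<open>Rectification\<close>

definition zero_tail :: "nat \<Rightarrow> (nat \<Rightarrow> nat) \<Rightarrow> bool" where
  "zero_tail n u \<longleftrightarrow> (\<forall>t\<ge>n. u t = 0)"

lemma cnt_zero_tail:
  assumes "zero_tail n u" "i \<noteq> 0" shows "cnt u i t \<le> cnt u i n"
proof (cases "t \<le> n")
  case True
  then show ?thesis by (rule cnt_mono)
next
  case False
  then have "n \<le> t" by simp
  then have "cnt u i t = cnt u i n"
    by (induction t rule: dec_induct) (use assms in \<open>auto simp: zero_tail_def\<close>)
  then show ?thesis by simp
qed

lemma inner_cells_tabw:
  assumes sk: "skew \<mu> u" and c: "(i, j) \<in> inner_cells (dom (tabw \<mu> u n k))" shows "j < \<mu> i"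
proof -
  obtain i' j' where d: "i \<le> i'" "j \<le> j'" "j' < lam \<mu> u n i'"
    using c by (auto simp: inner_cells_def tabw_dom)
  have "lam \<mu> u n i' \<le> lam \<mu> u n i"
    by (rule lift_Suc_antimono_le[of "lam \<mu> u n", OF _ d(1)]) (rule skewD[OF sk])
  then show ?thesis using c d by (auto simp: inner_cells_def tabw_dom)
qed

text \<open>A row without entries carries no information about \<open>\<mu>\<close>; \<open>\<mu>\<close> is normalised so that it counts the
  inner cells.\<close>
lemma canonical_shape:
  assumes l: "letters b u" and z: "zero_tail n u" and sk: "skew \<mu> u"
  obtains \<nu> where "tabw \<mu> u n 0 = tabw \<nu> u n 0" "skew \<nu> u"
    "inner_cells (dom (tabw \<mu> u n 0)) = {(i, j). j < \<nu> i}" "\<And>i. b \<le> i \<Longrightarrow> \<nu> i = 0"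
proof -
  define I where "I = inner_cells (dom (tabw \<mu> u n 0))"
  define \<nu> where "\<nu> i = (LEAST j. (i, j) \<notin> I)" for i
  have sub: "(i, j) \<in> I \<Longrightarrow> j < \<mu> i" for i j unfolding I_def by (rule inner_cells_tabw[OF sk])
  have inI: "(i, j) \<in> I \<longleftrightarrow> \<not> (\<mu> i \<le> j \<and> j < lam \<mu> u n i) \<and> (\<exists>i' j'. \<mu> i' \<le> j' \<and> j' < lam \<mu> u n i' \<and> i \<le> i' \<and> j \<le> j')" for i j
    unfolding I_def inner_cells_def tabw_dom by auto
  have down: "(i, j0) \<in> I" if mI: "(i, j) \<in> I" and j0: "j0 \<le> j" for i j j0
  proof -
    have "j0 < \<mu> i" using sub[OF mI] j0 by simp
    moreover obtain i' j' where "\<mu> i' \<le> j'" "j' < lam \<mu> u n i'" "i \<le> i'" "j \<le> j'" using mI unfolding inI by blast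
    then have "\<exists>i' j'. \<mu> i' \<le> j' \<and> j' < lam \<mu> u n i' \<and> i \<le> i' \<and> j0 \<le> j'" using le_trans[OF j0] by blast
    ultimately show ?thesis unfolding inI by simp
  qed
  have mem: "(i, j) \<in> I \<longleftrightarrow> j < \<nu> i" for i j
  proof
    have ex: "(i, \<mu> i) \<notin> I" using sub[of i "\<mu> i"] by blast
    then have L: "(i, \<nu> i) \<notin> I" unfolding \<nu>_def by (rule LeastI)
    { assume "(i, j) \<in> I"
      then show "j < \<nu> i" using down[of i j "\<nu> i"] L by (meson not_le) }
    { assume "j < \<nu> i"
      then show "(i, j) \<in> I" unfolding \<nu>_def using not_less_Least by blast }
  qed
  have le: "\<nu> i \<le> \<mu> i" for i using sub[of i "\<mu> i"] mem[of i "\<mu> i"] by (meson less_irrefl not_le)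
  have ne: "\<nu> i = \<mu> i" if "cnt u i n > 0" for i
  proof -
    have "(i, j) \<in> I" if "j < \<mu> i" for j
    proof -
      have "\<mu> i < lam \<mu> u n i" using \<open>cnt u i n > 0\<close> by (simp add: lam_def)
      then show ?thesis using that unfolding inI by (meson le_refl less_imp_le not_le)
    qed
    then have "\<mu> i \<le> \<nu> i" using mem[of i "\<nu> i"] by (meson less_irrefl not_le)
    then show ?thesis using le[of i] by simp
  qed
  have "tabw \<mu> u n 0 = tabw \<nu> u n 0"
  proof (rule tabw_cong)
    fix s assume "s < n"
    then have "cnt u (u s) n > 0" using lam_less[of s n "\<lambda>i. 0" u] by (simp add: lam_def)
    then show "\<mu> (u s) = \<nu> (u s)" using ne by simp
  qed simp
  moreover have "skew \<nu> u"
    unfolding skew_def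
  proof (intro allI)
    fix t i
    have ct: "cnt u (Suc i) t \<le> cnt u (Suc i) n" by (rule cnt_zero_tail[OF z]) simp
    show "lam \<nu> u t (Suc i) \<le> lam \<nu> u t i"
    proof (cases "cnt u (Suc i) n = 0")
      case e1: True
      then have lt: "lam \<nu> u t (Suc i) = \<nu> (Suc i)" using ct by (simp add: lam_def)
      show ?thesis
      proof (cases "cnt u i n = 0")
        case True
        have "\<nu> (Suc i) \<le> \<nu> i"
        proof (rule ccontr)
          assume "\<not> \<nu> (Suc i) \<le> \<nu> i"
          then have "(Suc i, \<nu> i) \<in> I" using mem by simp
          then obtain i' j' where "\<mu> i' \<le> j'" "j' < lam \<mu> u n i'" "Suc i \<le> i'" "\<nu> i \<le> j'" unfolding inI by blast
          moreover have "\<not> (\<mu> i \<le> \<nu> i \<and> \<nu> i < lam \<mu> u n i)" using True by (simp add: lam_def)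
          ultimately have "(i, \<nu> i) \<in> I" unfolding inI by (meson Suc_leD)
          then show False using mem by simp
        qed
        then show ?thesis unfolding lt by (simp add: lam_def)
      next
        case False
        have "\<nu> (Suc i) \<le> lam \<mu> u t (Suc i)" using le[of "Suc i"] by (simp add: lam_def)
        also have "\<dots> \<le> lam \<mu> u t i" by (rule skewD[OF sk])
        also have "\<dots> = lam \<nu> u t i" using ne[of i] False by (simp add: lam_def)
        finally show ?thesis unfolding lt .
      qed
    next
      case f1: False
      show ?thesis
      proof (cases "cnt u i n = 0")
        case True
        have "lam \<mu> u n (Suc i) \<le> \<nu> i"
        proof (rule ccontr)
          assume A: "\<not> lam \<mu> u n (Suc i) \<le> \<nu> i"
          have "\<not> (\<mu> i \<le> \<nu> i \<and> \<nu> i < lam \<mu> u n i)" using True by (simp add: lam_def)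
          moreover have "\<mu> (Suc i) \<le> lam \<mu> u n (Suc i) - 1" "lam \<mu> u n (Suc i) - 1 < lam \<mu> u n (Suc i)" "\<nu> i \<le> lam \<mu> u n (Suc i) - 1"
            using f1 A by (auto simp: lam_def)
          ultimately have "(i, \<nu> i) \<in> I" unfolding inI by (meson le_SucI le_refl)
          then show False using mem by simp
        qed
        moreover have "lam \<nu> u t (Suc i) \<le> lam \<mu> u n (Suc i)" using ct ne[of "Suc i"] f1 by (simp add: lam_def)
        ultimately show ?thesis by (simp add: lam_def)
      next
        case False
        then have "lam \<nu> u t (Suc i) = lam \<mu> u t (Suc i)" "lam \<nu> u t i = lam \<mu> u t i"
          using ne[of i] ne[of "Suc i"] f1 by (simp_all add: lam_def)
        then show ?thesis using skewD[OF sk, of t i] by simp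
      qed
    qed
  qed
  moreover have "I = {(i, j). j < \<nu> i}" using mem by auto
  moreover have "\<nu> i = 0" if "b \<le> i" for i
  proof (rule ccontr)
    assume "\<nu> i \<noteq> 0"
    then have "(i, 0) \<in> I" using mem by simp
    then obtain i' j' where A: "\<mu> i' \<le> j'" "j' < lam \<mu> u n i'" "i \<le> i'" unfolding inI by blast
    then have "cnt u i' n = 0" using cnt_zero[OF l, of i' n] that by simp
    then show False using A by (simp add: lam_def)
  qed
  ultimately show ?thesis using that unfolding I_def by blast
qed

text \<open>The invariant of rectification. The valuation is controlled for the length
  \<open>n\<close> only, and the inner cells are tied to \<open>\<mu>\<close> so that their number
  measures progress.\<close>

definition skew_state :: "nat \<Rightarrow> nat \<Rightarrow> (nat \<Rightarrow> nat) \<Rightarrow> tab \<Rightarrow> bool" where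
  "skew_state b n u0 T \<longleftrightarrow> (\<exists>\<mu> u. T = tabw \<mu> u n 0 \<and> letters b u \<and> zero_tail n u \<and> skew \<mu> u
     \<and> inner_cells (dom T) = {(i, j). j < \<mu> i} \<and> (\<forall>i\<ge>b. \<mu> i = 0) \<and> (\<forall>x. good b x \<longrightarrow> V b u n x = V b u0 n x))"

lemma skew_stateI:
  assumes "letters b u" "zero_tail n u" "skew \<mu> u" "\<And>x. good b x \<Longrightarrow> V b u n x = V b u0 n x"
  shows "skew_state b n u0 (tabw \<mu> u n 0)"
proof -
  obtain \<nu> where "tabw \<mu> u n 0 = tabw \<nu> u n 0" "skew \<nu> u"
    "inner_cells (dom (tabw \<mu> u n 0)) = {(i, j). j < \<nu> i}" "\<And>i. b \<le> i \<Longrightarrow> \<nu> i = 0"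
    using canonical_shape[OF assms(1-3)] by blast
  then show ?thesis unfolding skew_state_def using assms by blast
qed

text \<open>A slide into any inner corner. The corner picked by the choice operator in
  \<open>rect_step\<close> is thus irrelevant, and the outer slides of \<open>RectStar\<close>
  become moves of the same kind after a half turn.\<close>

definition rect_move :: "tab \<Rightarrow> tab \<Rightarrow> bool" where
  "rect_move T T' \<longleftrightarrow> (if inner_cells (dom T) = {} then T' = T
     else \<exists>c. inner_corner (dom T) c \<and> T' = fst (jdt_slide T c))"

lemma inner_cells_finite:
  assumes "skew_state b n u0 T" shows "finite (inner_cells (dom T))"
proof -
  obtain \<mu> where "inner_cells (dom T) = {(i, j). j < \<mu> i}" "\<forall>i\<ge>b. \<mu> i = 0"
    using assms by (auto simp: skew_state_def)
  then have "inner_cells (dom T) \<subseteq> Sigma {..<b} (\<lambda>i. {..<\<mu> i})" by (force simp: not_le[symmetric])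
  then show ?thesis by (rule finite_subset) simp
qed

lemma inner_corner_exists:
  assumes "skew_state b n u0 T" "inner_cells (dom T) \<noteq> {}" shows "\<exists>c. inner_corner (dom T) c"
proof -
  obtain \<mu> where I: "inner_cells (dom T) = {(i, j). j < \<mu> i}" and z: "\<And>i. b \<le> i \<Longrightarrow> \<mu> i = 0"
    using assms(1) by (auto simp: skew_state_def)
  let ?S = "{i. i < b \<and> \<mu> i > 0}"
  obtain i j where "j < \<mu> i" using assms(2) I by auto
  moreover have "i < b" by (rule ccontr) (use z[of i] calculation in simp)
  ultimately have ne: "?S \<noteq> {}" by auto
  define l where "l = Max ?S"
  have l: "l \<in> ?S" unfolding l_def by (rule Max_in[OF _ ne]) simp
  have "\<mu> (Suc l) = 0"
  proof (rule ccontr)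
    assume A: "\<mu> (Suc l) \<noteq> 0"
    then have "Suc l < b" using z[of "Suc l"] by (meson not_le)
    then have "Suc l \<in> ?S" using A by simp
    then have "Suc l \<le> l" unfolding l_def by (intro Max_ge) auto
    then show False by simp
  qed
  then have "inner_corner (dom T) (l, \<mu> l - 1)" using l by (auto simp: inner_corner_def I)
  then show ?thesis by blast
qed

text \<open>The starting cell of the slide ceases to be an inner cell and no new inner cell
  appears.\<close>

lemma rect_move_state:
  assumes st: "skew_state b n u0 T" and mv: "rect_move T T'"
  shows "skew_state b n u0 T'" "inner_cells (dom T) \<noteq> {} \<Longrightarrow> card (inner_cells (dom T')) < card (inner_cells (dom T))"
proof -
  obtain \<mu> u where T: "T = tabw \<mu> u n 0" "letters b u" "zero_tail n u" "skew \<mu> u"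
    "inner_cells (dom T) = {(i, j). j < \<mu> i}" "\<And>x. good b x \<Longrightarrow> V b u n x = V b u0 n x"
    using st by (auto simp: skew_state_def)
  have main: "skew_state b n u0 T' \<and> card (inner_cells (dom T')) < card (inner_cells (dom T))"
    if ne: "inner_cells (dom T) \<noteq> {}"
  proof -
    obtain l j where c: "inner_corner (dom T) (l, j)" "T' = fst (jdt_slide T (l, j))"
      using mv ne by (auto simp: rect_move_def)
    have j: "j = \<mu> l - 1" "\<mu> (Suc l) < \<mu> l" "j < \<mu> l" using c(1) by (auto simp: inner_corner_def T(5))
    let ?m = "\<mu>(l := \<mu> l - 1)" and ?v = "sl \<mu> u l"
    have T': "T' = tabw ?m ?v n 0" using c(2) jdt_slide_tabw[OF T(4) j(2), of n 0] unfolding T(1) j(1) by simp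
    have sk: "skew ?m ?v" by (rule skew_sl[OF T(4) j(2)])
    have zt: "zero_tail n ?v" using T(3) sl_le[of \<mu> u l] unfolding zero_tail_def by (metis le_zero_eq)
    have "skew_state b n u0 T'"
      unfolding T' by (rule skew_stateI[OF letters_sl[OF T(2)] zt sk]) (use V_sl[OF T(2) _ T(4) j(2)] T(6) in simp)
    moreover have "inner_cells (dom T') \<subseteq> inner_cells (dom T) - {(l, j)}"
    proof
      fix c assume c: "c \<in> inner_cells (dom T')"
      obtain i j' where "c = (i, j')" by fastforce
      then show "c \<in> inner_cells (dom T) - {(l, j)}"
        using inner_cells_tabw[OF sk, of i j' n 0] c j unfolding T(5) T' by (auto split: if_splits)
    qed
    moreover have "(l, j) \<in> inner_cells (dom T)" using j T(5) by simp
    ultimately show ?thesis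
      using inner_cells_finite[OF st] by (metis card_Diff1_less card_mono finite_Diff le_less_trans)
  qed
  show "skew_state b n u0 T'"
    using main st mv by (cases "inner_cells (dom T) = {}") (auto simp: rect_move_def)
  show "inner_cells (dom T) \<noteq> {} \<Longrightarrow> card (inner_cells (dom T')) < card (inner_cells (dom T))"
    using main by blast
qed

lemma rect_moves:
  assumes "skew_state b n u0 (X 0)" "\<And>k. skew_state b n u0 (X k) \<Longrightarrow> rect_move (X k) (X (Suc k))"
    "K = card (inner_cells (dom (X 0)))"
  obtains q where "X K = tabw (\<lambda>i. 0) q n 0" "letters b q" "lattice q" "\<And>x. good b x \<Longrightarrow> V b q n x = V b u0 n x"
proof -
  have st: "skew_state b n u0 (X k)" for k
    by (induction k) (use assms(1,2) rect_move_state(1) in blast)+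
  have "card (inner_cells (dom (X k))) \<le> K - k" for k
  proof (induction k)
    case (Suc k)
    show ?case
    proof (cases "inner_cells (dom (X k)) = {}")
      case True
      then show ?thesis using assms(2)[OF st] by (simp add: rect_move_def)
    next
      case False
      then show ?thesis using rect_move_state(2)[OF st assms(2)[OF st] False] Suc by simp
    qed
  qed (use assms(3) in simp)
  from this[of K] have "inner_cells (dom (X K)) = {}" using inner_cells_finite[OF st] by simp
  then obtain \<mu> q where q: "X K = tabw \<mu> q n 0" "letters b q" "skew \<mu> q" "{(i, j). j < \<mu> i} = {}" "\<forall>x. good b x \<longrightarrow> V b q n x = V b u0 n x"
    using st[of K] unfolding skew_state_def by auto
  have "\<mu> = (\<lambda>i. 0)" using q(4) by fastforce
  then show ?thesis using that q skew_zero by simp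
qed

lemma Rect_tabw:
  assumes "letters b u" "zero_tail n u" "skew \<mu> u"
  obtains q where "Rect (tabw \<mu> u n 0) = tabw (\<lambda>i. 0) q n 0" "letters b q" "lattice q" "\<And>x. good b x \<Longrightarrow> V b q n x = V b u n x"
proof -
  let ?X = "\<lambda>k. (rect_step ^^ k) (tabw \<mu> u n 0)"
  have s0: "skew_state b n u (?X 0)" using skew_stateI[OF assms] by simp
  have mv: "rect_move T (rect_step T)" if "skew_state b n u T" for T
  proof (cases "inner_cells (dom T) = {}")
    case True
    then show ?thesis by (simp add: rect_move_def rect_step_def)
  next
    case False
    have "inner_corner (dom T) (SOME c. inner_corner (dom T) c)" by (rule someI_ex[OF inner_corner_exists[OF that False]])
    then show ?thesis unfolding rect_move_def rect_step_def using False by metis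
  qed
  show ?thesis
    by (rule rect_moves[of b n u ?X "card (inner_cells (dom (?X 0)))"]) (use s0 mv that in \<open>auto simp: Rect_def\<close>)
qed

section \<open>Half turns: outer slides as inner slides\<close>

definition rotc :: "nat \<Rightarrow> nat \<Rightarrow> nat \<times> nat \<Rightarrow> nat \<times> nat" where
  "rotc b W c = (b - 1 - fst c, W - 1 - snd c)"

definition rot_tab :: "nat \<Rightarrow> nat \<Rightarrow> nat \<Rightarrow> tab \<Rightarrow> tab" where
  "rot_tab b W n T c = (if c \<in> rect b W then map_option (\<lambda>v. Suc n - v) (T (rotc b W c)) else None)"

text \<open>The bound on the entries makes the subtraction of natural numbers in
  \<open>rot_tab\<close> reversible.\<close>

definition boxed :: "nat \<Rightarrow> nat \<Rightarrow> nat \<Rightarrow> tab \<Rightarrow> bool" where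
  "boxed b W n T \<longleftrightarrow> dom T \<subseteq> rect b W \<and> (\<forall>c v. T c = Some v \<longrightarrow> v \<le> n)"

lemma boxedD: "boxed b W n T \<Longrightarrow> dom T \<subseteq> rect b W" "boxed b W n T \<Longrightarrow> T c = Some v \<Longrightarrow> v \<le> n"
  unfolding boxed_def by blast+

lemma rect_iff: "c \<in> rect b W \<longleftrightarrow> fst c < b \<and> snd c < W"
  by (cases c) (simp add: rect_def)

lemma rotc_rect: "c \<in> rect b W \<Longrightarrow> rotc b W c \<in> rect b W" "c \<in> rect b W \<Longrightarrow> rotc b W (rotc b W c) = c"
  by (cases c; auto simp: rotc_def rect_def)+

lemma rotc_inj: "inj_on (rotc b W) (rect b W)"
  by (rule inj_onI) (metis rotc_rect(2))

lemma rot_tab_rotc: "c \<in> rect b W \<Longrightarrow> rot_tab b W n T (rotc b W c) = map_option (\<lambda>v. Suc n - v) (T c)"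
  by (simp add: rot_tab_def rotc_rect)

lemma rot_tab_outside: "c \<notin> rect b W \<Longrightarrow> rot_tab b W n T c = None"
  by (simp add: rot_tab_def)

lemma rot_tab_dom: "boxed b W n T \<Longrightarrow> dom (rot_tab b W n T) = rotc b W ` dom T"
proof (intro equalityI subsetI)
  assume B: "boxed b W n T"
  { fix c assume "c \<in> dom (rot_tab b W n T)"
    then have "c \<in> rect b W" "rotc b W c \<in> dom T" by (auto simp: rot_tab_def split: if_splits)
    then show "c \<in> rotc b W ` dom T" using rotc_rect(2)[of c b W] by (metis imageI) }
  { fix c assume "c \<in> rotc b W ` dom T"
    then obtain d where d: "c = rotc b W d" "d \<in> dom T" by (rule imageE)
    then have "d \<in> rect b W" using B by (auto simp: boxed_def)
    then show "c \<in> dom (rot_tab b W n T)" using d rot_tab_rotc[of d b W n T] by auto }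
qed

lemma rot_tab_rot_tab: "boxed b W n T \<Longrightarrow> rot_tab b W n (rot_tab b W n T) = T"
proof
  fix c assume B: "boxed b W n T"
  show "rot_tab b W n (rot_tab b W n T) c = T c"
  proof (cases "c \<in> rect b W")
    case True
    then have "rot_tab b W n (rot_tab b W n T) c = map_option (\<lambda>v. Suc n - v) (map_option (\<lambda>v. Suc n - v) (T c))"
      using rot_tab_rotc[OF True, of n T] by (simp add: rot_tab_def)
    also have "\<dots> = T c"
    proof (cases "T c")
      case (Some v) then show ?thesis using boxedD(2)[OF B Some] by simp
    qed simp
    finally show ?thesis .
  next
    case False
    then show ?thesis using boxedD(1)[OF B] by (cases "T c") (auto simp: rot_tab_def)
  qed
qed

lemma rot_tab_upd:
  assumes "c \<in> rect b W"
  shows "rot_tab b W n (T(c := x)) = (rot_tab b W n T)(rotc b W c := map_option (\<lambda>v. Suc n - v) x)"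
proof
  fix d
  have "d \<in> rect b W \<Longrightarrow> rotc b W d = c \<longleftrightarrow> d = rotc b W c" using assms rotc_rect(2)[of _ b W] by metis
  then show "rot_tab b W n (T(c := x)) d = ((rot_tab b W n T)(rotc b W c := map_option (\<lambda>v. Suc n - v) x)) d"
    using rotc_rect(1)[OF assms] by (auto simp: rot_tab_def)
qed

lemma boxed_upd: "boxed b W n T \<Longrightarrow> c \<in> rect b W \<Longrightarrow> v \<le> n \<Longrightarrow> boxed b W n (T(c := Some v))"
  "boxed b W n T \<Longrightarrow> boxed b W n (T(c := None))"
  by (auto simp: boxed_def split: if_splits)

text \<open>The half turn exchanges left with right and up with down, and complementing the entries
  reverses comparisons. In case of a tie both rules choose the vertical neighbour.\<close>

lemma rjdt_step_rot:
  assumes B: "boxed b W n T" and c: "c \<in> rect b W" and s: "rjdt_step (T, c) = (T', c')"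
  shows "jdt_step (rot_tab b W n T, rotc b W c) = (rot_tab b W n T', rotc b W c')" "boxed b W n T'" "c' \<in> rect b W"
proof -
  obtain i j where ij: "c = (i, j)" by fastforce
  have lt: "i < b" "j < W" using c ij by (auto simp: rect_def)
  let ?f = "\<lambda>v. Suc n - v"
  let ?T = "rot_tab b W n T"
  obtain i1 j1 where r: "rotc b W (i, j) = (i1, j1)" by fastforce
  have ij1: "i1 = b - 1 - i" "j1 = W - 1 - j" using r by (auto simp: rotc_def)
  have R: "?T (i1, Suc j1) = map_option ?f (if j = 0 then None else T (i, j - 1))"
  proof (cases "j = 0")
    case True then show ?thesis using lt ij1 by (simp add: rot_tab_outside rect_def)
  next
    case False
    then have "(i1, Suc j1) = rotc b W (i, j - 1)" "(i, j - 1) \<in> rect b W" using lt ij1 by (auto simp: rotc_def rect_def)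
    then show ?thesis using rot_tab_rotc[of "(i, j - 1)" b W n T] False by simp
  qed
  have L: "?T (Suc i1, j1) = map_option ?f (if i = 0 then None else T (i - 1, j))"
  proof (cases "i = 0")
    case True then show ?thesis using lt ij1 by (simp add: rot_tab_outside rect_def)
  next
    case False
    then have "(Suc i1, j1) = rotc b W (i - 1, j)" "(i - 1, j) \<in> rect b W" using lt ij1 by (auto simp: rotc_def rect_def)
    then show ?thesis using rot_tab_rotc[of "(i - 1, j)" b W n T] False by simp
  qed
  have val: "T d = Some v \<Longrightarrow> v \<le> n" for d v by (rule boxedD(2)[OF B])
  define Lv where "Lv = (if j = 0 then None else T (i, j - 1))"
  define Uv where "Uv = (if i = 0 then None else T (i - 1, j))"
  note R = R[folded Lv_def] and L = L[folded Uv_def]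
  have step: "rjdt_step (T, (i, j)) = (case (Lv, Uv) of (None, None) \<Rightarrow> (T, (i, j))
      | (Some x, None) \<Rightarrow> (T((i, j) := Some x, (i, j - 1) := None), (i, j - 1))
      | (None, Some y) \<Rightarrow> (T((i, j) := Some y, (i - 1, j) := None), (i - 1, j))
      | (Some x, Some y) \<Rightarrow> if y < x then (T((i, j) := Some x, (i, j - 1) := None), (i, j - 1))
          else (T((i, j) := Some y, (i - 1, j) := None), (i - 1, j)))"
    unfolding rjdt_step_def Let_def prod.case Lv_def Uv_def ..
  have "Lv = None \<and> Uv = None \<and> T' = T \<and> c' = (i, j)
    \<or> (\<exists>x. Lv = Some x \<and> (\<forall>y. Uv = Some y \<longrightarrow> y < x) \<and> T' = T((i, j) := Some x, (i, j - 1) := None) \<and> c' = (i, j - 1))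
    \<or> (\<exists>y. Uv = Some y \<and> (\<forall>x. Lv = Some x \<longrightarrow> x \<le> y) \<and> T' = T((i, j) := Some y, (i - 1, j) := None) \<and> c' = (i - 1, j))"
    using s unfolding ij step by (cases Lv; cases Uv) (auto split: if_splits)
  then consider (stop) "Lv = None" "Uv = None" "T' = T" "c' = (i, j)"
    | (left) x where "Lv = Some x" "\<And>y. Uv = Some y \<Longrightarrow> y < x" "T' = T((i, j) := Some x, (i, j - 1) := None)" "c' = (i, j - 1)"
    | (up) y where "Uv = Some y" "\<And>x. Lv = Some x \<Longrightarrow> x \<le> y" "T' = T((i, j) := Some y, (i - 1, j) := None)" "c' = (i - 1, j)"
    by blast
  then have "jdt_step (?T, (i1, j1)) = (rot_tab b W n T', rotc b W c') \<and> boxed b W n T' \<and> c' \<in> rect b W"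
  proof cases
    case stop
    then show ?thesis using R L B c r ij jdt_step_stop[of ?T i1 j1] by simp
  next
    case (left x)
    have j: "j \<noteq> 0" "T (i, j - 1) = Some x" using left(1) by (auto simp: Lv_def split: if_splits)
    have inb: "(i, j - 1) \<in> rect b W" "(i, j) \<in> rect b W" using lt by (auto simp: rect_def)
    have rc: "rotc b W (i, j - 1) = (i1, Suc j1)" using j lt ij1 by (auto simp: rotc_def)
    have "jdt_step (?T, (i1, j1)) = (?T((i1, j1) := Some (?f x), (i1, Suc j1) := None), (i1, Suc j1))"
    proof (rule jdt_step_right)
      show "?T (i1, Suc j1) = Some (?f x)" using R left(1) by simp
      fix y' assume "?T (Suc i1, j1) = Some y'"
      then obtain y where y: "Uv = Some y" "y' = ?f y" using L by auto
      then show "?f x < y'" using left(2)[OF y(1)] val[OF j(2)] by simp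
    qed
    then show ?thesis
      unfolding left(3,4) rot_tab_upd[OF inb(1)] rot_tab_upd[OF inb(2)] rc r
      using boxed_upd(1)[OF B inb(2) val[OF j(2)]] boxed_upd(2) inb by simp
  next
    case (up y)
    have i: "i \<noteq> 0" "T (i - 1, j) = Some y" using up(1) by (auto simp: Uv_def split: if_splits)
    have inb: "(i - 1, j) \<in> rect b W" "(i, j) \<in> rect b W" using lt by (auto simp: rect_def)
    have rc: "rotc b W (i - 1, j) = (Suc i1, j1)" using i lt ij1 by (auto simp: rotc_def)
    have "jdt_step (?T, (i1, j1)) = (?T((i1, j1) := Some (?f y), (Suc i1, j1) := None), (Suc i1, j1))"
    proof -
      have 1: "?T (Suc i1, j1) = Some (?f y)" using L up(1) by simp
      have 2: "?f y \<le> x'" if e: "?T (i1, Suc j1) = Some x'" for x'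
      proof -
        obtain x where x: "Lv = Some x" "x' = ?f x" using R e by (cases Lv) auto
        then show ?thesis using up(2)[OF x(1)] by simp
      qed
      show ?thesis using 1 2 by (cases "?T (i1, Suc j1)") (auto simp: jdt_step_def Let_def not_less[symmetric])
    qed
    then show ?thesis
      unfolding up(3,4) rot_tab_upd[OF inb(1)] rot_tab_upd[OF inb(2)] rc r
      using boxed_upd(1)[OF B inb(2) val[OF i(2)]] boxed_upd(2) inb by simp
  qed
  then show "jdt_step (rot_tab b W n T, rotc b W c) = (rot_tab b W n T', rotc b W c')" "boxed b W n T'" "c' \<in> rect b W"
    using r ij by simp_all
qed

lemma rjdt_slide_rot:
  assumes B: "boxed b W n T" and c: "c \<in> rect b W"
  shows "fst (jdt_slide (rot_tab b W n T) (rotc b W c)) = rot_tab b W n (fst (rjdt_slide T c))" "boxed b W n (fst (rjdt_slide T c))"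
proof -
  have "card (dom (rot_tab b W n T)) = card (dom T)"
    unfolding rot_tab_dom[OF B] by (rule card_image[OF inj_on_subset[OF rotc_inj]]) (use B in \<open>simp add: boxed_def\<close>)
  moreover have "(jdt_step ^^ k) (rot_tab b W n T, rotc b W c) = (rot_tab b W n (fst ((rjdt_step ^^ k) (T, c))), rotc b W (snd ((rjdt_step ^^ k) (T, c))))
      \<and> boxed b W n (fst ((rjdt_step ^^ k) (T, c))) \<and> snd ((rjdt_step ^^ k) (T, c)) \<in> rect b W" for k
  proof (induction k)
    case (Suc k)
    obtain T1 c1 where 1: "(rjdt_step ^^ k) (T, c) = (T1, c1)" by (cases "(rjdt_step ^^ k) (T, c)")
    obtain T2 c2 where 2: "rjdt_step (T1, c1) = (T2, c2)" by (cases "rjdt_step (T1, c1)")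
    have "boxed b W n T1" "c1 \<in> rect b W" using Suc 1 by simp_all
    then show ?case using rjdt_step_rot[OF _ _ 2, of b W n] Suc 1 2 by simp
  qed (use B c in simp)
  ultimately show "fst (jdt_slide (rot_tab b W n T) (rotc b W c)) = rot_tab b W n (fst (rjdt_slide T c))" "boxed b W n (fst (rjdt_slide T c))"
    by (simp_all add: jdt_slide_def rjdt_slide_def)
qed

lemma inner_cells_rot:
  assumes D: "D \<subseteq> rect b W" shows "inner_cells (rotc b W ` D) = rotc b W ` outer_cells (rect b W) D"
proof (intro equalityI subsetI)
  fix c assume c: "c \<in> inner_cells (rotc b W ` D)"
  then obtain d where d: "d \<in> D" "fst c \<le> fst (rotc b W d)" "snd c \<le> snd (rotc b W d)" by (auto simp: inner_cells_def)
  have db: "d \<in> rect b W" using d D by auto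
  have cb: "c \<in> rect b W" using d(2,3) rotc_rect(1)[OF db] by (simp add: rect_iff)
  have "rotc b W c \<notin> D" using c rotc_rect(2)[OF cb] by (auto simp: inner_cells_def) (metis imageI)
  moreover have "fst d \<le> fst (rotc b W c)" "snd d \<le> snd (rotc b W c)"
    using d db cb by (auto simp: rotc_def rect_def)
  ultimately have "rotc b W c \<in> outer_cells (rect b W) D" using rotc_rect(1)[OF cb] d(1) by (auto simp: outer_cells_def)
  then show "c \<in> rotc b W ` outer_cells (rect b W) D" using rotc_rect(2)[OF cb] by (metis imageI)
next
  fix c assume "c \<in> rotc b W ` outer_cells (rect b W) D"
  then obtain e where e: "c = rotc b W e" "e \<in> outer_cells (rect b W) D" by (rule imageE)
  have eb: "e \<in> rect b W" "e \<notin> D" using e by (auto simp: outer_cells_def)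
  obtain d where d: "d \<in> D" "fst d \<le> fst e" "snd d \<le> snd e" using e by (auto simp: outer_cells_def)
  have "c \<notin> rotc b W ` D"
  proof
    assume "c \<in> rotc b W ` D"
    then obtain x where "c = rotc b W x" "x \<in> D" by (rule imageE)
    then have "x = e" using inj_onD[OF rotc_inj, of b W x e] e(1) eb D by auto
    then show False using eb \<open>x \<in> D\<close> by simp
  qed
  moreover have "fst c \<le> fst (rotc b W d)" "snd c \<le> snd (rotc b W d)" using d e(1) by (auto simp: rotc_def)
  ultimately show "c \<in> inner_cells (rotc b W ` D)" using d(1) by (auto simp: inner_cells_def)
qed

lemma inner_corner_rot:
  assumes D: "D \<subseteq> rect b W" and c: "c \<in> rect b W"
  shows "inner_corner (rotc b W ` D) (rotc b W c) \<longleftrightarrow> outer_corner (rect b W) D c"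
proof -
  obtain i j where ij: "c = (i, j)" by fastforce
  have lt: "i < b" "j < W" using c ij by (auto simp: rect_def)
  have ob: "outer_cells (rect b W) D \<subseteq> rect b W" by (auto simp: outer_cells_def)
  have mem: "rotc b W d \<in> rotc b W ` outer_cells (rect b W) D \<longleftrightarrow> d \<in> outer_cells (rect b W) D" if "d \<in> rect b W" for d
    using inj_on_image_mem_iff[OF rotc_inj that ob] .
  have out: "d \<notin> rotc b W ` outer_cells (rect b W) D" if "d \<notin> rect b W" for d
    using that ob rotc_rect(1) by blast
  have 1: "(fst (rotc b W c), Suc (snd (rotc b W c))) \<notin> rotc b W ` outer_cells (rect b W) D
      \<longleftrightarrow> j = 0 \<or> (i, j - 1) \<notin> outer_cells (rect b W) D"
  proof (cases "j = 0")
    case True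
    then have "(fst (rotc b W c), Suc (snd (rotc b W c))) \<notin> rect b W" using lt ij by (simp add: rotc_def rect_def)
    then show ?thesis using out True by blast
  next
    case False
    then have "(fst (rotc b W c), Suc (snd (rotc b W c))) = rotc b W (i, j - 1)" "(i, j - 1) \<in> rect b W"
      using lt ij by (auto simp: rotc_def rect_def)
    then show ?thesis using mem False by metis
  qed
  have 2: "(Suc (fst (rotc b W c)), snd (rotc b W c)) \<notin> rotc b W ` outer_cells (rect b W) D
      \<longleftrightarrow> i = 0 \<or> (i - 1, j) \<notin> outer_cells (rect b W) D"
  proof (cases "i = 0")
    case True
    then have "(Suc (fst (rotc b W c)), snd (rotc b W c)) \<notin> rect b W" using lt ij by (simp add: rotc_def rect_def)
    then show ?thesis using out True by blast
  next
    case False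
    then have "(Suc (fst (rotc b W c)), snd (rotc b W c)) = rotc b W (i - 1, j)" "(i - 1, j) \<in> rect b W"
      using lt ij by (auto simp: rotc_def rect_def)
    then show ?thesis using mem False by metis
  qed
  show ?thesis
    unfolding inner_corner_def outer_corner_def inner_cells_rot[OF D] 1 2 mem[OF c] by (simp add: ij)
qed

lemma rstar_move:
  assumes B: "boxed b W n T" and st: "skew_state b n u0 (rot_tab b W n T)"
  shows "rect_move (rot_tab b W n T) (rot_tab b W n (rstar_step (rect b W) T))" "boxed b W n (rstar_step (rect b W) T)"
proof -
  have D: "dom T \<subseteq> rect b W" using B by (simp add: boxed_def)
  note dr = rot_tab_dom[OF B]
  have "rect_move (rot_tab b W n T) (rot_tab b W n (rstar_step (rect b W) T)) \<and> boxed b W n (rstar_step (rect b W) T)"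
  proof (cases "outer_cells (rect b W) (dom T) = {}")
    case True
    then show ?thesis using B inner_cells_rot[OF D] by (simp add: rstar_step_def rect_move_def dr)
  next
    case False
    then have ne: "inner_cells (dom (rot_tab b W n T)) \<noteq> {}" unfolding dr inner_cells_rot[OF D] by simp
    obtain c' where c': "inner_corner (rotc b W ` dom T) c'" using inner_corner_exists[OF st ne] unfolding dr by blast
    then have "c' \<in> rotc b W ` outer_cells (rect b W) (dom T)" unfolding inner_corner_def inner_cells_rot[OF D] by blast
    then obtain c where c: "c' = rotc b W c" "c \<in> outer_cells (rect b W) (dom T)" by (rule imageE)
    have "c \<in> rect b W" using c(2) by (simp add: outer_cells_def)
    then have ex: "\<exists>c. outer_corner (rect b W) (dom T) c" using c' c(1) inner_corner_rot[OF D] by blast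
    define c0 where "c0 = (SOME c. outer_corner (rect b W) (dom T) c)"
    have c0: "outer_corner (rect b W) (dom T) c0" unfolding c0_def by (rule someI_ex[OF ex])
    have c0b: "c0 \<in> rect b W" using c0 by (simp add: outer_corner_def outer_cells_def)
    have s: "rstar_step (rect b W) T = fst (rjdt_slide T c0)" using False by (simp add: rstar_step_def c0_def)
    have "inner_corner (dom (rot_tab b W n T)) (rotc b W c0)" unfolding dr using inner_corner_rot[OF D c0b] c0 by blast
    then show ?thesis unfolding s using rjdt_slide_rot[OF B c0b] ne unfolding rect_move_def by metis
  qed
  then show "rect_move (rot_tab b W n T) (rot_tab b W n (rstar_step (rect b W) T))" "boxed b W n (rstar_step (rect b W) T)" by auto
qed

lemma rot_tabw:
  assumes l: "letters b u" and D: "\<And>i. i < b \<Longrightarrow> lam \<mu> u n i \<le> W"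
  shows "rot_tab b W n (tabw \<mu> u n 0) = tabw (\<lambda>i. if i < b then W - lam \<mu> u n (b - 1 - i) else 0) (revw b n u) n 0"
    (is "_ = tabw ?m ?v n 0")
proof -
  have ub: "u t < b" for t using l by (simp add: letters_def)
  have box: "pos \<mu> u t \<in> rect b W" if "t < n" for t
    using ub[of t] lam_less[OF that, of \<mu> u] D[OF ub[of t]] by (simp add: pos_def rect_def)
  have rp: "pos ?m ?v s = rotc b W (pos \<mu> u (n - 1 - s))" if s: "s < n" for s
  proof -
    define t where "t = n - 1 - s"
    have t: "t < n" "n - s = Suc t" using s by (auto simp: t_def)
    have v: "?v s = b - 1 - u t" using s by (simp add: revw_def t_def)
    have i: "b - 1 - u t < b" "b - 1 - (b - 1 - u t) = u t" using ub[of t] by auto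
    have "cnt ?v (b - 1 - u t) s + cnt u (u t) (Suc t) = cnt u (u t) n"
      using cnt_revw[OF l i(1), of s n] s unfolding i(2) t(2) by simp
    moreover have "\<mu> (u t) + cnt u (u t) n \<le> W" using D[OF ub[of t]] by (simp add: lam_def)
    ultimately have "lam ?m ?v s (b - 1 - u t) = W - 1 - lam \<mu> u t (u t)"
      using i by (simp add: lam_def)
    then show ?thesis unfolding t_def[symmetric] by (simp add: pos_def v rotc_def)
  qed
  show ?thesis
    unfolding tabw_def[of ?m]
  proof (rule tabf_eqI[OF pos_inj])
    fix s assume s: "s < n"
    then have t: "n - 1 - s < n" by simp
    show "rot_tab b W n (tabw \<mu> u n 0) (pos ?m ?v s) = Some (0 + Suc s)"
      unfolding rp[OF s] rot_tab_rotc[OF box[OF t]] tabw_Some[OF t] using s by simp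
  next
    fix c assume c: "c \<notin> pos ?m ?v ` {..<n}"
    show "rot_tab b W n (tabw \<mu> u n 0) c = None"
    proof (rule ccontr)
      assume A: "rot_tab b W n (tabw \<mu> u n 0) c \<noteq> None"
      then have cb: "c \<in> rect b W" "tabw \<mu> u n 0 (rotc b W c) \<noteq> None" by (auto simp: rot_tab_def split: if_splits)
      then have "rotc b W c \<in> dom (tabw \<mu> u n 0)" by auto
      then obtain t where t: "rotc b W c = pos \<mu> u t" "t \<in> {..<n}" unfolding tabw_def tabf_dom by (rule imageE)
      have "n - 1 - t < n" "n - 1 - (n - 1 - t) = t" using t(2) by auto
      then have "pos ?m ?v (n - 1 - t) = c" using rp[of "n - 1 - t"] t(1) rotc_rect(2)[OF cb(1)] by simp
      then show False using c \<open>n - 1 - t < n\<close> by blast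
    qed
  qed
qed

lemma skew_rot:
  assumes l: "letters b u" and sk: "skew \<mu> u" and W: "lam \<mu> u n 0 \<le> W"
  shows "skew (\<lambda>i. if i < b then W - lam \<mu> u n (b - 1 - i) else 0) (revw b n u)" (is "skew ?m ?v")
    "i < b \<Longrightarrow> lam \<mu> u n i \<le> W"
proof -
  have le: "lam \<mu> u n i \<le> W" for i

  proof -
    have "lam \<mu> u n i \<le> lam \<mu> u n 0" by (rule lift_Suc_antimono_le[of "lam \<mu> u n"]) (simp_all add: skewD[OF sk])
    then show ?thesis using W by simp
  qed
  then show "i < b \<Longrightarrow> lam \<mu> u n i \<le> W" .
  have ub: "u t < b" for t using l by (simp add: letters_def)
  have lb: "letters b ?v" by (rule letters_revw) (use ub[of 0] in simp)
  have lm: "lam ?m ?v t i + lam \<mu> u (n - t) (b - 1 - i) = W" if "i < b" "t \<le> n" for i t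
    using cnt_revw[OF l that] le[of "b - 1 - i"] that(1) by (simp add: lam_def)
  show "skew ?m ?v"
    unfolding skew_def
  proof (intro allI)
    fix t i
    show "lam ?m ?v t (Suc i) \<le> lam ?m ?v t i"
    proof (cases "Suc i < b")
      case False
      then show ?thesis using cnt_zero[OF lb, of "Suc i" t] by (simp add: lam_def)
    next
      case i: True
      have e: "b - 1 - i = Suc (b - 1 - Suc i)" using i by simp
      have small: "lam ?m ?v s (Suc i) \<le> lam ?m ?v s i" if "s \<le> n" for s
        using lm[OF i that] lm[of i s] that i skewD[OF sk, of "n - s" "b - 1 - Suc i"] unfolding e by simp
      show ?thesis
      proof (cases "t \<le> n")
        case True then show ?thesis by (rule small)
      next
        case False
        have "zero_tail n ?v" by (simp add: zero_tail_def revw_def)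
        then have "lam ?m ?v t (Suc i) \<le> lam ?m ?v n (Suc i)" using cnt_zero_tail[of n ?v "Suc i" t] by (simp add: lam_def)
        also have "\<dots> \<le> lam ?m ?v n i" by (rule small) simp
        also have "\<dots> \<le> lam ?m ?v t i" by (rule lam_mono) (use False in simp)
        finally show ?thesis .
      qed
    qed
  qed
qed

text \<open>After a half turn the outer slides are rectification moves of the reversed word. A
  nonempty top row guarantees that the rectangle used by \<open>RectStar\<close> is wide enough for
  all rows.\<close>

lemma RectStar_tabw:
  assumes l: "letters b u" and sk: "skew \<mu> u" and ne: "0 < cnt u 0 n"
  obtains q \<nu> where "RectStar b (tabw \<mu> u n 0) = tabw \<nu> (revw b n q) n 0" "letters b q" "lattice q"
    "\<And>x. good b x \<Longrightarrow> V b q n x = V b (revw b n u) n x"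
proof -
  define T where "T = tabw \<mu> u n 0"
  define W where "W = Suc (Max (snd ` dom T))"
  have fin: "finite (snd ` dom T)" unfolding T_def using tabw_card(2) by blast
  have b1: "1 \<le> b" using l unfolding letters_def by (metis Suc_leI gr_implies_not0 not_gr_zero One_nat_def)
  have "(0, lam \<mu> u n 0 - 1) \<in> dom T" unfolding T_def tabw_dom using ne by (auto simp: lam_def)
  then have "lam \<mu> u n 0 - 1 \<le> Max (snd ` dom T)" using fin by (intro Max_ge) (auto intro!: rev_image_eqI)
  then have lW: "lam \<mu> u n 0 \<le> W" using ne by (simp add: W_def)
  have box: "boxed b W n T"
    unfolding boxed_def
  proof (intro conjI allI impI subsetI)
    fix c assume c: "c \<in> dom T"
    then have "snd c \<le> Max (snd ` dom T)" using fin by (intro Max_ge) auto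
    moreover have "fst c < b"
      using c l unfolding T_def tabw_def tabf_dom by (auto simp: pos_def letters_def)
    ultimately show "c \<in> rect b W" by (cases c) (simp add: rect_def W_def)
  next
    fix c v assume "T c = Some v"
    then obtain s where "s < n" "v = 0 + Suc s" unfolding T_def tabw_def by (rule tabf_SomeE[OF pos_inj])
    then show "v \<le> n" by simp
  qed
  note sr = skew_rot[OF l sk lW]
  let ?v = "revw b n u"
  let ?X = "\<lambda>k. rot_tab b W n ((rstar_step (rect b W) ^^ k) T)"
  have X0: "?X 0 = tabw (\<lambda>i. if i < b then W - lam \<mu> u n (b - 1 - i) else 0) ?v n 0"
    unfolding T_def using rot_tabw[OF l sr(2)] by simp
  have s0: "skew_state b n ?v (?X 0)"
    unfolding X0 by (rule skew_stateI[OF letters_revw[OF b1] _ sr(1)]) (simp_all add: zero_tail_def revw_def)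
  have bx: "boxed b W n ((rstar_step (rect b W) ^^ k) T) \<and> skew_state b n ?v (?X k)" for k
  proof (induction k)
    case (Suc k)
    let ?T = "(rstar_step (rect b W) ^^ k) T"
    have "rect_move (rot_tab b W n ?T) (rot_tab b W n (rstar_step (rect b W) ?T))" "boxed b W n (rstar_step (rect b W) ?T)"
      using rstar_move[of b W n ?T ?v] Suc by blast+
    then show ?case using rect_move_state(1)[of b n ?v "rot_tab b W n ?T"] Suc by simp
  qed (use box s0 in simp)
  have mv: "rect_move (?X k) (?X (Suc k))" for k
    using rstar_move(1)[of b W n "(rstar_step (rect b W) ^^ k) T" ?v] bx[of k] by simp
  define K where "K = card (outer_cells (rect b W) (dom T))"
  have D: "dom T \<subseteq> rect b W" using box by (simp add: boxed_def)
  have K: "K = card (inner_cells (dom (?X 0)))"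
  proof -
    have "card (rotc b W ` outer_cells (rect b W) (dom T)) = K"
      unfolding K_def by (rule card_image[OF inj_on_subset[OF rotc_inj]]) (auto simp: outer_cells_def)
    then show ?thesis using rot_tab_dom[OF box] inner_cells_rot[OF D] by simp
  qed
  obtain q where q: "?X K = tabw (\<lambda>i. 0) q n 0" "letters b q" "lattice q" "\<And>x. good b x \<Longrightarrow> V b q n x = V b ?v n x"
    using rect_moves[of b n ?v ?X K] s0 mv K by blast
  have RS: "RectStar b T = (rstar_step (rect b W) ^^ K) T" by (simp add: RectStar_def W_def K_def)
  have qW: "lam (\<lambda>i. 0) q n i \<le> W" if "i < b" for i
  proof (cases "cnt q i n = 0")
    case False
    then have "(i, cnt q i n - 1) \<in> dom (?X K)" unfolding q(1) tabw_dom by (simp add: lam_def)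
    then have "(i, cnt q i n - 1) \<in> rect b W" by (auto simp: rot_tab_def split: if_splits)
    then have "cnt q i n - 1 < W" by (simp add: rect_def)
    then show ?thesis using False by (simp add: lam_def)
  qed (simp add: lam_def)
  have "RectStar b T = rot_tab b W n (?X K)" unfolding RS using rot_tab_rot_tab[of b W n] bx[of K] by simp
  also have "\<dots> = tabw (\<lambda>i. if i < b then W - lam (\<lambda>i. 0) q n (b - 1 - i) else 0) (revw b n q) n 0"
    unfolding q(1) by (rule rot_tabw[OF q(2) qW])
  finally show ?thesis using that q unfolding T_def by blast
qed

section \<open>Rows of a tableau as lists of times\<close>

lemma filter_letters:
  "length (filter (\<lambda>t. u t = i) [0..<n]) = cnt u i n"
  "j < cnt u i n \<Longrightarrow> filter (\<lambda>t. u t = i) [0..<n] ! j < n \<and> u (filter (\<lambda>t. u t = i) [0..<n] ! j) = i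
     \<and> cnt u i (filter (\<lambda>t. u t = i) [0..<n] ! j) = j"
proof -
  show len: "length (filter (\<lambda>t. u t = i) [0..<n]) = cnt u i n" for n by (induction n) auto
  show "j < cnt u i n \<Longrightarrow> filter (\<lambda>t. u t = i) [0..<n] ! j < n \<and> u (filter (\<lambda>t. u t = i) [0..<n] ! j) = i
     \<and> cnt u i (filter (\<lambda>t. u t = i) [0..<n] ! j) = j"
  proof (induction n)
    case (Suc n)
    show ?case
    proof (cases "j < cnt u i n")
      case True
      then have "filter (\<lambda>t. u t = i) [0..<Suc n] ! j = filter (\<lambda>t. u t = i) [0..<n] ! j" by (simp add: nth_append len)
      then show ?thesis using Suc.IH[OF True] by simp
    next
      case False
      then have "u n = i" "j = cnt u i n" using Suc.prems by (auto split: if_splits)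
      then have "filter (\<lambda>t. u t = i) [0..<Suc n] ! j = n" by (simp add: nth_append len)
      then show ?thesis using \<open>u n = i\<close> \<open>j = cnt u i n\<close> by simp
    qed
  qed simp
qed

lemma row_of_tabw: "row_of (tabw \<mu> u n k) i = map (\<lambda>t. k + Suc t) (filter (\<lambda>t. u t = i) [0..<n])"
proof (rule nth_equalityI)
  have cols: "{j. (i, j) \<in> dom (tabw \<mu> u n k)} = {\<mu> i..<lam \<mu> u n i}" unfolding tabw_dom by auto
  show len: "length (row_of (tabw \<mu> u n k) i) = length (map (\<lambda>t. k + Suc t) (filter (\<lambda>t. u t = i) [0..<n]))"
    unfolding row_of_def cols by (simp add: filter_letters lam_def)
  fix j assume "j < length (row_of (tabw \<mu> u n k) i)"
  then have j: "j < cnt u i n" unfolding row_of_def cols by (simp add: lam_def)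
  define t where "t = filter (\<lambda>t. u t = i) [0..<n] ! j"
  have t: "t < n" "u t = i" "cnt u i t = j" using filter_letters(2)[OF j] by (auto simp: t_def)
  have "row_of (tabw \<mu> u n k) i ! j = the (tabw \<mu> u n k (i, \<mu> i + j))"
    unfolding row_of_def cols using j by (simp add: lam_def)
  also have "(i, \<mu> i + j) = pos \<mu> u t" using t by (simp add: pos_def lam_def)
  finally show "row_of (tabw \<mu> u n k) i ! j = map (\<lambda>t. k + Suc t) (filter (\<lambda>t. u t = i) [0..<n]) ! j"
    using tabw_Some[OF t(1), of \<mu> u k] j by (simp add: filter_letters(1) t_def)
qed

lemma row_of_shift: "row_of (shift T x) i = map (\<lambda>v. v + x) (row_of T i)"
proof -
  have "{j. (i, j) \<in> dom (shift T x)} = {j. (i, j) \<in> dom T}" by (auto simp: shift_def)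
  moreover have "set (sorted_list_of_set {j. (i, j) \<in> dom T}) \<subseteq> {j. (i, j) \<in> dom T}"
    by (cases "finite {j. (i, j) \<in> dom T}") auto
  ultimately show ?thesis unfolding row_of_def by (auto simp: shift_def)
qed

lemma tab_of_rows_word:
  assumes "letters b g"
  shows "tab_of_rows (map (\<lambda>i. map Suc (filter (\<lambda>t. g t = i) [0..<n])) [0..<b]) = tabw (\<lambda>i. 0) g n 0"
  unfolding tabw_def
proof (rule tabf_eqI[OF pos_inj])
  fix s assume s: "s < n"
  have gb: "g s < b" using assms by (simp add: letters_def)
  have j: "cnt g (g s) s < cnt g (g s) n" using lam_less[OF s, of "\<lambda>i. 0" g] by (simp add: lam_def)
  define t where "t = filter (\<lambda>t. g t = g s) [0..<n] ! cnt g (g s) s"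
  have "g t = g s" "cnt g (g s) t = cnt g (g s) s" using filter_letters(2)[OF j] by (auto simp: t_def)
  then have "pos (\<lambda>i. 0) g t = pos (\<lambda>i. 0) g s" by (simp add: pos_def lam_def)
  then have "t = s" using inj_onD[OF pos_inj[of "\<lambda>i. 0" g UNIV]] by simp
  then show "tab_of_rows (map (\<lambda>i. map Suc (filter (\<lambda>t. g t = i) [0..<n])) [0..<b]) (pos (\<lambda>i. 0) g s) = Some (0 + Suc s)"
    using gb j by (simp add: tab_of_rows_def pos_def lam_def filter_letters(1) t_def)
next
  fix c assume c: "c \<notin> pos (\<lambda>i. 0) g ` {..<n}"
  obtain i j where ij: "c = (i, j)" by fastforce
  have "\<not> j < cnt g i n" using c unfolding pos_image ij by (simp add: lam_def)
  then show "tab_of_rows (map (\<lambda>i. map Suc (filter (\<lambda>t. g t = i) [0..<n])) [0..<b]) c = None"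
    unfolding ij by (simp add: tab_of_rows_def filter_letters(1))
qed

lemma filter_upt_add:
  "filter P [0..<x + y] = filter P [0..<x] @ map ((+) x) (filter (\<lambda>t. P (x + t)) [0..<y])"
proof -
  have "[x..<x + y] = map ((+) x) [0..<y]" 
  proof -
    have "(+) x = (\<lambda>i. i + x)" by (simp add: fun_eq_iff)
    then show ?thesis by (simp add: map_add_upt add.commute[of x y])
  qed
  then show ?thesis by (simp add: upt_add_eq_append[of 0 x y] filter_map comp_def)
qed

context periodic_word
begin

lemma lam_mu0: "lam mu0 w (k * m) i = (if i < b then mu0 i + k * r else 0)"
  using cnt_per[of i k 0] cnt_zero[OF lw, of i "k * m"] mu0_0[of i] by (simp add: lam_def)

text \<open>Every row gains \<open>r\<close> cells in each period, so attaching shifted copies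
  amounts to reading further periods of the word.\<close>

lemma tpow_tabw: "tpow (tabw mu0 w m 0) k = tabw mu0 w (k * m) 0"
  unfolding tabw_def[of mu0 w "k * m"]
proof (rule tabf_eqI[OF pos_inj])
  let ?S = "tabw mu0 w m 0"
  have cols: "{j'. (i, j') \<in> dom ?S} = (if i < b then {mu0 i..<mu0 i + r} else {})" for i
    unfolding tabw_dom using lam_mu0[of 1 i] mu0_0[of i] by auto
  have cd: "card (dom ?S) = m" by (rule tabw_card)
  have tp: "tpow ?S k (i, j) = (if i < b \<and> mu0 i \<le> j \<and> j < mu0 i + k * r
      then map_option (\<lambda>v. v + ((j - mu0 i) div r) * m) (?S (i, mu0 i + (j - mu0 i) mod r)) else None)" for i j
  proof (cases "i < b")
    case True
    have "{mu0 i..<mu0 i + r} \<noteq> {}" "Min {mu0 i..<mu0 i + r} = mu0 i" "card {mu0 i..<mu0 i + r} = r"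
      using r1 by (auto intro!: Min_eqI)
    then show ?thesis unfolding tpow_def prod.case cols cd Let_def using True by simp
  next
    case False
    then show ?thesis unfolding tpow_def prod.case cols Let_def by simp
  qed
  { fix s assume s: "s < k * m"
    define e s0 where "e = s div m" and "s0 = s mod m"
    have se: "s = e * m + s0" unfolding e_def s0_def by (rule div_mult_mod_eq[symmetric])
    have s0: "s0 < m" using m1 by (simp add: s0_def)
    have ek: "e < k" using s m1 by (simp add: e_def less_mult_imp_div_less)
    define i where "i = w s0"
    have wi: "w s = i" unfolding se i_def by (rule per_mult)
    have ib: "i < b" using lw by (simp add: i_def letters_def)
    have cs: "cnt w i s = e * r + cnt w i s0" unfolding se by (rule cnt_per[OF ib])
    have cr: "cnt w i s0 < r" using lam_less[OF s0, of "\<lambda>i. 0" w] cnt_m[OF ib] by (simp add: lam_def i_def)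
    have p: "pos mu0 w s = (i, mu0 i + (e * r + cnt w i s0))" by (simp add: pos_def lam_def wi cs)
    have "e * r + cnt w i s0 < Suc e * r" using cr by simp
    also have "\<dots> \<le> k * r" using ek by (intro mult_right_mono) auto
    finally have lt: "e * r + cnt w i s0 < k * r" .
    have "?S (i, mu0 i + cnt w i s0) = Some (Suc s0)"
      using tabw_Some[OF s0, of mu0 w 0] by (simp add: pos_def lam_def i_def)
    then show "tpow ?S k (pos mu0 w s) = Some (0 + Suc s)"
      unfolding p tp using ib lt cr by (simp add: se)
  }
  { fix c assume c: "c \<notin> pos mu0 w ` {..<k * m}"
    obtain i j where ij: "c = (i, j)" by fastforce
    show "tpow ?S k c = None"
      using c unfolding pos_image ij tp by (cases "i < b") (auto simp: lam_mu0)
  }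
qed

lemma beta_shape: "{(i, j). mu0 i \<le> j \<and> j < lam mu0 w m i} = beta b r"
proof -
  have "lam mu0 w m i = (if i < b then (b - i) * r else 0)" for i
  proof (cases "i < b")
    case True
    then have "b - i = Suc (b - 1 - i)" by simp
    then show ?thesis using lam_mu0[of 1 i] True by (simp add: mu0_def)
  qed (use lam_mu0[of 1 i] in simp)
  then show ?thesis by (auto simp: beta_def mu0_def split: if_splits)
qed

end

lemma periodic_extension:
  assumes "1 \<le> b" "1 \<le> r" "letters b u" "\<And>i. i < b \<Longrightarrow> cnt u i (b * r) = r"
  shows "periodic_word b r (\<lambda>t. u (t mod (b * r)))"
proof
  show "cnt (\<lambda>t. u (t mod (b * r))) i (b * r) = r" if "i < b" for i
    using assms(4)[OF that] cnt_cong[of "b * r" "\<lambda>t. u (t mod (b * r))" u i] by simp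
qed (use assms in \<open>auto simp: letters_def\<close>)

lemma SYT_beta:
  assumes b: "1 \<le> b" and r: "1 \<le> r"
  shows "SYT (beta b r) = (\<lambda>w. tabw (\<lambda>i. (b - 1 - i) * r) w (b * r) 0) ` {w. periodic_word b r w}"
proof (intro equalityI subsetI)
  let ?mu = "\<lambda>i. (b - 1 - i) * r"
  have bt: "beta b r = {(i, j). i < b \<and> ?mu i \<le> j \<and> j < (b - i) * r}" by (simp add: beta_def)
  have len: "(b - i) * r = ?mu i + r" if "i < b" for i
  proof -
    have "b - i = Suc (b - 1 - i)" using that by simp
    then show ?thesis by simp
  qed
  have cb: "card (beta b r) = b * r"
  proof -
    have "beta b r = Sigma {..<b} (\<lambda>i. {?mu i..<?mu i + r})" unfolding bt using len by auto
    then show ?thesis by (simp add: card_SigmaI)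
  qed
  { fix T assume "T \<in> SYT (beta b r)"
    then have st: "is_standard (beta b r) T" by (simp add: SYT_def)
    obtain u where u: "T = tabw ?mu u (card (beta b r)) 0" "letters b u"
      "\<And>i. i < b \<Longrightarrow> ?mu i + cnt u i (card (beta b r)) = max (?mu i) ((b - i) * r)"
      using standard_is_tabw[OF st bt b] by blast
    have "cnt u i (b * r) = r" if "i < b" for i using u(3)[OF that] len[OF that] cb by simp
    then have "periodic_word b r (\<lambda>t. u (t mod (b * r)))" using periodic_extension b r u(2) by blast
    moreover have "T = tabw ?mu (\<lambda>t. u (t mod (b * r))) (b * r) 0" unfolding u(1) cb by (rule tabw_cong) simp_all
    ultimately show "T \<in> (\<lambda>w. tabw ?mu w (b * r) 0) ` {w. periodic_word b r w}" by blast }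
  { fix T assume "T \<in> (\<lambda>w. tabw ?mu w (b * r) 0) ` {w. periodic_word b r w}"
    then obtain w where w: "T = tabw ?mu w (b * r) 0" "periodic_word b r w" by auto
    interpret periodic_word b r w by fact
    have mu: "?mu = mu0" by (simp add: mu0_def fun_eq_iff)
    have "is_standard {(i, j). mu0 i \<le> j \<and> j < lam mu0 w m i} (tabw mu0 w m 0)"
      by (rule tabw_standard) (rule skewD[OF skew_mu0])
    then have "is_standard (beta b r) (tabw mu0 w m 0)" unfolding beta_shape .
    then show "T \<in> SYT (beta b r)" unfolding SYT_def w(1) mu by (simp add: m_def) }
qed

section \<open>Counting periodic words and the rows of the glued tableau\<close>

lemma count_mset_word: "count (mset (map w [0..<n])) i = cnt w i n"
  by (induction n) auto

text \<open>One period is an arbitrary arrangement of \<open>r\<close> copies of each of the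
  \<open>b\<close> letters.\<close>

lemma card_periodic_words:
  assumes b: "1 \<le> b" and r: "1 \<le> r"
  shows "card {w. periodic_word b r w} = fact (b * r) div fact r ^ b"
proof -
  define A where "A = (\<Sum>i<b. replicate_mset r i)"
  have cA: "count A i = (if i < b then r else 0)" for i
    unfolding A_def by (simp add: count_sum)
  have sA: "size A = b * r" unfolding A_def by (simp add: size_multiset_sum)
  have setA: "set_mset A = {..<b}" using cA r by (auto simp: set_mset_def)
  have "bij_betw (\<lambda>w. map w [0..<b * r]) {w. periodic_word b r w} (permutations_of_multiset A)"
  proof (rule bij_betw_imageI)
    show "inj_on (\<lambda>w. map w [0..<b * r]) {w. periodic_word b r w}"
    proof (rule inj_onI)
      fix w v assume A: "w \<in> {w. periodic_word b r w}" "v \<in> {w. periodic_word b r w}" "map w [0..<b * r] = map v [0..<b * r]"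
      interpret W: periodic_word b r w using A by simp
      interpret P: periodic_word b r v using A by simp
      show "w = v"
      proof
        fix t
        have "t mod W.m < b * r" using W.m1 by (simp add: W.m_def)
        then have "w (t mod W.m) = v (t mod W.m)" using A(3) by (simp add: list_eq_iff_nth_eq)
        then show "w t = v t" using W.per_mod[of t] P.per_mod[of t] by simp
      qed
    qed
    show "(\<lambda>w. map w [0..<b * r]) ` {w. periodic_word b r w} = permutations_of_multiset A"
    proof (intro equalityI subsetI)
      fix xs assume "xs \<in> (\<lambda>w. map w [0..<b * r]) ` {w. periodic_word b r w}"
      then obtain w where w: "xs = map w [0..<b * r]" "periodic_word b r w" by auto
      interpret periodic_word b r w by fact
      have "mset xs = A"
      proof (rule multiset_eqI)
        fix i show "count (mset xs) i = count A i"
          unfolding w(1) count_mset_word cA using cnt_zero[OF lw, of i "b * r"] bal[of i] by simp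
      qed
      then show "xs \<in> permutations_of_multiset A" by (simp add: permutations_of_multiset_def)
    next
      fix xs assume "xs \<in> permutations_of_multiset A"
      then have xs: "mset xs = A" by (simp add: permutations_of_multiset_def)
      then have len: "length xs = b * r" using sA by (metis size_mset)
      define u where "u t = (if t < b * r then xs ! t else 0)" for t
      have mu: "map u [0..<b * r] = xs" using len by (intro nth_equalityI) (auto simp: u_def)
      have "set xs = {..<b}" using xs setA by (metis set_mset_mset)
      have "u t < b" for t
      proof (cases "t < b * r")
        case True
        then have "xs ! t \<in> set xs" using len by simp
        then show ?thesis using \<open>set xs = {..<b}\<close> True by (simp add: u_def)
      qed (use b in \<open>simp add: u_def\<close>)
      then have "letters b u" by (simp add: letters_def)
      moreover have "cnt u i (b * r) = r" if "i < b" for i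
        using count_mset_word[of u "b * r" i] xs cA[of i] that mu by simp
      ultimately have pw: "periodic_word b r (\<lambda>t. u (t mod (b * r)))" using periodic_extension b r by blast
      have "map (\<lambda>t. u (t mod (b * r))) [0..<b * r] = xs" using mu by (intro nth_equalityI) (auto simp: len u_def)
      then show "xs \<in> (\<lambda>w. map w [0..<b * r]) ` {w. periodic_word b r w}" using pw by blast
    qed
  qed
  then have "card {w. periodic_word b r w} = card (permutations_of_multiset A)" by (rule bij_betw_same_card)
  also have "\<dots> = fact (b * r) div (\<Prod>x\<in>set_mset A. fact (count A x))"
    unfolding card_permutations_of_multiset(1) sA ..
  also have "(\<Prod>x\<in>set_mset A. fact (count A x)) = (\<Prod>x<b. fact r)"
    unfolding setA by (rule prod.cong) (simp_all add: cA)
  finally show ?thesis by simp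
qed

text \<open>The zeros after the cut lengthen the top row only.\<close>

lemma skew_truncate:
  assumes "skew \<mu> u" shows "skew \<mu> (\<lambda>t. if t < n then u t else 0)" (is "skew \<mu> ?v")
  unfolding skew_def
proof (intro allI)
  fix t i
  have eq: "lam \<mu> ?v s i = lam \<mu> u s i" if "s \<le> n" for s i by (rule lam_cong) (use that in auto)
  show "lam \<mu> ?v t (Suc i) \<le> lam \<mu> ?v t i"
  proof (cases "t \<le> n")
    case True
    show ?thesis unfolding eq[OF True] by (rule skewD[OF assms])
  next
    case False
    have "lam \<mu> ?v t (Suc i) \<le> lam \<mu> ?v n (Suc i)"
      using cnt_zero_tail[of n ?v "Suc i" t] by (simp add: lam_def zero_tail_def)
    also have "\<dots> \<le> lam \<mu> ?v n i" unfolding eq[OF le_refl] by (rule skewD[OF assms])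
    also have "\<dots> \<le> lam \<mu> ?v t i" by (rule lam_mono) (use False in simp)
    finally show ?thesis .
  qed
qed

context glued
begin

text \<open>The valuation for length \<open>n\<close> determines a lattice word up to time
  \<open>n\<close>, so rectifying a finite piece of \<open>w\<close> gives a prefix of
  \<open>q\<close>.\<close>

lemma Rect_row: "row_of (Rect (tabw mu0 w n 0)) i = map Suc (filter (\<lambda>t. q t = i) [0..<n])"
proof -
  let ?w = "\<lambda>t. if t < n then w t else 0"
  have lw': "letters b ?w" using lw b1 by (simp add: letters_def)
  obtain q1 where q1: "Rect (tabw mu0 ?w n 0) = tabw (\<lambda>i. 0) q1 n 0" "letters b q1" "lattice q1" "\<And>x. good b x \<Longrightarrow> V b q1 n x = V b ?w n x"
    by (rule Rect_tabw[OF lw' _ skew_truncate[OF skew_mu0]]) (auto simp: zero_tail_def)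
  have "V b q1 n x = V b q n x" if "good b x" for x
    using q1(4)[OF that] V_cong[of n ?w w b x] hwq(3) that by (simp add: veq_def)
  then have qq: "q1 t = q t" if "t < n" for t using lattice_unique[OF q1(2,3) hwq(1,2) _ that] by blast
  have "tabw mu0 w n 0 = tabw mu0 ?w n 0" by (rule tabw_cong) auto
  then have "row_of (Rect (tabw mu0 w n 0)) i = map Suc (filter (\<lambda>t. q1 t = i) [0..<n])"
    using q1(1) by (simp add: row_of_tabw)
  also have "filter (\<lambda>t. q1 t = i) [0..<n] = filter (\<lambda>t. q t = i) [0..<n]" by (rule filter_cong) (auto simp: qq)
  finally show ?thesis .
qed

lemma RectStar_row:
  assumes n: "n = (b - 1) * m"
  shows "row_of (RectStar b (tabw mu0 w n 0)) i = map Suc (filter (\<lambda>t. revw b n R.q t = i) [0..<n])"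
proof (cases "b = 1")
  case True
  \<comment> \<open>The tableau is empty. The \<open>Max\<close> in \<open>RectStar\<close> is then
    unspecified, but there are no outer cells.\<close>
  then have "dom (tabw mu0 w n 0) = {}" using n by (simp add: tabw_def tabf_dom)
  then have "RectStar b (tabw mu0 w n 0) = tabw mu0 w n 0" by (simp add: RectStar_def outer_cells_def)
  then show ?thesis using n True by (simp add: row_of_tabw)
next
  case False
  let ?w = "\<lambda>t. if t < n then w t else 0"
  have lw': "letters b ?w" using lw b1 by (simp add: letters_def)
  have tw: "tabw mu0 w n 0 = tabw mu0 ?w n 0" by (rule tabw_cong) auto
  have "cnt ?w 0 n = cnt w 0 n" by (rule cnt_cong) simp
  then have "0 < cnt ?w 0 n" using cnt_per[of 0 "b - 1" 0] False b1 r1 unfolding n by simp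
  then obtain q2 \<nu> where q2: "RectStar b (tabw mu0 ?w n 0) = tabw \<nu> (revw b n q2) n 0" "letters b q2" "lattice q2"
    "\<And>x. good b x \<Longrightarrow> V b q2 n x = V b (revw b n ?w) n x"
    using RectStar_tabw[OF lw' skew_truncate[OF skew_mu0]] by blast
  have rv: "revw b n ?w t = rvw b m w t" if t: "t < n" for t
  proof -
    have lt: "t mod m < m" using m1 by simp
    have "t div m < b - 1" using t n less_mult_imp_div_less by blast
    then obtain d where d: "b - 1 = Suc (t div m + d)" by (metis less_imp_Suc_add)
    have "n = Suc (t div m + d) * m" by (simp only: n d)
    then have "n = t div m * m + (d * m + m)" by (simp add: algebra_simps)
    moreover have "t = t div m * m + t mod m" by (rule div_mult_mod_eq[symmetric])
    ultimately have "n - 1 - t = d * m + (m - 1 - t mod m)" using lt by linarith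
    then have "w (n - 1 - t) = w (m - 1 - t mod m)" using per_mult by simp
    then show ?thesis using t by (simp add: revw_def rvw_def)
  qed
  have "V b q2 n x = V b R.q n x" if "good b x" for x
    using q2(4)[OF that] V_cong[of n "revw b n ?w" "rvw b m w" b x] rv R.hwq(3) that by (simp add: veq_def)
  then have qq: "q2 t = R.q t" if "t < n" for t using lattice_unique[OF q2(2,3) R.hwq(1,2) _ that] by blast
  have "row_of (RectStar b (tabw mu0 w n 0)) i = map Suc (filter (\<lambda>t. revw b n q2 t = i) [0..<n])"
    unfolding tw q2(1) by (simp add: row_of_tabw)
  also have "filter (\<lambda>t. revw b n q2 t = i) [0..<n] = filter (\<lambda>t. revw b n R.q t = i) [0..<n]"
    by (rule filter_cong) (auto simp: revw_def qq)
  finally show ?thesis .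
qed

text \<open>The three pieces of a row list the times before \<open>n\<close>, from \<open>n\<close>
  to \<open>L\<close>, and from \<open>L\<close> on. In the middle interval rectification has no
  effect, and the shifts are its two end points.\<close>

lemma R_tabw: "R a b r (tabw mu0 w m 0) = tabw (\<lambda>i. 0) (glue a b m w) (a * m) 0"
proof -
  define n where "n = (b - 1) * m"
  define c where "c = (a + 2 - 2 * b) * m"
  define L where "L = (a + 1 - b) * m"
  let ?g = "glue a b m w"
  have nc: "n + c = L" "L + n = a * m"
  proof -
    have "(b - 1) + (a + 2 - 2 * b) = a + 1 - b" using a2b b1 by linarith
    then show "n + c = L" unfolding n_def c_def L_def by (simp add: add_mult_distrib[symmetric])
    show "L + n = a * m" using bounds(1) by (simp add: L_def n_def)
  qed
  have x: "(b - 1) * b * r = n" "(a + 1 - b) * b * r = L" by (simp_all add: n_def L_def m_def mult.assoc)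
  have rows: "row_of (Rect (tpow (tabw mu0 w m 0) (b - 1))) i
     @ row_of (shift (tpow (tabw mu0 w m 0) (a + 2 - 2 * b)) ((b - 1) * b * r)) i
     @ row_of (shift (RectStar b (tpow (tabw mu0 w m 0) (b - 1))) ((a + 1 - b) * b * r)) i
     = map Suc (filter (\<lambda>t. ?g t = i) [0..<a * m])" for i
  proof -
    have "filter (\<lambda>t. ?g t = i) [0..<a * m] = filter (\<lambda>t. ?g t = i) [0..<n] @ map ((+) n) (filter (\<lambda>t. ?g (n + t) = i) [0..<c])
        @ map ((+) L) (filter (\<lambda>t. ?g (L + t) = i) [0..<n])"
      using filter_upt_add[of "\<lambda>t. ?g t = i" L n] filter_upt_add[of "\<lambda>t. ?g t = i" n c] unfolding nc by simp
    also have "filter (\<lambda>t. ?g t = i) [0..<n] = filter (\<lambda>t. q t = i) [0..<n]"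
      unfolding glue_def L_def[symmetric] q_def by (rule filter_cong) (use nc in auto)
    also have "filter (\<lambda>t. ?g (n + t) = i) [0..<c] = filter (\<lambda>t. w t = i) [0..<c]"
    proof (rule filter_cong)
      fix t assume "t \<in> set [0..<c]"
      then have "?g (n + t) = w (n + t)" using nc(1) by (intro glue_middle) (auto simp: n_def L_def)
      then show "(?g (n + t) = i) = (w t = i)" using per_mult[of "b - 1" t] by (simp add: n_def)
    qed simp
    also have "filter (\<lambda>t. ?g (L + t) = i) [0..<n] = filter (\<lambda>t. revw b n R.q t = i) [0..<n]"
    proof (rule filter_cong)
      fix t assume "t \<in> set [0..<n]"
      then have t: "t < n" by simp
      have "a * m - 1 - (L + t) = n - 1 - t" "L + t < a * m" using nc(2) t by linarith+
      then show "(?g (L + t) = i) = (revw b n R.q t = i)"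
        unfolding glue_def L_def[symmetric] revw_def R.q_def using t by simp
    qed simp
    finally show ?thesis
      unfolding x tpow_tabw n_def[symmetric] c_def[symmetric] row_of_shift Rect_row RectStar_row[OF n_def] row_of_tabw
      by (simp add: comp_def add.commute)
  qed
  show ?thesis
    unfolding R_def rows by (rule tab_of_rows_word[OF letters_glue])
qed

end

lemma fixed_words:
  assumes b: "1 \<le> b" and r: "1 \<le> r" and a: "2 * b \<le> a + 1"
  shows "{u. closed b (a * r) u \<and> (prw b (b * (a * r)) ^^ (b * r)) u = u} = glue a b (b * r) ` {w. periodic_word b r w}"
proof (intro equalityI subsetI)
  fix u assume "u \<in> {u. closed b (a * r) u \<and> (prw b (b * (a * r)) ^^ (b * r)) u = u}"
  then have u: "closed b (a * r) u" "(prw b (b * (a * r)) ^^ (b * r)) u = u" by auto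
  show "u \<in> glue a b (b * r) ` {w. periodic_word b r w}"
  proof (cases "2 \<le> b")
    case True
    interpret promotion_fixed a b r u by unfold_locales (use True r a u in auto)
    show ?thesis using fixed_is_glue by (auto simp: m_def)
  next
    case False
    \<comment> \<open>\<open>cyclic_exchange\<close> needs \<open>2 \<le> b\<close>. For a single
      row all words are zero.\<close>
    then have b1: "b = 1" using b by simp
    have pw: "periodic_word b r (\<lambda>t. 0)"
    proof
      show "cnt (\<lambda>t. 0) i (b * r) = r" if "i < b" for i using that b1 by (simp add: cnt_def)
    qed (use b r in \<open>auto simp: letters_def\<close>)
    interpret W: periodic_word b r "\<lambda>t. 0" by (rule pw)
    interpret G: glued b r "\<lambda>t. 0" a by unfold_locales (rule a)
    have "letters b (glue a b (b * r) (\<lambda>t. 0))" using G.letters_glue by (simp add: W.m_def)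
    then have "u = glue a b (b * r) (\<lambda>t. 0)" using closedD(1)[OF u(1)] b1 by (auto simp: letters_def fun_eq_iff)
    then show ?thesis using pw by blast
  qed
next
  fix u assume "u \<in> glue a b (b * r) ` {w. periodic_word b r w}"
  then obtain w where w: "u = glue a b (b * r) w" "periodic_word b r w" by auto
  interpret W: periodic_word b r w by (rule w(2))
  interpret glued b r w a by unfold_locales (rule a)
  show "u \<in> {u. closed b (a * r) u \<and> (prw b (b * (a * r)) ^^ (b * r)) u = u}"
    using closed_glue glue_fixed unfolding w(1) bounds(3) by (simp add: W.m_def)
qed

theorem theorem1p14:
  fixes a b r :: nat
  assumes "b \<ge> 1" and "r \<ge> 1" and "a \<ge> 2 * b - 1"
  shows "{T \<in> SYT (rect b (a * r)). (pr ^^ (b * r)) T = T} = R a b r ` SYT (beta b r)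
         \<and> card {T \<in> SYT (rect b (a * r)). (pr ^^ (b * r)) T = T} = fact (b * r) div (fact r ^ b)"
proof -
  have a: "2 * b \<le> a + 1" "1 \<le> a * r" using assms by auto
  let ?N = "b * (a * r)"
  let ?tab = "\<lambda>u. tabw (\<lambda>i. 0) u ?N 0"
  let ?W = "{w. periodic_word b r w}"
  have prk: "(pr ^^ k) (?tab u) = ?tab ((prw b ?N ^^ k) u)" if "closed b (a * r) u" for k u
  proof (induction k)
    case (Suc k)
    then show ?case using pr_tabw[OF closed_prw_pow[OF that a(2) assms(1)] a(2) assms(1)] by simp
  qed simp
  have inj: "u = v" if "closed b (a * r) u" "closed b (a * r) v" "?tab u = ?tab v" for u v
  proof
    fix t show "u t = v t"
      using tabw_inj[OF that(3), of t] closedD(4)[OF that(1), of t] closedD(4)[OF that(2), of t] by (cases "t < ?N") auto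
  qed
  have fix_eq: "{T \<in> SYT (rect b (a * r)). (pr ^^ (b * r)) T = T}
      = ?tab ` {u. closed b (a * r) u \<and> (prw b ?N ^^ (b * r)) u = u}"
  proof (intro equalityI subsetI)
    fix T assume "T \<in> {T \<in> SYT (rect b (a * r)). (pr ^^ (b * r)) T = T}"
    then obtain u where u: "T = ?tab u" "closed b (a * r) u" "(pr ^^ (b * r)) T = T"
      unfolding SYT_rect[OF assms(1)] by auto
    have "(prw b ?N ^^ (b * r)) u = u"
      by (rule inj[OF closed_prw_pow[OF u(2) a(2) assms(1)] u(2)]) (use u prk in simp)
    then show "T \<in> ?tab ` {u. closed b (a * r) u \<and> (prw b ?N ^^ (b * r)) u = u}" using u by blast
  next
    fix T assume "T \<in> ?tab ` {u. closed b (a * r) u \<and> (prw b ?N ^^ (b * r)) u = u}"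
    then obtain u where u: "T = ?tab u" "closed b (a * r) u" "(prw b ?N ^^ (b * r)) u = u" by auto
    then show "T \<in> {T \<in> SYT (rect b (a * r)). (pr ^^ (b * r)) T = T}"
      unfolding SYT_rect[OF assms(1)] using prk[OF u(2), of "b * r"] by simp
  qed
  have fixed: "{T \<in> SYT (rect b (a * r)). (pr ^^ (b * r)) T = T} = (\<lambda>w. ?tab (glue a b (b * r) w)) ` ?W"
    unfolding fix_eq fixed_words[OF assms(1,2) a(1)] image_image ..
  have Rw: "R a b r (tabw (\<lambda>i. (b - 1 - i) * r) w (b * r) 0) = ?tab (glue a b (b * r) w)" if "periodic_word b r w" for w
  proof -
    interpret W: periodic_word b r w by (rule that)
    interpret glued b r w a by unfold_locales (rule a(1))
    have "(\<lambda>i. (b - 1 - i) * r) = W.mu0" by (simp add: W.mu0_def fun_eq_iff)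
    then show ?thesis using R_tabw by (simp add: W.m_def mult.left_commute)
  qed
  have "R a b r ` SYT (beta b r) = (\<lambda>w. ?tab (glue a b (b * r) w)) ` ?W"
    unfolding SYT_beta[OF assms(1,2)] image_image by (rule image_cong) (use Rw in auto)
  \<comment> \<open>\<open>w\<close> is recovered from the period beginning at
    \<open>(b - 1) * W.m\<close>, which lies in the middle part where the glued word equals
    \<open>w\<close>.\<close>
  moreover have "inj_on (\<lambda>w. ?tab (glue a b (b * r) w)) ?W"
  proof (rule inj_onI)
    fix w v assume A: "w \<in> ?W" "v \<in> ?W" "?tab (glue a b (b * r) w) = ?tab (glue a b (b * r) v)"
    interpret W: periodic_word b r w using A(1) by simp
    interpret W: glued b r w a by unfold_locales (rule a(1))
    interpret P: periodic_word b r v using A(2) by simp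
    interpret P: glued b r v a by unfold_locales (rule a(1))
    have "glue a b W.m w = glue a b W.m v"
      by (rule inj) (use A(3) W.closed_glue P.closed_glue in \<open>simp_all add: W.m_def\<close>)
    then have eq: "w t = v t" if "(b - 1) * W.m \<le> t" "t < (a + 1 - b) * W.m" for t
      using W.glue_middle[OF that] P.glue_middle[OF that] by simp
    show "w = v"
    proof
      fix t
      have "Suc (b - 1) * W.m \<le> (a + 1 - b) * W.m" using a(1) assms(1) by (intro mult_right_mono) auto
      moreover have "t mod W.m < W.m" using W.m1 by simp
      ultimately have "w ((b - 1) * W.m + t mod W.m) = v ((b - 1) * W.m + t mod W.m)" by (intro eq) simp_all
      then show "w t = v t" using W.per_mult P.per_mult W.per_mod[of t] P.per_mod[of t] by simp
    qed
  qed
  then have "card ((\<lambda>w. ?tab (glue a b (b * r) w)) ` ?W) = card ?W" by (rule card_image)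
  ultimately show ?thesis using fixed card_periodic_words[OF assms(1,2)] by simp
qed

end
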